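(* The mapping $\mathcal{S}\times\mathcal{Z}'\times\mathbb{C}^M_\diamond\ni(\sigma,\zeta,I)\mapsto U(\sigma,\zeta,I)\in\mathbb{C}^M_\diamond$ is Fréchet differentiable. To be more precise, for any $(\sigma,\zeta,I)\in\mathcal{S}\times\mathcal{Z}'\times\mathbb{C}^M_\diamond$, $$\big\|U(\sigma+\omega,\zeta+\eta,I+J)-U(\sigma,\zeta,I)-U'(\sigma,\zeta,I;\omega,\eta,J)\big\|_2=\mathcal{O}\big(\max\{\|\omega\|_{L^\infty(\Omega)}^2,\|\eta\|_{L^\infty(E)}^2,\|J\|_2^2\}\big)$$ for $(\omega,\eta,J)\in L^\infty(\Omega)\times L^\infty(E)\times\mathbb{C}^M_\diamond$ tending to zero, where the Fréchet derivative $U'(\sigma,\zeta,I;\omega,\eta,J)\in\mathbb{C}^M_\diamond$ is the second part of the solution $(u',U')\in\mathcal{H}^1$ of $$B_{\sigma,\zeta}\big((u',U'),(v,V)\big)=J\cdot\overline{V}-\int_\Omega\omega\nabla u\cdot\nabla\overline{v}\,dx-\int_{\partial\Omega}\eta\,(U-u)(\overline{V}-\overline{v})\,dS\qquad\text{for all }(v,V)\in\mathcal{H}^1,$$ with $(u,U)\in\mathcal{H}^1$ the solution of the forward problem for $(\sigma,\zeta,I)$. Moreover, this derivative can be assembled through the relation $$U'(\sigma,\zeta,I;\omega,\eta,J)\cdot\tilde I=J\cdot\tilde U-\int_\Omega\omega\nabla u\cdot\nabla\tilde u\,dx-\int_{\partial\Omega}\eta\,(U-u)(\tilde U-\tilde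 u)\,dS,$$ where $(u,U),(\tilde u,\tilde U)\in\mathcal{H}^1$ are the solutions of the forward problem at the common parameters $(\sigma,\zeta)\in\mathcal{S}\times\mathcal{Z}'$ but for the current patterns $I,\tilde I\in\mathbb{C}^M_\diamond$, respectively.
   Context: $\Omega\subset\mathbb{R}^n$, $n=2$ or $3$, is a bounded Lipschitz domain. $M\ge 2$ is an integer. The boundary $\partial\Omega$ is partially covered by $M$ electrodes, identified with the nonempty connected subsets $e_1,\dots,e_M$ of $\partial\Omega$ that they cover. The extended electrodes $E_1,\dots,E_M\subset\partial\Omega$ are relatively open, connected and mutually disjoint, with $e_m\subset E_m$ for all $m$; $E:=\bigcup_{m=1}^M\overline{E}_m$ (the case $E=\partial\Omega$ is not excluded). All function spaces are complex-valued. $L^\infty(E)$ is regarded as a subset of $L^\infty(\partial\Omega)$ via continuation by zero. A vector $V=[V_1,\dots,V_M]^{\rm T}\in\mathbb{C}^M$ is identified with the piecewise constant function $\sum_{m=1}^M V_m\chi_m$ on $\partial\Omega$, where $\chi_m$ is the characteristic function of $E_m$. $\mathbb{C}^M_\diamond=\{J\in\mathbb{C}^M:\sum_{m=1}^M J_m=0\}$, with the Euclidean norm $\|\cdot\|_2$; the dot product $a\cdot b=\sum_m a_m b_m$ is bilinear. $\mathcal{H}^1$ is the quotient of $H^1(\Omega)\oplus\mathbb{C}^M$ obtained by identifying $(v,V)$ with $(v+c,V+c\mathbf{1})$ for all $c\in\mathbb{C}$, where $\mathbf{1}=[1,\dots,1]^{\rm T}\in\mathbb{C}^M$; when the second component is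 interpreted as a piecewise constant function on the electrodes, the additive constant is also supported on $\overline{E}$. It is equipped with the quotient norm $$\|(v,V)\|_{\mathcal{H}^1}=\inf_{c\in\mathbb{C}}\big(\|v-c\|_{H^1(\Omega)}^2+\|V-c\mathbf{1}\|_2^2\big)^{1/2}.$$ For $\sigma\in L^\infty(\Omega)$ and $\zeta\in L^\infty(E)$ the sesquilinear form $B_{\sigma,\zeta}:\mathcal{H}^1\times\mathcal{H}^1\to\mathbb{C}$ is $$B_{\sigma,\zeta}\big((w,W),(v,V)\big)=\int_\Omega\sigma\nabla w\cdot\nabla\overline{v}\,dx+\int_{\partial\Omega}\zeta\,(W-w)(\overline{V}-\overline{v})\,dS .$$ $\mathcal{S}=\{\sigma\in L^\infty(\Omega): \operatorname{ess\,inf}(\mathrm{Re}\,\sigma)>0\}$. $\mathcal{Z}'$ is the set of all $\zeta\in L^\infty(E)$ such that for every $\sigma\in\mathcal{S}$ there is a constant $c=c(\sigma,\zeta)>0$ with $\mathrm{Re}\big(B_{\sigma,\zeta}((v,V),(v,V))\big)\ge c\,\|(v,V)\|_{\mathcal{H}^1}^2$ for all $(v,V)\in\mathcal{H}^1$; it is an open subset of $L^\infty(E)$. Forward problem: for $(\sigma,\zeta,I)\in\mathcal{S}\times\mathcal{Z}'\times\mathbb{C}^M_\diamond$, its solution is the unique $(u,U)\in\mathcal{H}^1$ (it exists by the Lax--Milgram lemma) such that $$B_{\sigma,\zeta}\big((u,U),(v,V)\big)=I\cdot\overline{V}\qquad\text{for all }(v,V)\in\mathcal{H}^1 .$$ $U(\sigma,\zeta,I)\in\mathbb{C}^M_\diamond$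 denotes the second component of this solution, for the representative of the equivalence class whose second component has zero mean. The variational problem for $(u',U')$ is likewise uniquely solvable by the Lax--Milgram theorem, its solution depends linearly on $(J,\omega,\eta)$, and $U'$ is taken with zero mean. *)

theory Defs
  imports
    "HOL-Analysis.Analysis"
    "HOL-Probability.Essential_Supremum"
    "HOL-Library.Function_Algebras"
begin

section \<open>Lipschitz domains and surface measure\<close>

text \<open>Near each boundary point, \<open>\<Omega>\<close> is the strict epigraph of a Lipschitz function on the hyperplane
  orthogonal to some unit vector \<open>\<nu>\<close>.\<close>

definition bounded_lipschitz_domain :: "(real^'n) set \<Rightarrow> bool" where
  "bounded_lipschitz_domain \<Omega> \<longleftrightarrow>
     open \<Omega> \<and> connected \<Omega> \<and> bounded \<Omega> \<and> \<Omega> \<noteq> {} \<and>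
     (\<forall>x\<^sub>0\<in>frontier \<Omega>. \<exists>r \<nu> L \<gamma>. 0 < r \<and> norm \<nu> = 1 \<and> L-lipschitz_on {z. z \<bullet> \<nu> = 0} \<gamma> \<and>
        \<Omega> \<inter> ball x\<^sub>0 r = {y \<in> ball x\<^sub>0 r. \<gamma> (y - (y \<bullet> \<nu>) *\<^sub>R \<nu>) < y \<bullet> \<nu>})"

definition hausdorff_pre :: "real \<Rightarrow> real \<Rightarrow> 'a::metric_space set \<Rightarrow> ennreal" where
  "hausdorff_pre s \<delta> A =
     (INF C \<in> {C :: nat \<Rightarrow> 'a set. A \<subseteq> (\<Union>i. C i) \<and> (\<forall>i. bounded (C i) \<and> diameter (C i) \<le> \<delta>)}.
        \<Sum>i. ennreal (unit_ball_vol s * (diameter (C i) / 2) powr s))"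

definition hausdorff_outer :: "real \<Rightarrow> 'a::metric_space set \<Rightarrow> ennreal" where
  "hausdorff_outer s A = (SUP \<delta>\<in>{0<..}. hausdorff_pre s \<delta> A)"

text \<open>The surface measure \<open>dS\<close> is the \<open>(n-1)\<close>-dimensional Hausdorff measure on the Borel subsets of
  \<open>\<partial>\<Omega>\<close>; the factor \<^const>\<open>unit_ball_vol\<close> above is the normalisation that makes it agree with the
  classical surface area.\<close>

definition surface_measure :: "(real^'n) set \<Rightarrow> (real^'n) measure" where
  "surface_measure \<Omega> =
     measure_of (frontier \<Omega>) (sets (restrict_space borel (frontier \<Omega>)))
       (hausdorff_outer (real CARD('n) - 1))"


section \<open>Function spaces\<close>

text \<open>Elements of all function spaces are represented by functions (not by classes modulo null
  sets), and the values of these functions outside the underlying set are irrelevant.\<close>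

definition L2 :: "'a measure \<Rightarrow> ('a \<Rightarrow> 'b::{second_countable_topology, real_normed_vector}) set" where
  "L2 M = {f \<in> borel_measurable M. integrable M (\<lambda>x. (norm (f x))\<^sup>2)}"

definition Linf :: "'a measure \<Rightarrow> ('a \<Rightarrow> complex) set" where
  "Linf M = {f \<in> borel_measurable M. esssup M (\<lambda>x. ereal (cmod (f x))) < \<infinity>}"

definition Linf_norm :: "'a measure \<Rightarrow> ('a \<Rightarrow> complex) \<Rightarrow> real" where
  "Linf_norm M f = real_of_ereal (esssup M (\<lambda>x. ereal (cmod (f x))))"

definition essinf :: "'a measure \<Rightarrow> ('a \<Rightarrow> real) \<Rightarrow> ereal" where
  "essinf M f = - esssup M (\<lambda>x. - ereal (f x))"

definition C1_fun :: "(real^'n \<Rightarrow> complex) \<Rightarrow> bool" where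
  "C1_fun \<phi> \<longleftrightarrow> (\<exists>D :: real^'n \<Rightarrow> ((real^'n) \<Rightarrow>\<^sub>L complex).
     (\<forall>x. (\<phi> has_derivative blinfun_apply (D x)) (at x)) \<and> continuous_on UNIV D)"

definition partial_deriv :: "'n \<Rightarrow> (real^'n \<Rightarrow> complex) \<Rightarrow> real^'n \<Rightarrow> complex" where
  "partial_deriv i \<phi> x = frechet_derivative \<phi> (at x) (axis i 1)"

definition test_fun :: "(real^'n) set \<Rightarrow> (real^'n \<Rightarrow> complex) \<Rightarrow> bool" where
  "test_fun \<Omega> \<phi> \<longleftrightarrow> C1_fun \<phi> \<and> (\<exists>K. compact K \<and> K \<subseteq> \<Omega> \<and> (\<forall>x. x \<notin> K \<longrightarrow> \<phi> x = 0))"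

definition has_weak_gradient ::
  "(real^'n) set \<Rightarrow> (real^'n \<Rightarrow> complex) \<Rightarrow> (real^'n \<Rightarrow> complex^'n) \<Rightarrow> bool" where
  "has_weak_gradient \<Omega> v G \<longleftrightarrow>
     (\<forall>\<phi> i. test_fun \<Omega> \<phi> \<longrightarrow>
        (LINT x|lebesgue_on \<Omega>. v x * partial_deriv i \<phi> x) = - (LINT x|lebesgue_on \<Omega>. G x $ i * \<phi> x))"

definition H1 :: "(real^'n) set \<Rightarrow> (real^'n \<Rightarrow> complex) set" where
  "H1 \<Omega> = {v \<in> L2 (lebesgue_on \<Omega>). \<exists>G \<in> L2 (lebesgue_on \<Omega>). has_weak_gradient \<Omega> v G}"

definition weak_grad :: "(real^'n) set \<Rightarrow> (real^'n \<Rightarrow> complex) \<Rightarrow> real^'n \<Rightarrow> complex^'n" where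
  "weak_grad \<Omega> v = (SOME G. G \<in> L2 (lebesgue_on \<Omega>) \<and> has_weak_gradient \<Omega> v G)"

definition H1_norm :: "(real^'n) set \<Rightarrow> (real^'n \<Rightarrow> complex) \<Rightarrow> real" where
  "H1_norm \<Omega> v = sqrt ((LINT x|lebesgue_on \<Omega>. (cmod (v x))\<^sup>2) +
                       (LINT x|lebesgue_on \<Omega>. (norm (weak_grad \<Omega> v x))\<^sup>2))"

text \<open>The trace is the extension by continuity, from \<open>H\<^sup>1(\<Omega>)\<close> to \<open>L\<^sup>2(\<partial>\<Omega>)\<close>, of the restriction map
  \<open>\<phi> \<mapsto> \<phi>|\<^bsub>\<partial>\<Omega>\<^esub>\<close> on continuously differentiable functions.\<close>

definition has_trace ::
  "(real^'n) set \<Rightarrow> (real^'n \<Rightarrow> complex) \<Rightarrow> (real^'n \<Rightarrow> complex) \<Rightarrow> bool" where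
  "has_trace \<Omega> v g \<longleftrightarrow> g \<in> L2 (surface_measure \<Omega>) \<and>
     (\<exists>\<phi> :: nat \<Rightarrow> real^'n \<Rightarrow> complex. (\<forall>k. C1_fun (\<phi> k)) \<and>
        (\<lambda>k. H1_norm \<Omega> (\<lambda>x. \<phi> k x - v x)) \<longlonglongrightarrow> 0 \<and>
        (\<lambda>k. LINT x|surface_measure \<Omega>. (cmod (\<phi> k x - g x))\<^sup>2) \<longlonglongrightarrow> 0)"

definition trace_on :: "(real^'n) set \<Rightarrow> (real^'n \<Rightarrow> complex) \<Rightarrow> real^'n \<Rightarrow> complex" where
  "trace_on \<Omega> v = (SOME g. has_trace \<Omega> v g)"


section \<open>Electrodes\<close>

text \<open>\<open>e m\<close> are the electrodes, \<open>EE m\<close> the extended electrodes.\<close>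

definition electrode_config ::
  "(real^'n) set \<Rightarrow> ('m \<Rightarrow> (real^'n) set) \<Rightarrow> ('m \<Rightarrow> (real^'n) set) \<Rightarrow> bool" where
  "electrode_config \<Omega> e EE \<longleftrightarrow>
     (\<forall>m. e m \<noteq> {} \<and> connected (e m) \<and> e m \<subseteq> frontier \<Omega>) \<and>
     (\<forall>m. openin (top_of_set (frontier \<Omega>)) (EE m) \<and> connected (EE m)) \<and>
     (\<forall>m k. m \<noteq> k \<longrightarrow> EE m \<inter> EE k = {}) \<and>
     (\<forall>m. e m \<subseteq> EE m)"

definition electrode_region :: "('m \<Rightarrow> (real^'n) set) \<Rightarrow> (real^'n) set" where
  "electrode_region EE = (\<Union>m. closure (EE m))"

definition contact_measure ::
  "(real^'n) set \<Rightarrow> ('m \<Rightarrow> (real^'n) set) \<Rightarrow> (real^'n) measure" where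
  "contact_measure \<Omega> EE = restrict_space (surface_measure \<Omega>) (electrode_region EE)"

definition vec_mean :: "complex^'m \<Rightarrow> complex" where
  "vec_mean V = (\<Sum>m\<in>UNIV. V $ m) / of_nat CARD('m)"

definition Cdiamond :: "(complex^'m) set" where
  "Cdiamond = {J. (\<Sum>m\<in>UNIV. J $ m) = 0}"

text \<open>Bilinear, without conjugation.\<close>

definition dot :: "complex^'m \<Rightarrow> complex^'m \<Rightarrow> complex" where
  "dot a b = (\<Sum>m\<in>UNIV. a $ m * b $ m)"

definition cnj_vec :: "complex^'m \<Rightarrow> complex^'m" where
  "cnj_vec a = (\<chi> m. cnj (a $ m))"

text \<open>The function on \<open>\<partial>\<Omega>\<close> belonging to \<open>V\<close>. On the sets \<open>EE m\<close> it equals \<open>V $ m\<close>, i.e. it is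
  \<open>\<Sum>\<^sub>m V\<^sub>m \<chi>\<^sub>m\<close>. The additive constant, split off as the mean, is supported on the closed region
  \<^const>\<open>electrode_region\<close>; this matters only if the relative boundaries of the \<open>EE m\<close> have positive
  surface measure, in which case it is needed for \<open>B_form\<close> below to be well defined on the quotient.\<close>

definition electrode_fun :: "('m \<Rightarrow> (real^'n) set) \<Rightarrow> complex^'m \<Rightarrow> real^'n \<Rightarrow> complex" where
  "electrode_fun EE V x =
     (\<Sum>m\<in>UNIV. (V $ m - vec_mean V) * indicator (EE m) x) + vec_mean V * indicator (electrode_region EE) x"


section \<open>The quotient space and the sesquilinear form\<close>

text \<open>Elements of the quotient of \<open>H\<^sup>1(\<Omega>) \<oplus> \<complex>\<^sup>M\<close> by the span of \<open>(1, \<one>)\<close> are represented by pairs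
  \<open>(v, V)\<close>; the norm, the form \<open>B_form\<close> and the right-hand sides below do not depend on the choice of the
  representative.\<close>

type_synonym ('n, 'm) state = "(real^'n \<Rightarrow> complex) \<times> (complex^'m)"

definition HH :: "(real^'n) set \<Rightarrow> ('n, 'm::finite) state set" where
  "HH \<Omega> = H1 \<Omega> \<times> UNIV"

definition HH_norm :: "(real^'n) set \<Rightarrow> ('n, 'm::finite) state \<Rightarrow> real" where
  "HH_norm \<Omega> = (\<lambda>(v, V). INF c. sqrt ((H1_norm \<Omega> (\<lambda>x. v x - c))\<^sup>2 + (norm (V - (\<chi> m. c)))\<^sup>2))"

definition interior_form ::
  "(real^'n) set \<Rightarrow> (real^'n \<Rightarrow> complex) \<Rightarrow> (real^'n \<Rightarrow> complex^'n) \<Rightarrow> (real^'n \<Rightarrow> complex^'n) \<Rightarrow> complex"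
  where
  "interior_form \<Omega> \<sigma> F G = (LINT x|lebesgue_on \<Omega>. \<sigma> x * (\<Sum>i\<in>UNIV. F x $ i * G x $ i))"

text \<open>The coefficient \<open>\<zeta>\<close> is continued by zero from \<^const>\<open>electrode_region\<close> to the boundary.\<close>

definition boundary_form ::
  "(real^'n) set \<Rightarrow> ('m \<Rightarrow> (real^'n) set) \<Rightarrow> (real^'n \<Rightarrow> complex) \<Rightarrow>
   (real^'n \<Rightarrow> complex) \<Rightarrow> (real^'n \<Rightarrow> complex) \<Rightarrow> complex" where
  "boundary_form \<Omega> EE \<zeta> f g =
     (LINT x|surface_measure \<Omega>. (indicator (electrode_region EE) x * \<zeta> x) * f x * g x)"

text \<open>The function \<open>V - v\<close> on the boundary.\<close>

definition jump ::
  "(real^'n) set \<Rightarrow> ('m \<Rightarrow> (real^'n) set) \<Rightarrow> ('n, 'm::finite) state \<Rightarrow> real^'n \<Rightarrow> complex" where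
  "jump \<Omega> EE = (\<lambda>(v, V) x. electrode_fun EE V x - trace_on \<Omega> v x)"

definition B_form ::
  "(real^'n) set \<Rightarrow> ('m \<Rightarrow> (real^'n) set) \<Rightarrow> (real^'n \<Rightarrow> complex) \<Rightarrow> (real^'n \<Rightarrow> complex) \<Rightarrow>
   ('n, 'm::finite) state \<Rightarrow> ('n, 'm) state \<Rightarrow> complex" where
  "B_form \<Omega> EE \<sigma> \<zeta> p q =
     interior_form \<Omega> \<sigma> (weak_grad \<Omega> (fst p)) (\<lambda>x. cnj_vec (weak_grad \<Omega> (fst q) x)) +
     boundary_form \<Omega> EE \<zeta> (jump \<Omega> EE p) (\<lambda>x. cnj (jump \<Omega> EE q x))"

definition SS :: "(real^'n) set \<Rightarrow> (real^'n \<Rightarrow> complex) set" where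
  "SS \<Omega> = {\<sigma> \<in> Linf (lebesgue_on \<Omega>). 0 < essinf (lebesgue_on \<Omega>) (\<lambda>x. Re (\<sigma> x))}"

definition ZZ' :: "(real^'n) set \<Rightarrow> ('m::finite \<Rightarrow> (real^'n) set) \<Rightarrow> (real^'n \<Rightarrow> complex) set" where
  "ZZ' \<Omega> EE = {\<zeta> \<in> Linf (contact_measure \<Omega> EE).
     \<forall>\<sigma>\<in>SS \<Omega>. \<exists>c>0. \<forall>q\<in>HH \<Omega>. c * (HH_norm \<Omega> q)\<^sup>2 \<le> Re (B_form \<Omega> EE \<sigma> \<zeta> q q)}"


section \<open>The forward problem and its linearization\<close>

definition forward_solution ::
  "(real^'n) set \<Rightarrow> ('m \<Rightarrow> (real^'n) set) \<Rightarrow> (real^'n \<Rightarrow> complex) \<Rightarrow> (real^'n \<Rightarrow> complex) \<Rightarrow>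
   complex^'m \<Rightarrow> ('n, 'm::finite) state \<Rightarrow> bool" where
  "forward_solution \<Omega> EE \<sigma> \<zeta> I p \<longleftrightarrow>
     p \<in> HH \<Omega> \<and> (\<forall>q\<in>HH \<Omega>. B_form \<Omega> EE \<sigma> \<zeta> p q = dot I (cnj_vec (snd q)))"

definition linearized_solution ::
  "(real^'n) set \<Rightarrow> ('m \<Rightarrow> (real^'n) set) \<Rightarrow> (real^'n \<Rightarrow> complex) \<Rightarrow> (real^'n \<Rightarrow> complex) \<Rightarrow>
   complex^'m \<Rightarrow> (real^'n \<Rightarrow> complex) \<Rightarrow> (real^'n \<Rightarrow> complex) \<Rightarrow> complex^'m \<Rightarrow>
   ('n, 'm::finite) state \<Rightarrow> bool" where
  "linearized_solution \<Omega> EE \<sigma> \<zeta> I \<omega> \<eta> J p' \<longleftrightarrow>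
     p' \<in> HH \<Omega> \<and>
     (\<exists>p. forward_solution \<Omega> EE \<sigma> \<zeta> I p \<and>
       (\<forall>q\<in>HH \<Omega>. B_form \<Omega> EE \<sigma> \<zeta> p' q =
          dot J (cnj_vec (snd q))
          - interior_form \<Omega> \<omega> (weak_grad \<Omega> (fst p)) (\<lambda>x. cnj_vec (weak_grad \<Omega> (fst q) x))
          - boundary_form \<Omega> EE \<eta> (jump \<Omega> EE p) (\<lambda>x. cnj (jump \<Omega> EE q x))))"

type_synonym ('n, 'm) param = "(real^'n \<Rightarrow> complex) \<times> (real^'n \<Rightarrow> complex) \<times> (complex^'m)"

text \<open>The zero-mean electrode potentials. The description makes sense, and is used, for all
  parameters at which the variational problem is uniquely solvable.\<close>

definition U_map ::
  "(real^'n) set \<Rightarrow> ('m \<Rightarrow> (real^'n) set) \<Rightarrow> ('n, 'm::finite) param \<Rightarrow> complex^'m" where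
  "U_map \<Omega> EE = (\<lambda>(\<sigma>, \<zeta>, I). THE U. U \<in> Cdiamond \<and> (\<exists>u. forward_solution \<Omega> EE \<sigma> \<zeta> I (u, U)))"

definition U_deriv ::
  "(real^'n) set \<Rightarrow> ('m \<Rightarrow> (real^'n) set) \<Rightarrow> ('n, 'm::finite) param \<Rightarrow> ('n, 'm) param \<Rightarrow> complex^'m" where
  "U_deriv \<Omega> EE = (\<lambda>(\<sigma>, \<zeta>, I) (\<omega>, \<eta>, J).
     THE U'. U' \<in> Cdiamond \<and> (\<exists>u'. linearized_solution \<Omega> EE \<sigma> \<zeta> I \<omega> \<eta> J (u', U')))"


section \<open>Frechet differentiability on the parameter space\<close>

text \<open>The parameters form a seminormed complex vector space of representatives; sums of parameters
  are the pointwise ones.\<close>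

definition param_space ::
  "(real^'n) set \<Rightarrow> ('m::finite \<Rightarrow> (real^'n) set) \<Rightarrow> ('n, 'm) param set" where
  "param_space \<Omega> EE = Linf (lebesgue_on \<Omega>) \<times> Linf (contact_measure \<Omega> EE) \<times> Cdiamond"

definition param_norm ::
  "(real^'n) set \<Rightarrow> ('m::finite \<Rightarrow> (real^'n) set) \<Rightarrow> ('n, 'm) param \<Rightarrow> real" where
  "param_norm \<Omega> EE = (\<lambda>(\<omega>, \<eta>, J).
     Max {Linf_norm (lebesgue_on \<Omega>) \<omega>, Linf_norm (contact_measure \<Omega> EE) \<eta>, norm J})"

definition param_scale :: "complex \<Rightarrow> ('n, 'm::finite) param \<Rightarrow> ('n, 'm) param" where
  "param_scale c = (\<lambda>(\<omega>, \<eta>, J). (\<lambda>x. c * \<omega> x, \<lambda>x. c * \<eta> x, c *s J))"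

definition has_frechet_derivative_at ::
  "(real^'n) set \<Rightarrow> ('m::finite \<Rightarrow> (real^'n) set) \<Rightarrow> (('n, 'm) param \<Rightarrow> complex^'m) \<Rightarrow>
   (('n, 'm) param \<Rightarrow> complex^'m) \<Rightarrow> ('n, 'm) param \<Rightarrow> bool" where
  "has_frechet_derivative_at \<Omega> EE F F' p \<longleftrightarrow>
     (\<forall>h\<in>param_space \<Omega> EE. \<forall>k\<in>param_space \<Omega> EE. F' (h + k) = F' h + F' k) \<and>
     (\<forall>c. \<forall>h\<in>param_space \<Omega> EE. F' (param_scale c h) = c *s F' h) \<and>
     (\<exists>K. \<forall>h\<in>param_space \<Omega> EE. norm (F' h) \<le> K * param_norm \<Omega> EE h) \<and>
     (\<forall>\<epsilon>>0. \<exists>\<delta>>0. \<forall>h\<in>param_space \<Omega> EE. param_norm \<Omega> EE h < \<delta> \<longrightarrow>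
        norm (F (p + h) - F p - F' h) \<le> \<epsilon> * param_norm \<Omega> EE h)"

end

theory Submission
  imports Defs
begin

text \<open>All solutions are taken among the zero-mean states, where the quotient norm is equivalent to the norm of
  \<open>H\<^sup>1(\<Omega>) \<oplus> \<complex>\<^sup>M\<close>, and where the Lax--Milgram lemma applies. Subtracting the variational equations, the remainder
  \<open>r = p\<^sub>h - p - p'\<close> solves \<open>B(r, q) = - B\<^sub>h(p\<^sub>h - p, q)\<close>, where \<open>B\<^sub>h\<close> is the form with the
  perturbations as coefficients and \<open>p\<^sub>h - p\<close> is of first order; so \<open>r\<close> is of second order. Testing the linearized
  equation with the complex conjugate of a forward solution gives the formula for the derivative.

  The form is bounded because of the trace inequality. For the latter only an upper bound for the Hausdorff
  measure is needed: by Vitali's covering theorem it is dominated, on a piece of the boundary, by the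
  image under vertical projection of the Lebesgue measure on the strip above that piece, since the strip above a
  small ball contains a stack of disjoint balls. An increment along the vertical segments then estimates a
  continuously differentiable function on the boundary by its values and its gradient inside. Such functions are
  dense in \<open>H\<^sup>1(\<Omega>)\<close> by mollification with kernels that are shifted into the domain.\<close>

section \<open>Square integrable functions\<close>

text \<open>Everything in the statement is a representative: \<open>weak_grad\<close> and
  \<open>trace_on\<close> are values of \<open>SOME\<close>, \<open>U_map\<close> and
  \<open>U_deriv\<close> values of \<open>THE\<close>. Hence the algebraic laws for gradients and
  jumps hold only almost everywhere, and forward solutions are unique only up to constants and
  states of seminorm zero. What has to be shown is that no form sees these ambiguities and that the
  zero-mean potential vector is free of them. The trace exists because C1 functions are dense and
  satisfy a trace inequality, so the geometry has to come before the functional analysis. An upper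
  bound for the Hausdorff measure suffices there since \<open>surface_measure\<close> is built with
  \<open>measure_of\<close>: its value on a set is the outer measure or 0, so the bound holds
  whether or not the outer measure is countably additive. At perturbed parameters solvability comes
  from perturbing the coercivity estimate of the given pair (\<sigma>, \<zeta>), with half its
  constant.\<close>

definition l2 :: "'a measure \<Rightarrow> ('a \<Rightarrow> 'b::real_normed_vector) \<Rightarrow> real" where
  "l2 M f = sqrt (LINT x|M. (norm (f x))\<^sup>2)"

lemma l2_nonneg [simp]: "0 \<le> l2 M f"
  by (simp add: l2_def)

lemma l2_sq: "(l2 M f)\<^sup>2 = (LINT x|M. (norm (f x))\<^sup>2)"
  by (simp add: l2_def)

lemma L2_I: "f \<in> borel_measurable M \<Longrightarrow> integrable M (\<lambda>x. (norm (f x))\<^sup>2) \<Longrightarrow> f \<in> L2 M"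
  by (simp add: L2_def)

lemma L2_measurable: "f \<in> L2 M \<Longrightarrow> f \<in> borel_measurable M"
  by (simp add: L2_def)

lemma L2_integrable: "f \<in> L2 M \<Longrightarrow> integrable M (\<lambda>x. (norm (f x))\<^sup>2)"
  by (simp add: L2_def)

lemma L2_bound:
  fixes f :: "'a \<Rightarrow> 'b::{second_countable_topology, real_normed_vector}"
    and g :: "'a \<Rightarrow> 'c::{second_countable_topology, real_normed_vector}"
  assumes "g \<in> L2 M" "f \<in> borel_measurable M" "AE x in M. norm (f x) \<le> C * norm (g x)"
  shows "f \<in> L2 M"
proof (rule L2_I[OF assms(2)])
  note [measurable] = assms(2)
  have "integrable M (\<lambda>x. C\<^sup>2 * (norm (g x))\<^sup>2)"
    using L2_integrable[OF assms(1)] by simp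
  then show "integrable M (\<lambda>x. (norm (f x))\<^sup>2)"
  proof (rule Bochner_Integration.integrable_bound)
    show "AE x in M. norm ((norm (f x))\<^sup>2) \<le> norm (C\<^sup>2 * (norm (g x))\<^sup>2)"
      using assms(3)
    proof eventually_elim
      case (elim x)
      then have "(norm (f x))\<^sup>2 \<le> (C * norm (g x))\<^sup>2" by (intro power_mono) auto
      then show ?case by (simp add: power_mult_distrib)
    qed
  qed measurable
qed

lemma L2_add:
  fixes f g :: "'a \<Rightarrow> 'b::{second_countable_topology, real_normed_vector}"
  assumes "f \<in> L2 M" "g \<in> L2 M"
  shows "(\<lambda>x. f x + g x) \<in> L2 M"
proof (rule L2_I)
  note [measurable] = assms[THEN L2_measurable]
  show "(\<lambda>x. f x + g x) \<in> borel_measurable M" by measurable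
  have "integrable M (\<lambda>x. 2 * (norm (f x))\<^sup>2 + 2 * (norm (g x))\<^sup>2)"
    using assms[THEN L2_integrable] by simp
  then show "integrable M (\<lambda>x. (norm (f x + g x))\<^sup>2)"
  proof (rule Bochner_Integration.integrable_bound)
    show "AE x in M. norm ((norm (f x + g x))\<^sup>2) \<le> norm (2 * (norm (f x))\<^sup>2 + 2 * (norm (g x))\<^sup>2)"
    proof (rule AE_I2)
      fix x
      have "(norm (f x + g x))\<^sup>2 \<le> (norm (f x) + norm (g x))\<^sup>2"
        by (intro power_mono norm_triangle_ineq) auto
      also have "\<dots> \<le> 2 * (norm (f x))\<^sup>2 + 2 * (norm (g x))\<^sup>2"
        using sum_squares_bound[of "norm (f x)" "norm (g x)"] by (simp add: power2_sum)
      finally show "norm ((norm (f x + g x))\<^sup>2) \<le> norm (2 * (norm (f x))\<^sup>2 + 2 * (norm (g x))\<^sup>2)"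
        by simp
    qed
  qed measurable
qed

lemma L2_uminus:
  "f \<in> L2 M \<Longrightarrow> (\<lambda>x. - f x) \<in> L2 M"
  by (simp add: L2_def)

lemma L2_diff:
  fixes f g :: "'a \<Rightarrow> 'b::{second_countable_topology, real_normed_vector}"
  assumes "f \<in> L2 M" "g \<in> L2 M"
  shows "(\<lambda>x. f x - g x) \<in> L2 M"
  using L2_add[OF assms(1) L2_uminus[OF assms(2)]] by simp

lemma L2_zero [simp]: "(\<lambda>x. 0) \<in> L2 M"
  by (simp add: L2_def)

lemma l2_zero [simp]: "l2 M (\<lambda>x. 0) = 0"
  by (simp add: l2_def)

lemma L2_cmult:
  fixes f :: "'a \<Rightarrow> complex"
  assumes "f \<in> L2 M" shows "(\<lambda>x. c * f x) \<in> L2 M"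
  using assms by (intro L2_bound[OF assms, of _ "cmod c"]) (auto simp: norm_mult dest: L2_measurable)

lemma norm_smult_vec:
  fixes v :: "complex^'n"
  shows "norm (c *s v) = cmod c * norm v"
  by (simp add: norm_vec_def norm_mult L2_set_right_distrib)

lemma L2_smult_vec:
  fixes f :: "'a \<Rightarrow> complex^'n"
  assumes "f \<in> L2 M" shows "(\<lambda>x. c *s f x) \<in> L2 M"
proof (rule L2_bound[OF assms, of _ "cmod c"])
  have "continuous_on UNIV (\<lambda>v :: complex^'n. c *s v)"
    unfolding vector_scalar_mult_def by (intro continuous_intros)
  then show "(\<lambda>x. c *s f x) \<in> borel_measurable M"
    using L2_measurable[OF assms] borel_measurable_continuous_on by blast
qed (simp add: norm_smult_vec)

lemma L2_cnj: "f \<in> L2 M \<Longrightarrow> (\<lambda>x. cnj (f x)) \<in> L2 M"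
  by (rule L2_bound[where C=1]) (auto dest: L2_measurable intro: borel_measurable_continuous_on[OF continuous_on_cnj[OF continuous_on_id]])

lemma l2_cong_AE:
  assumes "f \<in> borel_measurable M" "g \<in> borel_measurable M" "AE x in M. f x = g x"
  shows "l2 M f = l2 M g"
proof -
  note [measurable] = assms(1,2)
  have "(LINT x|M. (norm (f x))\<^sup>2) = (LINT x|M. (norm (g x))\<^sup>2)"
    by (rule integral_cong_AE) (use assms(3) in \<open>auto\<close>)
  then show ?thesis by (simp add: l2_def)
qed

lemma l2_minus_commute: "l2 M (\<lambda>x. f x - g x) = l2 M (\<lambda>x. g x - f x)"
  by (simp add: l2_def norm_minus_commute)

lemma l2_eq_0:
  fixes f :: "'a \<Rightarrow> 'b::{second_countable_topology, real_normed_vector}"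
  assumes "f \<in> L2 M" "l2 M f = 0" shows "AE x in M. f x = 0"
proof -
  have "AE x in M. (norm (f x))\<^sup>2 = 0"
    using integral_nonneg_eq_0_iff_AE[OF L2_integrable[OF assms(1)]] assms(2) by (simp add: l2_def)
  then show ?thesis by simp
qed

lemma l2_nn:
  assumes "f \<in> L2 M"
  shows "(\<integral>\<^sup>+x. ennreal ((norm (f x))\<^sup>2) \<partial>M) = ennreal ((l2 M f)\<^sup>2)"
  unfolding l2_sq by (rule nn_integral_eq_integral[OF L2_integrable[OF assms]]) simp

text \<open>Way in from nonnegative integrals: one estimate gives membership and the norm bound,
  without a separate proof of integrability.\<close>

lemma L2_nn_I:
  fixes f :: "'a \<Rightarrow> 'b::{second_countable_topology, real_normed_vector}"
  assumes "f \<in> borel_measurable M" "(\<integral>\<^sup>+x. ennreal ((norm (f x))\<^sup>2) \<partial>M) \<le> ennreal C"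
  shows "f \<in> L2 M" "0 \<le> C \<Longrightarrow> l2 M f \<le> sqrt C"
proof -
  note [measurable] = assms(1)
  show f: "f \<in> L2 M"
    by (rule L2_I[OF assms(1)], rule integrableI_bounded)
       (use le_less_trans[OF assms(2) ennreal_less_top] in \<open>auto\<close>)
  show "l2 M f \<le> sqrt C" if "0 \<le> C"
    using assms(2) that unfolding l2_nn[OF f]
    by (metis ennreal_le_iff real_le_rsqrt)
qed

lemma L2_integrable_mult:
  fixes f :: "'a \<Rightarrow> 'b::{second_countable_topology, real_normed_vector}"
    and g :: "'a \<Rightarrow> 'c::{second_countable_topology, real_normed_vector}"
  assumes "f \<in> L2 M" "g \<in> L2 M"
  shows "integrable M (\<lambda>x. norm (f x) * norm (g x))"
proof -
  note [measurable] = assms[THEN L2_measurable]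
  have "integrable M (\<lambda>x. (norm (f x))\<^sup>2 + (norm (g x))\<^sup>2)"
    using assms[THEN L2_integrable] by simp
  then show ?thesis
  proof (rule Bochner_Integration.integrable_bound)
    show "AE x in M. norm (norm (f x) * norm (g x)) \<le> norm ((norm (f x))\<^sup>2 + (norm (g x))\<^sup>2)"
    proof (rule AE_I2)
      fix x
      have "norm (f x) * norm (g x) \<le> 2 * norm (f x) * norm (g x)" by simp
      also have "\<dots> \<le> (norm (f x))\<^sup>2 + (norm (g x))\<^sup>2" by (rule sum_squares_bound)
      finally show "norm (norm (f x) * norm (g x)) \<le> norm ((norm (f x))\<^sup>2 + (norm (g x))\<^sup>2)"
        by (simp add: abs_mult)
    qed
  qed measurable
qed

lemma L2_Cauchy_Schwarz:
  fixes f :: "'a \<Rightarrow> 'b::{second_countable_topology, real_normed_vector}"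
    and g :: "'a \<Rightarrow> 'c::{second_countable_topology, real_normed_vector}"
  assumes "f \<in> L2 M" "g \<in> L2 M"
  shows "(LINT x|M. norm (f x) * norm (g x)) \<le> l2 M f * l2 M g"
proof -
  note [measurable] = assms[THEN L2_measurable]
  let ?b = "LINT x|M. norm (f x) * norm (g x)"
  have b: "(\<integral>\<^sup>+x. ennreal (norm (f x)) * ennreal (norm (g x)) \<partial>M) = ennreal ?b"
    using nn_integral_eq_integral[OF L2_integrable_mult[OF assms]] by (simp add: ennreal_mult)
  have "(\<integral>\<^sup>+x. ennreal (norm (f x)) * ennreal (norm (g x)) \<partial>M)\<^sup>2
        \<le> (\<integral>\<^sup>+x. (ennreal (norm (f x)))\<^sup>2 \<partial>M) * (\<integral>\<^sup>+x. (ennreal (norm (g x)))\<^sup>2 \<partial>M)"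
    by (rule Cauchy_Schwarz_nn_integral) measurable
  then have "ennreal (?b\<^sup>2) \<le> ennreal ((l2 M f * l2 M g)\<^sup>2)"
    unfolding b by (simp add: ennreal_power l2_nn assms power_mult_distrib flip: ennreal_mult)
  then have "?b\<^sup>2 \<le> (l2 M f * l2 M g)\<^sup>2" by simp
  then show ?thesis by (rule power2_le_imp_le) simp
qed

lemma l2_triangle:
  fixes f g :: "'a \<Rightarrow> 'b::{second_countable_topology, real_normed_vector}"
  assumes "f \<in> L2 M" "g \<in> L2 M"
  shows "l2 M (\<lambda>x. f x + g x) \<le> l2 M f + l2 M g"
proof (rule power2_le_imp_le)
  have "(l2 M (\<lambda>x. f x + g x))\<^sup>2 \<le> (LINT x|M. (norm (f x))\<^sup>2 + (norm (g x))\<^sup>2 + 2 * (norm (f x) * norm (g x)))"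
    unfolding l2_sq
  proof (rule integral_mono)
    show "integrable M (\<lambda>x. (norm (f x + g x))\<^sup>2)" by (rule L2_integrable[OF L2_add[OF assms]])
    show "integrable M (\<lambda>x. (norm (f x))\<^sup>2 + (norm (g x))\<^sup>2 + 2 * (norm (f x) * norm (g x)))"
      using assms[THEN L2_integrable] L2_integrable_mult[OF assms] by auto
    fix x
    have "(norm (f x + g x))\<^sup>2 \<le> (norm (f x) + norm (g x))\<^sup>2"
      by (intro power_mono norm_triangle_ineq) auto
    then show "(norm (f x + g x))\<^sup>2 \<le> (norm (f x))\<^sup>2 + (norm (g x))\<^sup>2 + 2 * (norm (f x) * norm (g x))"
      by (simp add: power2_sum)
  qed
  also have "\<dots> = (l2 M f)\<^sup>2 + (l2 M g)\<^sup>2 + 2 * (LINT x|M. norm (f x) * norm (g x))"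
    using assms[THEN L2_integrable] L2_integrable_mult[OF assms] by (simp add: l2_sq)
  also have "\<dots> \<le> (l2 M f + l2 M g)\<^sup>2"
    using L2_Cauchy_Schwarz[OF assms] by (simp add: power2_sum)
  finally show "(l2 M (\<lambda>x. f x + g x))\<^sup>2 \<le> (l2 M f + l2 M g)\<^sup>2" .
qed simp

lemma l2_triangle3:
  fixes f g h :: "'a \<Rightarrow> 'b::{second_countable_topology, real_normed_vector}"
  assumes "f \<in> L2 M" "g \<in> L2 M" "h \<in> L2 M"
  shows "l2 M (\<lambda>x. f x - h x) \<le> l2 M (\<lambda>x. f x - g x) + l2 M (\<lambda>x. g x - h x)"
  using l2_triangle[OF L2_diff[OF assms(1,2)] L2_diff[OF assms(2,3)]] by simp

lemma l2_bound_AE: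
  fixes f :: "'a \<Rightarrow> 'b::{second_countable_topology, real_normed_vector}"
    and g :: "'a \<Rightarrow> 'c::{second_countable_topology, real_normed_vector}"
  assumes "g \<in> L2 M" "f \<in> borel_measurable M" "AE x in M. norm (f x) \<le> C * norm (g x)" "0 \<le> C"
  shows "l2 M f \<le> C * l2 M g"
proof (rule power2_le_imp_le)
  have f: "f \<in> L2 M" by (rule L2_bound[OF assms(1-3)])
  have "(l2 M f)\<^sup>2 \<le> (LINT x|M. C\<^sup>2 * (norm (g x))\<^sup>2)"
    unfolding l2_sq
  proof (rule integral_mono_AE)
    show "AE x in M. (norm (f x))\<^sup>2 \<le> C\<^sup>2 * (norm (g x))\<^sup>2"
      using assms(3) by eventually_elim (metis norm_ge_zero power_mono power_mult_distrib)
  qed (use L2_integrable[OF f] L2_integrable[OF assms(1)] in auto)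
  then show "(l2 M f)\<^sup>2 \<le> (C * l2 M g)\<^sup>2"
    by (simp add: power_mult_distrib l2_sq)
qed (use assms(4) in simp)

text \<open>Riesz-Fischer. Along a subsequence the increments decay like (1/4)^k in norm. Their
  squares, weighted by 4^k, still have a finite integrated sum, so almost everywhere the increments
  are at most a constant times (1/2)^k. This gives pointwise convergence, and Fatou's lemma returns
  to the norm.\<close>

lemma L2_complete:
  fixes f :: "nat \<Rightarrow> 'a \<Rightarrow> 'b::{second_countable_topology, banach}"
  assumes f: "\<And>n. f n \<in> L2 M"
    and Cauchy: "\<And>e. e > 0 \<Longrightarrow> \<exists>N. \<forall>m\<ge>N. \<forall>n\<ge>N. l2 M (\<lambda>x. f m x - f n x) < e"
  shows "\<exists>g\<in>L2 M. (\<lambda>n. l2 M (\<lambda>x. f n x - g x)) \<longlonglongrightarrow> 0"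
proof -
  note [measurable] = f[THEN L2_measurable]
  have "\<exists>N. \<forall>k. (\<forall>m\<ge>N k. \<forall>n\<ge>N k. l2 M (\<lambda>x. f m x - f n x) < (1/4)^k)"
    using Cauchy[of "(1/4)^_"] by (intro choice) auto
  then obtain N where N: "\<And>k m n. m \<ge> N k \<Longrightarrow> n \<ge> N k \<Longrightarrow> l2 M (\<lambda>x. f m x - f n x) < (1/4)^k"
    by blast
  \<comment> \<open>Partial sums make the indices nondecreasing and keep them at least
    \<open>N k\<close>.\<close>
  define r where "r k = (\<Sum>i\<le>k. N i)" for k
  have rN: "r k \<ge> N k" and rmono: "r (Suc k) \<ge> r k" for k
    by (auto simp: r_def intro: member_le_sum)
  have rN': "r m \<ge> N k" if "m \<ge> k" for m k
    using rN[of k] lift_Suc_mono_le[of r, OF rmono that] by simp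
  define u where "u k x = norm (f (r (Suc k)) x - f (r k) x)" for k x
  have [measurable]: "u k \<in> borel_measurable M" for k
    unfolding u_def by measurable
  have u: "(\<integral>\<^sup>+x. ennreal (4^k * (u k x)\<^sup>2) \<partial>M) \<le> ennreal ((1/4)^k)" for k
  proof -
    have d: "(\<lambda>x. f (r (Suc k)) x - f (r k) x) \<in> L2 M"
      by (intro L2_diff f)
    have "(\<integral>\<^sup>+x. ennreal (4^k * (u k x)\<^sup>2) \<partial>M) = ennreal (4^k) * (\<integral>\<^sup>+x. ennreal ((u k x)\<^sup>2) \<partial>M)"
      by (simp add: ennreal_mult nn_integral_cmult)
    also have "\<dots> = ennreal (4^k * (l2 M (\<lambda>x. f (r (Suc k)) x - f (r k) x))\<^sup>2)"
      unfolding u_def using l2_nn[OF d] by (simp add: ennreal_mult)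
    also have "\<dots> \<le> ennreal (4^k * ((1/4)^k)\<^sup>2)"
    proof (intro ennreal_leI mult_left_mono power_mono)
      show "l2 M (\<lambda>x. f (r (Suc k)) x - f (r k) x) \<le> (1 / 4) ^ k"
        using N[of k "r (Suc k)" "r k"] rN'[of k "Suc k"] rN[of k] by simp
    qed auto
    also have "4^k * ((1/4)^k)\<^sup>2 = ((1/4::real)^k)"
      by (simp add: power2_eq_square power_divide)
    finally show ?thesis .
  qed
  have "(\<integral>\<^sup>+x. (\<Sum>k. ennreal (4^k * (u k x)\<^sup>2)) \<partial>M) = (\<Sum>k. \<integral>\<^sup>+x. ennreal (4^k * (u k x)\<^sup>2) \<partial>M)"
    by (rule nn_integral_suminf) measurable
  also have "\<dots> \<le> (\<Sum>k. ennreal ((1/4)^k))"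
    by (intro suminf_le u) auto
  also have "\<dots> < \<infinity>"
    by (subst suminf_ennreal2) auto
  finally have "AE x in M. (\<Sum>k. ennreal (4^k * (u k x)\<^sup>2)) \<noteq> \<infinity>"
    by (intro nn_integral_PInf_AE) auto
  then have conv: "AE x in M. convergent (\<lambda>k. f (r k) x)"
  proof eventually_elim
    case (elim x)
    then have "summable (\<lambda>k. 4^k * (u k x)\<^sup>2)"
      by (intro summable_suminf_not_top) auto
    then have "(\<lambda>k. 4^k * (u k x)\<^sup>2) \<longlonglongrightarrow> 0" by (rule summable_LIMSEQ_zero)
    then have "Bseq (\<lambda>k. 4^k * (u k x)\<^sup>2)"
      by (intro convergent_imp_Bseq convergentI)
    then obtain K where K: "\<And>k. norm (4^k * (u k x)\<^sup>2) \<le> K"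
      unfolding Bseq_def by blast
    have "u k x \<le> sqrt K * (1/2)^k" for k
    proof -
      have "(2^k * u k x)\<^sup>2 \<le> K"
      proof -
        have "(2^k)\<^sup>2 = (4::real)^k" by (simp add: power2_eq_square flip: power_mult_distrib)
        then show ?thesis using K[of k] by (simp add: power_mult_distrib)
      qed
      then have "2^k * u k x \<le> sqrt K" by (rule real_le_rsqrt)
      then show ?thesis by (simp add: field_simps)
    qed
    then have le: "norm (u k x) \<le> sqrt K * (1/2)^k" for k
      by (simp add: u_def)
    have "summable (\<lambda>k. sqrt K * (1/2::real)^k)"
      by (intro summable_mult summable_geometric) simp
    then have "summable (\<lambda>k. u k x)"
      by (rule summable_comparison_test') (rule le)
    then have "summable (\<lambda>k. f (r (Suc k)) x - f (r k) x)"
      unfolding u_def by (rule summable_norm_cancel)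
    then have "convergent (\<lambda>n. \<Sum>k<n. f (r (Suc k)) x - f (r k) x)"
      by (simp add: summable_iff_convergent)
    then have "convergent (\<lambda>n. f (r n) x - f (r 0) x)"
      using sum_lessThan_telescope[of "\<lambda>n. f (r n) x"] by simp
    then have "convergent (\<lambda>n. (f (r n) x - f (r 0) x) + f (r 0) x)"
      by (rule convergent_add[OF _ convergent_const])
    then show ?case by simp
  qed
  \<comment> \<open>The value 0 where the subsequence diverges keeps the limit function
    measurable.\<close>
  define g where "g x = (if convergent (\<lambda>k. f (r k) x) then lim (\<lambda>k. f (r k) x) else 0)" for x
  have [measurable]: "g \<in> borel_measurable M"
  proof -
    have A: "{x\<in>space M. convergent (\<lambda>k. f (r k) x)} \<in> sets M"
      unfolding Cauchy_convergent_iff[symmetric] by (rule sets_Collect_Cauchy) measurable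
    show ?thesis unfolding g_def
    proof (rule borel_measurable_LIMSEQ_metric[where f="\<lambda>k x. if convergent (\<lambda>k. f (r k) x) then f (r k) x else 0"])
      show "(\<lambda>x. if convergent (\<lambda>k. f (r k) x) then f (r i) x else 0) \<in> borel_measurable M" for i
        using A by (intro measurable_If) auto
    qed (auto simp: convergent_LIMSEQ_iff)
  qed
  have lim: "AE x in M. (\<lambda>k. f (r k) x) \<longlonglongrightarrow> g x"
    using conv by eventually_elim (simp add: g_def convergent_LIMSEQ_iff)
  \<comment> \<open>Fatou's lemma: a uniform bound for the distance of \<open>f n\<close> to the
    tail of the subsequence passes to the limit \<open>g\<close>.\<close>
  have est: "(\<integral>\<^sup>+x. ennreal ((norm (f n x - g x))\<^sup>2) \<partial>M) \<le> ennreal (e\<^sup>2)"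
    if e: "\<And>m. m \<ge> K \<Longrightarrow> l2 M (\<lambda>x. f n x - f (r m) x) \<le> e" for n e K
  proof -
    have "(\<integral>\<^sup>+x. ennreal ((norm (f n x - g x))\<^sup>2) \<partial>M) = (\<integral>\<^sup>+x. liminf (\<lambda>k. ennreal ((norm (f n x - f (r k) x))\<^sup>2)) \<partial>M)"
    proof (rule nn_integral_cong_AE)
      show "AE x in M. ennreal ((norm (f n x - g x))\<^sup>2) = liminf (\<lambda>k. ennreal ((norm (f n x - f (r k) x))\<^sup>2))"
        using lim
      proof eventually_elim
        case (elim x)
        have "(\<lambda>k. ennreal ((norm (f n x - f (r k) x))\<^sup>2)) \<longlonglongrightarrow> ennreal ((norm (f n x - g x))\<^sup>2)"
          by (intro tendsto_intros elim)
        then show ?case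
          by (rule lim_imp_Liminf[OF sequentially_bot, symmetric])
      qed
    qed
    also have "\<dots> \<le> liminf (\<lambda>k. \<integral>\<^sup>+x. ennreal ((norm (f n x - f (r k) x))\<^sup>2) \<partial>M)"
      by (rule nn_integral_liminf) measurable
    also have "\<dots> \<le> liminf (\<lambda>k. ennreal (e\<^sup>2))"
    proof (rule Liminf_mono)
      show "\<forall>\<^sub>F k in sequentially. (\<integral>\<^sup>+x. ennreal ((norm (f n x - f (r k) x))\<^sup>2) \<partial>M) \<le> ennreal (e\<^sup>2)"
        unfolding eventually_sequentially
        by (intro exI[of _ K] allI impI, subst l2_nn) (auto intro!: L2_diff f ennreal_leI power_mono e)
    qed
    also have "\<dots> = ennreal (e\<^sup>2)" by (simp add: Liminf_const)
    finally show ?thesis .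
  qed
  have est2: "\<exists>n0. \<forall>n\<ge>n0. (\<lambda>x. f n x - g x) \<in> L2 M \<and> l2 M (\<lambda>x. f n x - g x) \<le> e" if e: "e > 0" for e
  proof -
    obtain n0 where n0: "\<And>m n. m \<ge> n0 \<Longrightarrow> n \<ge> n0 \<Longrightarrow> l2 M (\<lambda>x. f m x - f n x) < e / 2"
      using Cauchy[of "e/2"] e by auto
    obtain K where K: "(1/4::real)^K < e / 2"
      using real_arch_pow_inv[of "e/2" "1/4"] e by auto
    have "l2 M (\<lambda>x. f n x - f (r m) x) \<le> e" if "n \<ge> n0" "m \<ge> K" for n m
    proof -
      let ?p = "max n0 (N K)"
      have "l2 M (\<lambda>x. f n x - f (r m) x) \<le> l2 M (\<lambda>x. f n x - f ?p x) + l2 M (\<lambda>x. f ?p x - f (r m) x)"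
        by (intro l2_triangle3 f)
      moreover have "l2 M (\<lambda>x. f n x - f ?p x) < e / 2"
        using n0[of n ?p] that by simp
      moreover have "l2 M (\<lambda>x. f ?p x - f (r m) x) < (1/4)^K"
        using N[of K ?p "r m"] rN'[of K m] that by simp
      ultimately show ?thesis using K by simp
    qed
    then have "(\<lambda>x. f n x - g x) \<in> L2 M \<and> l2 M (\<lambda>x. f n x - g x) \<le> sqrt (e\<^sup>2)" if "n \<ge> n0" for n
      using L2_nn_I[of "\<lambda>x. f n x - g x" M "e\<^sup>2"] est[of K n e] that by simp
    then show ?thesis using e by auto
  qed
  obtain n0 where "(\<lambda>x. f n0 x - g x) \<in> L2 M" using est2[of 1] by auto
  from L2_diff[OF f[of n0] this] have g: "g \<in> L2 M" by simp
  moreover have "(\<lambda>n. l2 M (\<lambda>x. f n x - g x)) \<longlonglongrightarrow> 0"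
  proof (rule LIMSEQ_I)
    fix e :: real assume "e > 0"
    then obtain n0 where "\<forall>n\<ge>n0. l2 M (\<lambda>x. f n x - g x) \<le> e/2" using est2[of "e/2"] by auto
    then show "\<exists>n0. \<forall>n\<ge>n0. norm (l2 M (\<lambda>x. f n x - g x) - 0) < e"
      using \<open>e > 0\<close> by (intro exI[of _ n0]) (force)
  qed
  ultimately show ?thesis by blast
qed

section \<open>Continuously differentiable functions\<close>

definition cgrad :: "(real^'n \<Rightarrow> complex) \<Rightarrow> real^'n \<Rightarrow> complex^'n" where
  "cgrad \<phi> x = (\<chi> i. partial_deriv i \<phi> x)"

text \<open>A continuous gradient field yields the operator-valued derivative that
  \<open>C1_fun\<close> asks for, because in finite dimension continuity of an operator-valued map
  can be tested on basis vectors.\<close>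

lemma C1_funI:
  fixes \<phi> :: "real^'n \<Rightarrow> complex" and g :: "real^'n \<Rightarrow> complex^'n"
  assumes d: "\<And>x. (\<phi> has_derivative (\<lambda>h. \<Sum>i\<in>UNIV. of_real (h $ i) * g x $ i)) (at x)"
    and c: "continuous_on UNIV g"
  shows "C1_fun \<phi>" "cgrad \<phi> = g"
proof -
  let ?L = "\<lambda>x h. \<Sum>i\<in>UNIV. of_real (h $ i) * g x $ i"
  have b: "bounded_linear (?L x)" for x
    using has_derivative_bounded_linear[OF d] .
  have ax: "?L x (axis i 1) = g x $ i" for x i
  proof -
    have "?L x (axis i 1) = (\<Sum>j\<in>UNIV. if j = i then g x $ i else 0)"
      by (intro sum.cong) (auto simp: axis_def)
    then show ?thesis by simp
  qed
  define D where "D x = Blinfun (?L x)" for x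
  have D: "blinfun_apply (D x) = ?L x" for x
    unfolding D_def by (rule bounded_linear_Blinfun_apply[OF b])
  have "continuous_on UNIV D"
  proof (rule continuous_on_blinfun_componentwise)
    fix e :: "real^'n" assume "e \<in> Basis"
    show "continuous_on UNIV (\<lambda>x. blinfun_apply (D x) e)"
      unfolding D by (intro continuous_intros c)
  qed
  then show "C1_fun \<phi>"
    unfolding C1_fun_def using d D by (intro exI[of _ D]) auto
  have "partial_deriv i \<phi> x = g x $ i" for i x
    unfolding partial_deriv_def frechet_derivative_at[OF d, symmetric] by (rule ax)
  then show "cgrad \<phi> = g" by (simp add: cgrad_def fun_eq_iff vec_eq_iff)
qed

lemma C1_fun_has_derivative:
  fixes \<phi> :: "real^'n \<Rightarrow> complex"
  assumes "C1_fun \<phi>"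
  shows "(\<phi> has_derivative (\<lambda>h. \<Sum>i\<in>UNIV. of_real (h $ i) * cgrad \<phi> x $ i)) (at x)"
    and "continuous_on UNIV (cgrad \<phi>)"
proof -
  obtain D :: "real^'n \<Rightarrow> ((real^'n) \<Rightarrow>\<^sub>L complex)"
    where D: "\<And>x. (\<phi> has_derivative blinfun_apply (D x)) (at x)" and c: "continuous_on UNIV D"
    using assms unfolding C1_fun_def by blast
  have g: "cgrad \<phi> x $ i = D x (axis i 1)" for x i
    unfolding cgrad_def partial_deriv_def frechet_derivative_at[OF D, symmetric] by simp
  have "blinfun_apply (D x) h = (\<Sum>i\<in>UNIV. of_real (h $ i) * cgrad \<phi> x $ i)" for x h
  proof -
    have "h = (\<Sum>i\<in>UNIV. (h $ i) *\<^sub>R axis i 1)"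
      using basis_expansion[of h] by (simp add: scalar_mult_eq_scaleR)
    then have "blinfun_apply (D x) h = blinfun_apply (D x) (\<Sum>i\<in>UNIV. (h $ i) *\<^sub>R axis i 1)" by simp
    also have "\<dots> = (\<Sum>i\<in>UNIV. (h $ i) *\<^sub>R blinfun_apply (D x) (axis i 1))"
      by (simp add: blinfun.sum_right blinfun.scaleR_right)
    finally show ?thesis by (simp add: g scaleR_conv_of_real)
  qed
  then have "blinfun_apply (D x) = (\<lambda>h. \<Sum>i\<in>UNIV. of_real (h $ i) * cgrad \<phi> x $ i)" for x by blast
  then show "(\<phi> has_derivative (\<lambda>h. \<Sum>i\<in>UNIV. of_real (h $ i) * cgrad \<phi> x $ i)) (at x)"
    using D[of x] by simp
  have "cgrad \<phi> = (\<lambda>x. \<chi> i. blinfun_apply (D x) (axis i 1))"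
    by (simp add: fun_eq_iff vec_eq_iff g)
  then show "continuous_on UNIV (cgrad \<phi>)"
    by (simp add: continuous_intros c)
qed

lemma C1_fun_continuous: "C1_fun \<phi> \<Longrightarrow> continuous_on UNIV \<phi>"
  by (meson C1_fun_has_derivative(1) continuous_at_imp_continuous_on has_derivative_continuous)

lemma partial_deriv_cgrad: "partial_deriv i \<phi> x = cgrad \<phi> x $ i"
  by (simp add: cgrad_def)

lemma
  fixes \<phi> \<psi> :: "real^'n \<Rightarrow> complex"
  assumes \<phi>: "C1_fun \<phi>" and \<psi>: "C1_fun \<psi>"
  shows C1_fun_add: "C1_fun (\<lambda>x. \<phi> x + \<psi> x)"
    and cgrad_add: "cgrad (\<lambda>x. \<phi> x + \<psi> x) = (\<lambda>x. cgrad \<phi> x + cgrad \<psi> x)"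
    and C1_fun_mult: "C1_fun (\<lambda>x. \<phi> x * \<psi> x)"
    and cgrad_mult: "cgrad (\<lambda>x. \<phi> x * \<psi> x) = (\<lambda>x. \<phi> x *s cgrad \<psi> x + \<psi> x *s cgrad \<phi> x)"
proof -
  note d = C1_fun_has_derivative(1)[OF \<phi>] C1_fun_has_derivative(1)[OF \<psi>]
  note c = C1_fun_has_derivative(2)[OF \<phi>] C1_fun_has_derivative(2)[OF \<psi>]
    C1_fun_continuous[OF \<phi>] C1_fun_continuous[OF \<psi>]
  have 1: "((\<lambda>x. \<phi> x + \<psi> x) has_derivative (\<lambda>h. \<Sum>i\<in>UNIV. of_real (h $ i) * (cgrad \<phi> x + cgrad \<psi> x) $ i)) (at x)" for x
    by (rule has_derivative_eq_rhs[OF has_derivative_add[OF d]])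
       (simp add: fun_eq_iff algebra_simps sum.distrib)
  have 2: "((\<lambda>x. \<phi> x * \<psi> x) has_derivative (\<lambda>h. \<Sum>i\<in>UNIV. of_real (h $ i) * (\<phi> x *s cgrad \<psi> x + \<psi> x *s cgrad \<phi> x) $ i)) (at x)" for x
    by (rule has_derivative_eq_rhs[OF has_derivative_mult[OF d]])
       (simp add: fun_eq_iff algebra_simps sum.distrib sum_distrib_left)
  have c1: "continuous_on UNIV (\<lambda>x. cgrad \<phi> x + cgrad \<psi> x)"
    by (intro continuous_intros c)
  have c2: "continuous_on UNIV (\<lambda>x. \<phi> x *s cgrad \<psi> x + \<psi> x *s cgrad \<phi> x)"
    unfolding vector_scalar_mult_def by (intro continuous_intros c)
  show "C1_fun (\<lambda>x. \<phi> x + \<psi> x)" "cgrad (\<lambda>x. \<phi> x + \<psi> x) = (\<lambda>x. cgrad \<phi> x + cgrad \<psi> x)"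
    using C1_funI[OF 1 c1] by auto
  show "C1_fun (\<lambda>x. \<phi> x * \<psi> x)" "cgrad (\<lambda>x. \<phi> x * \<psi> x) = (\<lambda>x. \<phi> x *s cgrad \<psi> x + \<psi> x *s cgrad \<phi> x)"
    using C1_funI[OF 2 c2] by auto
qed

lemma
  shows C1_fun_const: "C1_fun (\<lambda>x :: real^'n. c)" and cgrad_const: "cgrad (\<lambda>x :: real^'n. c) = (\<lambda>x. 0)"
  using C1_funI[of "\<lambda>x. c" "\<lambda>x. 0"] by auto

lemma
  fixes \<phi> :: "real^'n \<Rightarrow> complex"
  assumes \<phi>: "C1_fun \<phi>"
  shows C1_fun_cmult: "C1_fun (\<lambda>x. c * \<phi> x)" and cgrad_cmult: "cgrad (\<lambda>x. c * \<phi> x) = (\<lambda>x. c *s cgrad \<phi> x)"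
  using C1_fun_mult[OF C1_fun_const \<phi>, of c] cgrad_mult[OF C1_fun_const \<phi>, of c]
  by (auto simp: cgrad_const)

lemma C1_fun_diff:
  fixes \<phi> \<psi> :: "real^'n \<Rightarrow> complex"
  assumes \<phi>: "C1_fun \<phi>" and \<psi>: "C1_fun \<psi>"
  shows "C1_fun (\<lambda>x. \<phi> x - \<psi> x)"
  using C1_fun_add[OF \<phi> C1_fun_cmult[OF \<psi>, of "-1"]] by simp

lemma
  fixes \<phi> :: "real^'n \<Rightarrow> complex"
  assumes \<phi>: "C1_fun \<phi>"
  shows C1_fun_cnj: "C1_fun (\<lambda>x. cnj (\<phi> x))" and cgrad_cnj: "cgrad (\<lambda>x. cnj (\<phi> x)) = (\<lambda>x. cnj_vec (cgrad \<phi> x))"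
proof -
  have 1: "((\<lambda>x. cnj (\<phi> x)) has_derivative (\<lambda>h. \<Sum>i\<in>UNIV. of_real (h $ i) * cnj_vec (cgrad \<phi> x) $ i)) (at x)" for x
    by (rule has_derivative_eq_rhs[OF has_derivative_cnj[OF C1_fun_has_derivative(1)[OF \<phi>]]])
       (simp add: fun_eq_iff cnj_vec_def)
  have 2: "continuous_on UNIV (\<lambda>x. cnj_vec (cgrad \<phi> x))"
    unfolding cnj_vec_def by (intro continuous_intros C1_fun_has_derivative(2)[OF \<phi>])
  show "C1_fun (\<lambda>x. cnj (\<phi> x))" "cgrad (\<lambda>x. cnj (\<phi> x)) = (\<lambda>x. cnj_vec (cgrad \<phi> x))"
    using C1_funI[OF 1 2] by auto
qed

lemma
  fixes k :: "real^'n \<Rightarrow> real" and g :: "real^'n \<Rightarrow> real^'n"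
  assumes d: "\<And>x. (k has_derivative (\<lambda>h. g x \<bullet> h)) (at x)" and c: "continuous_on UNIV g"
  shows C1_fun_of_real: "C1_fun (\<lambda>x. of_real (k x))"
    and cgrad_of_real: "cgrad (\<lambda>x. of_real (k x)) = (\<lambda>x. \<chi> i. of_real (g x $ i))"
proof -
  have 1: "((\<lambda>x. of_real (k x)) has_derivative (\<lambda>h. \<Sum>i\<in>UNIV. of_real (h $ i) * (\<chi> i. complex_of_real (g x $ i)) $ i)) (at x)" for x
    by (rule has_derivative_eq_rhs[OF has_derivative_of_real[OF d]])
       (simp add: fun_eq_iff inner_vec_def mult.commute)
  have 2: "continuous_on UNIV (\<lambda>x. \<chi> i. complex_of_real (g x $ i))"
    by (intro continuous_intros c)
  show "C1_fun (\<lambda>x. of_real (k x))" "cgrad (\<lambda>x. of_real (k x)) = (\<lambda>x. \<chi> i. of_real (g x $ i))"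
    using C1_funI[OF 1 2] by auto
qed

section \<open>Squared positive parts, bump functions and cutoffs\<close>

lemma sqpos_deriv: "((\<lambda>t::real. (max 0 t)\<^sup>2) has_field_derivative 2 * max 0 t) (at t)"
proof -
  consider "t < 0" | "t > 0" | "t = 0" by linarith
  then show ?thesis
  proof cases
    case 1
    have "((\<lambda>t::real. 0) has_field_derivative 0) (at t)" by simp
    then have "((\<lambda>t::real. (max 0 t)\<^sup>2) has_field_derivative 0) (at t)"
      by (rule has_field_derivative_transform_within_open[of _ _ _ "{..<0}"]) (use 1 in auto)
    then show ?thesis using 1 by simp
  next
    case 2
    have "((\<lambda>t::real. t\<^sup>2) has_field_derivative 2 * t) (at t)"
      by (auto intro!: derivative_eq_intros)
    then have "((\<lambda>t::real. (max 0 t)\<^sup>2) has_field_derivative 2 * t) (at t)"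
      by (rule has_field_derivative_transform_within_open[of _ _ _ "{0<..}"]) (use 2 in auto)
    then show ?thesis using 2 by simp
  next
    case 3
    have "((\<lambda>h. ((max 0 (0 + h))\<^sup>2 - (max 0 (0::real))\<^sup>2) / h) \<longlongrightarrow> 0) (at 0)"
    proof (rule Lim_null_comparison)
      show "\<forall>\<^sub>F h in at 0. norm (((max 0 (0 + h))\<^sup>2 - (max 0 (0::real))\<^sup>2) / h) \<le> \<bar>h\<bar>"
        by (rule always_eventually) (auto simp: max_def power2_eq_square)
      show "((\<lambda>h::real. \<bar>h\<bar>) \<longlongrightarrow> 0) (at 0)"
        by (rule tendsto_eq_intros | simp)+
    qed
    then show ?thesis unfolding DERIV_def using 3 by simp
  qed
qed

text \<open>Squaring the positive part makes it continuously differentiable. As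
  \<open>test_fun\<close> asks only for C1, this bump on the ball of radius \<open>r\<close> about
  \<open>a\<close> takes the place of the smooth exponential one.\<close>

definition bump :: "real^'n \<Rightarrow> real \<Rightarrow> real^'n \<Rightarrow> real" where
  "bump a r u = (max 0 (r\<^sup>2 - (norm (u - a))\<^sup>2))\<^sup>2"

definition bump_grad :: "real^'n \<Rightarrow> real \<Rightarrow> real^'n \<Rightarrow> real^'n" where
  "bump_grad a r u = (- 4 * max 0 (r\<^sup>2 - (norm (u - a))\<^sup>2)) *\<^sub>R (u - a)"

lemma norm_sq_deriv: "((\<lambda>u. (norm (u - a))\<^sup>2) has_derivative (\<lambda>h. 2 * ((u - a) \<bullet> h))) (at (u :: real^'n))"
  unfolding power2_norm_eq_inner
  by (auto intro!: derivative_eq_intros simp: inner_commute)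

lemma bump_deriv: "(bump a r has_derivative (\<lambda>h. bump_grad a r u \<bullet> h)) (at u)"
proof -
  have 1: "((\<lambda>u. r\<^sup>2 - (norm (u - a))\<^sup>2) has_derivative (\<lambda>h. - 2 * ((u - a) \<bullet> h))) (at u)"
    by (rule has_derivative_eq_rhs[OF has_derivative_diff[OF has_derivative_const norm_sq_deriv]]) simp
  show ?thesis
    unfolding bump_def[abs_def]
    by (rule has_derivative_eq_rhs[OF has_derivative_compose[OF 1 has_field_derivative_imp_has_derivative[OF sqpos_deriv]]])
       (simp add: fun_eq_iff bump_grad_def)
qed

lemma continuous_bump: "continuous_on UNIV (bump a r)" "continuous_on UNIV (bump_grad a r)"
  unfolding bump_def[abs_def] bump_grad_def[abs_def] by (intro continuous_intros)+

lemma bump_outside: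
  assumes "r > 0" "dist u a \<ge> r" shows "bump a r u = 0" "bump_grad a r u = 0"
proof -
  have "r\<^sup>2 \<le> (norm (u - a))\<^sup>2" using assms by (intro power_mono) (auto simp: dist_norm)
  then show "bump a r u = 0" "bump_grad a r u = 0" by (auto simp: bump_def bump_grad_def)
qed

lemma bump_pos:
  assumes "dist u a < r" shows "bump a r u > 0"
proof -
  have "(norm (u - a))\<^sup>2 < r\<^sup>2" using assms by (intro power_strict_mono) (auto simp: dist_norm)
  then show ?thesis by (auto simp: bump_def)
qed

lemma bump_nonneg: "bump a r u \<ge> 0"
  by (simp add: bump_def)

text \<open>\<open>?s\<close> is affine in the squared distance, with value 0 at radius r/2 and 1 at
  radius r. The squared positive part of \<open>?m\<close> is then 1 inside, 0 outside, and C1 as a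
  composition of squared positive parts.\<close>

lemma cutoff_exists:
  fixes x0 :: "real^'n"
  assumes "r > 0"
  obtains b :: "real^'n \<Rightarrow> complex" where "C1_fun b"
    "\<And>x. x \<in> cball x0 (r/2) \<Longrightarrow> b x = 1" "\<And>x. x \<notin> ball x0 r \<Longrightarrow> b x = 0" "\<And>x. x \<notin> ball x0 r \<Longrightarrow> cgrad b x = 0"
proof -
  let ?s = "\<lambda>x. ((norm (x - x0))\<^sup>2 - r\<^sup>2/4) / (3 * r\<^sup>2 / 4)"
  let ?m = "\<lambda>x. 1 - (max 0 (?s x))\<^sup>2"
  define k where "k x = (max 0 (?m x))\<^sup>2" for x
  define g where "g x = (2 * max 0 (?m x) * - (2 * max 0 (?s x)) * (2 / (3 * r\<^sup>2 / 4))) *\<^sub>R (x - x0)" for x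
  have s: "(?s has_derivative (\<lambda>h. (2 / (3 * r\<^sup>2 / 4)) * ((x - x0) \<bullet> h))) (at x)" for x
    unfolding divide_inverse[of _ "3 * r\<^sup>2 / 4"]
    by (rule has_derivative_eq_rhs[OF has_derivative_mult_left[OF has_derivative_diff[OF norm_sq_deriv has_derivative_const]]]) simp
  have m: "(?m has_derivative (\<lambda>h. - (2 * max 0 (?s x)) * ((2 / (3 * r\<^sup>2 / 4)) * ((x - x0) \<bullet> h)))) (at x)" for x
    using has_derivative_diff[OF has_derivative_const[of 1] has_derivative_compose[OF s has_field_derivative_imp_has_derivative[OF sqpos_deriv]]]
    by simp
  have k: "(k has_derivative (\<lambda>h. g x \<bullet> h)) (at x)" for x
    unfolding k_def[abs_def]
    by (rule has_derivative_eq_rhs[OF has_derivative_compose[OF m has_field_derivative_imp_has_derivative[OF sqpos_deriv]]])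
       (simp add: fun_eq_iff g_def)
  have g: "continuous_on UNIV g"
    unfolding g_def[abs_def] using assms by (intro continuous_intros) auto
  have out: "?s x \<ge> 1" if "x \<notin> ball x0 r" for x
  proof -
    have "r\<^sup>2 \<le> (norm (x - x0))\<^sup>2" using that assms by (intro power_mono) (auto simp: dist_norm norm_minus_commute)
    then show ?thesis using assms by (simp add: field_simps)
  qed
  have out0: "max 0 (?m x) = 0" if "x \<notin> ball x0 r" for x
  proof -
    have "1 \<le> (max 0 (?s x))\<^sup>2" using out[OF that] by (simp add: one_le_power)
    then show ?thesis by simp
  qed
  show thesis
  proof
    show "C1_fun (\<lambda>x. complex_of_real (k x))" by (rule C1_fun_of_real[OF k g])
    show "complex_of_real (k x) = 1" if "x \<in> cball x0 (r/2)" for x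
    proof -
      have "(norm (x - x0))\<^sup>2 \<le> (r/2)\<^sup>2" using that by (intro power_mono) (auto simp: dist_norm norm_minus_commute)
      then have "?s x \<le> 0" using assms by (simp add: field_simps power_divide)
      then show ?thesis by (simp add: k_def)
    qed
    show "complex_of_real (k x) = 0" if "x \<notin> ball x0 r" for x
      using out0[OF that] by (simp add: k_def)
    show "cgrad (\<lambda>x. complex_of_real (k x)) x = 0" if "x \<notin> ball x0 r" for x
      unfolding cgrad_of_real[OF k g] using out0[OF that] by (simp add: g_def vec_eq_iff)
  qed
qed

section \<open>Translations and mollification\<close>

lemma nn_integral_lborel_translate:
  fixes f :: "'a::euclidean_space \<Rightarrow> ennreal"
  assumes [measurable]: "f \<in> borel_measurable borel"
  shows "(\<integral>\<^sup>+x. f (x + h) \<partial>lborel) = (\<integral>\<^sup>+x. f x \<partial>lborel)"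
proof -
  have "(\<integral>\<^sup>+x. f x \<partial>lborel) = (\<integral>\<^sup>+x. f x \<partial>distr lborel borel ((+) h))"
    by (simp add: lborel_distr_plus)
  also have "\<dots> = (\<integral>\<^sup>+x. f (h + x) \<partial>lborel)"
    by (rule nn_integral_distr) measurable
  finally show ?thesis by (simp add: add.commute)
qed

lemma integral_lborel_translate:
  fixes f :: "'a::euclidean_space \<Rightarrow> 'b::{banach, second_countable_topology}"
  assumes [measurable]: "f \<in> borel_measurable borel"
  shows "(LINT x|lborel. f (x + h)) = (LINT x|lborel. f x)"
proof -
  have "(LINT x|lborel. f x) = (LINT x|distr lborel borel ((+) h). f x)"
    by (simp add: lborel_distr_plus)
  also have "\<dots> = (LINT x|lborel. f (h + x))"
    by (rule integral_distr) measurable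
  finally show ?thesis by (simp add: add.commute)
qed

lemma lborel_distr_reflect:
  fixes x :: "'a::euclidean_space"
  shows "distr lborel borel (\<lambda>u. x - u) = lborel"
  using lborel_affine[of "-1" x] by (simp add: density_1)

lemma
  fixes f :: "'a::euclidean_space \<Rightarrow> 'b::{banach, second_countable_topology}"
  assumes [measurable]: "f \<in> borel_measurable borel"
  shows integral_lborel_reflect: "(LINT u|lborel. f (x - u)) = (LINT u|lborel. f u)"
    and integrable_lborel_reflect: "integrable lborel (\<lambda>u. f (x - u)) \<longleftrightarrow> integrable lborel f"
proof -
  have "(LINT u|lborel. f u) = (LINT u|distr lborel borel (\<lambda>u. x - u). f u)"
    by (simp add: lborel_distr_reflect)
  also have "\<dots> = (LINT u|lborel. f (x - u))"
    by (rule integral_distr) measurable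
  finally show "(LINT u|lborel. f (x - u)) = (LINT u|lborel. f u)" by simp
  have "integrable (distr lborel borel (\<lambda>u. x - u)) f \<longleftrightarrow> integrable lborel (\<lambda>u. f (x - u))"
    by (rule integrable_distr_eq) measurable
  then show "integrable lborel (\<lambda>u. f (x - u)) \<longleftrightarrow> integrable lborel f"
    by (simp add: lborel_distr_reflect)
qed

lemma
  fixes f :: "'a::euclidean_space \<Rightarrow> 'b::{second_countable_topology, real_normed_vector}"
  assumes f: "f \<in> L2 lborel"
  shows L2_translate: "(\<lambda>x. f (x + h)) \<in> L2 lborel"
    and l2_translate: "l2 lborel (\<lambda>x. f (x + h)) = l2 lborel f"
proof -
  have [measurable]: "f \<in> borel_measurable borel" using L2_measurable[OF f] by simp
  have eq: "(\<integral>\<^sup>+x. ennreal ((norm (f (x + h)))\<^sup>2) \<partial>lborel) = ennreal ((l2 lborel f)\<^sup>2)"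
    using nn_integral_lborel_translate[of "\<lambda>x. ennreal ((norm (f x))\<^sup>2)" h] l2_nn[OF f] by simp
  have m: "(\<lambda>x. f (x + h)) \<in> borel_measurable lborel" by simp
  show 1: "(\<lambda>x. f (x + h)) \<in> L2 lborel"
    by (rule L2_nn_I(1)[OF m eq_refl[OF eq]])
  show "l2 lborel (\<lambda>x. f (x + h)) = l2 lborel f"
    using eq unfolding l2_nn[OF 1] by simp
qed

section \<open>Continuity of translations in the mean\<close>

definition shift_continuous :: "('a::euclidean_space \<Rightarrow> 'b::{second_countable_topology, real_normed_vector}) \<Rightarrow> bool" where
  "shift_continuous f \<longleftrightarrow> ((\<lambda>h. l2 lborel (\<lambda>x. f (x + h) - f x)) \<longlongrightarrow> 0) (nhds 0)"

text \<open>Translations are isometries of \<open>L2 lborel\<close>, so the usual three-term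
  estimate works uniformly in the shift.\<close>

lemma shift_continuous_closure:
  fixes f :: "'a::euclidean_space \<Rightarrow> 'b::{second_countable_topology, real_normed_vector}"
  assumes f: "f \<in> L2 lborel"
    and g: "\<And>e. e > 0 \<Longrightarrow> \<exists>g\<in>L2 lborel. shift_continuous g \<and> l2 lborel (\<lambda>x. f x - g x) < e"
  shows "shift_continuous f"
  unfolding shift_continuous_def tendsto_iff
proof (intro allI impI)
  fix e :: real assume "e > 0"
  then obtain g where g: "g \<in> L2 lborel" "shift_continuous g" "l2 lborel (\<lambda>x. f x - g x) < e/3"
    using g[of "e/3"] by auto
  have "\<forall>\<^sub>F h in nhds 0. dist (l2 lborel (\<lambda>x. g (x + h) - g x)) 0 < e/3"
    using tendstoD[OF g(2)[unfolded shift_continuous_def], of "e/3"] \<open>e > 0\<close> by simp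
  then show "\<forall>\<^sub>F h in nhds 0. dist (l2 lborel (\<lambda>x. f (x + h) - f x)) 0 < e"
  proof eventually_elim
    case (elim h)
    note fh = L2_translate[OF f, of h] and gh = L2_translate[OF g(1), of h]
    have "l2 lborel (\<lambda>x. f (x + h) - f x) \<le> l2 lborel (\<lambda>x. f (x + h) - g (x + h)) + l2 lborel (\<lambda>x. g (x + h) - f x)"
      by (intro l2_triangle3 f fh gh)
    moreover have "l2 lborel (\<lambda>x. g (x + h) - f x) \<le> l2 lborel (\<lambda>x. g (x + h) - g x) + l2 lborel (\<lambda>x. g x - f x)"
      by (intro l2_triangle3 f g fh gh)
    moreover have "l2 lborel (\<lambda>x. f (x + h) - g (x + h)) = l2 lborel (\<lambda>x. f x - g x)"
      using l2_translate[OF L2_diff[OF f g(1)]] .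
    moreover have "l2 lborel (\<lambda>x. g x - f x) = l2 lborel (\<lambda>x. f x - g x)"
      by (rule l2_minus_commute)
    ultimately show ?case using g(3) elim by simp
  qed
qed

lemma shift_continuous_add:
  assumes f: "f \<in> L2 lborel" "shift_continuous f" and g: "g \<in> L2 lborel" "shift_continuous g"
  shows "shift_continuous (\<lambda>x. f x + g x)"
  unfolding shift_continuous_def
proof (rule Lim_null_comparison)
  show "\<forall>\<^sub>F h in nhds 0. norm (l2 lborel (\<lambda>x. (f (x + h) + g (x + h)) - (f x + g x)))
     \<le> l2 lborel (\<lambda>x. f (x + h) - f x) + l2 lborel (\<lambda>x. g (x + h) - g x)"
  proof (rule always_eventually, rule allI)
    fix h
    have "l2 lborel (\<lambda>x. (f (x + h) - f x) + (g (x + h) - g x)) \<le> l2 lborel (\<lambda>x. f (x + h) - f x) + l2 lborel (\<lambda>x. g (x + h) - g x)"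
      by (intro l2_triangle L2_diff L2_translate f g)
    then show "norm (l2 lborel (\<lambda>x. (f (x + h) + g (x + h)) - (f x + g x)))
     \<le> l2 lborel (\<lambda>x. f (x + h) - f x) + l2 lborel (\<lambda>x. g (x + h) - g x)"
      by (simp add: algebra_simps)
  qed
  show "((\<lambda>h. l2 lborel (\<lambda>x. f (x + h) - f x) + l2 lborel (\<lambda>x. g (x + h) - g x)) \<longlongrightarrow> 0) (nhds 0)"
    using tendsto_add[OF f(2)[unfolded shift_continuous_def] g(2)[unfolded shift_continuous_def]] by simp
qed

lemma L2_indicator:
  fixes c :: "'b::{second_countable_topology, real_normed_vector}"
  assumes [measurable]: "A \<in> sets M" and fin: "emeasure M A < \<infinity>"
  shows "(\<lambda>x. indicator A x *\<^sub>R c) \<in> L2 M"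
    and "(l2 M (\<lambda>x. indicator A x *\<^sub>R c))\<^sup>2 = measure M A * (norm c)\<^sup>2"
proof -
  have eq: "(\<lambda>x. (norm (indicator A x *\<^sub>R c))\<^sup>2) = (\<lambda>x. indicator A x * (norm c)\<^sup>2)"
    by (auto simp: indicator_def fun_eq_iff)
  have i: "integrable M (\<lambda>x. indicator A x :: real)" using fin by simp
  show "(\<lambda>x. indicator A x *\<^sub>R c) \<in> L2 M"
    by (rule L2_I) (use i in \<open>simp_all only: eq, simp_all\<close>)
  show "(l2 M (\<lambda>x. indicator A x *\<^sub>R c))\<^sup>2 = measure M A * (norm c)\<^sup>2"
    unfolding l2_sq eq using i sets.sets_into_space[OF assms(1)] by (simp add: Int_absorb1 Int_absorb2)
qed

text \<open>Up to the factor |c|^2 the squared norm of the difference is twice the measure of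
  \<open>U\<close> minus twice the measure of its overlap with the translate. The overlap converges
  by dominated convergence, since a point of an open set stays in it under small shifts.\<close>

lemma shift_continuous_open:
  fixes U :: "'a::euclidean_space set" and c :: "'b::{second_countable_topology, real_normed_vector}"
  assumes U: "open U" and fin: "emeasure lborel U < \<infinity>"
  shows "shift_continuous (\<lambda>x. indicator U x *\<^sub>R c)"
proof -
  have [measurable]: "U \<in> sets borel" using U by simp
  let ?I = "\<lambda>x. indicator U x :: real"
  have i: "integrable lborel ?I" using fin by simp
  have ih: "integrable lborel (\<lambda>x. ?I (x + h))" for h
    using integrable_distr_eq[of "(+) h" lborel borel ?I] i by (simp add: lborel_distr_plus add.commute)
  have ip: "integrable lborel (\<lambda>x. ?I x * ?I (x + h))" for h
    by (rule Bochner_Integration.integrable_bound[OF i]) (auto simp: indicator_def)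
  have sq: "(l2 lborel (\<lambda>x. ?I (x + h) *\<^sub>R c - ?I x *\<^sub>R c))\<^sup>2
      = (2 * measure lborel U - 2 * (LINT x|lborel. ?I x * ?I (x + h))) * (norm c)\<^sup>2" for h
  proof -
    have "(\<lambda>x. (norm (?I (x + h) *\<^sub>R c - ?I x *\<^sub>R c))\<^sup>2)
        = (\<lambda>x. (?I (x + h) + ?I x - 2 * (?I x * ?I (x + h))) * (norm c)\<^sup>2)"
      by (auto simp: indicator_def fun_eq_iff)
    then have "(l2 lborel (\<lambda>x. ?I (x + h) *\<^sub>R c - ?I x *\<^sub>R c))\<^sup>2
       = ((LINT x|lborel. ?I (x + h)) + (LINT x|lborel. ?I x) - 2 * (LINT x|lborel. ?I x * ?I (x + h))) * (norm c)\<^sup>2"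
      unfolding l2_sq using i ih ip by simp
    moreover have "(LINT x|lborel. ?I (x + h)) = (LINT x|lborel. ?I x)"
      by (rule integral_lborel_translate) measurable
    ultimately show ?thesis by simp
  qed
  have seq: "(\<lambda>n. l2 lborel (\<lambda>x. ?I (x + X n) *\<^sub>R c - ?I x *\<^sub>R c)) \<longlonglongrightarrow> 0" if X: "X \<longlonglongrightarrow> 0" for X
  proof -
    have "(\<lambda>n. LINT x|lborel. ?I x * ?I (x + X n)) \<longlonglongrightarrow> (LINT x|lborel. ?I x)"
    proof (rule integral_dominated_convergence[OF _ _ i])
      show "AE x in lborel. (\<lambda>n. ?I x * ?I (x + X n)) \<longlonglongrightarrow> ?I x"
      proof (rule AE_I2)
        fix x :: 'a
        show "(\<lambda>n. ?I x * ?I (x + X n)) \<longlonglongrightarrow> ?I x"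
        proof (cases "x \<in> U")
          case True
          have "(\<lambda>n. x + X n) \<longlonglongrightarrow> x" using tendsto_add[OF tendsto_const X, of x] by simp
          then have "\<forall>\<^sub>F n in sequentially. x + X n \<in> U"
            using U True by (rule topological_tendstoD)
          then have "\<forall>\<^sub>F n in sequentially. ?I x * ?I (x + X n) = ?I x"
            by eventually_elim (simp add: True)
          then show ?thesis by (rule tendsto_eventually)
        qed simp
      qed
    qed (auto simp: indicator_def)
    then have "(\<lambda>n. (2 * measure lborel U - 2 * (LINT x|lborel. ?I x * ?I (x + X n))) * (norm c)\<^sup>2)
       \<longlonglongrightarrow> (2 * measure lborel U - 2 * (LINT x|lborel. ?I x)) * (norm c)\<^sup>2"
      by (intro tendsto_intros)
    then have "(\<lambda>n. (l2 lborel (\<lambda>x. ?I (x + X n) *\<^sub>R c - ?I x *\<^sub>R c))\<^sup>2) \<longlonglongrightarrow> 0"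
      unfolding sq by simp
    then have "(\<lambda>n. sqrt ((l2 lborel (\<lambda>x. ?I (x + X n) *\<^sub>R c - ?I x *\<^sub>R c))\<^sup>2)) \<longlonglongrightarrow> sqrt 0"
      by (rule tendsto_real_sqrt)
    then show ?thesis by simp
  qed
  show ?thesis
    unfolding shift_continuous_def tendsto_iff
  proof (intro allI impI)
    fix e :: real assume e: "e > 0"
    \<comment> \<open>Writing \<open>nhds 0\<close> as a neighbourhood filter within the whole space
      makes the sequential criterion for such filters applicable.\<close>
    have "\<forall>\<^sub>F h in inf (nhds 0) (principal UNIV). dist (l2 lborel (\<lambda>x. ?I (x + h) *\<^sub>R c - ?I x *\<^sub>R c)) 0 < e"
    proof (rule sequentially_imp_eventually_nhds_within, intro allI impI, elim conjE)
      fix X :: "nat \<Rightarrow> 'a" assume "X \<longlonglongrightarrow> 0"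
      from tendstoD[OF seq[OF this] e]
      show "\<forall>\<^sub>F n in sequentially. dist (l2 lborel (\<lambda>x. ?I (x + X n) *\<^sub>R c - ?I x *\<^sub>R c)) 0 < e" .
    qed
    then show "\<forall>\<^sub>F h in nhds 0. dist (l2 lborel (\<lambda>x. ?I (x + h) *\<^sub>R c - ?I x *\<^sub>R c)) 0 < e"
      by simp
  qed
qed

text \<open>Outer regularity encloses the set in an open set of only slightly larger
  measure.\<close>

lemma shift_continuous_indicator:
  fixes A :: "'a::euclidean_space set" and c :: "'b::{second_countable_topology, real_normed_vector}"
  assumes A: "A \<in> sets borel" and fin: "emeasure lborel A < \<infinity>"
  shows "shift_continuous (\<lambda>x. indicator A x *\<^sub>R c)"
proof (rule shift_continuous_closure)
  show "(\<lambda>x. indicator A x *\<^sub>R c) \<in> L2 lborel" by (rule L2_indicator) (use A fin in auto)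
  fix e :: real assume e: "e > 0"
  \<comment> \<open>The added 1 admits \<open>c\<close> = 0.\<close>
  define d where "d = e\<^sup>2 / ((norm c)\<^sup>2 + 1)"
  have d: "d > 0" using e by (simp add: d_def add_nonneg_pos)
  obtain U where U: "open U" "A \<subseteq> U" "emeasure lborel (U - A) < d"
    using outer_regular_lborel[OF A d] by blast
  have [measurable]: "U \<in> sets borel" using U by simp
  have UA: "U - A \<in> sets lborel" using A by simp
  have finUA: "emeasure lborel (U - A) < \<infinity>" using order.strict_trans[OF U(3) ennreal_less_top] by simp
  have "emeasure lborel U \<le> emeasure lborel A + emeasure lborel (U - A)"
    using emeasure_subadditive[of A lborel "U - A"] A UA U(2) by (simp add: Un_absorb1)
  also have "\<dots> < \<infinity>" using fin finUA by simp
  finally have finU: "emeasure lborel U < \<infinity>" .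
  have "(l2 lborel (\<lambda>x. indicator A x *\<^sub>R c - indicator U x *\<^sub>R c))\<^sup>2 = (l2 lborel (\<lambda>x. indicator (U - A) x *\<^sub>R c))\<^sup>2"
    unfolding l2_def using U(2)
    by (intro arg_cong[where f="\<lambda>x. (sqrt x)\<^sup>2"] Bochner_Integration.integral_cong) (auto simp: indicator_def)
  also have "\<dots> = measure lborel (U - A) * (norm c)\<^sup>2"
    by (rule L2_indicator(2)[OF UA finUA])
  also have "\<dots> \<le> d * (norm c)\<^sup>2"
    using U(3) d by (intro mult_right_mono) (auto simp: measure_def intro!: enn2real_leI)
  also have "\<dots> < d * ((norm c)\<^sup>2 + 1)" using d by simp
  also have "\<dots> = e\<^sup>2"
    using add_nonneg_pos[of "(norm c)\<^sup>2" 1] by (simp add: d_def)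
  finally have "l2 lborel (\<lambda>x. indicator A x *\<^sub>R c - indicator U x *\<^sub>R c) < e"
    using e by (simp add: power_less_imp_less_base)
  moreover have "(\<lambda>x. indicator U x *\<^sub>R c) \<in> L2 lborel" by (rule L2_indicator) (use finU in auto)
  ultimately show "\<exists>g\<in>L2 lborel. shift_continuous g \<and> l2 lborel (\<lambda>x. indicator A x *\<^sub>R c - g x) < e"
    using shift_continuous_open[OF U(1) finU] by blast
qed

text \<open>Simple functions dominated by 2|f| converge to \<open>f\<close> in the mean, and each of
  them is a finite sum of multiples of indicators.\<close>

lemma shift_continuous_L2:
  fixes f :: "'a::euclidean_space \<Rightarrow> 'b::{second_countable_topology, banach}"
  assumes f: "f \<in> L2 lborel"
  shows "shift_continuous f"
proof (rule shift_continuous_closure[OF f])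
  fix e :: real assume e: "e > 0"
  note fm[measurable] = L2_measurable[OF f]
  obtain s where s: "\<And>i. simple_function lborel (s i)" "\<And>x. (\<lambda>i. s i x) \<longlonglongrightarrow> f x"
    "\<And>i x. norm (s i x) \<le> 2 * norm (f x)"
    using borel_measurable_implies_sequence_metric[OF fm, of 0] by auto
  have sm[measurable]: "s i \<in> borel_measurable lborel" for i
    using s(1) by (rule borel_measurable_simple_function)
  have sL: "s i \<in> L2 lborel" for i
    by (rule L2_bound[OF f sm, of _ 2]) (simp add: s)
  have tcs: "shift_continuous (s i)" for i
  proof -
    \<comment> \<open>Chebyshev's inequality: a nonzero value is taken on a set of finite measure.
      The value 0 may be taken on a set of infinite measure, but its summand vanishes.\<close>
    have fin: "emeasure lborel {x. s i x = y} < \<infinity>" if "y \<noteq> 0" for y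
    proof -
      have ms: "{x. s i x = y} \<in> sets lborel" using sm by simp
      have "ennreal ((norm y)\<^sup>2) * emeasure lborel {x. s i x = y} = (\<integral>\<^sup>+x. ennreal ((norm y)\<^sup>2) * indicator {x. s i x = y} x \<partial>lborel)"
        by (rule nn_integral_cmult_indicator[OF ms, symmetric])
      also have "\<dots> \<le> (\<integral>\<^sup>+x. ennreal ((norm (s i x))\<^sup>2) \<partial>lborel)"
        by (intro nn_integral_mono) (auto simp: indicator_def)
      also have "\<dots> < \<infinity>" using l2_nn[OF sL] by simp
      finally show ?thesis using that by (auto simp: ennreal_mult_less_top)
    qed
    have all: "(\<lambda>x. \<Sum>y\<in>Y. indicator {x. s i x = y} x *\<^sub>R y) \<in> L2 lborel \<and> shift_continuous (\<lambda>x. \<Sum>y\<in>Y. indicator {x. s i x = y} x *\<^sub>R y)"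
      if "finite Y" for Y
      using that
    proof induction
      case empty
      then show ?case by (simp add: shift_continuous_def)
    next
      case (insert y Y)
      have yy: "(\<lambda>x. indicator {x. s i x = y} x *\<^sub>R y) \<in> L2 lborel \<and> shift_continuous (\<lambda>x. indicator {x. s i x = y} x *\<^sub>R y)"
      proof (cases "y = 0")
        case False
        have "{x. s i x = y} \<in> sets lborel" using sm by simp
        then show ?thesis
          by (intro conjI L2_indicator(1) shift_continuous_indicator fin[OF False]) auto
      qed (simp add: shift_continuous_def)
      then show ?case
        unfolding sum.insert[OF insert(1,2)]
        by (intro conjI L2_add[OF conjunct1[OF yy] conjunct1[OF insert(3)]]
            shift_continuous_add[OF conjunct1[OF yy] conjunct2[OF yy] conjunct1[OF insert(3)] conjunct2[OF insert(3)]])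
    qed
    have fin': "finite (range (s i))" using simple_functionD(1)[OF s(1)] by simp
    have eq: "(\<lambda>x. \<Sum>y\<in>range (s i). indicator {x. s i x = y} x *\<^sub>R y) = s i"
    proof
      fix x
      have "(\<Sum>y\<in>range (s i). indicator {x. s i x = y} x *\<^sub>R y) = (\<Sum>y\<in>range (s i). if y = s i x then y else 0)"
        by (intro sum.cong) (auto simp: indicator_def)
      then show "(\<Sum>y\<in>range (s i). indicator {x. s i x = y} x *\<^sub>R y) = s i x"
        using fin' by simp
    qed
    show ?thesis using all[OF fin'] unfolding eq by blast
  qed
  have "(\<lambda>i. LINT x|lborel. (norm (f x - s i x))\<^sup>2) \<longlonglongrightarrow> (LINT x::'a|lborel. (0::real))"
  \<comment> \<open>The bound 2|f| for the simple functions gives 3|f| for the difference, hence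
    9|f|^2 for the integrand.\<close>
  proof (rule integral_dominated_convergence[where w = "\<lambda>x. 9 * (norm (f x))\<^sup>2"])
    show "integrable lborel (\<lambda>x. 9 * (norm (f x))\<^sup>2)" using L2_integrable[OF f] by simp
    show "AE x in lborel. (\<lambda>i. (norm (f x - s i x))\<^sup>2) \<longlonglongrightarrow> 0"
    proof (rule AE_I2)
      fix x
      have "(\<lambda>i. (norm (f x - s i x))\<^sup>2) \<longlonglongrightarrow> (norm (f x - f x))\<^sup>2" by (intro tendsto_intros s)
      then show "(\<lambda>i. (norm (f x - s i x))\<^sup>2) \<longlonglongrightarrow> 0" by simp
    qed
    show "AE x in lborel. norm ((norm (f x - s i x))\<^sup>2) \<le> 9 * (norm (f x))\<^sup>2" for i
    proof (rule AE_I2)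
      fix x
      have "norm (f x - s i x) \<le> 3 * norm (f x)"
        using norm_triangle_ineq4[of "f x" "s i x"] s(3)[of i x] by simp
      then have "(norm (f x - s i x))\<^sup>2 \<le> (3 * norm (f x))\<^sup>2" by (intro power_mono) auto
      then show "norm ((norm (f x - s i x))\<^sup>2) \<le> 9 * (norm (f x))\<^sup>2" by (simp add: power_mult_distrib)
    qed
  qed auto
  then have "(\<lambda>i. LINT x|lborel. (norm (f x - s i x))\<^sup>2) \<longlonglongrightarrow> 0" by simp
  from order_tendstoD(2)[OF this, of "e\<^sup>2"] e
  obtain i where "(l2 lborel (\<lambda>x. f x - s i x))\<^sup>2 < e\<^sup>2"
    unfolding l2_sq eventually_sequentially by auto
  then have "l2 lborel (\<lambda>x. f x - s i x) < e"
    using e by (simp add: power_less_imp_less_base)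
  then show "\<exists>g\<in>L2 lborel. shift_continuous g \<and> l2 lborel (\<lambda>x. f x - g x) < e"
    using tcs sL by blast
qed

section \<open>Compactly supported kernels and mollification\<close>

lemma integrable_compact_support:
  fixes f :: "'a::euclidean_space \<Rightarrow> 'b::{banach, second_countable_topology}"
  assumes c: "continuous_on UNIV f" and K: "compact K" and z: "\<And>x. x \<notin> K \<Longrightarrow> f x = 0"
  shows "integrable lborel f"
proof -
  have "integrable lborel (\<lambda>x. indicator K x *\<^sub>R f x)"
    by (rule borel_integrable_compact[OF K continuous_on_subset[OF c]]) simp
  moreover have "(\<lambda>x. indicator K x *\<^sub>R f x) = f"
    using z by (auto simp: indicator_def fun_eq_iff)
  ultimately show ?thesis by simp
qed

lemma L2_compact_support:
  fixes f :: "'a::euclidean_space \<Rightarrow> 'b::{banach, second_countable_topology}"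
  assumes c: "continuous_on UNIV f" and K: "compact K" and z: "\<And>x. x \<notin> K \<Longrightarrow> f x = 0"
  shows "f \<in> L2 lborel"
proof (rule L2_I)
  show "f \<in> borel_measurable lborel" using borel_measurable_continuous_onI[OF c] by simp
  show "integrable lborel (\<lambda>x. (norm (f x))\<^sup>2)"
    by (rule integrable_compact_support[OF _ K]) (use z in \<open>auto intro!: continuous_intros c\<close>)
qed

text \<open>A probability density on the ball about \<open>a\<close> and not about the origin: the
  displacement \<open>a\<close> later moves the points at which a function is evaluated into the
  domain.\<close>

definition ker :: "real^'n \<Rightarrow> real \<Rightarrow> real^'n \<Rightarrow> real" where
  "ker a r u = bump a r u / (LINT u|lborel. bump a r u)"

definition ker_grad :: "real^'n \<Rightarrow> real \<Rightarrow> real^'n \<Rightarrow> real^'n" where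
  "ker_grad a r u = bump_grad a r u /\<^sub>R (LINT u|lborel. bump a r u)"

lemma bump_integrable:
  assumes "r > 0" shows "integrable lborel (bump a r)"
  by (rule integrable_compact_support[OF continuous_bump(1) compact_cball[of a r]])
     (use assms in \<open>auto intro!: bump_outside simp: dist_commute\<close>)

text \<open>A vanishing integral would make the ball on which the bump is positive a null
  set.\<close>

lemma bump_integral_pos:
  fixes a :: "real^'n"
  assumes "r > 0" shows "(LINT u|lborel. bump a r u) > 0"
proof -
  have "(LINT u|lborel. bump a r u) \<noteq> 0"
  proof
    assume "(LINT u|lborel. bump a r u) = 0"
    then have "AE u in lborel. bump a r u = 0"
      using integral_nonneg_eq_0_iff_AE[OF bump_integrable[OF assms, of a]] by (simp add: bump_nonneg)
    then have "AE u in lborel. u \<notin> ball a r"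
      by eventually_elim (use bump_pos[of _ a r] in \<open>force simp: dist_commute\<close>)
    then have "emeasure lborel (ball a r) = 0"
      by (subst (asm) AE_iff_measurable[of "ball a r"]) auto
    moreover have "0 < unit_ball_vol (real CARD('n)) * r ^ CARD('n)"
      using assms by (intro mult_pos_pos) (simp_all add: unit_ball_vol_pos)
    ultimately show False
      using assms emeasure_ball[of r a] by (simp add: ennreal_eq_0_iff)
  qed
  moreover have "(LINT u|lborel. bump a r u) \<ge> 0" by (simp add: bump_nonneg)
  ultimately show ?thesis by simp
qed

context
  fixes a :: "real^'n" and r :: real
  assumes r: "r > 0"
begin

lemma ker_deriv: "(ker a r has_derivative (\<lambda>h. ker_grad a r u \<bullet> h)) (at u)"
  unfolding ker_def[abs_def] ker_grad_def divide_inverse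
  by (rule has_derivative_eq_rhs[OF has_derivative_mult_left[OF bump_deriv]]) (simp add: fun_eq_iff)

lemma ker_continuous: "continuous_on UNIV (ker a r)" "continuous_on UNIV (ker_grad a r)"
  unfolding ker_def[abs_def] ker_grad_def[abs_def] divide_inverse
  by (intro continuous_intros continuous_bump)+

lemma ker_outside: "u \<notin> ball a r \<Longrightarrow> ker a r u = 0" "u \<notin> ball a r \<Longrightarrow> ker_grad a r u = 0"
  unfolding ker_def ker_grad_def using bump_outside[where u=u and a=a and r=r] r by (auto simp: dist_commute)

lemma ker_nonneg: "ker a r u \<ge> 0"
  using bump_integral_pos[OF r] by (simp add: ker_def bump_nonneg)

lemma ker_integrable: "integrable lborel (ker a r)"
  unfolding ker_def[abs_def] using bump_integrable[OF r, of a] by simp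

lemma ker_integral: "(LINT u|lborel. ker a r u) = 1"
  unfolding ker_def using bump_integral_pos[OF r, of a] by simp

text \<open>On the closed ball of radius r + 1 this is compactness. If one of two points at distance
  below 1 leaves that ball, both lie outside the support, where the gradient vanishes.\<close>

lemma ker_grad_uniformly_continuous:
  assumes "e > 0"
  obtains d where "d > 0" "\<And>u v. dist u v < d \<Longrightarrow> dist (ker_grad a r u) (ker_grad a r v) < e"
proof -
  have "uniformly_continuous_on (cball a (r+1)) (ker_grad a r)"
    by (intro compact_uniformly_continuous continuous_on_subset[OF ker_continuous(2)]) auto
  then obtain d where d: "d > 0" "\<And>u v. u \<in> cball a (r+1) \<Longrightarrow> v \<in> cball a (r+1) \<Longrightarrow> dist v u < d \<Longrightarrow> dist (ker_grad a r v) (ker_grad a r u) < e"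
    unfolding uniformly_continuous_on_def using assms by metis
  show thesis
  proof
    show "min d 1 > 0" using d by simp
    fix u v :: "real^'n" assume uv: "dist u v < min d 1"
    show "dist (ker_grad a r u) (ker_grad a r v) < e"
    proof (cases "u \<in> cball a (r+1) \<and> v \<in> cball a (r+1)")
      case True
      then show ?thesis using d(2)[of v u] uv by simp
    next
      case False
      then have "dist a u > r + 1 \<or> dist a v > r + 1" by auto
      moreover have "dist a u \<le> dist a v + dist u v" "dist a v \<le> dist a u + dist u v"
        by (metis dist_commute dist_triangle)+
      ultimately have "u \<notin> ball a r" "v \<notin> ball a r" using uv by auto
      then show ?thesis using ker_outside(2) assms by simp
    qed
  qed
qed

text \<open>Only values of \<open>f\<close> on the ball of radius \<open>r\<close> about x - a
  enter, because the kernel is supported about \<open>a\<close>.\<close>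

definition conv :: "(real^'n \<Rightarrow> complex) \<Rightarrow> real^'n \<Rightarrow> complex" where
  "conv f x = (LINT z|lborel. of_real (ker a r (x - z)) * f z)"

definition conv_grad :: "(real^'n \<Rightarrow> complex) \<Rightarrow> real^'n \<Rightarrow> complex^'n" where
  "conv_grad f x = (\<chi> i. LINT z|lborel. of_real (ker_grad a r (x - z) $ i) * f z)"

lemma ker_shift_continuous:
  "continuous_on UNIV (\<lambda>z. ker a r (x - z))" "continuous_on UNIV (\<lambda>z. ker_grad a r (x - z))"
  by (intro continuous_on_compose2[OF ker_continuous(1)] continuous_on_compose2[OF ker_continuous(2)] continuous_intros; simp)+

lemma ker_mult_integrable:
  assumes f: "integrable lborel f"
  shows "integrable lborel (\<lambda>z. complex_of_real (ker a r (x - z)) * f z)"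
    and "integrable lborel (\<lambda>z. complex_of_real (ker_grad a r (x - z) $ i) * f z)"
proof -
  note [measurable] = borel_measurable_integrable[OF f]
  have m: "(\<lambda>z. ker a r (x - z)) \<in> borel_measurable borel" "(\<lambda>z. ker_grad a r (x - z) $ i) \<in> borel_measurable borel"
    by (intro borel_measurable_continuous_onI continuous_on_component ker_shift_continuous)+
  note [measurable] = m
  have "compact (ker a r ` cball a r)" "compact (ker_grad a r ` cball a r)"
    by (intro compact_continuous_image continuous_on_subset[OF ker_continuous(1)] continuous_on_subset[OF ker_continuous(2)]; simp)+
  then have "bounded (ker a r ` cball a r)" "bounded (ker_grad a r ` cball a r)"
    by (auto intro: compact_imp_bounded)
  then obtain B1 B2 where B: "\<And>u. u \<in> cball a r \<Longrightarrow> norm (ker a r u) \<le> B1" "\<And>u. u \<in> cball a r \<Longrightarrow> norm (ker_grad a r u) \<le> B2"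
    unfolding bounded_iff by blast
  have B': "norm (ker a r u) \<le> max B1 0" "norm (ker_grad a r u) \<le> max B2 0" for u
  proof (atomize (full), cases "u \<in> cball a r")
    case True
    then show "norm (ker a r u) \<le> max B1 0 \<and> norm (ker_grad a r u) \<le> max B2 0"
      using B[of u] by (simp add: le_max_iff_disj)
  next
    case False
    then have "u \<notin> ball a r" by auto
    then show "norm (ker a r u) \<le> max B1 0 \<and> norm (ker_grad a r u) \<le> max B2 0"
      by (simp add: ker_outside)
  qed
  show "integrable lborel (\<lambda>z. complex_of_real (ker a r (x - z)) * f z)"
  proof (rule Bochner_Integration.integrable_bound[OF integrable_mult_right[OF integrable_norm[OF f], of "max B1 0"]])
    show "AE z in lborel. norm (complex_of_real (ker a r (x - z)) * f z) \<le> norm (max B1 0 * norm (f z))"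
      using B'(1) by (auto simp: norm_mult abs_mult intro!: AE_I2 mult_right_mono)
  qed measurable
  show "integrable lborel (\<lambda>z. complex_of_real (ker_grad a r (x - z) $ i) * f z)"
  proof (rule Bochner_Integration.integrable_bound[OF integrable_mult_right[OF integrable_norm[OF f], of "max B2 0"]])
    have "\<bar>ker_grad a r u $ i\<bar> \<le> max B2 0" for u
      using component_le_norm_cart[of "ker_grad a r u" i] B'(2)[of u] by linarith
    then show "AE z in lborel. norm (complex_of_real (ker_grad a r (x - z) $ i) * f z) \<le> norm (max B2 0 * norm (f z))"
      by (auto simp: norm_mult abs_mult intro!: AE_I2 mult_right_mono)
    show "(\<lambda>z. complex_of_real (ker_grad a r (x - z) $ i) * f z) \<in> borel_measurable lborel"
      using borel_measurable_times[OF measurable_compose[OF m(2) borel_measurable_of_real], of f]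
        borel_measurable_integrable[OF f] by simp
  qed
qed

text \<open>Differentiation under the integral sign: the first-order remainder of the kernel is
  small uniformly in its argument, so it can be integrated against any integrable
  \<open>f\<close>.\<close>

lemma conv_C1:
  assumes f: "integrable lborel f"
  shows "C1_fun (conv f)" "cgrad (conv f) = conv_grad f"
proof -
  note [measurable] = borel_measurable_integrable[OF f]
  \<comment> \<open>Tolerances for the kernel are divided by S + 1 and not by S, to admit S =
    0.\<close>
  define S where "S = (LINT z|lborel. norm (f z))"
  have S: "S \<ge> 0" by (simp add: S_def)
  have taylor: "\<exists>d>0. \<forall>u h. norm h < d \<longrightarrow> \<bar>ker a r (u + h) - ker a r u - ker_grad a r u \<bullet> h\<bar> \<le> e * norm h" if "e > 0" for e
  proof -
    obtain d where d: "d > 0" "\<And>u v. dist u v < d \<Longrightarrow> dist (ker_grad a r u) (ker_grad a r v) < e"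
      using ker_grad_uniformly_continuous[OF \<open>e > 0\<close>] by blast
    have "\<bar>ker a r (u + h) - ker a r u - ker_grad a r u \<bullet> h\<bar> \<le> e * norm h" if h: "norm h < d" for u h
    proof -
      \<comment> \<open>Subtracting the linear part at \<open>u\<close> leaves a function with small
        gradient on the ball of radius \<open>d\<close>, so the mean value inequality bounds the
        remainder.\<close>
      let ?F = "\<lambda>v. ker a r v - ker_grad a r u \<bullet> v"
      have "norm (?F (u + h) - ?F u) \<le> e * norm (u + h - u)"
      proof (rule differentiable_bound[of "ball u d" ?F "\<lambda>v h. (ker_grad a r v - ker_grad a r u) \<bullet> h"])
        fix v assume v: "v \<in> ball u d"
        show "(?F has_derivative (\<lambda>h. (ker_grad a r v - ker_grad a r u) \<bullet> h)) (at v within ball u d)"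
          by (rule has_derivative_at_withinI, rule has_derivative_eq_rhs[OF has_derivative_diff[OF ker_deriv has_derivative_inner_right[OF has_derivative_ident]]])
             (simp add: fun_eq_iff inner_diff_left)
        show "onorm (\<lambda>h. (ker_grad a r v - ker_grad a r u) \<bullet> h) \<le> e"
        proof (rule onorm_bound)
          show "norm ((ker_grad a r v - ker_grad a r u) \<bullet> x) \<le> e * norm x" for x
          proof -
            have "norm ((ker_grad a r v - ker_grad a r u) \<bullet> x) \<le> norm (ker_grad a r v - ker_grad a r u) * norm x"
              using Cauchy_Schwarz_ineq2 by auto
            also have "\<dots> \<le> e * norm x"
              using d(2)[of v u] v by (intro mult_right_mono) (auto simp: dist_norm norm_minus_commute)
            finally show ?thesis .
          qed
        qed (use \<open>e > 0\<close> in simp)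
      qed (use h d in \<open>auto simp: dist_norm\<close>)
      then show ?thesis by (simp add: inner_add_right algebra_simps)
    qed
    then show ?thesis using d(1) by blast
  qed
  have deriv: "(conv f has_derivative (\<lambda>h. \<Sum>i\<in>UNIV. of_real (h $ i) * conv_grad f x $ i)) (at x)" for x
    unfolding has_derivative_at_alt
  proof (intro conjI allI impI)
    show "bounded_linear (\<lambda>h. \<Sum>i\<in>UNIV. of_real (h $ i) * conv_grad f x $ i)"
      by (intro bounded_linear_sum bounded_linear_mult_const bounded_linear_compose[OF bounded_linear_of_real bounded_linear_vec_nth])
    fix e :: real assume e: "e > 0"
    have e': "e / (S + 1) > 0" using e S by simp
    obtain d where d: "d > 0" "\<And>u h. norm h < d \<Longrightarrow> \<bar>ker a r (u + h) - ker a r u - ker_grad a r u \<bullet> h\<bar> \<le> e / (S + 1) * norm h"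
      using taylor[OF e'] by blast
    have "norm (conv f y - conv f x - (\<Sum>i\<in>UNIV. of_real ((y - x) $ i) * conv_grad f x $ i)) \<le> e * norm (y - x)"
      if y: "norm (y - x) < d" for y
    proof -
      let ?h = "y - x"
      let ?G = "\<lambda>z. ker a r (x - z + ?h) - ker a r (x - z) - ker_grad a r (x - z) \<bullet> ?h"
      have "conv f y - conv f x - (\<Sum>i\<in>UNIV. of_real (?h $ i) * conv_grad f x $ i)
         = (LINT z|lborel. of_real (ker a r (y - z)) * f z - of_real (ker a r (x - z)) * f z
              - (\<Sum>i\<in>UNIV. of_real (?h $ i) * (of_real (ker_grad a r (x - z) $ i) * f z)))"
        unfolding conv_def conv_grad_def
        by (simp add: ker_mult_integrable[OF f] Bochner_Integration.integral_sum)
      also have "\<dots> = (LINT z|lborel. of_real (?G z) * f z)"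
      proof (rule Bochner_Integration.integral_cong[OF refl])
        fix z
        have "x - z + ?h = y - z" by simp
        moreover have "(\<Sum>i\<in>UNIV. of_real (?h $ i) * (of_real (ker_grad a r (x - z) $ i) * f z))
            = complex_of_real (ker_grad a r (x - z) \<bullet> ?h) * f z"
          by (simp add: inner_vec_def sum_distrib_right sum_distrib_left mult_ac)
        ultimately show "of_real (ker a r (y - z)) * f z - of_real (ker a r (x - z)) * f z
              - (\<Sum>i\<in>UNIV. of_real (?h $ i) * (of_real (ker_grad a r (x - z) $ i) * f z)) = of_real (?G z) * f z"
          by (simp add: algebra_simps)
      qed
      finally have eq: "conv f y - conv f x - (\<Sum>i\<in>UNIV. of_real (?h $ i) * conv_grad f x $ i) = (LINT z|lborel. of_real (?G z) * f z)" .
      have "norm (LINT z|lborel. of_real (?G z) * f z) \<le> (LINT z|lborel. e / (S + 1) * norm ?h * norm (f z))"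
      proof (rule Bochner_Integration.integral_norm_bound_integral)
        show "integrable lborel (\<lambda>z. e / (S + 1) * norm ?h * norm (f z))" using f by simp
        have m: "(\<lambda>z. ker a r (y - z)) \<in> borel_measurable borel" "(\<lambda>z. ker a r (x - z)) \<in> borel_measurable borel"
            "(\<lambda>z. ker_grad a r (x - z)) \<in> borel_measurable borel"
          by (intro borel_measurable_continuous_onI ker_shift_continuous)+
        note [measurable] = m
        have le: "norm (of_real (?G z) * f z) \<le> e / (S + 1) * norm ?h * norm (f z)" for z
          unfolding norm_mult norm_of_real using d(2)[OF y, of "x - z"] by (rule mult_right_mono) simp
        then show "norm (of_real (?G z) * f z) \<le> e / (S + 1) * norm ?h * norm (f z)" for z .
        show "integrable lborel (\<lambda>z. of_real (?G z) * f z)"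
        proof (rule Bochner_Integration.integrable_bound)
          show "integrable lborel (\<lambda>z. e / (S + 1) * norm ?h * norm (f z))" using f by simp
          show "AE z in lborel. norm (of_real (?G z) * f z) \<le> norm (e / (S + 1) * norm ?h * norm (f z))"
            unfolding real_norm_def by (intro AE_I2 order_trans[OF le abs_ge_self])
        qed simp
      qed
      also have "\<dots> = e / (S + 1) * norm ?h * S" unfolding S_def by simp
      also have "\<dots> \<le> e * norm ?h"
        using S e by (simp add: field_simps)
      finally show ?thesis unfolding eq .
    qed
    then show "\<exists>d>0. \<forall>y. norm (y - x) < d \<longrightarrow> norm (conv f y - conv f x - (\<Sum>i\<in>UNIV. of_real ((y - x) $ i) * conv_grad f x $ i)) \<le> e * norm (y - x)"
      using d(1) by blast
  qed
  have cont: "continuous_on UNIV (conv_grad f)"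
    unfolding conv_grad_def[abs_def]
  proof (rule continuous_on_vec_lambda)
    fix i
    show "continuous_on UNIV (\<lambda>x. LINT z|lborel. of_real (ker_grad a r (x - z) $ i) * f z)"
      unfolding continuous_on_iff
    proof (intro ballI allI impI)
      fix x :: "real^'n" and e :: real assume e: "e > 0"
      have e': "e / (S + 1) > 0" using e S by simp
      obtain d where d: "d > 0" "\<And>u v. dist u v < d \<Longrightarrow> dist (ker_grad a r u) (ker_grad a r v) < e / (S + 1)"
        using ker_grad_uniformly_continuous[OF e'] by blast
      have "dist (LINT z|lborel. of_real (ker_grad a r (y - z) $ i) * f z) (LINT z|lborel. of_real (ker_grad a r (x - z) $ i) * f z) < e"
        if y: "dist y x < d" for y
      proof -
        have "dist (LINT z|lborel. of_real (ker_grad a r (y - z) $ i) * f z) (LINT z|lborel. of_real (ker_grad a r (x - z) $ i) * f z)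
          = norm (LINT z|lborel. of_real (ker_grad a r (y - z) $ i) * f z - of_real (ker_grad a r (x - z) $ i) * f z)"
          by (simp add: dist_norm ker_mult_integrable[OF f])
        also have "\<dots> \<le> (LINT z|lborel. e / (S + 1) * norm (f z))"
        proof (rule Bochner_Integration.integral_norm_bound_integral)
          show "integrable lborel (\<lambda>z. of_real (ker_grad a r (y - z) $ i) * f z - of_real (ker_grad a r (x - z) $ i) * f z)"
            by (intro Bochner_Integration.integrable_diff ker_mult_integrable f)
          fix z
          have "\<bar>ker_grad a r (y - z) $ i - ker_grad a r (x - z) $ i\<bar> \<le> e / (S + 1)"
            using component_le_norm_cart[of "ker_grad a r (y - z) - ker_grad a r (x - z)" i] d(2)[of "y - z" "x - z"] y
            by (simp add: dist_norm)
          then have "norm (complex_of_real (ker_grad a r (y - z) $ i - ker_grad a r (x - z) $ i) * f z) \<le> e / (S + 1) * norm (f z)"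
            unfolding norm_mult norm_of_real by (rule mult_right_mono) simp
          then show "norm (of_real (ker_grad a r (y - z) $ i) * f z - of_real (ker_grad a r (x - z) $ i) * f z) \<le> e / (S + 1) * norm (f z)"
            by (simp add: algebra_simps)
        qed (use f in simp)
        also have "\<dots> = e / (S + 1) * S" unfolding S_def by simp
        also have "\<dots> < e" using S e by (simp add: field_simps)
        finally show ?thesis .
      qed
      then show "\<exists>d>0. \<forall>y\<in>UNIV. dist y x < d \<longrightarrow> dist (LINT z|lborel. of_real (ker_grad a r (y - z) $ i) * f z) (LINT z|lborel. of_real (ker_grad a r (x - z) $ i) * f z) < e"
        using d(1) by blast
    qed
  qed
  show "C1_fun (conv f)" "cgrad (conv f) = conv_grad f"
    using C1_funI[OF deriv cont] by auto
qed

lemma ker_mult_integrable_L2: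
  assumes f: "f \<in> L2 lborel"
  shows "integrable lborel (\<lambda>z. complex_of_real (ker a r (x - z)) * f z)"
proof -
  note [measurable] = L2_measurable[OF f]
  have k: "(\<lambda>z. ker a r (x - z)) \<in> L2 lborel"
  proof (rule L2_compact_support[OF ker_shift_continuous(1) compact_cball[of "x - a" r]])
    fix z assume "z \<notin> cball (x - a) r"
    then have "x - z \<notin> ball a r" by (auto simp: dist_norm algebra_simps norm_minus_commute)
    then show "ker a r (x - z) = 0" by (rule ker_outside)
  qed
  note [measurable] = L2_measurable[OF k]
  show ?thesis
    by (rule Bochner_Integration.integrable_bound[OF L2_integrable_mult[OF k f]]) (auto simp: norm_mult abs_mult)
qed

text \<open>The kernel has mass 1. Split into two square roots in the Cauchy-Schwarz inequality, it
  bounds the squared error at a point by an average of squared translation errors over shifts in its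
  support. Exchanging the integrals turns these into the norms that \<open>e\<close> bounds.\<close>

lemma conv_L2_bound:
  assumes f: "f \<in> L2 lborel"
    and e: "0 \<le> e" "\<And>u. u \<in> ball a r \<Longrightarrow> l2 lborel (\<lambda>x. f (x - u) - f x) \<le> e"
  shows "(\<integral>\<^sup>+x. ennreal ((norm (conv f x - f x))\<^sup>2) \<partial>lborel) \<le> ennreal (e\<^sup>2)"
proof -
  have fm[measurable]: "f \<in> borel_measurable borel" using L2_measurable[OF f] by simp
  have km[measurable]: "ker a r \<in> borel_measurable borel"
    by (rule borel_measurable_continuous_onI[OF ker_continuous(1)])
  have pt: "ennreal ((norm (conv f x - f x))\<^sup>2) \<le> (\<integral>\<^sup>+u. ennreal (ker a r u) * ennreal ((norm (f (x - u) - f x))\<^sup>2) \<partial>lborel)" for x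
  proof -
    let ?g = "\<lambda>u. complex_of_real (ker a r u) * f (x - u)"
    have i1: "integrable lborel ?g"
      using ker_mult_integrable_L2[OF f, of x] integrable_lborel_reflect[of "\<lambda>z. complex_of_real (ker a r (x - z)) * f z" x] by simp
    have i2: "integrable lborel (\<lambda>u. complex_of_real (ker a r u) * f x)"
      by (intro integrable_mult_left integrable_of_real ker_integrable)
    have "conv f x = (LINT u|lborel. ?g u)"
      unfolding conv_def using integral_lborel_reflect[of "\<lambda>z. complex_of_real (ker a r (x - z)) * f z" x] by simp
    moreover have "(LINT u|lborel. complex_of_real (ker a r u) * f x) = f x"
      by (simp add: ker_integral)
    ultimately have "conv f x - f x = (LINT u|lborel. ?g u - complex_of_real (ker a r u) * f x)"
      using i1 i2 by simp
    also have "\<dots> = (LINT u|lborel. complex_of_real (ker a r u) * (f (x - u) - f x))"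
      by (simp add: algebra_simps)
    finally have eq: "conv f x - f x = (LINT u|lborel. complex_of_real (ker a r u) * (f (x - u) - f x))" .
    have "ennreal (norm (conv f x - f x)) \<le> (\<integral>\<^sup>+u. ennreal (norm (complex_of_real (ker a r u) * (f (x - u) - f x))) \<partial>lborel)"
      unfolding eq by (rule integral_norm_bound_ennreal) (use i1 i2 in \<open>simp add: algebra_simps\<close>)
    also have "\<dots> = (\<integral>\<^sup>+u. ennreal (sqrt (ker a r u)) * ennreal (sqrt (ker a r u) * norm (f (x - u) - f x)) \<partial>lborel)"
      using ker_nonneg by (intro nn_integral_cong) (simp add: norm_mult ennreal_mult[symmetric] mult.assoc[symmetric])
    finally have "(ennreal (norm (conv f x - f x)))\<^sup>2 \<le> (\<integral>\<^sup>+u. ennreal (sqrt (ker a r u)) * ennreal (sqrt (ker a r u) * norm (f (x - u) - f x)) \<partial>lborel)\<^sup>2"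
      by (rule power_mono) simp
    also have "\<dots> \<le> (\<integral>\<^sup>+u. (ennreal (sqrt (ker a r u)))\<^sup>2 \<partial>lborel) * (\<integral>\<^sup>+u. (ennreal (sqrt (ker a r u) * norm (f (x - u) - f x)))\<^sup>2 \<partial>lborel)"
      by (rule Cauchy_Schwarz_nn_integral) measurable
    also have "(\<integral>\<^sup>+u. (ennreal (sqrt (ker a r u)))\<^sup>2 \<partial>lborel) = (\<integral>\<^sup>+u. ennreal (ker a r u) \<partial>lborel)"
      using ker_nonneg by (simp add: ennreal_power)
    also have "\<dots> = 1"
      using nn_integral_eq_integral[OF ker_integrable] ker_nonneg by (simp add: ker_integral)
    finally show ?thesis
      using ker_nonneg by (simp add: ennreal_power power_mult_distrib ennreal_mult)
  qed
  have "(\<integral>\<^sup>+x. ennreal ((norm (conv f x - f x))\<^sup>2) \<partial>lborel) \<le> (\<integral>\<^sup>+x. (\<integral>\<^sup>+u. ennreal (ker a r u) * ennreal ((norm (f (x - u) - f x))\<^sup>2) \<partial>lborel) \<partial>lborel)"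
    by (intro nn_integral_mono pt)
  also have "\<dots> = (\<integral>\<^sup>+u. (\<integral>\<^sup>+x. ennreal (ker a r u) * ennreal ((norm (f (x - u) - f x))\<^sup>2) \<partial>lborel) \<partial>lborel)"
    by (rule lborel_pair.Fubini') measurable
  also have "\<dots> = (\<integral>\<^sup>+u. ennreal (ker a r u) * (\<integral>\<^sup>+x. ennreal ((norm (f (x - u) - f x))\<^sup>2) \<partial>lborel) \<partial>lborel)"
    by (intro nn_integral_cong nn_integral_cmult) measurable
  also have "\<dots> \<le> (\<integral>\<^sup>+u. ennreal (ker a r u) * ennreal (e\<^sup>2) \<partial>lborel)"
  proof (intro nn_integral_mono)
    fix u
    show "ennreal (ker a r u) * (\<integral>\<^sup>+x. ennreal ((norm (f (x - u) - f x))\<^sup>2) \<partial>lborel) \<le> ennreal (ker a r u) * ennreal (e\<^sup>2)"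
    proof (cases "u \<in> ball a r")
      case True
      have "(\<lambda>x. f (x - u) - f x) \<in> L2 lborel" using L2_diff[OF L2_translate[OF f, of "-u"] f] by simp
      from l2_nn[OF this] show ?thesis
        using e(2)[OF True] by (auto intro!: mult_left_mono ennreal_leI power_mono)
    qed (simp add: ker_outside)
  qed
  also have "\<dots> = (\<integral>\<^sup>+u. ennreal (ker a r u) \<partial>lborel) * ennreal (e\<^sup>2)"
    by (rule nn_integral_multc) measurable
  also have "(\<integral>\<^sup>+u. ennreal (ker a r u) \<partial>lborel) = 1"
    using nn_integral_eq_integral[OF ker_integrable] ker_nonneg by (simp add: ker_integral)
  finally show ?thesis by simp
qed

end

text \<open>Centre and radius of the kernel shrink together: its support lies within \<epsilon> (|d|
  + 1) of the origin, and such shifts move \<open>f\<close> by less than \<open>e\<close> in the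
  mean once \<epsilon> is small.\<close>

lemma conv_tendsto:
  fixes f :: "real^'n \<Rightarrow> complex"
  assumes f: "f \<in> L2 lborel" and e: "e > 0"
  obtains \<epsilon>0 where "\<epsilon>0 > 0"
    "\<And>\<epsilon>. 0 < \<epsilon> \<Longrightarrow> \<epsilon> < \<epsilon>0 \<Longrightarrow> (\<integral>\<^sup>+x. ennreal ((norm (conv (\<epsilon> *\<^sub>R d) \<epsilon> f x - f x))\<^sup>2) \<partial>lborel) \<le> ennreal (e\<^sup>2)"
proof -
  have "\<forall>\<^sub>F h in nhds 0. l2 lborel (\<lambda>x. f (x + h) - f x) < e"
    using tendstoD[OF shift_continuous_L2[OF f, unfolded shift_continuous_def] e] by simp
  then obtain \<delta> where \<delta>: "\<delta> > 0" "\<And>h. dist h 0 < \<delta> \<Longrightarrow> l2 lborel (\<lambda>x. f (x + h) - f x) < e"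
    unfolding eventually_nhds_metric by blast
  show thesis
  proof
    show "\<delta> / (norm d + 1) > 0" using \<delta>(1) by (simp add: add_nonneg_pos)
    fix \<epsilon> assume \<epsilon>: "0 < \<epsilon>" "\<epsilon> < \<delta> / (norm d + 1)"
    show "(\<integral>\<^sup>+x. ennreal ((norm (conv (\<epsilon> *\<^sub>R d) \<epsilon> f x - f x))\<^sup>2) \<partial>lborel) \<le> ennreal (e\<^sup>2)"
    proof (rule conv_L2_bound[OF \<epsilon>(1) f])
      fix u assume "u \<in> ball (\<epsilon> *\<^sub>R d) \<epsilon>"
      then have "norm (\<epsilon> *\<^sub>R d - u) < \<epsilon>" by (simp add: dist_norm)
      moreover have "norm u \<le> norm (\<epsilon> *\<^sub>R d) + norm (\<epsilon> *\<^sub>R d - u)"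
        by (metis norm_minus_commute norm_triangle_sub)
      ultimately have "norm u < \<epsilon> * (norm d + 1)" using \<epsilon>(1) by (simp add: algebra_simps)
      also have "\<dots> < \<delta>" using \<epsilon>(2) by (simp add: pos_less_divide_eq add_nonneg_pos)
      finally show "l2 lborel (\<lambda>x. f (x - u) - f x) \<le> e"
        using \<delta>(2)[of "-u"] by simp
    qed (use e in simp)
  qed
qed

section \<open>Weak gradients\<close>

lemma cmod_sum_mult_le:
  fixes h :: "real^'n" and g :: "complex^'n"
  shows "cmod (\<Sum>i\<in>UNIV. of_real (h $ i) * g $ i) \<le> norm h * norm g"
proof -
  have "cmod (\<Sum>i\<in>UNIV. of_real (h $ i) * g $ i) \<le> (\<Sum>i\<in>UNIV. \<bar>h $ i\<bar> * \<bar>cmod (g $ i)\<bar>)"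
    by (rule order_trans[OF norm_sum]) (simp add: norm_mult)
  also have "\<dots> \<le> L2_set (\<lambda>i. \<bar>h $ i\<bar>) UNIV * L2_set (\<lambda>i. cmod (g $ i)) UNIV"
    using L2_set_mult_ineq[of "\<lambda>i. \<bar>h $ i\<bar>" "\<lambda>i. cmod (g $ i)" UNIV] by simp
  also have "\<dots> = norm h * norm g" by (simp add: norm_vec_def)
  finally show ?thesis .
qed

lemma C1_fun_Lipschitz:
  fixes F :: "real^'n \<Rightarrow> complex"
  assumes F: "C1_fun F" and B: "\<And>x. x \<in> S \<Longrightarrow> norm (cgrad F x) \<le> B" and S: "convex S" "x \<in> S" "y \<in> S"
  shows "cmod (F y - F x) \<le> B * norm (y - x)"
proof (rule differentiable_bound[OF S(1) _ _ S(3,2)])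
  fix z assume z: "z \<in> S"
  show "(F has_derivative (\<lambda>h. \<Sum>i\<in>UNIV. of_real (h $ i) * cgrad F z $ i)) (at z within S)"
    using C1_fun_has_derivative(1)[OF F] has_derivative_at_withinI by blast
  show "onorm (\<lambda>h. \<Sum>i\<in>UNIV. complex_of_real (h $ i) * cgrad F z $ i) \<le> B"
  proof (rule onorm_bound)
    show "0 \<le> B" using B[OF z] norm_ge_zero order_trans by blast
    show "norm (\<Sum>i\<in>UNIV. complex_of_real (h $ i) * cgrad F z $ i) \<le> B * norm h" for h
      using order_trans[OF cmod_sum_mult_le mult_left_mono[OF B[OF z] norm_ge_zero]] by (simp add: mult.commute)
  qed
qed

text \<open>Translation invariance makes the integrals of the difference quotients vanish.\<close>

lemma integral_cgrad_compact_support: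
  fixes F :: "real^'n \<Rightarrow> complex"
  assumes F: "C1_fun F" and K: "compact K" and z: "\<And>x. x \<notin> K \<Longrightarrow> F x = 0"
  shows "(LINT x|lborel. cgrad F x $ i) = 0"
proof -
  \<comment> \<open>The complement of \<open>K\<close> is open, so the function is zero near every
    point outside \<open>K\<close>.\<close>
  have zg: "cgrad F x = 0" if "x \<notin> K" for x
  proof -
    have "open (- K)" using K compact_imp_closed by blast
    then have "(F has_derivative (\<lambda>h. 0)) (at x)"
      using has_derivative_transform_within_open[OF has_derivative_const[of 0], of "- K" x F] that z by auto
    then have "frechet_derivative F (at x) = (\<lambda>h. 0)"
      using frechet_derivative_at by metis
    then show ?thesis by (simp add: cgrad_def partial_deriv_def vec_eq_iff)
  qed
  obtain R where R: "K \<subseteq> ball 0 R" using compact_imp_bounded[OF K] bounded_subset_ballD by blast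
  have contg: "continuous_on UNIV (cgrad F)" by (rule C1_fun_has_derivative(2)[OF F])
  have "bounded (cgrad F ` K)"
    by (intro compact_imp_bounded compact_continuous_image continuous_on_subset[OF contg] K) simp
  then obtain B0 where B0: "\<And>x. x \<in> K \<Longrightarrow> norm (cgrad F x) \<le> B0" unfolding bounded_iff by blast
  define B where "B = max B0 0"
  have B: "norm (cgrad F x) \<le> B" "B \<ge> 0" for x
    using B0[of x] zg[of x] unfolding B_def by (cases "x \<in> K"; simp add: le_max_iff_disj)+
  have Fc: "continuous_on UNIV F" by (rule C1_fun_continuous[OF F])
  have Fm[measurable]: "F \<in> borel_measurable borel" by (rule borel_measurable_continuous_onI[OF Fc])
  have Fi: "integrable lborel F" by (rule integrable_compact_support[OF Fc K z])
  let ?e = "axis i (1::real) :: real^'n"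
  let ?t = "\<lambda>n. inverse (real (Suc n))"
  let ?q = "\<lambda>n x. (F (x + ?t n *\<^sub>R ?e) - F x) / of_real (?t n)"
  have "integrable lborel (\<lambda>x. F (x + h))" for h
    using integrable_distr_eq[of "(+) h" lborel borel F] Fi by (simp add: lborel_distr_plus add.commute)
  then have q0: "(LINT x|lborel. ?q n x) = 0" for n
    using Fi integral_lborel_translate[OF Fm] by simp
  have tt: "?t \<longlonglongrightarrow> 0" by (rule LIMSEQ_inverse_real_of_nat)
  have "(\<lambda>n. LINT x|lborel. ?q n x) \<longlonglongrightarrow> (LINT x|lborel. cgrad F x $ i)"
  \<comment> \<open>The steps \<open>?t n\<close> are at most 1, so the difference quotients vanish
    outside the ball of radius R + 1; inside it the gradient bound \<open>B\<close> dominates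
    them.\<close>
  proof (rule integral_dominated_convergence[where w="\<lambda>x. B * indicator (cball 0 (R + 1)) x"])
    show "(\<lambda>x. cgrad F x $ i) \<in> borel_measurable lborel"
      using borel_measurable_continuous_onI[OF continuous_on_component[OF contg]] by simp
    show "?q n \<in> borel_measurable lborel" for n by measurable
    show "integrable lborel (\<lambda>x::real^'n. B * indicator (cball 0 (R + 1)) x :: real)"
      by (intro integrable_mult_right integrable_real_indicator) (use emeasure_lborel_cball_finite[of "0 :: real^'n" "R + 1"] in auto)
    show "AE x in lborel. (\<lambda>n. ?q n x) \<longlonglongrightarrow> cgrad F x $ i"
    proof (rule AE_I2)
      fix x :: "real^'n"
      have d: "(F has_derivative (\<lambda>h. \<Sum>j\<in>UNIV. of_real (h $ j) * cgrad F x $ j)) (at (x + 0 *\<^sub>R ?e))"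
        using C1_fun_has_derivative(1)[OF F] by simp
      have l: "((\<lambda>t. x + t *\<^sub>R ?e) has_derivative (\<lambda>t. t *\<^sub>R ?e)) (at 0)"
        by (auto intro!: derivative_eq_intros)
      have "((\<lambda>t. F (x + t *\<^sub>R ?e)) has_derivative (\<lambda>t. \<Sum>j\<in>UNIV. of_real ((t *\<^sub>R ?e) $ j) * cgrad F x $ j)) (at 0)"
        by (rule has_derivative_compose[OF l d])
      moreover have "(\<Sum>j\<in>UNIV. of_real ((t *\<^sub>R ?e) $ j) * cgrad F x $ j) = t *\<^sub>R (cgrad F x $ i)" for t
      proof -
        have "(\<Sum>j\<in>UNIV. of_real ((t *\<^sub>R ?e) $ j) * cgrad F x $ j) = (\<Sum>j\<in>UNIV. if j = i then of_real t * cgrad F x $ i else 0)"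
          by (intro sum.cong) (auto simp: axis_def)
        then show ?thesis by (simp add: scaleR_conv_of_real)
      qed
      ultimately have "((\<lambda>t. F (x + t *\<^sub>R ?e)) has_derivative (\<lambda>t. t *\<^sub>R (cgrad F x $ i))) (at 0)"
        by simp
      then have lim0: "((\<lambda>t. norm (F (x + t *\<^sub>R ?e) - F x - t *\<^sub>R (cgrad F x $ i)) / norm t) \<longlongrightarrow> 0) (at 0)"
        unfolding has_derivative_at by simp
      have "filterlim ?t (at 0) sequentially"
        using tt by (simp add: filterlim_at)
      from filterlim_compose[OF lim0 this]
      have "(\<lambda>n. norm (F (x + ?t n *\<^sub>R ?e) - F x - ?t n *\<^sub>R (cgrad F x $ i)) / norm (?t n)) \<longlonglongrightarrow> 0" .
      moreover have "norm (F (x + ?t n *\<^sub>R ?e) - F x - ?t n *\<^sub>R (cgrad F x $ i)) / norm (?t n)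
          = norm (?q n x - cgrad F x $ i)" for n
      proof -
        have "?q n x - cgrad F x $ i = (F (x + ?t n *\<^sub>R ?e) - F x - ?t n *\<^sub>R (cgrad F x $ i)) / of_real (?t n)"
          by (simp add: scaleR_conv_of_real diff_divide_distrib del: of_nat_Suc)
        then show ?thesis by (simp only: norm_divide norm_of_real real_norm_def)
      qed
      ultimately have "(\<lambda>n. norm (?q n x - cgrad F x $ i)) \<longlonglongrightarrow> 0" by simp
      then have "(\<lambda>n. ?q n x - cgrad F x $ i) \<longlonglongrightarrow> 0" by (rule tendsto_norm_zero_cancel)
      then show "(\<lambda>n. ?q n x) \<longlonglongrightarrow> cgrad F x $ i"
        by (rule LIM_zero_cancel)
    qed
    show "AE x in lborel. norm (?q n x) \<le> B * indicator (cball 0 (R + 1)) x" for n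
    proof (rule AE_I2)
      fix x :: "real^'n"
      have nt: "norm (?t n *\<^sub>R ?e) = ?t n" "?t n \<le> 1" by (auto simp: field_simps)
      show "norm (?q n x) \<le> B * indicator (cball 0 (R + 1)) x"
      proof (cases "x \<in> cball 0 (R + 1)")
        case True
        have "cmod (F (x + ?t n *\<^sub>R ?e) - F x) \<le> B * norm (x + ?t n *\<^sub>R ?e - x)"
          by (rule C1_fun_Lipschitz[where S=UNIV, OF F B(1)]) auto
        then have "cmod (F (x + ?t n *\<^sub>R ?e) - F x) \<le> B * ?t n" using nt by simp
        then have "cmod (F (x + ?t n *\<^sub>R ?e) - F x) / ?t n \<le> B"
          by (subst pos_divide_le_eq) simp_all
        moreover have "norm (?q n x) = cmod (F (x + ?t n *\<^sub>R ?e) - F x) / ?t n"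
          unfolding norm_divide norm_of_real by simp
        ultimately show ?thesis using True by simp
      next
        case False
        then have "norm x > R + 1" by simp
        moreover have "norm x \<le> norm (x + ?t n *\<^sub>R ?e) + norm (?t n *\<^sub>R ?e)"
          by (metis add_diff_cancel norm_triangle_ineq4)
        ultimately have "norm (x + ?t n *\<^sub>R ?e) > R" "norm x > R" using nt by linarith+
        then have "x + ?t n *\<^sub>R ?e \<notin> K" "x \<notin> K" using R by (auto simp: subset_eq)
        then show ?thesis using z False by simp
      qed
    qed
  qed
  then show ?thesis unfolding q0 using LIMSEQ_unique tendsto_const by blast
qed

text \<open>Elements of \<open>L2 (lebesgue_on \<Omega>)\<close> are only Lebesgue measurable on
  \<Omega>. Translations, Fubini's theorem and convolution work with Borel functions on the whole
  space, hence this Borel representative continued by zero.\<close>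

definition ext :: "(real^'n) set \<Rightarrow> (real^'n \<Rightarrow> complex) \<Rightarrow> (real^'n \<Rightarrow> complex) \<Rightarrow> bool" where
  "ext \<Omega> f f' \<longleftrightarrow> f' \<in> borel_measurable borel \<and> (\<forall>x. x \<notin> \<Omega> \<longrightarrow> f' x = 0) \<and> (AE x in lebesgue_on \<Omega>. f x = f' x)"

text \<open>A Lebesgue measurable function agrees almost everywhere with a Borel one. The fact used
  for this is about real functions, so real and imaginary parts are treated separately.\<close>

lemma ext_exists:
  fixes f :: "real^'n \<Rightarrow> complex"
  assumes f: "f \<in> borel_measurable (lebesgue_on \<Omega>)" and \<Omega>: "open \<Omega>"
  shows "\<exists>f'. ext \<Omega> f f'"
proof -
  have \<Omega>b: "\<Omega> \<in> sets borel" using \<Omega> by simp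
  have \<Omega>s: "\<Omega> \<in> sets lebesgue" using \<Omega>b by simp
  let ?g = "\<lambda>x. if x \<in> \<Omega> then f x else 0"
  have g: "?g \<in> borel_measurable lebesgue" by (rule borel_measurable_if_I[OF f \<Omega>s])
  have gR: "(\<lambda>x. Re (?g x)) \<in> borel_measurable lebesgue" and gI: "(\<lambda>x. Im (?g x)) \<in> borel_measurable lebesgue"
    using g by (auto intro: borel_measurable_Re borel_measurable_Im)
  obtain a b where ab: "a \<in> borel_measurable borel" "b \<in> borel_measurable borel"
    "AE x in lborel. Re (?g x) = a x" "AE x in lborel. Im (?g x) = b x"
    using completion_ex_borel_measurable_real[OF gR] completion_ex_borel_measurable_real[OF gI] by auto
  define f' where "f' x = indicator \<Omega> x * (of_real (a x) + \<i> * of_real (b x))" for x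
  have m: "f' \<in> borel_measurable borel"
    unfolding f'_def[abs_def] using ab(1,2) \<Omega>b by measurable
  have "AE x in lborel. x \<in> \<Omega> \<longrightarrow> f x = f' x"
    using ab(3,4) by eventually_elim (auto simp: f'_def complex_eq_iff)
  then have "AE x in lebesgue_on \<Omega>. f x = f' x"
    using \<Omega>s by (subst AE_restrict_space_iff) (auto intro: AE_completion)
  then show ?thesis using m unfolding ext_def by (auto simp: f'_def)
qed

lemma borel_measurable_lebesgue_onI:
  "f \<in> borel_measurable borel \<Longrightarrow> f \<in> borel_measurable (lebesgue_on \<Omega>)"
  by (intro measurable_restrict_space1 measurable_completion) simp

lemma nn_integral_lebesgue_on:
  assumes "open \<Omega>" "f \<in> borel_measurable borel"
  shows "(\<integral>\<^sup>+x. f x \<partial>lebesgue_on \<Omega>) = (\<integral>\<^sup>+x. f x * indicator \<Omega> x \<partial>lborel)"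
  using assms by (simp add: nn_integral_restrict_space nn_integral_completion)

lemma LINT_lebesgue_on_vanish:
  fixes f :: "'a::euclidean_space \<Rightarrow> 'b::{banach, second_countable_topology}"
  assumes "open \<Omega>" "f \<in> borel_measurable borel" "\<And>x. x \<notin> \<Omega> \<Longrightarrow> f x = 0"
  shows "(LINT x|lebesgue_on \<Omega>. f x) = (LINT x|lborel. f x)"
    and "integrable (lebesgue_on \<Omega>) f \<longleftrightarrow> integrable lborel f"
proof -
  have "(\<lambda>x. indicator \<Omega> x *\<^sub>R f x) = f" using assms(3) by (auto simp: indicator_def fun_eq_iff)
  then show "(LINT x|lebesgue_on \<Omega>. f x) = (LINT x|lborel. f x)" "integrable (lebesgue_on \<Omega>) f \<longleftrightarrow> integrable lborel f"
    using assms(1,2) by (simp_all add: integral_restrict_space integral_completion integrable_restrict_space integrable_completion)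
qed

lemma ext_L2:
  fixes f :: "real^'n \<Rightarrow> complex"
  assumes e: "ext \<Omega> f f'" and f: "f \<in> L2 (lebesgue_on \<Omega>)" and \<Omega>: "open \<Omega>"
  shows "f' \<in> L2 lborel"
proof (rule L2_I)
  have m[measurable]: "f' \<in> borel_measurable borel" and z: "\<And>x. x \<notin> \<Omega> \<Longrightarrow> f' x = 0" and ae: "AE x in lebesgue_on \<Omega>. f x = f' x"
    using e by (auto simp: ext_def)
  show "f' \<in> borel_measurable lborel" by simp
  have "f' \<in> L2 (lebesgue_on \<Omega>)"
    by (rule L2_bound[OF f borel_measurable_lebesgue_onI[OF m], of 1]) (use ae in \<open>auto elim: eventually_mono\<close>)
  from L2_integrable[OF this]
  show "integrable lborel (\<lambda>x. (norm (f' x))\<^sup>2)"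
    by (subst LINT_lebesgue_on_vanish(2)[OF \<Omega>, symmetric]) (use z in auto)
qed

lemma ext_integral:
  fixes f :: "real^'n \<Rightarrow> complex"
  assumes e: "ext \<Omega> f f'" and f: "f \<in> borel_measurable (lebesgue_on \<Omega>)" and \<Omega>: "open \<Omega>"
    and \<phi>: "\<phi> \<in> borel_measurable borel"
  shows "(LINT x|lebesgue_on \<Omega>. f x * \<phi> x) = (LINT x|lborel. f' x * \<phi> x)"
proof -
  have m[measurable]: "f' \<in> borel_measurable borel" and z: "\<And>x. x \<notin> \<Omega> \<Longrightarrow> f' x = 0" and ae: "AE x in lebesgue_on \<Omega>. f x = f' x"
    using e by (auto simp: ext_def)
  note [measurable] = f \<phi> borel_measurable_lebesgue_onI[OF \<phi>] borel_measurable_lebesgue_onI[OF m]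
  have "(LINT x|lebesgue_on \<Omega>. f x * \<phi> x) = (LINT x|lebesgue_on \<Omega>. f' x * \<phi> x)"
    by (rule integral_cong_AE) (use ae in \<open>auto elim: eventually_mono\<close>)
  also have "\<dots> = (LINT x|lborel. f' x * \<phi> x)"
    by (rule LINT_lebesgue_on_vanish(1)[OF \<Omega>]) (use z in auto)
  finally show ?thesis .
qed

text \<open>Reflection makes the kernel a test function of the integration variable, supported in
  the ball about x - a. The sign from the chain rule cancels the one in the definition of the weak
  gradient, so that mollification commutes with differentiation.\<close>

lemma
  fixes a x :: "real^'n"
  assumes r: "r > 0"
  shows ker_reflect_cgrad: "cgrad (\<lambda>z. complex_of_real (ker a r (x - z))) z $ i = - of_real (ker_grad a r (x - z) $ i)"
    and ker_reflect_test: "cball (x - a) r \<subseteq> \<Omega> \<Longrightarrow> test_fun \<Omega> (\<lambda>z. complex_of_real (ker a r (x - z)))"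
proof -
  have d: "((\<lambda>z. ker a r (x - z)) has_derivative (\<lambda>h. (- ker_grad a r (x - z)) \<bullet> h)) (at z)" for z
    by (rule has_derivative_eq_rhs[OF has_derivative_compose[OF has_derivative_diff[OF has_derivative_const has_derivative_ident] ker_deriv[OF r]]])
       (simp add: fun_eq_iff)
  have c: "continuous_on UNIV (\<lambda>z. - ker_grad a r (x - z))"
    by (intro continuous_intros ker_shift_continuous r)
  have C1: "C1_fun (\<lambda>z. complex_of_real (ker a r (x - z)))" by (rule C1_fun_of_real[OF d c])
  show "cgrad (\<lambda>z. complex_of_real (ker a r (x - z))) z $ i = - of_real (ker_grad a r (x - z) $ i)"
    unfolding cgrad_of_real[OF d c] by simp
  show "test_fun \<Omega> (\<lambda>z. complex_of_real (ker a r (x - z)))" if "cball (x - a) r \<subseteq> \<Omega>"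
    unfolding test_fun_def
  proof (intro conjI exI[of _ "cball (x - a) r"] C1 that allI impI)
    fix z assume "z \<notin> cball (x - a) r"
    then have "x - z \<notin> ball a r" by (auto simp: dist_norm algebra_simps norm_minus_commute)
    then show "complex_of_real (ker a r (x - z)) = 0" using ker_outside[OF r] by simp
  qed simp
qed

text \<open>Reflected kernels are test functions as long as their support stays inside \<Omega>, so
  the mollification of \<open>f\<close> vanishes away from the boundary. It also converges to
  \<open>f\<close> in the mean.\<close>

lemma weakly_zero_imp_AE_zero:
  fixes f :: "real^'n \<Rightarrow> complex"
  assumes \<Omega>: "open \<Omega>" "bounded \<Omega>" and f: "f \<in> L2 (lebesgue_on \<Omega>)"
    and z: "\<And>\<phi>. test_fun \<Omega> \<phi> \<Longrightarrow> (LINT x|lebesgue_on \<Omega>. f x * \<phi> x) = 0"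
  shows "AE x in lebesgue_on \<Omega>. f x = 0"
proof -
  obtain f' where f': "ext \<Omega> f f'" using ext_exists[OF L2_measurable[OF f] \<Omega>(1)] by blast
  note f'L = ext_L2[OF f' f \<Omega>(1)]
  have [measurable]: "f' \<in> borel_measurable borel" using f' by (simp add: ext_def)
  \<comment> \<open>\<open>infdist\<close> to the empty set is 0 by convention; the complement has
    to be nonempty for points of \<Omega> to have positive distance from it.\<close>
  have ne: "- \<Omega> \<noteq> {}" using \<Omega>(2) by (metis Compl_empty_eq bounded_empty boolean_algebra.compl_zero double_compl not_bounded_UNIV)
  have conv0: "conv 0 \<epsilon> f' x = 0" if "\<epsilon> > 0" "cball x \<epsilon> \<subseteq> \<Omega>" for x \<epsilon>
  proof -
    have t: "test_fun \<Omega> (\<lambda>z. complex_of_real (ker 0 \<epsilon> (x - z)))"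
      using ker_reflect_test[OF that(1), of x 0 \<Omega>] that(2) by simp
    then have b: "(\<lambda>z. complex_of_real (ker 0 \<epsilon> (x - z))) \<in> borel_measurable borel"
      by (intro borel_measurable_continuous_onI C1_fun_continuous) (simp add: test_fun_def)
    show ?thesis using z[OF t] ext_integral[OF f' L2_measurable[OF f] \<Omega>(1) b]
      by (simp add: conv_def[OF that(1)] mult.commute)
  qed
  \<comment> \<open>Points far enough from the complement for a kernel of radius at most 1/(n+1)
    about the point. These sets exhaust \<Omega>.\<close>
  define A where "A n = {x \<in> \<Omega>. infdist x (- \<Omega>) > inverse (real (Suc n))}" for n
  have [measurable]: "A n \<in> sets borel" for n
  proof -
    have "A n = \<Omega> \<inter> {x. infdist x (- \<Omega>) > inverse (real (Suc n))}" by (auto simp: A_def)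
    moreover have "open {x. infdist x (- \<Omega>) > inverse (real (Suc n))}"
      by (intro open_Collect_less continuous_intros)
    ultimately show ?thesis using \<Omega>(1) by auto
  qed
  have "AE x in lborel. x \<in> A n \<longrightarrow> f' x = 0" for n
  proof -
    have le: "(\<integral>\<^sup>+x. ennreal ((norm (f' x))\<^sup>2) * indicator (A n) x \<partial>lborel) \<le> ennreal e" if e: "e > 0" for e :: real
    proof -
      obtain \<epsilon>0 where \<epsilon>0: "\<epsilon>0 > 0"
        "\<And>\<epsilon>. 0 < \<epsilon> \<Longrightarrow> \<epsilon> < \<epsilon>0 \<Longrightarrow> (\<integral>\<^sup>+x. ennreal ((norm (conv (\<epsilon> *\<^sub>R 0) \<epsilon> f' x - f' x))\<^sup>2) \<partial>lborel) \<le> ennreal ((sqrt e)\<^sup>2)"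
        using conv_tendsto[OF f'L, of "sqrt e" 0] e by auto
      define \<epsilon> where "\<epsilon> = min (\<epsilon>0 / 2) (inverse (real (Suc n)))"
      have \<epsilon>: "0 < \<epsilon>" "\<epsilon> < \<epsilon>0" "\<epsilon> \<le> inverse (real (Suc n))" using \<epsilon>0(1) by (auto simp: \<epsilon>_def min_def)
      have "(\<integral>\<^sup>+x. ennreal ((norm (f' x))\<^sup>2) * indicator (A n) x \<partial>lborel) \<le> (\<integral>\<^sup>+x. ennreal ((norm (conv (\<epsilon> *\<^sub>R 0) \<epsilon> f' x - f' x))\<^sup>2) \<partial>lborel)"
      proof (intro nn_integral_mono)
        fix x
        show "ennreal ((norm (f' x))\<^sup>2) * indicator (A n) x \<le> ennreal ((norm (conv (\<epsilon> *\<^sub>R 0) \<epsilon> f' x - f' x))\<^sup>2)"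
        proof (cases "x \<in> A n")
          case True
          have "cball x \<epsilon> \<subseteq> \<Omega>"
          proof
            fix y assume y: "y \<in> cball x \<epsilon>"
            show "y \<in> \<Omega>"
            proof (rule ccontr)
              assume "y \<notin> \<Omega>"
              then have "infdist x (- \<Omega>) \<le> dist x y" by (intro infdist_le) auto
              then show False using y True \<epsilon>(3) by (auto simp: A_def)
            qed
          qed
          then show ?thesis using conv0[OF \<epsilon>(1)] True by simp
        qed simp
      qed
      also have "\<dots> \<le> ennreal e" using \<epsilon>0(2)[OF \<epsilon>(1,2)] e by simp
      finally show ?thesis .
    qed
    have "(\<integral>\<^sup>+x. ennreal ((norm (f' x))\<^sup>2) * indicator (A n) x \<partial>lborel) \<le> 0"
    proof (rule ennreal_le_epsilon)
      fix e :: real assume "0 < e"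
      from le[OF this] show "(\<integral>\<^sup>+x. ennreal ((norm (f' x))\<^sup>2) * indicator (A n) x \<partial>lborel) \<le> 0 + ennreal e"
        by simp
    qed
    then have "(\<integral>\<^sup>+x. ennreal ((norm (f' x))\<^sup>2) * indicator (A n) x \<partial>lborel) = 0" by simp
    moreover have "(\<lambda>x. ennreal ((norm (f' x))\<^sup>2) * indicator (A n) x) \<in> borel_measurable lborel" by measurable
    ultimately have "AE x in lborel. ennreal ((norm (f' x))\<^sup>2) * indicator (A n) x = 0"
      using nn_integral_0_iff_AE by blast
    then show ?thesis by eventually_elim (auto simp: indicator_def split: if_splits)
  qed
  then have "AE x in lborel. \<forall>n. x \<in> A n \<longrightarrow> f' x = 0"
    by (intro AE_all_countable[THEN iffD2] allI)
  then have "AE x in lborel. x \<in> \<Omega> \<longrightarrow> f' x = 0"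
  proof eventually_elim
    case (elim x)
    show ?case
    proof
      assume x: "x \<in> \<Omega>"
      have "infdist x (- \<Omega>) > 0"
        using in_closed_iff_infdist_zero[of "- \<Omega>" x] \<Omega>(1) ne x infdist_nonneg[of x "- \<Omega>"]
        by (auto simp: closed_Compl less_le)
      then obtain n where "inverse (real (Suc n)) < infdist x (- \<Omega>)" using reals_Archimedean by blast
      then show "f' x = 0" using elim x by (auto simp: A_def)
    qed
  qed
  then have "AE x in lebesgue_on \<Omega>. f' x = 0"
    using \<Omega>(1) by (subst AE_restrict_space_iff) (auto intro: AE_completion)
  moreover have "AE x in lebesgue_on \<Omega>. f x = f' x" using f' by (simp add: ext_def)
  ultimately show ?thesis by eventually_elim simp
qed

lemma
  fixes f g :: "'a \<Rightarrow> complex"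
  assumes f: "f \<in> L2 M" and g: "g \<in> L2 M"
  shows L2_mult_integrable: "integrable M (\<lambda>x. f x * g x)"
    and L2_mult_integral_le: "cmod (LINT x|M. f x * g x) \<le> l2 M f * l2 M g"
proof -
  note [measurable] = f[THEN L2_measurable] g[THEN L2_measurable]
  show "integrable M (\<lambda>x. f x * g x)"
    by (rule Bochner_Integration.integrable_bound[OF L2_integrable_mult[OF f g]]) (auto simp: norm_mult)
  have "cmod (LINT x|M. f x * g x) \<le> (LINT x|M. norm (f x) * norm (g x))"
    using integral_norm_bound[of M "\<lambda>x. f x * g x"] by (simp add: norm_mult)
  then show "cmod (LINT x|M. f x * g x) \<le> l2 M f * l2 M g"
    using L2_Cauchy_Schwarz[OF f g] by linarith
qed

lemma vec_nth_borel [measurable]: "(\<lambda>v :: complex^'n. v $ i) \<in> borel_measurable borel"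
  by (intro borel_measurable_continuous_onI continuous_intros)

lemma
  fixes G :: "'a \<Rightarrow> complex^'n"
  assumes G: "G \<in> L2 M"
  shows L2_component: "(\<lambda>x. G x $ i) \<in> L2 M"
    and l2_component_le: "l2 M (\<lambda>x. G x $ i) \<le> l2 M G"
proof -
  have m: "(\<lambda>x. G x $ i) \<in> borel_measurable M"
    using measurable_compose[OF L2_measurable[OF G] vec_nth_borel] .
  have le: "AE x in M. norm (G x $ i) \<le> 1 * norm (G x)"
    by (intro AE_I2) (simp add: Finite_Cartesian_Product.norm_nth_le)
  show "(\<lambda>x. G x $ i) \<in> L2 M" by (rule L2_bound[OF G m le])
  show "l2 M (\<lambda>x. G x $ i) \<le> l2 M G" using l2_bound_AE[OF G m le] by simp
qed

lemma norm_vec_sq: "(norm (v :: complex^'n))\<^sup>2 = (\<Sum>i\<in>UNIV. (cmod (v $ i))\<^sup>2)"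
  by (simp add: norm_vec_def L2_set_def sum_nonneg)

lemma norm_cnj_vec [simp]: "norm (cnj_vec v) = norm v"
  by (simp add: cnj_vec_def norm_vec_def)

lemma borel_measurable_cnj_vec:
  "G \<in> borel_measurable M \<Longrightarrow> (\<lambda>x. cnj_vec (G x :: complex^'n)) \<in> borel_measurable M"
proof (rule measurable_compose[of G M borel])
  show "(cnj_vec :: complex^'n \<Rightarrow> complex^'n) \<in> borel_measurable borel"
    unfolding cnj_vec_def by (intro borel_measurable_continuous_onI continuous_intros)
qed

lemma L2_cnj_vec: "G \<in> L2 M \<Longrightarrow> (\<lambda>x. cnj_vec (G x :: complex^'n)) \<in> L2 M"
  by (rule L2_bound[of G _ _ 1]) (auto intro: borel_measurable_cnj_vec L2_measurable)

text \<open>Relational form of the weak gradient: an explicit \<open>G\<close> can be computed with,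
  whereas \<open>weak_grad\<close> is an arbitrary choice among the admissible fields.\<close>

definition wg :: "(real^'n) set \<Rightarrow> (real^'n \<Rightarrow> complex) \<Rightarrow> (real^'n \<Rightarrow> complex^'n) \<Rightarrow> bool" where
  "wg \<Omega> v G \<longleftrightarrow> v \<in> L2 (lebesgue_on \<Omega>) \<and> G \<in> L2 (lebesgue_on \<Omega>) \<and> has_weak_gradient \<Omega> v G"

lemma wg_D:
  assumes "wg \<Omega> v G"
  shows "v \<in> L2 (lebesgue_on \<Omega>)" "G \<in> L2 (lebesgue_on \<Omega>)" "v \<in> H1 \<Omega>"
    "\<And>\<phi> i. test_fun \<Omega> \<phi> \<Longrightarrow> (LINT x|lebesgue_on \<Omega>. v x * cgrad \<phi> x $ i) = - (LINT x|lebesgue_on \<Omega>. G x $ i * \<phi> x)"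
  using assms by (auto simp: wg_def H1_def has_weak_gradient_def partial_deriv_cgrad)

lemma wg_weak_grad: "v \<in> H1 \<Omega> \<Longrightarrow> wg \<Omega> v (weak_grad \<Omega> v)"
  unfolding wg_def weak_grad_def H1_def
  using someI_ex[of "\<lambda>G. G \<in> L2 (lebesgue_on \<Omega>) \<and> has_weak_gradient \<Omega> v G"] by auto

lemma test_fun_D:
  assumes "test_fun \<Omega> \<phi>"
  shows "C1_fun \<phi>" "continuous_on UNIV \<phi>" "continuous_on UNIV (\<lambda>x. cgrad \<phi> x $ i)"
  using assms C1_fun_continuous C1_fun_has_derivative(2) by (auto simp: test_fun_def intro: continuous_on_component)

lemma test_fun_mult:
  assumes "C1_fun b" "test_fun \<Omega> \<phi>"
  shows "test_fun \<Omega> (\<lambda>x. b x * \<phi> x)"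
proof -
  obtain K where "compact K" "K \<subseteq> \<Omega>" "\<And>x. x \<notin> K \<Longrightarrow> \<phi> x = 0" using assms(2) by (auto simp: test_fun_def)
  then show ?thesis using C1_fun_mult[OF assms(1) test_fun_D(1)[OF assms(2)]]
    unfolding test_fun_def by (intro conjI exI[of _ K]) auto
qed

lemma test_fun_cnj:
  assumes "test_fun \<Omega> \<phi>" shows "test_fun \<Omega> (\<lambda>x. cnj (\<phi> x))"
proof -
  obtain K where "compact K" "K \<subseteq> \<Omega>" "\<And>x. x \<notin> K \<Longrightarrow> \<phi> x = 0" using assms by (auto simp: test_fun_def)
  then show ?thesis using C1_fun_cnj[OF test_fun_D(1)[OF assms]]
    unfolding test_fun_def by (intro conjI exI[of _ K]) auto
qed

section \<open>Calculus of weak gradients on a bounded open set\<close>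

locale bounded_open =
  fixes \<Omega> :: "(real^'n) set"
  assumes open_\<Omega>: "open \<Omega>" and bounded_\<Omega>: "bounded \<Omega>"
begin

abbreviation "M\<Omega> \<equiv> lebesgue_on \<Omega>"

lemma finite_M\<Omega>: "finite_measure M\<Omega>"
  using lmeasurable_open[OF bounded_\<Omega> open_\<Omega>] finite_measure_lebesgue_on by blast

lemma L2_continuous:
  fixes \<phi> :: "real^'n \<Rightarrow> 'b::{banach, second_countable_topology}"
  assumes "continuous_on UNIV \<phi>"
  shows "\<phi> \<in> L2 M\<Omega>"
proof -
  interpret finite_measure M\<Omega> by (rule finite_M\<Omega>)
  have "bounded (\<phi> ` closure \<Omega>)"
    using bounded_\<Omega> by (intro compact_imp_bounded compact_continuous_image continuous_on_subset[OF assms]) auto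
  then obtain B where B: "\<And>x. x \<in> closure \<Omega> \<Longrightarrow> norm (\<phi> x) \<le> B" unfolding bounded_iff by blast
  have c: "(\<lambda>x. 1::real) \<in> L2 M\<Omega>" by (rule L2_I) auto
  show ?thesis
  proof (rule L2_bound[OF c borel_measurable_lebesgue_onI[OF borel_measurable_continuous_onI[OF assms]], of B])
    show "AE x in M\<Omega>. norm (\<phi> x) \<le> B * norm (1::real)"
      using B closure_subset by (intro AE_I2) auto
  qed
qed

lemma L2_mult_continuous:
  fixes b f :: "real^'n \<Rightarrow> complex"
  assumes b: "continuous_on UNIV b" and f: "f \<in> L2 M\<Omega>"
  shows "(\<lambda>x. b x * f x) \<in> L2 M\<Omega>"
proof -
  have "bounded (b ` closure \<Omega>)"
    using bounded_\<Omega> by (intro compact_imp_bounded compact_continuous_image continuous_on_subset[OF b]) auto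
  then obtain B where B: "\<And>x. x \<in> closure \<Omega> \<Longrightarrow> norm (b x) \<le> B" unfolding bounded_iff by blast
  note [measurable] = L2_measurable[OF f] borel_measurable_lebesgue_onI[OF borel_measurable_continuous_onI[OF b]]
  show ?thesis
  proof (rule L2_bound[OF f, of _ B])
    show "AE x in M\<Omega>. norm (b x * f x) \<le> B * norm (f x)"
      using B closure_subset by (intro AE_I2) (auto simp: norm_mult intro!: mult_right_mono)
  qed measurable
qed

lemma wg_integrable:
  assumes "wg \<Omega> v G" "test_fun \<Omega> \<phi>"
  shows "integrable M\<Omega> (\<lambda>x. v x * cgrad \<phi> x $ i)" "integrable M\<Omega> (\<lambda>x. G x $ i * \<phi> x)"
  by (intro L2_mult_integrable wg_D(1)[OF assms(1)] L2_component wg_D(2)[OF assms(1)] L2_continuous test_fun_D[OF assms(2)])+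

lemma wgI:
  assumes "v \<in> L2 M\<Omega>" "G \<in> L2 M\<Omega>"
    "\<And>\<phi> i. test_fun \<Omega> \<phi> \<Longrightarrow> (LINT x|M\<Omega>. v x * cgrad \<phi> x $ i) = - (LINT x|M\<Omega>. G x $ i * \<phi> x)"
  shows "wg \<Omega> v G"
  using assms by (auto simp: wg_def has_weak_gradient_def partial_deriv_cgrad)

lemma wg_add:
  assumes 1: "wg \<Omega> v G" and 2: "wg \<Omega> w H"
  shows "wg \<Omega> (\<lambda>x. v x + w x) (\<lambda>x. G x + H x)"
proof (rule wgI)
  fix \<phi> i assume t: "test_fun \<Omega> \<phi>"
  show "(LINT x|M\<Omega>. (v x + w x) * cgrad \<phi> x $ i) = - (LINT x|M\<Omega>. (G x + H x) $ i * \<phi> x)"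
    using wg_integrable[OF 1 t, of i] wg_integrable[OF 2 t, of i] wg_D(4)[OF 1 t, of i] wg_D(4)[OF 2 t, of i]
    by (simp add: distrib_right)
qed (intro L2_add wg_D(1,2)[OF 1] wg_D(1,2)[OF 2])+

lemma wg_cmult:
  assumes 1: "wg \<Omega> v G"
  shows "wg \<Omega> (\<lambda>x. c * v x) (\<lambda>x. c *s G x)"
proof (rule wgI)
  fix \<phi> i assume t: "test_fun \<Omega> \<phi>"
  show "(LINT x|M\<Omega>. c * v x * cgrad \<phi> x $ i) = - (LINT x|M\<Omega>. (c *s G x) $ i * \<phi> x)"
    using wg_D(4)[OF 1 t, of i] by (simp add: mult.assoc)
qed (intro L2_cmult L2_smult_vec wg_D(1,2)[OF 1])+

lemma wg_diff:
  assumes 1: "wg \<Omega> v G" and 2: "wg \<Omega> w H"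
  shows "wg \<Omega> (\<lambda>x. v x - w x) (\<lambda>x. G x - H x)"
  using wg_add[OF 1 wg_cmult[OF 2, of "-1"]] by (simp add: vec.scale_minus_left)

lemma wg_cnj:
  assumes 1: "wg \<Omega> v G"
  shows "wg \<Omega> (\<lambda>x. cnj (v x)) (\<lambda>x. cnj_vec (G x))"
proof (rule wgI)
  fix \<phi> i assume t: "test_fun \<Omega> \<phi>"
  have "(LINT x|M\<Omega>. v x * cnj (cgrad \<phi> x $ i)) = - (LINT x|M\<Omega>. G x $ i * cnj (\<phi> x))"
    using wg_D(4)[OF 1 test_fun_cnj[OF t], of i] cgrad_cnj[OF test_fun_D(1)[OF t]] by (simp add: cnj_vec_def)
  moreover have "(LINT x|M\<Omega>. cnj (v x) * cgrad \<phi> x $ i) = cnj (LINT x|M\<Omega>. v x * cnj (cgrad \<phi> x $ i))"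
    using Bochner_Integration.integral_cnj[of M\<Omega> "\<lambda>x. v x * cnj (cgrad \<phi> x $ i)"] by simp
  moreover have "(LINT x|M\<Omega>. cnj_vec (G x) $ i * \<phi> x) = cnj (LINT x|M\<Omega>. G x $ i * cnj (\<phi> x))"
    using Bochner_Integration.integral_cnj[of M\<Omega> "\<lambda>x. G x $ i * cnj (\<phi> x)"] by (simp add: cnj_vec_def)
  ultimately
  show "(LINT x|M\<Omega>. cnj (v x) * cgrad \<phi> x $ i) = - (LINT x|M\<Omega>. cnj_vec (G x) $ i * \<phi> x)"
    by simp
qed (intro L2_cnj L2_cnj_vec wg_D(1,2)[OF 1])+

text \<open>Each component of the difference is orthogonal to all test functions. This is what makes
  \<open>weak_grad\<close> and \<open>H1_norm\<close> computable from any admissible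
  gradient.\<close>

lemma wg_unique:
  assumes 1: "wg \<Omega> v G" and 2: "wg \<Omega> v H"
  shows "AE x in M\<Omega>. G x = H x"
proof -
  have "AE x in M\<Omega>. G x $ i - H x $ i = 0" for i
  proof (rule weakly_zero_imp_AE_zero[OF open_\<Omega> bounded_\<Omega>])
    show "(\<lambda>x. G x $ i - H x $ i) \<in> L2 M\<Omega>"
      by (intro L2_diff L2_component wg_D(2)[OF 1] wg_D(2)[OF 2])
    fix \<phi> assume t: "test_fun \<Omega> \<phi>"
    show "(LINT x|M\<Omega>. (G x $ i - H x $ i) * \<phi> x) = 0"
      using wg_integrable(2)[OF 1 t, of i] wg_integrable(2)[OF 2 t, of i] wg_D(4)[OF 1 t, of i] wg_D(4)[OF 2 t, of i]
      by (simp add: left_diff_distrib)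
  qed
  then have "AE x in M\<Omega>. \<forall>i\<in>UNIV. G x $ i - H x $ i = 0"
    by (intro AE_finite_allI) auto
  then show ?thesis by eventually_elim (simp add: vec_eq_iff)
qed

lemma weak_grad_AE: "wg \<Omega> v G \<Longrightarrow> AE x in M\<Omega>. weak_grad \<Omega> v x = G x"
  using wg_unique wg_weak_grad wg_D(3) by blast

lemma H1_norm_wg:
  assumes "wg \<Omega> v G"
  shows "H1_norm \<Omega> v = sqrt ((l2 M\<Omega> v)\<^sup>2 + (l2 M\<Omega> G)\<^sup>2)"
proof -
  have "l2 M\<Omega> (weak_grad \<Omega> v) = l2 M\<Omega> G"
    by (rule l2_cong_AE[OF _ _ weak_grad_AE[OF assms]])
       (intro L2_measurable wg_D(2)[OF assms] wg_D(2)[OF wg_weak_grad[OF wg_D(3)[OF assms]]])+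
  then show ?thesis unfolding H1_norm_def l2_sq[symmetric] by simp
qed

lemma H1_norm_nonneg [simp]: "H1_norm \<Omega> v \<ge> 0"
  by (simp add: H1_norm_def)

lemma
  assumes "v \<in> H1 \<Omega>" "w \<in> H1 \<Omega>"
  shows H1_add: "(\<lambda>x. v x + w x) \<in> H1 \<Omega>" and H1_diff: "(\<lambda>x. v x - w x) \<in> H1 \<Omega>"
  using wg_add[OF wg_weak_grad[OF assms(1)] wg_weak_grad[OF assms(2)]]
    wg_diff[OF wg_weak_grad[OF assms(1)] wg_weak_grad[OF assms(2)]] by (auto dest: wg_D(3))

lemma H1_cmult: "v \<in> H1 \<Omega> \<Longrightarrow> (\<lambda>x. c * v x) \<in> H1 \<Omega>"
  using wg_cmult[OF wg_weak_grad] wg_D(3) by blast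

lemma H1_cnj: "v \<in> H1 \<Omega> \<Longrightarrow> (\<lambda>x. cnj (v x)) \<in> H1 \<Omega>"
  using wg_cnj[OF wg_weak_grad] wg_D(3) by blast

lemma H1_norm_triangle:
  assumes v: "v \<in> H1 \<Omega>" and w: "w \<in> H1 \<Omega>"
  shows "H1_norm \<Omega> (\<lambda>x. v x + w x) \<le> H1_norm \<Omega> v + H1_norm \<Omega> w"
proof -
  note gv = wg_weak_grad[OF v] and gw = wg_weak_grad[OF w]
  have "H1_norm \<Omega> (\<lambda>x. v x + w x) \<le> sqrt ((l2 M\<Omega> v + l2 M\<Omega> w)\<^sup>2 + (l2 M\<Omega> (weak_grad \<Omega> v) + l2 M\<Omega> (weak_grad \<Omega> w))\<^sup>2)"
    unfolding H1_norm_wg[OF wg_add[OF gv gw]]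
    by (intro real_sqrt_le_mono add_mono power_mono l2_triangle wg_D(1,2)[OF gv] wg_D(1,2)[OF gw]) auto
  also have "\<dots> \<le> H1_norm \<Omega> v + H1_norm \<Omega> w"
    unfolding H1_norm_wg[OF gv] H1_norm_wg[OF gw] by (rule real_sqrt_sum_squares_triangle_ineq)
  finally show ?thesis .
qed

lemma l2_cmult: "l2 M (\<lambda>x. c * f x) = cmod c * l2 M f"
  by (simp add: l2_def norm_mult power_mult_distrib real_sqrt_mult)

lemma l2_smult: "l2 M (\<lambda>x. c *s (f x :: complex^'m)) = cmod c * l2 M f"
  by (simp add: l2_def norm_smult_vec power_mult_distrib real_sqrt_mult)

lemma H1_norm_cmult:
  assumes v: "v \<in> H1 \<Omega>"
  shows "H1_norm \<Omega> (\<lambda>x. c * v x) = cmod c * H1_norm \<Omega> v"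
  unfolding H1_norm_wg[OF wg_cmult[OF wg_weak_grad[OF v]]] H1_norm_wg[OF wg_weak_grad[OF v]] l2_cmult l2_smult
  by (simp add: power_mult_distrib real_sqrt_mult flip: distrib_left)

lemma H1_norm_minus_commute:
  assumes "v \<in> H1 \<Omega>" "w \<in> H1 \<Omega>"
  shows "H1_norm \<Omega> (\<lambda>x. v x - w x) = H1_norm \<Omega> (\<lambda>x. w x - v x)"
  using H1_norm_cmult[OF H1_diff[OF assms], of "-1"] by simp

text \<open>Integration by parts: the product with a test function has compact support in \<Omega>,
  so the integral of its gradient vanishes and no boundary term appears.\<close>

lemma wg_C1:
  assumes \<phi>: "C1_fun \<phi>"
  shows "wg \<Omega> \<phi> (cgrad \<phi>)"
proof (rule wgI)
  show "\<phi> \<in> L2 M\<Omega>" "cgrad \<phi> \<in> L2 M\<Omega>"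
    using \<phi> by (auto intro: L2_continuous C1_fun_continuous C1_fun_has_derivative(2))
  fix \<psi> i assume t: "test_fun \<Omega> \<psi>"
  obtain K where K: "compact K" "K \<subseteq> \<Omega>" "\<And>x. x \<notin> K \<Longrightarrow> \<psi> x = 0" using t by (auto simp: test_fun_def)
  let ?F = "\<lambda>x. \<phi> x * \<psi> x"
  have F: "C1_fun ?F" by (rule C1_fun_mult[OF \<phi> test_fun_D(1)[OF t]])
  have gF: "cgrad ?F x $ i = \<phi> x * cgrad \<psi> x $ i + cgrad \<phi> x $ i * \<psi> x" for x
    using cgrad_mult[OF \<phi> test_fun_D(1)[OF t]] by simp
  have z: "cgrad \<phi>' x = 0" if "x \<notin> \<Omega>" "C1_fun \<phi>'" "\<And>x. x \<notin> K \<Longrightarrow> \<phi>' x = 0" for x \<phi>'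
  proof -
    have "open (- K)" using K compact_imp_closed by blast
    then have "(\<phi>' has_derivative (\<lambda>h. 0)) (at x)"
      using has_derivative_transform_within_open[OF has_derivative_const[of 0], of "- K" x \<phi>'] that K(2) by auto
    then have "frechet_derivative \<phi>' (at x) = (\<lambda>h. 0)"
      using frechet_derivative_at by metis
    then show ?thesis by (simp add: cgrad_def partial_deriv_def vec_eq_iff)
  qed
  have zF: "cgrad ?F x = 0" if "x \<notin> \<Omega>" for x
    by (rule z[OF that F]) (simp add: K(3))
  have "(LINT x|M\<Omega>. cgrad ?F x $ i) = (LINT x|lborel. cgrad ?F x $ i)"
    by (rule LINT_lebesgue_on_vanish(1)[OF open_\<Omega> borel_measurable_continuous_onI[OF continuous_on_component[OF C1_fun_has_derivative(2)[OF F]]]])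
       (simp add: zF)
  also have "\<dots> = 0"
    by (rule integral_cgrad_compact_support[OF F K(1)]) (simp add: K(3))
  finally have "(LINT x|M\<Omega>. \<phi> x * cgrad \<psi> x $ i + cgrad \<phi> x $ i * \<psi> x) = 0"
    unfolding gF .
  moreover have "integrable M\<Omega> (\<lambda>x. \<phi> x * cgrad \<psi> x $ i)" "integrable M\<Omega> (\<lambda>x. cgrad \<phi> x $ i * \<psi> x)"
    by (intro L2_mult_integrable L2_continuous C1_fun_continuous[OF \<phi>] test_fun_D[OF t] continuous_on_component[OF C1_fun_has_derivative(2)[OF \<phi>]])+
  ultimately show "(LINT x|M\<Omega>. \<phi> x * cgrad \<psi> x $ i) = - (LINT x|M\<Omega>. cgrad \<phi> x $ i * \<psi> x)"
    by (simp add: eq_neg_iff_add_eq_0)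
qed

text \<open>The product b \<phi> is again a test function, and testing the weak gradient of
  \<open>v\<close> with it produces both terms of the product rule.\<close>

lemma wg_mult_C1:
  assumes b: "C1_fun b" and v: "wg \<Omega> v G"
  shows "wg \<Omega> (\<lambda>x. b x * v x) (\<lambda>x. b x *s G x + v x *s cgrad b x)"
proof (rule wgI)
  note bc = C1_fun_continuous[OF b] and bg = continuous_on_component[OF C1_fun_has_derivative(2)[OF b]]
  note vL = wg_D(1)[OF v] and GL = L2_component[OF wg_D(2)[OF v]]
  show "(\<lambda>x. b x * v x) \<in> L2 M\<Omega>" by (rule L2_mult_continuous[OF bc vL])
  have cL: "(\<lambda>x. (b x *s G x + v x *s cgrad b x) $ i) \<in> L2 M\<Omega>" for i
    using L2_add[OF L2_mult_continuous[OF bc GL[of i]] L2_mult_continuous[OF bg[of i] vL]]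
    by (simp add: mult.commute)
  show "(\<lambda>x. b x *s G x + v x *s cgrad b x) \<in> L2 M\<Omega>"
  proof (rule L2_I)
    show "(\<lambda>x. b x *s G x + v x *s cgrad b x) \<in> borel_measurable M\<Omega>"
    \<comment> \<open>Measurability is checked against the real basis of the complex vector space;
      each basis element selects the real or imaginary part of one component.\<close>
    proof (rule borel_measurable_euclidean_space[THEN iffD2], rule ballI)
      fix e :: "complex^'n" assume "e \<in> Basis"
      then obtain i c where e: "e = axis i c" "c \<in> Basis" by (auto simp: Basis_vec_def)
      show "(\<lambda>x. (b x *s G x + v x *s cgrad b x) \<bullet> e) \<in> borel_measurable M\<Omega>"
        unfolding e inner_axis using L2_measurable[OF cL[of i]] by measurable
    qed
    show "integrable M\<Omega> (\<lambda>x. (norm (b x *s G x + v x *s cgrad b x))\<^sup>2)"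
      unfolding norm_vec_sq by (intro Bochner_Integration.integrable_sum L2_integrable cL)
  qed
  fix \<phi> i assume t: "test_fun \<Omega> \<phi>"
  note t' = test_fun_mult[OF b t]
  have "(LINT x|M\<Omega>. v x * cgrad (\<lambda>x. b x * \<phi> x) x $ i) = - (LINT x|M\<Omega>. G x $ i * (b x * \<phi> x))"
    by (rule wg_D(4)[OF v t'])
  moreover have "v x * cgrad (\<lambda>x. b x * \<phi> x) x $ i = b x * v x * cgrad \<phi> x $ i + (v x * cgrad b x $ i) * \<phi> x" for x
    using cgrad_mult[OF b test_fun_D(1)[OF t]] by (simp add: algebra_simps)
  moreover have i1: "integrable M\<Omega> (\<lambda>x. b x * v x * cgrad \<phi> x $ i)"
    by (intro L2_mult_integrable L2_mult_continuous[OF bc vL] L2_continuous test_fun_D[OF t])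
  moreover have i2: "integrable M\<Omega> (\<lambda>x. (v x * cgrad b x $ i) * \<phi> x)"
    using L2_mult_integrable[OF L2_mult_continuous[OF bg[of i] vL] L2_continuous[OF test_fun_D(2)[OF t]]] by (simp add: mult.commute)
  moreover have i3: "integrable M\<Omega> (\<lambda>x. (b x * G x $ i) * \<phi> x)"
    by (intro L2_mult_integrable L2_mult_continuous[OF bc GL] L2_continuous test_fun_D[OF t])
  moreover have "(b x *s G x + v x *s cgrad b x) $ i * \<phi> x = (b x * G x $ i) * \<phi> x + (v x * cgrad b x $ i) * \<phi> x" for x
    by (simp add: algebra_simps)
  moreover have "G x $ i * (b x * \<phi> x) = (b x * G x $ i) * \<phi> x" for x by (simp add: mult_ac)
  ultimately show "(LINT x|M\<Omega>. b x * v x * cgrad \<phi> x $ i) = - (LINT x|M\<Omega>. (b x *s G x + v x *s cgrad b x) $ i * \<phi> x)"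
    by (simp add: algebra_simps)
qed

lemma L2_mult_tendsto:
  fixes f :: "nat \<Rightarrow> 'a \<Rightarrow> complex"
  assumes f: "\<And>n. f n \<in> L2 M" "g \<in> L2 M" "\<phi> \<in> L2 M" and lim: "(\<lambda>n. l2 M (\<lambda>x. f n x - g x)) \<longlonglongrightarrow> 0"
  shows "(\<lambda>n. LINT x|M. f n x * \<phi> x) \<longlonglongrightarrow> (LINT x|M. g x * \<phi> x)"
proof (rule LIM_zero_cancel, rule Lim_null_comparison)
  show "\<forall>\<^sub>F n in sequentially. norm ((LINT x|M. f n x * \<phi> x) - (LINT x|M. g x * \<phi> x)) \<le> l2 M (\<lambda>x. f n x - g x) * l2 M \<phi>"
  proof (rule always_eventually, rule allI)
    fix n
    have "(LINT x|M. f n x * \<phi> x) - (LINT x|M. g x * \<phi> x) = (LINT x|M. (f n x - g x) * \<phi> x)"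
      using L2_mult_integrable[OF f(1,3)] L2_mult_integrable[OF f(2,3)] by (simp add: left_diff_distrib)
    then show "norm ((LINT x|M. f n x * \<phi> x) - (LINT x|M. g x * \<phi> x)) \<le> l2 M (\<lambda>x. f n x - g x) * l2 M \<phi>"
      using L2_mult_integral_le[OF L2_diff[OF f(1,2)] f(3)] by metis
  qed
  show "(\<lambda>n. l2 M (\<lambda>x. f n x - g x) * l2 M \<phi>) \<longlonglongrightarrow> 0"
    by (rule tendsto_mult_left_zero[OF lim])
qed

text \<open>For a fixed test function both sides of the defining identity are continuous in the
  mean.\<close>

lemma wg_closed:
  assumes "\<And>n. wg \<Omega> (v n) (G n)" and vL: "w \<in> L2 M\<Omega>" and GL: "H \<in> L2 M\<Omega>"
    and v: "(\<lambda>n. l2 M\<Omega> (\<lambda>x. v n x - w x)) \<longlonglongrightarrow> 0" and G: "(\<lambda>n. l2 M\<Omega> (\<lambda>x. G n x - H x)) \<longlonglongrightarrow> 0"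
  shows "wg \<Omega> w H"
proof (rule wgI[OF vL GL])
  fix \<phi> i assume t: "test_fun \<Omega> \<phi>"
  have 1: "(\<lambda>n. LINT x|M\<Omega>. v n x * cgrad \<phi> x $ i) \<longlonglongrightarrow> (LINT x|M\<Omega>. w x * cgrad \<phi> x $ i)"
    by (rule L2_mult_tendsto[OF wg_D(1)[OF assms(1)] vL L2_continuous[OF test_fun_D(3)[OF t]] v])
  have "(\<lambda>n. l2 M\<Omega> (\<lambda>x. G n x $ i - H x $ i)) \<longlonglongrightarrow> 0"
  proof (rule Lim_null_comparison[OF _ G], rule always_eventually, rule allI)
    fix n
    show "norm (l2 M\<Omega> (\<lambda>x. G n x $ i - H x $ i)) \<le> l2 M\<Omega> (\<lambda>x. G n x - H x)"
      using l2_component_le[OF L2_diff[OF wg_D(2)[OF assms(1)] GL], of n i] by simp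
  qed
  from L2_mult_tendsto[OF L2_component[OF wg_D(2)[OF assms(1)]] L2_component[OF GL] L2_continuous[OF test_fun_D(2)[OF t]] this]
  have 2: "(\<lambda>n. LINT x|M\<Omega>. G n x $ i * \<phi> x) \<longlonglongrightarrow> (LINT x|M\<Omega>. H x $ i * \<phi> x)" .
  have "(\<lambda>n. LINT x|M\<Omega>. v n x * cgrad \<phi> x $ i) \<longlonglongrightarrow> - (LINT x|M\<Omega>. H x $ i * \<phi> x)"
    unfolding wg_D(4)[OF assms(1) t] by (rule tendsto_minus[OF 2])
  then show "(LINT x|M\<Omega>. w x * cgrad \<phi> x $ i) = - (LINT x|M\<Omega>. H x $ i * \<phi> x)"
    using 1 LIMSEQ_unique by blast
qed

text \<open>Functions and gradients converge separately in \<open>L2\<close>, and closedness of the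
  weak gradient identifies the second limit as the gradient of the first.\<close>

lemma H1_complete:
  assumes v: "\<And>n. v n \<in> H1 \<Omega>"
    and Cauchy: "\<And>e. e > 0 \<Longrightarrow> \<exists>N. \<forall>m\<ge>N. \<forall>n\<ge>N. H1_norm \<Omega> (\<lambda>x. v m x - v n x) < e"
  shows "\<exists>w\<in>H1 \<Omega>. (\<lambda>n. H1_norm \<Omega> (\<lambda>x. v n x - w x)) \<longlonglongrightarrow> 0"
proof -
  let ?G = "\<lambda>n. weak_grad \<Omega> (v n)"
  note wgv = wg_weak_grad[OF v]
  have n: "H1_norm \<Omega> (\<lambda>x. v m x - v n x) = sqrt ((l2 M\<Omega> (\<lambda>x. v m x - v n x))\<^sup>2 + (l2 M\<Omega> (\<lambda>x. ?G m x - ?G n x))\<^sup>2)" for m n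
    by (rule H1_norm_wg[OF wg_diff[OF wgv wgv]])
  have le: "l2 M\<Omega> (\<lambda>x. v m x - v n x) \<le> H1_norm \<Omega> (\<lambda>x. v m x - v n x)" "l2 M\<Omega> (\<lambda>x. ?G m x - ?G n x) \<le> H1_norm \<Omega> (\<lambda>x. v m x - v n x)" for m n
    unfolding n by (auto intro: real_le_rsqrt)
  obtain w where w: "w \<in> L2 M\<Omega>" "(\<lambda>n. l2 M\<Omega> (\<lambda>x. v n x - w x)) \<longlonglongrightarrow> 0"
    using L2_complete[of v M\<Omega>] wg_D(1)[OF wgv] Cauchy le(1) by (meson le_less_trans)
  obtain H where H: "H \<in> L2 M\<Omega>" "(\<lambda>n. l2 M\<Omega> (\<lambda>x. ?G n x - H x)) \<longlonglongrightarrow> 0"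
    using L2_complete[of ?G M\<Omega>] wg_D(2)[OF wgv] Cauchy le(2) by (meson le_less_trans)
  have wg: "wg \<Omega> w H" by (rule wg_closed[OF wgv w(1) H(1) w(2) H(2)])
  have "(\<lambda>n. sqrt ((l2 M\<Omega> (\<lambda>x. v n x - w x))\<^sup>2 + (l2 M\<Omega> (\<lambda>x. ?G n x - H x))\<^sup>2)) \<longlonglongrightarrow> sqrt (0\<^sup>2 + 0\<^sup>2)"
    by (intro tendsto_intros w(2) H(2))
  then show ?thesis
    using wg_D(3)[OF wg] unfolding H1_norm_wg[OF wg_diff[OF wgv wg], symmetric] by auto
qed

end

section \<open>Density of continuously differentiable functions\<close>

context bounded_open
begin

text \<open>The approximants are C1 on the whole space, so that they have values on the
  boundary.\<close>

definition approximable :: "(real^'n \<Rightarrow> complex) \<Rightarrow> bool" where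
  "approximable v \<longleftrightarrow> (\<forall>e>0. \<exists>\<phi>. C1_fun \<phi> \<and> H1_norm \<Omega> (\<lambda>x. \<phi> x - v x) < e)"

lemma approximable_add:
  assumes v: "v \<in> H1 \<Omega>" "approximable v" and w: "w \<in> H1 \<Omega>" "approximable w"
  shows "approximable (\<lambda>x. v x + w x)"
  unfolding approximable_def
proof (intro allI impI)
  fix e :: real assume e: "e > 0"
  obtain \<phi> where \<phi>: "C1_fun \<phi>" "H1_norm \<Omega> (\<lambda>x. \<phi> x - v x) < e/2"
    using v(2) e unfolding approximable_def by (meson half_gt_zero)
  obtain \<psi> where \<psi>: "C1_fun \<psi>" "H1_norm \<Omega> (\<lambda>x. \<psi> x - w x) < e/2"
    using w(2) e unfolding approximable_def by (meson half_gt_zero)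
  have "H1_norm \<Omega> (\<lambda>x. (\<phi> x - v x) + (\<psi> x - w x)) \<le> H1_norm \<Omega> (\<lambda>x. \<phi> x - v x) + H1_norm \<Omega> (\<lambda>x. \<psi> x - w x)"
    by (intro H1_norm_triangle H1_diff v w wg_D(3)[OF wg_C1[OF \<phi>(1)]] wg_D(3)[OF wg_C1[OF \<psi>(1)]])
  moreover have "(\<lambda>x. (\<phi> x - v x) + (\<psi> x - w x)) = (\<lambda>x. (\<phi> x + \<psi> x) - (v x + w x))" by auto
  ultimately show "\<exists>\<phi>. C1_fun \<phi> \<and> H1_norm \<Omega> (\<lambda>x. \<phi> x - (v x + w x)) < e"
    using \<phi>(2) \<psi>(2) by (intro exI[of _ "\<lambda>x. \<phi> x + \<psi> x"] conjI C1_fun_add \<phi>(1) \<psi>(1)) simp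
qed

lemma ext_exists_ball:
  assumes f: "f \<in> borel_measurable M\<Omega>" and z: "\<And>x. x \<in> \<Omega> \<Longrightarrow> x \<notin> B \<Longrightarrow> f x = 0" and B: "open B"
  obtains f' where "ext \<Omega> f f'" "\<And>x. x \<notin> B \<Longrightarrow> f' x = 0"
proof -
  obtain g where g: "ext \<Omega> f g" using ext_exists[OF f open_\<Omega>] by blast
  have [measurable]: "g \<in> borel_measurable borel" "B \<in> sets borel" using g B by (auto simp: ext_def)
  have "ext \<Omega> f (\<lambda>x. indicator B x * g x)"
    unfolding ext_def
  proof (intro conjI)
    show "AE x in M\<Omega>. f x = indicator B x * g x"
    proof -
      have "AE x in M\<Omega>. f x = g x" using g by (simp add: ext_def)
      moreover have "AE x in M\<Omega>. x \<in> \<Omega>" by (rule AE_I2) simp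
      ultimately show ?thesis by eventually_elim (use z in \<open>auto simp: indicator_def\<close>)
    qed
  qed (use g in \<open>auto simp: ext_def\<close>)
  then show thesis by (rule that) simp
qed

text \<open>\<open>\<phi>\<close> and \<open>\<psi>\<close> have to agree only inside \<Omega>: in
  the use for gradients, \<open>\<phi>\<close> is a derivative of the mollified function and
  \<open>\<psi>\<close> a mollified derivative, and these may differ outside.\<close>

lemma l2_le_ext:
  assumes w: "w \<in> L2 M\<Omega>" and w': "ext \<Omega> w w'" and \<phi>: "continuous_on UNIV \<phi>"
    and \<psi>: "\<psi> \<in> borel_measurable borel" "\<And>x. x \<in> \<Omega> \<Longrightarrow> \<phi> x = \<psi> x"
    and le: "(\<integral>\<^sup>+x. ennreal ((norm (\<psi> x - w' x))\<^sup>2) \<partial>lborel) \<le> ennreal (e\<^sup>2)" and e: "e \<ge> 0"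
  shows "l2 M\<Omega> (\<lambda>x. \<phi> x - w x) \<le> e"
proof -
  note [measurable] = L2_measurable[OF w] borel_measurable_lebesgue_onI[OF borel_measurable_continuous_onI[OF \<phi>]] \<psi>(1)
  have [measurable]: "w' \<in> borel_measurable borel" and ae: "AE x in M\<Omega>. w x = w' x" using w' by (auto simp: ext_def)
  have dL: "(\<lambda>x. \<phi> x - w x) \<in> borel_measurable M\<Omega>" by measurable
  have "(\<integral>\<^sup>+x. ennreal ((norm (\<phi> x - w x))\<^sup>2) \<partial>M\<Omega>) = (\<integral>\<^sup>+x. ennreal ((norm (\<psi> x - w' x))\<^sup>2) \<partial>M\<Omega>)"
  proof (rule nn_integral_cong_AE)
    have "AE x in M\<Omega>. x \<in> \<Omega>" by (rule AE_I2) simp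
    with ae show "AE x in M\<Omega>. ennreal ((norm (\<phi> x - w x))\<^sup>2) = ennreal ((norm (\<psi> x - w' x))\<^sup>2)"
      by eventually_elim (simp add: \<psi>(2))
  qed
  also have "\<dots> = (\<integral>\<^sup>+x. ennreal ((norm (\<psi> x - w' x))\<^sup>2) * indicator \<Omega> x \<partial>lborel)"
    by (rule nn_integral_lebesgue_on[OF open_\<Omega>]) measurable
  also have "\<dots> \<le> (\<integral>\<^sup>+x. ennreal ((norm (\<psi> x - w' x))\<^sup>2) \<partial>lborel)"
    by (intro nn_integral_mono) (auto simp: indicator_def)
  also note le
  finally show ?thesis using L2_nn_I(2)[OF dL] e by fastforce
qed

text \<open>With kernel centre \<open>- \<epsilon> d\<close> the mollification at \<open>x\<close>
  sees the ball of radius \<epsilon> about x + \<epsilon> d. Where \<open>chart\<close> places that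
  ball inside \<Omega>, differentiation commutes with mollification; at distance 2\<rho> or more
  from \<open>x0\<close> both sides vanish, since \<open>w\<close> lives in the ball of radius
  \<rho>.\<close>

lemma approximable_local:
  assumes w: "wg \<Omega> w H" and z: "\<And>x. x \<notin> ball x0 \<rho> \<Longrightarrow> w x = 0" "\<And>x. x \<notin> ball x0 \<rho> \<Longrightarrow> H x = 0"
    and \<rho>: "\<rho> > 0" and \<epsilon>0: "\<epsilon>0 > 0"
    and chart: "\<And>x \<epsilon>. x \<in> \<Omega> \<Longrightarrow> x \<in> ball x0 (2 * \<rho>) \<Longrightarrow> 0 < \<epsilon> \<Longrightarrow> \<epsilon> < \<epsilon>0 \<Longrightarrow> cball (x + \<epsilon> *\<^sub>R d) \<epsilon> \<subseteq> \<Omega>"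
  shows "approximable w"
  unfolding approximable_def
proof (intro allI impI)
  fix e :: real assume e: "e > 0"
  \<comment> \<open>One error term for the function and one for each gradient component, each at
    most \<open>e'\<close>. The root of N e'^2 is at most N e', which is e/2.\<close>
  define N where "N = real CARD('n) + 1"
  have N: "N > 0" by (simp add: N_def)
  define e' where "e' = e / (2 * N)"
  have e': "e' > 0" using e N by (simp add: e'_def)
  note wL = wg_D(1)[OF w] and HL = L2_component[OF wg_D(2)[OF w]]
  obtain w' where w': "ext \<Omega> w w'" "\<And>x. x \<notin> ball x0 \<rho> \<Longrightarrow> w' x = 0"
    using ext_exists_ball[OF L2_measurable[OF wL], of "ball x0 \<rho>"] z by auto
  have "\<forall>i. \<exists>h. ext \<Omega> (\<lambda>x. H x $ i) h \<and> (\<forall>x. x \<notin> ball x0 \<rho> \<longrightarrow> h x = 0)"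
  proof
    fix i
    obtain h where "ext \<Omega> (\<lambda>x. H x $ i) h" "\<And>x. x \<notin> ball x0 \<rho> \<Longrightarrow> h x = 0"
      by (rule ext_exists_ball[OF L2_measurable[OF HL[of i]], of "ball x0 \<rho>"]) (use z in auto)
    then show "\<exists>h. ext \<Omega> (\<lambda>x. H x $ i) h \<and> (\<forall>x. x \<notin> ball x0 \<rho> \<longrightarrow> h x = 0)" by blast
  qed
  then obtain h where h: "\<And>i. ext \<Omega> (\<lambda>x. H x $ i) (h i)" "\<And>i x. x \<notin> ball x0 \<rho> \<Longrightarrow> h i x = 0" by metis
  note w'L = ext_L2[OF w'(1) wL open_\<Omega>]
  note hL = ext_L2[OF h(1) HL open_\<Omega>]
  \<comment> \<open>On a ball of finite measure |f| \<le> |f|^2 + 1 turns square integrability into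
    the integrability that \<open>conv_C1\<close> requires.\<close>
  have int: "integrable lborel f'" if "f' \<in> L2 lborel" "\<And>x. x \<notin> ball x0 \<rho> \<Longrightarrow> f' x = 0" for f' :: "real^'n \<Rightarrow> complex"
  proof -
    have i: "integrable lborel (\<lambda>x. (norm (f' x))\<^sup>2 + indicator (ball x0 \<rho>) x)"
      using L2_integrable[OF that(1)] by (intro Bochner_Integration.integrable_add integrable_real_indicator) (use emeasure_lborel_ball_finite[of x0 \<rho>] in auto)
    show ?thesis
    proof (rule Bochner_Integration.integrable_bound[OF i L2_measurable[OF that(1)]], rule AE_I2)
      fix x
      have "norm (f' x) \<le> (norm (f' x))\<^sup>2 + 1"
        using sum_squares_bound[of "norm (f' x)" 1] norm_ge_zero[of "f' x"] unfolding one_power2 by linarith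
      then show "norm (f' x) \<le> norm ((norm (f' x))\<^sup>2 + indicator (ball x0 \<rho>) x :: real)"
      proof (cases "x \<in> ball x0 \<rho>")
        case True
        then show ?thesis using \<open>norm (f' x) \<le> (norm (f' x))\<^sup>2 + 1\<close> by simp
      next
        case False
        from that(2)[OF this] show ?thesis by simp
      qed
    qed
  qed
  note w'i = int[OF w'L w'(2)]
  obtain \<epsilon>w where \<epsilon>w: "\<epsilon>w > 0" "\<And>\<epsilon>. 0 < \<epsilon> \<Longrightarrow> \<epsilon> < \<epsilon>w \<Longrightarrow> (\<integral>\<^sup>+x. ennreal ((norm (conv (\<epsilon> *\<^sub>R (- d)) \<epsilon> w' x - w' x))\<^sup>2) \<partial>lborel) \<le> ennreal (e'\<^sup>2)"
    using that by (rule conv_tendsto[OF w'L e', of "- d"])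
  have "\<forall>i. \<exists>\<epsilon>h>0. \<forall>\<epsilon>. 0 < \<epsilon> \<longrightarrow> \<epsilon> < \<epsilon>h \<longrightarrow> (\<integral>\<^sup>+x. ennreal ((norm (conv (\<epsilon> *\<^sub>R (- d)) \<epsilon> (h i) x - h i x))\<^sup>2) \<partial>lborel) \<le> ennreal (e'\<^sup>2)"
  proof
    fix i
    obtain \<epsilon>1 where "\<epsilon>1 > 0" and le: "\<And>\<epsilon>. 0 < \<epsilon> \<Longrightarrow> \<epsilon> < \<epsilon>1 \<Longrightarrow> (\<integral>\<^sup>+x. ennreal ((norm (conv (\<epsilon> *\<^sub>R (- d)) \<epsilon> (h i) x - h i x))\<^sup>2) \<partial>lborel) \<le> ennreal (e'\<^sup>2)"
      using that by (rule conv_tendsto[OF hL[of i] e', of "- d"])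
    show "\<exists>\<epsilon>h>0. \<forall>\<epsilon>. 0 < \<epsilon> \<longrightarrow> \<epsilon> < \<epsilon>h \<longrightarrow> (\<integral>\<^sup>+x. ennreal ((norm (conv (\<epsilon> *\<^sub>R (- d)) \<epsilon> (h i) x - h i x))\<^sup>2) \<partial>lborel) \<le> ennreal (e'\<^sup>2)"
      by (rule exI[of _ \<epsilon>1]) (intro conjI allI impI \<open>\<epsilon>1 > 0\<close> le)
  qed
  then obtain \<epsilon>h where \<epsilon>h: "\<And>i. \<epsilon>h i > 0" "\<And>i \<epsilon>. 0 < \<epsilon> \<Longrightarrow> \<epsilon> < \<epsilon>h i \<Longrightarrow> (\<integral>\<^sup>+x. ennreal ((norm (conv (\<epsilon> *\<^sub>R (- d)) \<epsilon> (h i) x - h i x))\<^sup>2) \<partial>lborel) \<le> ennreal (e'\<^sup>2)"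
    by (auto dest!: choice)
  have nd: "norm d + 1 > 0" by (simp add: add_nonneg_pos)
  \<comment> \<open>The finitely many upper bounds for \<epsilon>. The one with \<rho> keeps the
    reach \<epsilon> (|d| + 1) of the kernel below \<rho>.\<close>
  define A where "A = {\<epsilon>0, \<epsilon>w, \<rho> / (norm d + 1)} \<union> range \<epsilon>h"
  have A: "finite A" "A \<noteq> {}" by (auto simp: A_def)
  have Apos: "y > 0" if "y \<in> A" for y
    using that \<epsilon>0 \<epsilon>w(1) \<epsilon>h(1) divide_pos_pos[OF \<rho> nd] unfolding A_def by blast
  define \<epsilon> where "\<epsilon> = Min A / 2"
  have \<epsilon>: "\<epsilon> > 0" using Apos[OF Min_in[OF A]] by (simp add: \<epsilon>_def)
  have Mle: "\<epsilon> < y" if "y \<in> A" for y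
    using Min_le[OF A(1) that] Apos[OF Min_in[OF A]] by (simp add: \<epsilon>_def)
  have \<epsilon>le: "\<epsilon> < \<epsilon>0" "\<epsilon> < \<epsilon>w" "\<epsilon> < \<rho> / (norm d + 1)" "\<epsilon> < \<epsilon>h i" for i
    by (auto intro!: Mle simp: A_def)
  define a where "a = \<epsilon> *\<^sub>R (- d)"
  define \<phi> where "\<phi> = conv a \<epsilon> w'"
  have \<phi>: "C1_fun \<phi>" "cgrad \<phi> = conv_grad a \<epsilon> w'"
    unfolding \<phi>_def using conv_C1[OF \<epsilon> w'i] by auto
  have grad: "cgrad \<phi> x $ i = conv a \<epsilon> (h i) x" if x: "x \<in> \<Omega>" for x i
  proof (cases "x \<in> ball x0 (2 * \<rho>)")
    case True
    have "cball (x - a) \<epsilon> \<subseteq> \<Omega>" using chart[OF x True \<epsilon> \<epsilon>le(1)] by (simp add: a_def)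
    then have t: "test_fun \<Omega> (\<lambda>z. complex_of_real (ker a \<epsilon> (x - z)))" by (rule ker_reflect_test[OF \<epsilon>])
    have m: "(\<lambda>z. complex_of_real (ker a \<epsilon> (x - z))) \<in> borel_measurable borel"
      "(\<lambda>z. cgrad (\<lambda>z. complex_of_real (ker a \<epsilon> (x - z))) z $ i) \<in> borel_measurable borel"
      by (intro borel_measurable_continuous_onI test_fun_D[OF t])+
    have "(LINT z|lborel. w' z * cgrad (\<lambda>z. complex_of_real (ker a \<epsilon> (x - z))) z $ i) = - (LINT z|lborel. h i z * complex_of_real (ker a \<epsilon> (x - z)))"
      using wg_D(4)[OF w t, of i] ext_integral[OF w'(1) L2_measurable[OF wL] open_\<Omega> m(2)]
        ext_integral[OF h(1) L2_measurable[OF HL] open_\<Omega> m(1)] by simp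
    then show ?thesis
      unfolding \<phi>(2) conv_grad_def[OF \<epsilon>] conv_def[OF \<epsilon>] ker_reflect_cgrad[OF \<epsilon>] by (simp add: mult.commute)
  next
    case False
    have out: "x - z' \<notin> ball a \<epsilon>" if "z' \<in> ball x0 \<rho>" for z'
    proof
      assume "x - z' \<in> ball a \<epsilon>"
      then have "norm (a - (x - z')) < \<epsilon>" by (simp add: dist_norm)
      moreover have "norm (x - z') \<le> norm a + norm (a - (x - z'))"
        by (metis norm_minus_commute norm_triangle_sub)
      moreover have "norm a = \<epsilon> * norm d" using \<epsilon> by (simp add: a_def)
      ultimately have "norm (x - z') < \<epsilon> * (norm d + 1)" by (simp add: algebra_simps)
      also have "\<dots> < \<rho>" using \<epsilon>le(3) nd by (simp add: pos_less_divide_eq)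
      finally have "dist x z' < \<rho>" by (simp add: dist_norm)
      moreover have "dist x0 x \<le> dist x0 z' + dist x z'" by (metis dist_commute dist_triangle)
      ultimately show False using that False by simp
    qed
    have 1: "complex_of_real (ker_grad a \<epsilon> (x - z') $ i) * w' z' = 0" for z'
      using out[of z'] w'(2)[of z'] ker_outside(2)[OF \<epsilon>, of "x - z'" a] by (cases "z' \<in> ball x0 \<rho>") auto
    have 2: "complex_of_real (ker a \<epsilon> (x - z')) * h i z' = 0" for z'
      using out[of z'] h(2)[of z'] ker_outside(1)[OF \<epsilon>, of "x - z'" a] by (cases "z' \<in> ball x0 \<rho>") auto
    show ?thesis
      unfolding \<phi>(2) conv_grad_def[OF \<epsilon>] conv_def[OF \<epsilon>] vec_lambda_beta 1 2 ..
  qed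
  have b1: "l2 M\<Omega> (\<lambda>x. \<phi> x - w x) \<le> e'"
  proof (rule l2_le_ext[where \<phi>=\<phi> and \<psi>=\<phi> and w'=w'])
    show "w \<in> L2 M\<Omega>" "ext \<Omega> w w'" "continuous_on UNIV \<phi>" by (rule wL, rule w'(1), rule C1_fun_continuous[OF \<phi>(1)])
    show "\<phi> \<in> borel_measurable borel" by (rule borel_measurable_continuous_onI[OF C1_fun_continuous[OF \<phi>(1)]])
    show "(\<integral>\<^sup>+x. ennreal ((cmod (\<phi> x - w' x))\<^sup>2) \<partial>lborel) \<le> ennreal (e'\<^sup>2)"
      unfolding \<phi>_def a_def by (rule \<epsilon>w(2)[OF \<epsilon> \<epsilon>le(2)])
  qed (use e' in simp_all)
  have b2: "l2 M\<Omega> (\<lambda>x. cgrad \<phi> x $ i - H x $ i) \<le> e'" for i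
  proof (rule l2_le_ext[where \<phi>="\<lambda>x. cgrad \<phi> x $ i" and \<psi>="conv a \<epsilon> (h i)" and w'="h i"])
    show "(\<lambda>x. H x $ i) \<in> L2 M\<Omega>" by (rule HL)
    show "ext \<Omega> (\<lambda>x. H x $ i) (h i)" by (rule h(1))
    show "continuous_on UNIV (\<lambda>x. cgrad \<phi> x $ i)"
      by (rule continuous_on_component[OF C1_fun_has_derivative(2)[OF \<phi>(1)]])
    show "(\<integral>\<^sup>+x. ennreal ((cmod (conv a \<epsilon> (h i) x - h i x))\<^sup>2) \<partial>lborel) \<le> ennreal (e'\<^sup>2)"
      unfolding a_def by (rule \<epsilon>h(2)[OF \<epsilon> \<epsilon>le(4)])
    show "conv a \<epsilon> (h i) \<in> borel_measurable borel"
      by (intro borel_measurable_continuous_onI C1_fun_continuous conv_C1[OF \<epsilon>] int[OF hL h(2)])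
    show "cgrad \<phi> x $ i = conv a \<epsilon> (h i) x" if "x \<in> \<Omega>" for x by (rule grad[OF that])
  qed (use e' in simp_all)
  have dG: "(\<lambda>x. cgrad \<phi> x - H x) \<in> L2 M\<Omega>" by (intro L2_diff wg_D(2)[OF wg_C1[OF \<phi>(1)]] wg_D(2)[OF w])
  have "(l2 M\<Omega> (\<lambda>x. cgrad \<phi> x - H x))\<^sup>2 = (LINT x|M\<Omega>. (\<Sum>i\<in>UNIV. (cmod ((cgrad \<phi> x - H x) $ i))\<^sup>2))"
    unfolding l2_sq norm_vec_sq ..
  also have "\<dots> = (\<Sum>i\<in>UNIV. (l2 M\<Omega> (\<lambda>x. (cgrad \<phi> x - H x) $ i))\<^sup>2)"
    unfolding l2_sq by (intro Bochner_Integration.integral_sum L2_integrable L2_component dG)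
  also have "\<dots> \<le> (\<Sum>i\<in>(UNIV :: 'n set). e'\<^sup>2)"
    using b2 by (intro sum_mono power_mono) auto
  finally have b3: "(l2 M\<Omega> (\<lambda>x. cgrad \<phi> x - H x))\<^sup>2 \<le> real CARD('n) * e'\<^sup>2" by simp
  have "H1_norm \<Omega> (\<lambda>x. \<phi> x - w x) = sqrt ((l2 M\<Omega> (\<lambda>x. \<phi> x - w x))\<^sup>2 + (l2 M\<Omega> (\<lambda>x. cgrad \<phi> x - H x))\<^sup>2)"
    by (rule H1_norm_wg[OF wg_diff[OF wg_C1[OF \<phi>(1)] w]])
  also have "\<dots> \<le> sqrt ((N * e')\<^sup>2)"
  proof (rule real_sqrt_le_mono)
    have "(l2 M\<Omega> (\<lambda>x. \<phi> x - w x))\<^sup>2 \<le> e'\<^sup>2" using b1 by (intro power_mono) auto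
    then have "(l2 M\<Omega> (\<lambda>x. \<phi> x - w x))\<^sup>2 + (l2 M\<Omega> (\<lambda>x. cgrad \<phi> x - H x))\<^sup>2 \<le> N * e'\<^sup>2"
      using b3 by (simp add: N_def algebra_simps)
    also have "\<dots> \<le> N\<^sup>2 * e'\<^sup>2"
      by (intro mult_right_mono) (auto simp: N_def power2_eq_square)
    finally show "(l2 M\<Omega> (\<lambda>x. \<phi> x - w x))\<^sup>2 + (l2 M\<Omega> (\<lambda>x. cgrad \<phi> x - H x))\<^sup>2 \<le> (N * e')\<^sup>2"
      by (simp add: power_mult_distrib)
  qed
  also have "\<dots> = e / 2" using N e by (simp add: e'_def)
  also have "\<dots> < e" using e by simp
  finally show "\<exists>\<phi>. C1_fun \<phi> \<and> H1_norm \<Omega> (\<lambda>x. \<phi> x - w x) < e" using \<phi>(1) by blast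
qed

text \<open>Base case of the induction over a finite cover: when no ball is left, the function
  vanishes on \<Omega>.\<close>

lemma approximable_AE_zero:
  assumes v: "v \<in> H1 \<Omega>" and z: "\<And>x. x \<in> \<Omega> \<Longrightarrow> v x = 0"
  shows "approximable v"
proof -
  have t: "wg \<Omega> v (\<lambda>x. 0)"
  proof (rule wgI[OF wg_D(1)[OF wg_weak_grad[OF v]] L2_zero])
    fix \<phi> i
    have "(LINT x|M\<Omega>. v x * cgrad \<phi> x $ i) = (LINT x|M\<Omega>. 0)"
      by (rule Bochner_Integration.integral_cong) (auto simp: z)
    then show "(LINT x|M\<Omega>. v x * cgrad \<phi> x $ i) = - (LINT x|M\<Omega>. (0 :: complex^'n) $ i * \<phi> x)" by simp
  qed
  have "(LINT x|M\<Omega>. (cmod (v x))\<^sup>2) = (LINT x|M\<Omega>. 0)"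
    by (rule Bochner_Integration.integral_cong) (auto simp: z)
  then have "l2 M\<Omega> v = 0" by (simp add: l2_def)
  then have "H1_norm \<Omega> v = 0" using H1_norm_wg[OF t] by simp
  then have "H1_norm \<Omega> (\<lambda>x. 0 - v x) = 0" using H1_norm_cmult[OF v, of "-1"] by simp
  then show ?thesis
    unfolding approximable_def by (intro allI impI exI[of _ "\<lambda>x. 0"] conjI C1_fun_const) simp
qed

text \<open>Near each point of the closure, \<open>\<Omega>\<close> contains the balls of radius \<open>\<epsilon>\<close> about \<open>x + \<epsilon> d\<close>: mollifying
  with kernels supported in shifted balls uses only values inside \<open>\<Omega>\<close>.\<close>

lemma approximable_of_charts:
  assumes charts: "\<And>x0. x0 \<in> closure \<Omega> \<Longrightarrow> \<exists>\<rho>>0. \<exists>\<epsilon>0>0. \<exists>d. \<forall>x\<in>\<Omega> \<inter> ball x0 (2 * \<rho>). \<forall>\<epsilon>. 0 < \<epsilon> \<longrightarrow> \<epsilon> < \<epsilon>0 \<longrightarrow> cball (x + \<epsilon> *\<^sub>R d) \<epsilon> \<subseteq> \<Omega>"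
    and v: "v \<in> H1 \<Omega>"
  shows "approximable v"
proof -
  obtain \<rho> \<epsilon>0 d where c: "\<And>x0. x0 \<in> closure \<Omega> \<Longrightarrow> \<rho> x0 > 0" "\<And>x0. x0 \<in> closure \<Omega> \<Longrightarrow> \<epsilon>0 x0 > (0::real)"
    "\<And>x0 x \<epsilon>. x0 \<in> closure \<Omega> \<Longrightarrow> x \<in> \<Omega> \<Longrightarrow> x \<in> ball x0 (2 * \<rho> x0) \<Longrightarrow> 0 < \<epsilon> \<Longrightarrow> \<epsilon> < \<epsilon>0 x0 \<Longrightarrow> cball (x + \<epsilon> *\<^sub>R d x0) \<epsilon> \<subseteq> \<Omega>"
    using charts by (simp only: Int_iff Ball_def) metis
  have "compact (closure \<Omega>)" using bounded_\<Omega> by simp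
  moreover have "closure \<Omega> \<subseteq> (\<Union>x0\<in>closure \<Omega>. ball x0 (\<rho> x0 / 2))"
  proof
    fix x assume x: "x \<in> closure \<Omega>"
    then have "x \<in> ball x (\<rho> x / 2)" using c(1) by simp
    with x show "x \<in> (\<Union>x0\<in>closure \<Omega>. ball x0 (\<rho> x0 / 2))" by blast
  qed
  ultimately obtain F where F: "F \<subseteq> closure \<Omega>" "finite F" "closure \<Omega> \<subseteq> (\<Union>x0\<in>F. ball x0 (\<rho> x0 / 2))"
    using compactE_image[of "closure \<Omega>" "closure \<Omega>" "\<lambda>x0. ball x0 (\<rho> x0 / 2)"] by blast
  \<comment> \<open>Induction on the balls outside which \<open>v\<close> vanishes. A cutoff equal
    to 1 on the first closed ball splits off a piece to which \<open>approximable_local\<close>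
    applies, and the rest vanishes outside the remaining balls.\<close>
  have "\<forall>v\<in>H1 \<Omega>. (\<forall>x\<in>\<Omega>. x \<notin> (\<Union>x0\<in>F. cball x0 (\<rho> x0 / 2)) \<longrightarrow> v x = 0) \<longrightarrow> approximable v"
    using F(2,1)
  proof (induction F)
    case empty
    then show ?case using approximable_AE_zero by simp
  next
    case (insert x0 F)
    show ?case
    proof (intro ballI impI)
      fix v assume v: "v \<in> H1 \<Omega>" and z: "\<forall>x\<in>\<Omega>. x \<notin> (\<Union>x0\<in>insert x0 F. cball x0 (\<rho> x0 / 2)) \<longrightarrow> v x = 0"
      have x0: "x0 \<in> closure \<Omega>" using insert by simp
      obtain b where b: "C1_fun b" "\<And>x. x \<in> cball x0 (\<rho> x0 / 2) \<Longrightarrow> b x = 1"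
        "\<And>x. x \<notin> ball x0 (\<rho> x0) \<Longrightarrow> b x = 0" "\<And>x. x \<notin> ball x0 (\<rho> x0) \<Longrightarrow> cgrad b x = 0"
        using cutoff_exists[OF c(1)[OF x0]] by metis
      note bv = wg_mult_C1[OF b(1) wg_weak_grad[OF v]]
      have bvH: "(\<lambda>x. b x * v x) \<in> H1 \<Omega>" by (rule wg_D(3)[OF bv])
      have rH: "(\<lambda>x. v x - b x * v x) \<in> H1 \<Omega>" by (rule H1_diff[OF v bvH])
      have "approximable (\<lambda>x. b x * v x)"
        by (rule approximable_local[OF bv _ _ c(1,2)[OF x0 ] c(3)[OF x0]]) (use b in auto)
      moreover have "approximable (\<lambda>x. v x - b x * v x)"
      proof -
        have "\<forall>x\<in>\<Omega>. x \<notin> (\<Union>x0\<in>F. cball x0 (\<rho> x0 / 2)) \<longrightarrow> v x - b x * v x = 0"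
        proof (intro ballI impI)
          fix x assume "x \<in> \<Omega>" "x \<notin> (\<Union>x0\<in>F. cball x0 (\<rho> x0 / 2))"
          then show "v x - b x * v x = 0" using z b(2)[of x] by (cases "x \<in> cball x0 (\<rho> x0 / 2)") auto
        qed
        then show ?thesis using insert rH by auto
      qed
      ultimately have "approximable (\<lambda>x. b x * v x + (v x - b x * v x))"
        by (intro approximable_add bvH rH)
      then show "approximable v" by simp
    qed
  qed
  moreover have "\<forall>x\<in>\<Omega>. x \<notin> (\<Union>x0\<in>F. cball x0 (\<rho> x0 / 2)) \<longrightarrow> v x = 0"
  proof (intro ballI impI)
    fix x assume x: "x \<in> \<Omega>" and nx: "x \<notin> (\<Union>x0\<in>F. cball x0 (\<rho> x0 / 2))"
    have "x \<in> (\<Union>x0\<in>F. ball x0 (\<rho> x0 / 2))" using x F(3) closure_subset by blast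
    then have "x \<in> (\<Union>x0\<in>F. cball x0 (\<rho> x0 / 2))" using ball_subset_cball by blast
    with nx show "v x = 0" by contradiction
  qed
  ultimately show ?thesis using v by blast
qed

end

section \<open>Boundary charts and the Hausdorff measure\<close>

locale lip_chart = bounded_open \<Omega> for \<Omega> :: "(real^'n) set" +
  fixes \<nu> x0 :: "real^'n" and L r :: real and \<gamma> :: "real^'n \<Rightarrow> real"
  assumes r: "r > 0" and \<nu>: "norm \<nu> = 1" and \<gamma>: "L-lipschitz_on {z. z \<bullet> \<nu> = 0} \<gamma>"
    and epigraph: "\<Omega> \<inter> ball x0 r = {y \<in> ball x0 r. \<gamma> (y - (y \<bullet> \<nu>) *\<^sub>R \<nu>) < y \<bullet> \<nu>}"
begin

text \<open>\<open>pr\<close> is the projection onto the hyperplane, \<open>ht\<close> the height above the graph, \<open>foot\<close> the point of the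
  graph below a given point.\<close>

definition "pr y = y - (y \<bullet> \<nu>) *\<^sub>R \<nu>"
definition "ht y = y \<bullet> \<nu> - \<gamma> (pr y)"
definition "foot y = y - ht y *\<^sub>R \<nu>"

lemma L: "L \<ge> 0" using \<gamma> by (rule lipschitz_on_nonneg)

lemma \<nu>\<nu>: "\<nu> \<bullet> \<nu> = 1" using \<nu> by (simp add: norm_eq_1)

lemma pr_orth: "pr y \<bullet> \<nu> = 0" by (simp add: pr_def inner_diff_left \<nu>\<nu>)

lemma pr_shift: "pr (y + s *\<^sub>R \<nu>) = pr y"
  by (simp add: pr_def inner_add_left \<nu>\<nu> scaleR_add_left)

lemma pr_norm: "norm (pr y - pr z) \<le> norm (y - z)"
proof -
  let ?d = "y - z"
  have key: "(norm (d - (d \<bullet> \<nu>) *\<^sub>R \<nu>))\<^sup>2 = (norm d)\<^sup>2 - (d \<bullet> \<nu>)\<^sup>2" for d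
  proof -
    have "orthogonal (d - (d \<bullet> \<nu>) *\<^sub>R \<nu>) ((d \<bullet> \<nu>) *\<^sub>R \<nu>)"
      by (simp add: orthogonal_def inner_diff_left \<nu>\<nu>)
    from norm_add_Pythagorean[OF this] show ?thesis using \<nu> by (simp add: power_mult_distrib)
  qed
  have "pr y - pr z = ?d - (?d \<bullet> \<nu>) *\<^sub>R \<nu>" by (simp add: pr_def inner_diff_left algebra_simps)
  then have "(norm (pr y - pr z))\<^sup>2 = (norm ?d)\<^sup>2 - (?d \<bullet> \<nu>)\<^sup>2"
    by (simp only: key)
  then have "(norm (pr y - pr z))\<^sup>2 \<le> (norm ?d)\<^sup>2" by simp
  then show ?thesis by (rule power2_le_imp_le) simp
qed

lemma ht_shift: "ht (y + s *\<^sub>R \<nu>) = ht y + s"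
  by (simp add: ht_def pr_shift inner_add_left \<nu>\<nu>)

lemma foot_shift: "foot (y + s *\<^sub>R \<nu>) = foot y"
  by (simp add: foot_def ht_shift algebra_simps)

text \<open>Projection to the hyperplane is nonexpansive, so the graph function contributes
  \<open>L\<close> and the linear coordinate along \<nu> contributes 1.\<close>

lemma ht_lipschitz: "\<bar>ht y - ht z\<bar> \<le> (1 + L) * norm (y - z)"
proof -
  have "\<bar>\<gamma> (pr y) - \<gamma> (pr z)\<bar> \<le> L * norm (pr y - pr z)"
    using lipschitz_onD[OF \<gamma>, of "pr y" "pr z"] by (simp add: pr_orth dist_norm)
  also have "\<dots> \<le> L * norm (y - z)" by (intro mult_left_mono pr_norm L)
  finally have 1: "\<bar>\<gamma> (pr y) - \<gamma> (pr z)\<bar> \<le> L * norm (y - z)" .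
  have "\<bar>(y - z) \<bullet> \<nu>\<bar> \<le> norm (y - z)" using Cauchy_Schwarz_ineq2[of "y - z" \<nu>] \<nu> by simp
  then show ?thesis using 1 by (simp add: ht_def inner_diff_left algebra_simps)
qed

lemma foot_lipschitz: "norm (foot y - foot z) \<le> (2 + L) * norm (y - z)"
proof -
  have "foot y - foot z = (y - z) - (ht y - ht z) *\<^sub>R \<nu>" by (simp add: foot_def algebra_simps)
  then have "norm (foot y - foot z) \<le> norm (y - z) + \<bar>ht y - ht z\<bar>"
    using norm_triangle_ineq4[of "y - z" "(ht y - ht z) *\<^sub>R \<nu>"] \<nu> by simp
  then show ?thesis using ht_lipschitz[of y z] by (simp add: algebra_simps)
qed

lemma continuous_ht: "continuous_on UNIV ht"
proof (rule lipschitz_on_continuous_on[of "1 + L"], rule lipschitz_onI)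
  show "dist (ht y) (ht z) \<le> (1 + L) * dist y z" for y z
    unfolding dist_norm real_norm_def by (rule ht_lipschitz)
qed (use L in simp)

lemma continuous_foot: "continuous_on UNIV foot"
proof (rule lipschitz_on_continuous_on[of "2 + L"], rule lipschitz_onI)
  show "dist (foot y) (foot z) \<le> (2 + L) * dist y z" for y z
    unfolding dist_norm by (rule foot_lipschitz)
qed (use L in simp)

lemma in_\<Omega>_iff:
  assumes "y \<in> ball x0 r"
  shows "y \<in> \<Omega> \<longleftrightarrow> ht y > 0"
proof -
  have "y \<in> \<Omega> \<inter> ball x0 r \<longleftrightarrow> y \<in> {y \<in> ball x0 r. \<gamma> (y - (y \<bullet> \<nu>) *\<^sub>R \<nu>) < y \<bullet> \<nu>}"
    by (simp only: epigraph)
  then show ?thesis using assms by (simp add: ht_def pr_def)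
qed

text \<open>A positive height would put the point into the open set \<Omega>. A negative one
  persists in a neighbourhood, which would be disjoint from \<Omega> although it meets its
  closure.\<close>

lemma frontier_ht:
  assumes "y \<in> frontier \<Omega>" "y \<in> ball x0 r"
  shows "ht y = 0"
proof -
  have "y \<notin> \<Omega>" using assms(1) open_\<Omega> by (simp add: frontier_def interior_open)
  then have "ht y \<le> 0" using in_\<Omega>_iff[OF assms(2)] by simp
  moreover have "\<not> ht y < 0"
  proof
    assume "ht y < 0"
    have o: "open ({z. ht z < 0} \<inter> ball x0 r)"
      by (intro open_Int open_ball open_Collect_less continuous_ht continuous_on_const)
    have "y \<in> ({z. ht z < 0} \<inter> ball x0 r) \<inter> closure \<Omega>"
      using \<open>ht y < 0\<close> assms by (simp add: frontier_def)
    then have "({z. ht z < 0} \<inter> ball x0 r) \<inter> \<Omega> \<noteq> {}"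
      using open_Int_closure_eq_empty[OF o, of \<Omega>] by blast
    then obtain z where "z \<in> \<Omega>" "ht z < 0" and z: "z \<in> ball x0 r" by blast
    then show False using in_\<Omega>_iff[OF z] by simp
  qed
  ultimately show ?thesis by simp
qed

text \<open>The vertical shift raises \<open>ht\<close> by \<epsilon> (L + 2), while a displacement
  by \<epsilon> changes it by at most \<epsilon> (1 + L); a gain of \<epsilon> remains. The total
  displacement \<epsilon> (L + 3) stays below r/2, so the chart still applies.\<close>

lemma shifted_ball:
  assumes x: "x \<in> \<Omega>" "x \<in> ball x0 (2 * (r/4))" and \<epsilon>: "0 < \<epsilon>" "\<epsilon> < r / (2 * (L + 3))"
  shows "cball (x + \<epsilon> *\<^sub>R ((L + 2) *\<^sub>R \<nu>)) \<epsilon> \<subseteq> \<Omega>"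
proof
  fix z assume z: "z \<in> cball (x + \<epsilon> *\<^sub>R ((L + 2) *\<^sub>R \<nu>)) \<epsilon>"
  let ?y = "x + (\<epsilon> * (L + 2)) *\<^sub>R \<nu>"
  have zy: "norm (z - ?y) \<le> \<epsilon>" using z by (simp add: dist_norm norm_minus_commute)
  have "norm (z - x) \<le> norm (z - ?y) + norm ((\<epsilon> * (L + 2)) *\<^sub>R \<nu>)"
    using norm_triangle_ineq[of "z - ?y" "(\<epsilon> * (L + 2)) *\<^sub>R \<nu>"] by (simp add: algebra_simps)
  also have "norm ((\<epsilon> * (L + 2)) *\<^sub>R \<nu>) = \<epsilon> * (L + 2)" using \<nu> \<epsilon> L by simp
  finally have "norm (z - x) \<le> \<epsilon> * (L + 3)" using zy by (simp add: algebra_simps)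
  also have "\<dots> < r / 2" using \<epsilon> L by (simp add: field_simps)
  finally have "dist x z < r / 2" by (simp add: dist_norm norm_minus_commute)
  then have zb: "z \<in> ball x0 r" using x(2) dist_triangle[of x0 z x] by simp
  have xb: "x \<in> ball x0 r" using x(2) r by simp
  have "ht x > 0" using in_\<Omega>_iff[OF xb] x(1) by simp
  moreover have "ht ?y = ht x + \<epsilon> * (L + 2)" by (rule ht_shift)
  moreover have "\<bar>ht z - ht ?y\<bar> \<le> (1 + L) * \<epsilon>"
    using ht_lipschitz[of z ?y] zy L by (meson add_nonneg_nonneg mult_left_mono order_trans zero_le_one)
  ultimately have "ht z > 0" using \<epsilon>(1) by (simp add: algebra_simps abs_le_iff)
  then show "z \<in> \<Omega>" using in_\<Omega>_iff[OF zb] by simp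
qed

section \<open>The strip above the graph and its vertical projection\<close>

definition "h = r / 4"

text \<open>A foot within \<open>h\<close> of the centre and a height below \<open>h\<close> place
  the strip within 2h = r/2 of the centre, inside the ball where the chart is valid.\<close>

definition "W = {y. 0 < ht y \<and> ht y < h \<and> foot y \<in> ball x0 h}"

definition "\<mu> = distr (density lborel (indicator W)) borel foot"

lemma h: "h > 0" using r by (simp add: h_def)

lemma open_W: "open W"
proof -
  have "W = {y. 0 < ht y} \<inter> {y. ht y < h} \<inter> foot -` ball x0 h" by (auto simp: W_def)
  moreover have "open (foot -` ball x0 h)" by (rule open_vimage[OF open_ball continuous_foot])
  moreover have "open {y. 0 < ht y}" "open {y. ht y < h}"
    by (intro open_Collect_less continuous_ht continuous_on_const)+
  ultimately show ?thesis by (simp only: open_Int)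
qed

lemma W_in_ball: "y \<in> W \<Longrightarrow> y \<in> ball x0 r"
proof -
  assume y: "y \<in> W"
  have "norm (y - foot y) < h" using y \<nu> by (simp add: foot_def W_def)
  then have "dist (foot y) y < h" by (simp add: dist_norm norm_minus_commute)
  moreover have "dist x0 (foot y) < h" using y by (simp add: W_def)
  ultimately show "y \<in> ball x0 r" using dist_triangle[of x0 y "foot y"] h by (simp add: h_def)
qed

lemma W_subset: "W \<subseteq> \<Omega>"
  using W_in_ball in_\<Omega>_iff by (auto simp: W_def)

lemma measurable_W [measurable]: "W \<in> sets borel"
  by (rule borel_open[OF open_W])

lemma measurable_foot [measurable]: "foot \<in> borel_measurable borel"
  by (rule borel_measurable_continuous_onI[OF continuous_foot])

lemma sets_\<mu> [simp, measurable_cong]: "sets \<mu> = sets borel" by (simp add: \<mu>_def)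
lemma space_\<mu> [simp]: "space \<mu> = UNIV" by (simp add: \<mu>_def)

lemma nn_integral_\<mu>:
  assumes [measurable]: "f \<in> borel_measurable borel"
  shows "(\<integral>\<^sup>+x. f x \<partial>\<mu>) = (\<integral>\<^sup>+y. indicator W y * f (foot y) \<partial>lborel)"
proof -
  have "(\<integral>\<^sup>+x. f x \<partial>\<mu>) = (\<integral>\<^sup>+y. f (foot y) \<partial>density lborel (indicator W))"
    unfolding \<mu>_def by (rule nn_integral_distr) measurable
  also have "\<dots> = (\<integral>\<^sup>+y. indicator W y * f (foot y) \<partial>lborel)"
    by (rule nn_integral_density) measurable
  finally show ?thesis .
qed

lemma emeasure_\<mu>:
  assumes [measurable]: "A \<in> sets borel"
  shows "emeasure \<mu> A = emeasure lborel (W \<inter> foot -` A)"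
proof -
  have m: "foot -` A \<in> sets borel"
    using measurable_sets[of foot borel borel A] by simp
  have "emeasure \<mu> A = (\<integral>\<^sup>+x. indicator A x \<partial>\<mu>)" by simp
  also have "\<dots> = (\<integral>\<^sup>+y. indicator W y * indicator A (foot y) \<partial>lborel)" by (rule nn_integral_\<mu>) measurable
  also have "\<dots> = (\<integral>\<^sup>+y. indicator (W \<inter> foot -` A) y \<partial>lborel)"
    by (intro nn_integral_cong) (auto simp: indicator_def)
  also have "\<dots> = emeasure lborel (W \<inter> foot -` A)" using m by simp
  finally show ?thesis .
qed

lemma \<mu>_finite: "emeasure \<mu> UNIV < \<infinity>"
proof -
  have "emeasure \<mu> UNIV \<le> emeasure lborel (ball x0 r)"
    using W_in_ball by (subst emeasure_\<mu>) (auto intro!: emeasure_mono)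
  also have "\<dots> < \<infinity>" by (rule emeasure_lborel_ball_finite)
  finally show ?thesis .
qed

text \<open>The strip above a small ball on the graph contains a stack of disjoint balls.\<close>

lemma \<mu>_ball_ge:
  assumes x: "ht x = 0" and q: "0 < q" "2 * q \<le> h" and sub: "ball x q \<subseteq> ball x0 h"
  shows "ennreal (h * unit_ball_vol (real CARD('n)) / (4 * (2 + L) ^ CARD('n)) * q powr (real CARD('n) - 1)) \<le> emeasure \<mu> (ball x q)"
proof -
  \<comment> \<open>Both \<open>foot\<close> and \<open>ht\<close> have Lipschitz constants at most
    2 + L, so on a ball of radius \<open>s\<close> the foot points and the heights stay within
    \<open>q\<close> of those of its centre.\<close>
  define s where "s = q / (2 + L)"
  have s: "s > 0" "(2 + L) * s = q" "s \<le> q" using q L by (auto simp: s_def field_simps)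
  \<comment> \<open>Number of layers of thickness 2q in a strip of height \<open>h\<close>; the ball
    centres sit at odd multiples of \<open>q\<close>. Since h/(2q) is at least 1, rounding down
    loses at most a factor 2.\<close>
  define N where "N = nat \<lfloor>h / (2 * q)\<rfloor>"
  have hq: "h / (2 * q) \<ge> 1" using q by simp
  have N1: "real N \<le> h / (2 * q)" unfolding N_def using hq by (simp add: of_nat_floor)
  have N2: "real N \<ge> h / (4 * q)"
  proof -
    have "1 \<le> \<lfloor>h / (2 * q)\<rfloor>" using hq by (simp add: le_floor_iff)
    moreover from this have "real N = of_int \<lfloor>h / (2 * q)\<rfloor>" by (simp add: N_def)
    ultimately have "real N \<ge> h / (2 * q) - 1" "real N \<ge> 1" by linarith+
    then have "2 * real N \<ge> h / (2 * q)" by linarith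
    then show ?thesis by (simp add: field_simps)
  qed
  define c where "c k = x + ((2 * real k + 1) * q) *\<^sub>R \<nu>" for k
  have htc: "ht (c k) = (2 * real k + 1) * q" for k unfolding c_def by (simp add: ht_shift x)
  have footc: "foot (c k) = x" for k unfolding c_def foot_shift by (simp add: foot_def x)
  have inW: "ball (c k) s \<subseteq> W \<inter> foot -` ball x q" if "k < N" for k
  proof
    fix y assume "y \<in> ball (c k) s"
    then have d: "norm (y - c k) < s" by (simp add: dist_norm norm_minus_commute)
    have "norm (foot y - x) \<le> (2 + L) * norm (y - c k)" using foot_lipschitz[of y "c k"] footc by simp
    also have "\<dots> < (2 + L) * s" using d L by (intro mult_strict_left_mono) auto
    finally have 1: "foot y \<in> ball x q" using s by (simp add: dist_norm norm_minus_commute)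
    have "\<bar>ht y - ht (c k)\<bar> \<le> (1 + L) * norm (y - c k)" by (rule ht_lipschitz)
    also have "\<dots> \<le> (2 + L) * norm (y - c k)" by (intro mult_right_mono) auto
    also have "\<dots> < (2 + L) * s" using d L by (intro mult_strict_left_mono) auto
    finally have 2: "\<bar>ht y - (2 * real k + 1) * q\<bar> < q" using s htc by simp
    define p where "p = 2 * real k * q"
    have p: "0 \<le> p" "(2 * real k + 1) * q = p + q" "(2 * real k + 2) * q = p + 2 * q"
      using q by (simp_all add: p_def algebra_simps)
    have 3: "ht y > 0" using 2 p(1) unfolding p(2) by linarith
    have "(2 * real k + 2) * q \<le> 2 * real N * q" using that q by (intro mult_right_mono) auto
    also have "\<dots> \<le> h" using N1 q by (simp add: field_simps)
    finally have 4: "ht y < h" using 2 unfolding p(2,3) by linarith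
    show "y \<in> W \<inter> foot -` ball x q" using 1 3 4 sub by (auto simp: W_def)
  qed
  have disj: "disjoint_family_on (\<lambda>k. ball (c k) s) {..<N}"
    unfolding disjoint_family_on_def
  proof (intro ballI impI)
    fix j k :: nat assume "j \<noteq> k"
    have "dist (c j) (c k) = \<bar>2 * (real j - real k) * q\<bar>"
    proof -
      have "c j - c k = (2 * (real j - real k) * q) *\<^sub>R \<nu>" by (simp add: c_def algebra_simps)
      then show ?thesis using \<nu> by (simp add: dist_norm)
    qed
    then have "dist (c j) (c k) = 2 * (\<bar>real j - real k\<bar> * q)" using q by (simp only: abs_mult abs_numeral abs_of_pos)
    moreover have "1 \<le> \<bar>real j - real k\<bar>"
      using \<open>j \<noteq> k\<close> by (cases j k rule: linorder_cases) auto
    then have "1 * q \<le> \<bar>real j - real k\<bar> * q" using q by (intro mult_right_mono) auto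
    ultimately have "dist (c j) (c k) \<ge> 2 * s" using s(3) by linarith
    then show "ball (c j) s \<inter> ball (c k) s = {}"
      by (intro disjoint_ballI) simp
  qed
  \<comment> \<open>At least h/(4q) balls of radius q/(2 + L) have a total volume of order q^(n-1),
    which is the area scale of a surface piece of radius \<open>q\<close>.\<close>
  have "h * unit_ball_vol (real CARD('n)) / (4 * (2 + L) ^ CARD('n)) * q powr (real CARD('n) - 1)
      = h / (4 * q) * (unit_ball_vol (real CARD('n)) * s ^ CARD('n))"
  proof -
    have "q powr (real CARD('n) - 1) = q ^ CARD('n) / q"
      using q by (simp add: powr_diff powr_realpow)
    then show ?thesis by (simp add: s_def power_divide field_simps)
  qed
  also have "\<dots> \<le> real N * (unit_ball_vol (real CARD('n)) * s ^ CARD('n))"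
    using N2 s by (intro mult_right_mono) auto
  finally have "ennreal (h * unit_ball_vol (real CARD('n)) / (4 * (2 + L) ^ CARD('n)) * q powr (real CARD('n) - 1))
     \<le> ennreal (real N * (unit_ball_vol (real CARD('n)) * s ^ CARD('n)))" by (rule ennreal_leI)
  also have "\<dots> = (\<Sum>k<N. emeasure lborel (ball (c k) s))"
    using s by (simp add: emeasure_ball ennreal_mult ennreal_of_nat_eq_real_of_nat)
  also have "\<dots> = emeasure lborel (\<Union>k<N. ball (c k) s)"
    by (rule sum_emeasure[OF _ disj]) auto
  also have "\<dots> \<le> emeasure lborel (W \<inter> foot -` ball x q)"
  proof (rule emeasure_mono)
    show "(\<Union>k<N. ball (c k) s) \<subseteq> W \<inter> foot -` ball x q" using inW by blast
    show "W \<inter> foot -` ball x q \<in> sets lborel"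
      using measurable_sets[of foot borel borel "ball x q"] by simp
  qed
  also have "\<dots> = emeasure \<mu> (ball x q)" by (rule emeasure_\<mu>[symmetric]) simp
  finally show ?thesis .
qed

text \<open>The power of 5 comes from the enlargement in Vitali's lemma. The denominator is the
  factor of \<open>q powr (n - 1)\<close> in \<open>\<mu>_ball_ge\<close>.\<close>

definition "Kh = unit_ball_vol (real CARD('n) - 1) * 5 powr (real CARD('n) - 1) / (h * unit_ball_vol (real CARD('n)) / (4 * (2 + L) ^ CARD('n)))"

text \<open>Vitali's lemma selects disjoint balls inside an open neighbourhood of the set whose
  fivefold enlargements cover the set. The enlargements are admissible in the Hausdorff sum, and by
  disjointness the balls together carry at most the strip measure of the neighbourhood.\<close>

lemma hausdorff_pre_le:
  assumes n: "CARD('n) \<ge> 2" and A: "A \<in> sets borel" "A \<subseteq> frontier \<Omega> \<inter> ball x0 h" and \<delta>: "\<delta> > 0"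
  shows "hausdorff_pre (real CARD('n) - 1) \<delta> A \<le> ennreal Kh * emeasure \<mu> A"
proof -
  let ?p = "real CARD('n) - 1"
  let ?k = "h * unit_ball_vol (real CARD('n)) / (4 * (2 + L) ^ CARD('n))"
  have k: "?k > 0" using h L by (auto intro!: divide_pos_pos mult_pos_pos zero_less_power simp: unit_ball_vol_pos)
  have p: "?p \<ge> 1" using n by simp
  have up: "unit_ball_vol ?p > 0" using p by (simp add: unit_ball_vol_pos)
  define kk where "kk = ?k"
  have kk: "kk > 0" using k by (simp only: kk_def)
  have Kh_eq: "Kh = unit_ball_vol ?p * 5 powr ?p / kk" by (simp only: Kh_def kk_def)
  have Kh: "Kh > 0" unfolding Kh_def using k up by (intro divide_pos_pos[OF _ k] mult_pos_pos) auto
  have open_case: "hausdorff_pre ?p \<delta> A \<le> ennreal Kh * emeasure \<mu> U" if U: "A \<subseteq> U" "open U" for U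
  proof -
    define V where "V = U \<inter> ball x0 h"
    have V: "A \<subseteq> V" "open V" using U A(2) by (auto simp: V_def)
    \<comment> \<open>Radii at most \<delta>/10, because the enlarged balls have diameter 10q, and
      at most h/2, as \<open>\<mu>_ball_ge\<close> requires.\<close>
    have "\<forall>x\<in>A. \<exists>q. 0 < q \<and> q \<le> min (h / 2) (\<delta> / 10) \<and> cball x q \<subseteq> V"
    proof
      fix x assume "x \<in> A"
      then obtain e where e: "e > 0" "cball x e \<subseteq> V" using V open_contains_cball by blast
      show "\<exists>q. 0 < q \<and> q \<le> min (h / 2) (\<delta> / 10) \<and> cball x q \<subseteq> V"
        using e h \<delta> by (intro exI[of _ "min e (min (h / 2) (\<delta> / 10))"]) (auto simp: subset_eq)
    qed
    from bchoice[OF this] obtain q where q0: "\<forall>x\<in>A. 0 < q x \<and> q x \<le> min (h / 2) (\<delta> / 10) \<and> cball x (q x) \<subseteq> V" ..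
    have q: "0 < q x" "q x \<le> min (h / 2) (\<delta> / 10)" "cball x (q x) \<subseteq> V" if "x \<in> A" for x
      using q0 that by blast+
    have qb: "0 < q i \<and> q i \<le> h / 2" if "i \<in> A" for i
      using q(1,2)[OF that] by simp
    have "\<exists>D. countable D \<and> D \<subseteq> A \<and> pairwise (\<lambda>i j. disjnt (cball i (q i)) (cball j (q j))) D \<and>
        (\<forall>i\<in>A. \<exists>j\<in>D. cball i (q i) \<subseteq> ball j (5 * q j))"
    proof (rule Vitali_covering_lemma_cballs_balls[of A q "h / 2" "\<lambda>x. x"])
      show "0 < q i \<and> q i \<le> h / 2" if "i \<in> A" for i by (rule qb[OF that])
    next
      fix D assume "countable D" "D \<subseteq> A" "pairwise (\<lambda>i j. disjnt (cball i (q i)) (cball j (q j))) D"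
        and c: "\<And>i. i \<in> A \<Longrightarrow> \<exists>j. j \<in> D \<and> \<not> disjnt (cball i (q i)) (cball j (q j)) \<and> cball i (q i) \<subseteq> ball j (5 * q j)"
      then show ?thesis by (intro exI[of _ D] conjI) blast+
    qed
    then obtain D where D: "countable D" "D \<subseteq> A" "pairwise (\<lambda>i j. disjnt (cball i (q i)) (cball j (q j))) D"
      "\<forall>i\<in>A. \<exists>j\<in>D. cball i (q i) \<subseteq> ball j (5 * q j)"
      by blast
    \<comment> \<open>\<open>hausdorff_pre\<close> expects a sequence of sets: the countable family
      is enumerated, and indices outside \<open>R\<close> receive the empty set, of diameter
      0.\<close>
    define g where "g = inv_into D (to_nat_on D)"
    define R where "R = to_nat_on D ` D"
    have inj: "inj_on (to_nat_on D) D" by (rule inj_on_to_nat_on[OF D(1)])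
    have gD: "g i \<in> D" if "i \<in> R" for i using that by (auto simp: g_def R_def inv_into_into)
    have gA: "g i \<in> A" if "i \<in> R" for i using gD[OF that] D(2) by blast
    have tg: "to_nat_on D (g i) = i" if "i \<in> R" for i
      using that unfolding g_def R_def by (rule f_inv_into_f)
    have g_inj: "g i \<noteq> g j" if "i \<in> R" "j \<in> R" "i \<noteq> j" for i j
      using tg[OF that(1)] tg[OF that(2)] that(3) by auto
    define C where "C i = (if i \<in> R then ball (g i) (5 * q (g i)) else {})" for i
    define B where "B i = (if i \<in> R then ball (g i) (q (g i)) else {})" for i
    have cover: "A \<subseteq> (\<Union>i. C i)"
    proof
      fix x assume x: "x \<in> A"
      obtain j where j: "j \<in> D" "cball x (q x) \<subseteq> ball j (5 * q j)" using bspec[OF D(4) x] ..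
      have "to_nat_on D j \<in> R" "g (to_nat_on D j) = j" using j(1) inj by (auto simp: R_def g_def)
      moreover have "x \<in> ball j (5 * q j)" using subsetD[OF j(2), of x] q(1)[OF x] by simp
      ultimately have "x \<in> C (to_nat_on D j)" by (simp add: C_def)
      then show "x \<in> (\<Union>i. C i)" by blast
    qed
    have diam: "diameter (C i) = 10 * q (g i)" if "i \<in> R" for i
      using q(1)[OF gA[OF that]] that by (simp add: C_def diameter_ball)
    have adm: "C \<in> {C. A \<subseteq> (\<Union>i. C i) \<and> (\<forall>i. bounded (C i) \<and> diameter (C i) \<le> \<delta>)}"
    proof (intro CollectI conjI allI cover)
      fix i
      show "bounded (C i)" by (simp add: C_def)
      show "diameter (C i) \<le> \<delta>"
      proof (cases "i \<in> R")
        case True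
        then show ?thesis using diam[OF True] q(2)[OF gA[OF True]] by simp
      qed (use \<delta> in \<open>simp add: C_def\<close>)
    qed
    have "hausdorff_pre ?p \<delta> A \<le> (\<Sum>i. ennreal (unit_ball_vol ?p * (diameter (C i) / 2) powr ?p))"
      unfolding hausdorff_pre_def using adm by (rule INF_lower)
    also have "\<dots> \<le> (\<Sum>i. ennreal Kh * emeasure \<mu> (B i))"
    proof (rule suminf_le)
      fix i
      show "ennreal (unit_ball_vol ?p * (diameter (C i) / 2) powr ?p) \<le> ennreal Kh * emeasure \<mu> (B i)"
      proof (cases "i \<in> R")
        case True
        note gAi = gA[OF True]
        let ?q = "q (g i)"
        have "(diameter (C i) / 2) powr ?p \<le> (5 * ?q) powr ?p"
          using diam[OF True] by simp
        also have "\<dots> = 5 powr ?p * ?q powr ?p" using q(1)[OF gAi] by (simp add: powr_mult)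
        finally have "unit_ball_vol ?p * (diameter (C i) / 2) powr ?p \<le> unit_ball_vol ?p * (5 powr ?p * ?q powr ?p)"
          using up by (intro mult_left_mono) auto
        also have "\<dots> = Kh * (kk * ?q powr ?p)" using kk by (simp add: Kh_eq)
        finally have "ennreal (unit_ball_vol ?p * (diameter (C i) / 2) powr ?p) \<le> ennreal (Kh * (kk * ?q powr ?p))"
          by (rule ennreal_leI)
        also have "\<dots> = ennreal Kh * ennreal (kk * ?q powr ?p)"
          using Kh kk by (intro ennreal_mult) auto
        also have "\<dots> \<le> ennreal Kh * emeasure \<mu> (ball (g i) ?q)"
        proof (unfold kk_def, intro mult_left_mono \<mu>_ball_ge q(1)[OF gAi])
          have "g i \<in> frontier \<Omega>" "g i \<in> ball x0 r" using gAi A(2) r by (auto simp: h_def)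
          then show "ht (g i) = 0" by (rule frontier_ht)
          show "2 * ?q \<le> h" using q(2)[OF gAi] by simp
          show "ball (g i) ?q \<subseteq> ball x0 h"
            using order_trans[OF ball_subset_cball q(3)[OF gAi]] by (simp add: V_def)
        qed simp
        finally show ?thesis using True by (simp add: B_def)
      next
        case False
        then show ?thesis using p by (simp add: C_def)
      qed
    qed auto
    also have "\<dots> = ennreal Kh * (\<Sum>i. emeasure \<mu> (B i))" by (rule ennreal_suminf_cmult)
    also have "(\<Sum>i. emeasure \<mu> (B i)) = emeasure \<mu> (\<Union>i. B i)"
    proof (rule suminf_emeasure)
      show "range B \<subseteq> sets \<mu>" by (auto simp: B_def)
      show "disjoint_family B"
        unfolding disjoint_family_on_def
      proof (intro ballI impI)
        fix i j :: nat assume "i \<noteq> j"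
        show "B i \<inter> B j = {}"
        proof (cases "i \<in> R \<and> j \<in> R")
          case True
          then have "disjnt (cball (g i) (q (g i))) (cball (g j) (q (g j)))"
            using D(3) gD g_inj \<open>i \<noteq> j\<close> unfolding pairwise_def by blast
          moreover have "B i \<subseteq> cball (g i) (q (g i))" "B j \<subseteq> cball (g j) (q (g j))" using True by (auto simp: B_def)
          ultimately show ?thesis unfolding disjnt_def by blast
        qed (auto simp: B_def)
      qed
    qed
    also have "emeasure \<mu> (\<Union>i. B i) \<le> emeasure \<mu> U"
    proof (rule emeasure_mono)
      show "(\<Union>i. B i) \<subseteq> U"
      proof
        fix y assume "y \<in> (\<Union>i. B i)"
        then obtain i where i: "i \<in> R" "y \<in> ball (g i) (q (g i))" by (auto simp: B_def split: if_splits)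
        then have "y \<in> cball (g i) (q (g i))" by simp
        then show "y \<in> U" using q(3)[OF gA[OF i(1)]] by (auto simp: V_def)
      qed
    qed (use U in simp)
    finally show ?thesis by (simp add: mult_left_mono)
  qed
  \<comment> \<open>The bound by open neighbourhoods passes to \<open>A\<close> itself by outer
    regularity of the finite measure \<mu>.\<close>
  have reg: "emeasure \<mu> A = (INF U \<in> {U. A \<subseteq> U \<and> open U}. emeasure \<mu> U)"
    by (rule outer_regular) (use A \<mu>_finite in auto)
  show ?thesis
  proof (rule ennreal_le_epsilon)
    fix e :: real assume e: "e > 0" and fin: "ennreal Kh * emeasure \<mu> A < top"
    have "emeasure \<mu> A < \<infinity>" by (rule le_less_trans[OF emeasure_mono[of A UNIV] \<mu>_finite]) auto
    then have "emeasure \<mu> A < emeasure \<mu> A + ennreal (e / Kh)" using e Kh by simp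
    then have "(INF U \<in> {U. A \<subseteq> U \<and> open U}. emeasure \<mu> U) < emeasure \<mu> A + ennreal (e / Kh)" unfolding reg .
    then obtain U where U: "A \<subseteq> U" "open U" "emeasure \<mu> U < emeasure \<mu> A + ennreal (e / Kh)"
      unfolding INF_less_iff by blast
    have "hausdorff_pre ?p \<delta> A \<le> ennreal Kh * emeasure \<mu> U" by (rule open_case[OF U(1,2)])
    also have "\<dots> \<le> ennreal Kh * (emeasure \<mu> A + ennreal (e / Kh))" using U(3) by (intro mult_left_mono) auto
    also have "\<dots> = ennreal Kh * emeasure \<mu> A + ennreal e"
      using Kh e by (simp add: distrib_left flip: ennreal_mult)
    finally show "hausdorff_pre ?p \<delta> A \<le> ennreal Kh * emeasure \<mu> A + ennreal e" .
  qed
qed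

lemma hausdorff_outer_le:
  assumes n: "CARD('n) \<ge> 2" and A: "A \<in> sets borel" "A \<subseteq> frontier \<Omega> \<inter> ball x0 h"
  shows "hausdorff_outer (real CARD('n) - 1) A \<le> ennreal Kh * emeasure \<mu> A"
  unfolding hausdorff_outer_def
proof (rule SUP_least)
  fix \<delta> :: real assume "\<delta> \<in> {0<..}"
  then have "0 < \<delta>" by simp
  then show "hausdorff_pre (real CARD('n) - 1) \<delta> A \<le> ennreal Kh * emeasure \<mu> A"
    by (rule hausdorff_pre_le[OF n A])
qed

end

section \<open>Traces\<close>

text \<open>\<open>measure_of\<close> assigns to a set the outer measure or, if that fails to be a
  measure on the given sets, the value 0; the inequality holds in either case.\<close>

lemma
  fixes \<Omega> :: "(real^'n) set"
  shows sets_surface_measure: "sets (surface_measure \<Omega>) = sets (restrict_space borel (frontier \<Omega>))"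
    and space_surface_measure [simp]: "space (surface_measure \<Omega>) = frontier \<Omega>"
    and emeasure_surface_measure_le: "emeasure (surface_measure \<Omega>) A \<le> hausdorff_outer (real CARD('n) - 1) A"
proof -
  have sub: "sets (restrict_space borel (frontier \<Omega>)) \<subseteq> Pow (frontier \<Omega>)"
    using sets.space_closed[of "restrict_space borel (frontier \<Omega>)"] by (simp add: space_restrict_space)
  show "sets (surface_measure \<Omega>) = sets (restrict_space borel (frontier \<Omega>))"
    unfolding surface_measure_def sets_measure_of[OF sub]
    using sets.sigma_sets_eq[of "restrict_space borel (frontier \<Omega>)"] by (simp add: space_restrict_space)
  show "space (surface_measure \<Omega>) = frontier \<Omega>"
    unfolding surface_measure_def by (rule space_measure_of[OF sub])
  show "emeasure (surface_measure \<Omega>) A \<le> hausdorff_outer (real CARD('n) - 1) A"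
    unfolding surface_measure_def emeasure_measure_of_conv by simp
qed

lemma sets_surface_measure_iff: "A \<in> sets (surface_measure \<Omega>) \<longleftrightarrow> A \<in> sets borel \<and> A \<subseteq> frontier \<Omega>"
  unfolding sets_surface_measure by (subst sets_restrict_space_iff) (auto intro: borel_closed frontier_closed)

lemma borel_measurable_surfaceI:
  "f \<in> borel_measurable borel \<Longrightarrow> f \<in> borel_measurable (surface_measure \<Omega>)"
  unfolding measurable_cong_sets[OF sets_surface_measure refl] by (rule measurable_restrict_space1)

section \<open>The trace inequality in a boundary chart\<close>

context lip_chart
begin

text \<open>The comparison on Borel sets is an inequality in the order of measures, and the integral
  of a nonnegative function is monotone in the measure.\<close>

lemma nn_integral_surface_le:
  assumes n: "CARD('n) \<ge> 2" and f[measurable]: "f \<in> borel_measurable borel"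
  shows "(\<integral>\<^sup>+x. indicator (ball x0 h) x * f x \<partial>surface_measure \<Omega>) \<le> ennreal Kh * (\<integral>\<^sup>+x. f x \<partial>\<mu>)"
proof -
  let ?S = "surface_measure \<Omega>"
  have id[measurable]: "(\<lambda>x. x) \<in> measurable ?S borel" by (rule borel_measurable_surfaceI) simp
  define N where "N = density (distr ?S borel (\<lambda>x. x)) (indicator (ball x0 h))"
  have sN: "sets N = sets borel" by (simp add: N_def)
  have eN: "emeasure N A \<le> ennreal Kh * emeasure \<mu> A" if A[measurable]: "A \<in> sets borel" for A
  proof -
    have AF: "A \<inter> ball x0 h \<inter> frontier \<Omega> \<in> sets borel"
      using A by (intro sets.Int) (auto intro: borel_closed)
    have "emeasure N A = (\<integral>\<^sup>+x. indicator (ball x0 h) x * indicator A x \<partial>distr ?S borel (\<lambda>x. x))"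
      unfolding N_def using A by (intro emeasure_density borel_measurable_indicator) auto
    also have "\<dots> = (\<integral>\<^sup>+x. indicator (A \<inter> ball x0 h) x \<partial>distr ?S borel (\<lambda>x. x))"
      by (intro nn_integral_cong) (auto simp: indicator_def)
    also have "\<dots> = emeasure (distr ?S borel (\<lambda>x. x)) (A \<inter> ball x0 h)"
      by (rule nn_integral_indicator) auto
    also have "\<dots> = emeasure ?S (A \<inter> ball x0 h \<inter> frontier \<Omega>)"
      by (subst emeasure_distr) auto
    also have "\<dots> \<le> hausdorff_outer (real CARD('n) - 1) (A \<inter> ball x0 h \<inter> frontier \<Omega>)"
      by (rule emeasure_surface_measure_le)
    also have "\<dots> \<le> ennreal Kh * emeasure \<mu> (A \<inter> ball x0 h \<inter> frontier \<Omega>)"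
      by (rule hausdorff_outer_le[OF n AF]) auto
    also have "\<dots> \<le> ennreal Kh * emeasure \<mu> A"
      using A by (intro mult_left_mono emeasure_mono) auto
    finally show ?thesis .
  qed
  have mm: "(\<lambda>x. indicator (ball x0 h) x * f x) \<in> borel_measurable borel"
    by (intro borel_measurable_times_ennreal borel_measurable_indicator f) simp
  have le: "N \<le> scale_measure (ennreal Kh) \<mu>"
    by (subst le_measure) (auto simp: sN le_fun_def space_scale_measure intro: eN emeasure_notin_sets[THEN eq_refl, THEN order_trans])
  have "(\<integral>\<^sup>+x. indicator (ball x0 h) x * f x \<partial>?S) = (\<integral>\<^sup>+x. indicator (ball x0 h) x * f x \<partial>distr ?S borel (\<lambda>x. x))"
    by (rule nn_integral_distr[symmetric]) (auto intro: mm)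
  also have "\<dots> = (\<integral>\<^sup>+x. f x \<partial>N)"
    unfolding N_def by (intro nn_integral_density[symmetric] borel_measurable_indicator) (simp_all add: f)
  also have "\<dots> \<le> (\<integral>\<^sup>+x. f x \<partial>scale_measure (ennreal Kh) \<mu>)"
    by (rule nn_integral_mono_measure[OF _ le]) (simp add: sN)
  also have "\<dots> = ennreal Kh * (\<integral>\<^sup>+x. f x \<partial>\<mu>)"
    by (rule nn_integral_scale_measure) (simp add: measurable_cong_sets[OF sets_\<mu> refl] f)
  finally show ?thesis .
qed

text \<open>Fundamental theorem of calculus on the vertical segment down to the graph, then
  Cauchy-Schwarz with a segment length below \<open>h\<close>. The bound is an integral over a fixed
  interval with an indicator of \<open>W\<close>, so that the order of integration over \<tau> and
  \<open>y\<close> can be exchanged later.\<close>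

lemma foot_increment:
  assumes \<phi>: "C1_fun \<phi>" and y: "y \<in> W"
  shows "ennreal ((cmod (\<phi> (foot y)))\<^sup>2) \<le> ennreal (2 * (cmod (\<phi> y))\<^sup>2)
    + ennreal (2 * h) * (\<integral>\<^sup>+\<tau>. indicator {-h<..<0} \<tau> * (indicator W (y + \<tau> *\<^sub>R \<nu>) * ennreal ((norm (cgrad \<phi> (y + \<tau> *\<^sub>R \<nu>)))\<^sup>2)) \<partial>lborel)"
    (is "_ \<le> _ + ennreal (2 * h) * ?I")
proof -
  define T where "T = ht y"
  have T: "0 < T" "T < h" using y by (auto simp: T_def W_def)
  note cg = C1_fun_has_derivative(2)[OF \<phi>]
  define g where "g \<tau> = (\<Sum>i\<in>UNIV. of_real (\<nu> $ i) * cgrad \<phi> (y + \<tau> *\<^sub>R \<nu>) $ i)" for \<tau> :: real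
  have gc: "continuous_on UNIV g"
    unfolding g_def[abs_def]
    by (intro continuous_intros continuous_on_compose2[OF cg]) auto
  have [measurable]: "g \<in> borel_measurable borel" by (rule borel_measurable_continuous_onI[OF gc])
  have gm: "(\<lambda>\<tau>. norm (cgrad \<phi> (y + \<tau> *\<^sub>R \<nu>))) \<in> borel_measurable borel"
    by (intro borel_measurable_continuous_onI continuous_intros continuous_on_compose2[OF cg]) auto
  note [measurable] = gm
  have g_le: "cmod (g \<tau>) \<le> norm (cgrad \<phi> (y + \<tau> *\<^sub>R \<nu>))" for \<tau>
    unfolding g_def using cmod_sum_mult_le[of \<nu> "cgrad \<phi> (y + \<tau> *\<^sub>R \<nu>)"] \<nu> by simp
  have d: "((\<lambda>\<tau>. \<phi> (y + \<tau> *\<^sub>R \<nu>)) has_vector_derivative g \<tau>) (at \<tau> within A)" for \<tau> A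
  proof -
    have l: "((\<lambda>\<tau>. y + \<tau> *\<^sub>R \<nu>) has_derivative (\<lambda>t. t *\<^sub>R \<nu>)) (at \<tau>)"
      by (auto intro!: derivative_eq_intros)
    have "((\<lambda>\<tau>. \<phi> (y + \<tau> *\<^sub>R \<nu>)) has_derivative (\<lambda>t. \<Sum>i\<in>UNIV. of_real ((t *\<^sub>R \<nu>) $ i) * cgrad \<phi> (y + \<tau> *\<^sub>R \<nu>) $ i)) (at \<tau>)"
      by (rule has_derivative_compose[OF l C1_fun_has_derivative(1)[OF \<phi>]])
    moreover have "(\<Sum>i\<in>UNIV. of_real ((t *\<^sub>R \<nu>) $ i) * cgrad \<phi> (y + \<tau> *\<^sub>R \<nu>) $ i) = t *\<^sub>R g \<tau>" for t
      by (simp only: scaleR_conv_of_real[of t "g \<tau>"]) (simp add: g_def sum_distrib_left mult.assoc)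
    ultimately show ?thesis
      unfolding has_vector_derivative_def by (simp add: has_derivative_at_withinI)
  qed
  have "(LINT \<tau>|lborel. indicator {-T..0} \<tau> *\<^sub>R g \<tau>) = \<phi> (y + 0 *\<^sub>R \<nu>) - \<phi> (y + (-T) *\<^sub>R \<nu>)"
    by (rule integral_FTC_atLeastAtMost) (use T d continuous_on_subset[OF gc] in auto)
  moreover have "y + (-T) *\<^sub>R \<nu> = foot y" by (simp add: foot_def T_def)
  ultimately have eq: "\<phi> y - \<phi> (foot y) = (LINT \<tau>|lborel. indicator {-T..0} \<tau> *\<^sub>R g \<tau>)" by simp
  have int: "integrable lborel (\<lambda>\<tau>. indicator {-T..0} \<tau> *\<^sub>R g \<tau>)"
    by (rule borel_integrable_compact) (auto intro: continuous_on_subset[OF gc])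
  have "ennreal (cmod (\<phi> y - \<phi> (foot y))) \<le> (\<integral>\<^sup>+\<tau>. ennreal (norm (indicator {-T..0} \<tau> *\<^sub>R g \<tau>)) \<partial>lborel)"
    unfolding eq by (rule integral_norm_bound_ennreal[OF int])
  also have "\<dots> \<le> (\<integral>\<^sup>+\<tau>. indicator {-T..0} \<tau> * (indicator {-T..0} \<tau> * ennreal (norm (cgrad \<phi> (y + \<tau> *\<^sub>R \<nu>)))) \<partial>lborel)"
    by (intro nn_integral_mono) (auto simp: indicator_def g_le intro!: ennreal_leI)
  finally have "(ennreal (cmod (\<phi> y - \<phi> (foot y))))\<^sup>2 \<le> (\<integral>\<^sup>+\<tau>. indicator {-T..0} \<tau> * (indicator {-T..0} \<tau> * ennreal (norm (cgrad \<phi> (y + \<tau> *\<^sub>R \<nu>)))) \<partial>lborel)\<^sup>2"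
    by (rule power_mono) simp
  also have "\<dots> \<le> (\<integral>\<^sup>+\<tau>. (indicator {-T..0} \<tau>)\<^sup>2 \<partial>lborel) * (\<integral>\<^sup>+\<tau>. (indicator {-T..0} \<tau> * ennreal (norm (cgrad \<phi> (y + \<tau> *\<^sub>R \<nu>))))\<^sup>2 \<partial>lborel)"
    by (rule Cauchy_Schwarz_nn_integral) measurable
  also have "\<dots> \<le> ennreal h * ?I"
  proof (intro mult_mono)
    have "(\<integral>\<^sup>+\<tau>. (indicator {-T..0} \<tau>)\<^sup>2 \<partial>lborel) = (\<integral>\<^sup>+\<tau>. indicator {-T..0} \<tau> \<partial>lborel)"
      by (intro nn_integral_cong) (auto simp: indicator_def)
    also have "\<dots> = ennreal T" using T by simp
    finally show "(\<integral>\<^sup>+\<tau>. (indicator {-T..0} \<tau>)\<^sup>2 \<partial>lborel) \<le> ennreal h" using T by (simp add: ennreal_leI)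
    \<comment> \<open>The endpoints are discarded: the lower one gives a point of the graph, outside
      \<open>W\<close>, and the upper one lies outside the open interval.\<close>
    have "AE \<tau> in lborel. \<tau> \<noteq> -T" "AE \<tau> in lborel. \<tau> \<noteq> (0::real)" by (rule AE_lborel_singleton)+
    then show "(\<integral>\<^sup>+\<tau>. (indicator {-T..0} \<tau> * ennreal (norm (cgrad \<phi> (y + \<tau> *\<^sub>R \<nu>))))\<^sup>2 \<partial>lborel) \<le> ?I"
    proof (intro nn_integral_mono_AE, eventually_elim)
      case (elim \<tau>)
      show ?case
      proof (cases "\<tau> \<in> {-T..0}")
        case True
        then have \<tau>: "-T < \<tau>" "\<tau> < 0" using elim by auto
        have "y + \<tau> *\<^sub>R \<nu> \<in> W" using y \<tau> T by (simp add: W_def ht_shift foot_shift T_def)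
        then show ?thesis using \<tau> T by (simp add: indicator_def ennreal_power)
      qed simp
    qed
  qed auto
  finally have inc: "ennreal ((cmod (\<phi> y - \<phi> (foot y)))\<^sup>2) \<le> ennreal h * ?I" by (simp add: ennreal_power)
  have "cmod (\<phi> (foot y)) \<le> cmod (\<phi> y) + cmod (\<phi> y - \<phi> (foot y))"
    by (metis norm_minus_commute norm_triangle_sub)
  then have "(cmod (\<phi> (foot y)))\<^sup>2 \<le> (cmod (\<phi> y) + cmod (\<phi> y - \<phi> (foot y)))\<^sup>2" by (intro power_mono) auto
  also have "\<dots> \<le> 2 * (cmod (\<phi> y))\<^sup>2 + 2 * (cmod (\<phi> y - \<phi> (foot y)))\<^sup>2"
    using sum_squares_bound[of "cmod (\<phi> y)" "cmod (\<phi> y - \<phi> (foot y))"] by (simp add: power2_sum)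
  finally have "ennreal ((cmod (\<phi> (foot y)))\<^sup>2) \<le> ennreal (2 * (cmod (\<phi> y))\<^sup>2 + 2 * (cmod (\<phi> y - \<phi> (foot y)))\<^sup>2)"
    by (rule ennreal_leI)
  also have "\<dots> = ennreal (2 * (cmod (\<phi> y))\<^sup>2) + ennreal 2 * ennreal ((cmod (\<phi> y - \<phi> (foot y)))\<^sup>2)"
    by (subst ennreal_plus) (auto simp: ennreal_mult)
  also have "\<dots> \<le> ennreal (2 * (cmod (\<phi> y))\<^sup>2) + ennreal 2 * (ennreal h * ?I)"
    by (intro add_left_mono mult_left_mono inc) simp
  also have "ennreal 2 * (ennreal h * ?I) = ennreal (2 * h) * ?I"
    using h by (subst ennreal_mult) (auto simp: mult.assoc)
  finally show ?thesis .
qed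

text \<open>After the integrals of \<open>foot_increment\<close> are exchanged, translation
  invariance frees the integral over \<open>y\<close> from \<tau>, so that the integral over \<tau>
  contributes another factor \<open>h\<close>.\<close>

lemma nn_integral_\<mu>_C1_le:
  assumes \<phi>: "C1_fun \<phi>"
  shows "(\<integral>\<^sup>+x. ennreal ((cmod (\<phi> x))\<^sup>2) \<partial>\<mu>) \<le>
    ennreal 2 * (\<integral>\<^sup>+y. ennreal ((cmod (\<phi> y))\<^sup>2) \<partial>M\<Omega>) + ennreal (2 * h\<^sup>2) * (\<integral>\<^sup>+y. ennreal ((norm (cgrad \<phi> y))\<^sup>2) \<partial>M\<Omega>)"
proof -
  have [measurable]: "\<phi> \<in> borel_measurable borel" "cgrad \<phi> \<in> borel_measurable borel"
    using \<phi> by (auto intro!: borel_measurable_continuous_onI C1_fun_continuous C1_fun_has_derivative(2))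
  let ?G = "\<lambda>y. indicator W y * ennreal ((norm (cgrad \<phi> y))\<^sup>2)"
  have "(\<integral>\<^sup>+x. ennreal ((cmod (\<phi> x))\<^sup>2) \<partial>\<mu>) = (\<integral>\<^sup>+y. indicator W y * ennreal ((cmod (\<phi> (foot y)))\<^sup>2) \<partial>lborel)"
    by (rule nn_integral_\<mu>) measurable
  also have "\<dots> \<le> (\<integral>\<^sup>+y. ennreal 2 * (indicator W y * ennreal ((cmod (\<phi> y))\<^sup>2))
       + ennreal (2 * h) * (\<integral>\<^sup>+\<tau>. indicator {-h<..<0} \<tau> * ?G (y + \<tau> *\<^sub>R \<nu>) \<partial>lborel) \<partial>lborel)"
  proof (rule nn_integral_mono)
    fix y
    show "indicator W y * ennreal ((cmod (\<phi> (foot y)))\<^sup>2) \<le> ennreal 2 * (indicator W y * ennreal ((cmod (\<phi> y))\<^sup>2))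
       + ennreal (2 * h) * (\<integral>\<^sup>+\<tau>. indicator {-h<..<0} \<tau> * ?G (y + \<tau> *\<^sub>R \<nu>) \<partial>lborel)"
    proof (cases "y \<in> W")
      case True
      have "ennreal (2 * (cmod (\<phi> y))\<^sup>2) = ennreal 2 * ennreal ((cmod (\<phi> y))\<^sup>2)" by (simp add: ennreal_mult)
      then show ?thesis using foot_increment[OF \<phi> True] True by simp
    qed simp
  qed
  also have "\<dots> = (\<integral>\<^sup>+y. ennreal 2 * (indicator W y * ennreal ((cmod (\<phi> y))\<^sup>2)) \<partial>lborel)
       + (\<integral>\<^sup>+y. ennreal (2 * h) * (\<integral>\<^sup>+\<tau>. indicator {-h<..<0} \<tau> * ?G (y + \<tau> *\<^sub>R \<nu>) \<partial>lborel) \<partial>lborel)"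
    by (rule nn_integral_add) measurable
  also have "(\<integral>\<^sup>+y. ennreal 2 * (indicator W y * ennreal ((cmod (\<phi> y))\<^sup>2)) \<partial>lborel) = ennreal 2 * (\<integral>\<^sup>+y. indicator W y * ennreal ((cmod (\<phi> y))\<^sup>2) \<partial>lborel)"
    by (rule nn_integral_cmult) measurable
  also have "(\<integral>\<^sup>+y. ennreal (2 * h) * (\<integral>\<^sup>+\<tau>. indicator {-h<..<0} \<tau> * ?G (y + \<tau> *\<^sub>R \<nu>) \<partial>lborel) \<partial>lborel)
      = ennreal (2 * h) * (\<integral>\<^sup>+y. (\<integral>\<^sup>+\<tau>. indicator {-h<..<0} \<tau> * ?G (y + \<tau> *\<^sub>R \<nu>) \<partial>lborel) \<partial>lborel)"
    by (rule nn_integral_cmult) measurable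
  also have "(\<integral>\<^sup>+y. (\<integral>\<^sup>+\<tau>. indicator {-h<..<0} \<tau> * ?G (y + \<tau> *\<^sub>R \<nu>) \<partial>lborel) \<partial>lborel)
      = (\<integral>\<^sup>+\<tau>. (\<integral>\<^sup>+y. indicator {-h<..<0} \<tau> * ?G (y + \<tau> *\<^sub>R \<nu>) \<partial>lborel) \<partial>lborel)"
    by (rule lborel_pair.Fubini') measurable
  also have "\<dots> = (\<integral>\<^sup>+\<tau>. indicator {-h<..<0} \<tau> * (\<integral>\<^sup>+y. ?G y \<partial>lborel) \<partial>lborel)"
  proof (rule nn_integral_cong)
    fix \<tau> :: real
    have "(\<integral>\<^sup>+y. indicator {-h<..<0} \<tau> * ?G (y + \<tau> *\<^sub>R \<nu>) \<partial>lborel) = indicator {-h<..<0} \<tau> * (\<integral>\<^sup>+y. ?G (y + \<tau> *\<^sub>R \<nu>) \<partial>lborel)"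
      by (rule nn_integral_cmult) measurable
    also have "(\<integral>\<^sup>+y. ?G (y + \<tau> *\<^sub>R \<nu>) \<partial>lborel) = (\<integral>\<^sup>+y. ?G y \<partial>lborel)"
      by (rule nn_integral_lborel_translate) measurable
    finally show "(\<integral>\<^sup>+y. indicator {-h<..<0} \<tau> * ?G (y + \<tau> *\<^sub>R \<nu>) \<partial>lborel) = indicator {-h<..<0} \<tau> * (\<integral>\<^sup>+y. ?G y \<partial>lborel)" .
  qed
  also have "\<dots> = (\<integral>\<^sup>+\<tau>. indicator {-h<..<(0::real)} \<tau> \<partial>lborel) * (\<integral>\<^sup>+y. ?G y \<partial>lborel)"
    by (rule nn_integral_multc) measurable
  also have "(\<integral>\<^sup>+\<tau>. indicator {-h<..<(0::real)} \<tau> \<partial>lborel) = ennreal h" using h by simp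
  also have "ennreal (2 * h) * (ennreal h * (\<integral>\<^sup>+y. ?G y \<partial>lborel)) = ennreal (2 * h\<^sup>2) * (\<integral>\<^sup>+y. ?G y \<partial>lborel)"
    using h by (simp add: mult.assoc[symmetric] ennreal_mult[symmetric] power2_eq_square)
  also have "ennreal 2 * (\<integral>\<^sup>+y. indicator W y * ennreal ((cmod (\<phi> y))\<^sup>2) \<partial>lborel) + ennreal (2 * h\<^sup>2) * (\<integral>\<^sup>+y. ?G y \<partial>lborel)
     \<le> ennreal 2 * (\<integral>\<^sup>+y. ennreal ((cmod (\<phi> y))\<^sup>2) \<partial>M\<Omega>) + ennreal (2 * h\<^sup>2) * (\<integral>\<^sup>+y. ennreal ((norm (cgrad \<phi> y))\<^sup>2) \<partial>M\<Omega>)"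
  proof -
    have W\<Omega>: "(\<integral>\<^sup>+y. indicator W y * f y \<partial>lborel) \<le> (\<integral>\<^sup>+y. f y \<partial>M\<Omega>)" if "f \<in> borel_measurable borel" for f :: "real^'n \<Rightarrow> ennreal"
      unfolding nn_integral_lebesgue_on[OF open_\<Omega> that]
      using W_subset by (intro nn_integral_mono) (auto simp: indicator_def)
    show ?thesis by (intro add_mono mult_left_mono W\<Omega>) auto
  qed
  finally show ?thesis .
qed

lemma local_trace_inequality:
  assumes n: "CARD('n) \<ge> 2"
  shows "\<exists>K\<ge>0. \<forall>\<phi>. C1_fun \<phi> \<longrightarrow>
    (\<integral>\<^sup>+x. indicator (ball x0 h) x * ennreal ((cmod (\<phi> x))\<^sup>2) \<partial>surface_measure \<Omega>) \<le> ennreal (K * (H1_norm \<Omega> \<phi>)\<^sup>2)"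
proof (intro exI conjI allI impI)
  \<comment> \<open>\<open>ennreal\<close> truncates at 0, so \<open>max Kh 0\<close> is an upper
    bound whatever the sign of \<open>Kh\<close>.\<close>
  let ?K = "max Kh 0 * (2 + 2 * h\<^sup>2)"
  show "0 \<le> ?K" by simp
  fix \<phi> :: "real^'n \<Rightarrow> complex" assume \<phi>: "C1_fun \<phi>"
  have [measurable]: "\<phi> \<in> borel_measurable borel" by (intro borel_measurable_continuous_onI C1_fun_continuous \<phi>)
  note w = wg_C1[OF \<phi>]
  have H: "(H1_norm \<Omega> \<phi>)\<^sup>2 = (l2 M\<Omega> \<phi>)\<^sup>2 + (l2 M\<Omega> (cgrad \<phi>))\<^sup>2" by (simp add: H1_norm_wg[OF w])
  have "(\<integral>\<^sup>+x. indicator (ball x0 h) x * ennreal ((cmod (\<phi> x))\<^sup>2) \<partial>surface_measure \<Omega>) \<le> ennreal Kh * (\<integral>\<^sup>+x. ennreal ((cmod (\<phi> x))\<^sup>2) \<partial>\<mu>)"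
    by (rule nn_integral_surface_le[OF n]) measurable
  also have "\<dots> \<le> ennreal Kh * (ennreal 2 * (\<integral>\<^sup>+y. ennreal ((cmod (\<phi> y))\<^sup>2) \<partial>M\<Omega>) + ennreal (2 * h\<^sup>2) * (\<integral>\<^sup>+y. ennreal ((norm (cgrad \<phi> y))\<^sup>2) \<partial>M\<Omega>))"
    by (intro mult_left_mono nn_integral_\<mu>_C1_le \<phi>) simp
  also have "\<dots> = ennreal Kh * ennreal (2 * (l2 M\<Omega> \<phi>)\<^sup>2 + 2 * h\<^sup>2 * (l2 M\<Omega> (cgrad \<phi>))\<^sup>2)"
    unfolding l2_nn[OF wg_D(1)[OF w]] l2_nn[OF wg_D(2)[OF w]] by (simp add: ennreal_mult ennreal_plus)
  also have "\<dots> \<le> ennreal (max Kh 0) * ennreal ((2 + 2 * h\<^sup>2) * (H1_norm \<Omega> \<phi>)\<^sup>2)"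
  proof (intro mult_mono ennreal_leI)
    have "2 * (l2 M\<Omega> \<phi>)\<^sup>2 \<le> (2 + 2 * h\<^sup>2) * (l2 M\<Omega> \<phi>)\<^sup>2" "2 * h\<^sup>2 * (l2 M\<Omega> (cgrad \<phi>))\<^sup>2 \<le> (2 + 2 * h\<^sup>2) * (l2 M\<Omega> (cgrad \<phi>))\<^sup>2"
      by (intro mult_right_mono; simp)+
    then show "2 * (l2 M\<Omega> \<phi>)\<^sup>2 + 2 * h\<^sup>2 * (l2 M\<Omega> (cgrad \<phi>))\<^sup>2 \<le> (2 + 2 * h\<^sup>2) * (H1_norm \<Omega> \<phi>)\<^sup>2"
      unfolding H by (simp only: distrib_left)
  qed auto
  also have "\<dots> = ennreal (?K * (H1_norm \<Omega> \<phi>)\<^sup>2)"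
    by (subst ennreal_mult[symmetric]) (auto simp: mult.assoc)
  finally show "(\<integral>\<^sup>+x. indicator (ball x0 h) x * ennreal ((cmod (\<phi> x))\<^sup>2) \<partial>surface_measure \<Omega>) \<le> ennreal (?K * (H1_norm \<Omega> \<phi>)\<^sup>2)" .
qed

end

section \<open>The global trace inequality and the trace of an H1 function\<close>

locale lip_dom =
  fixes \<Omega> :: "(real^'n) set"
  assumes lipschitz_domain: "bounded_lipschitz_domain \<Omega>" and dim: "CARD('n) \<ge> 2"
begin

sublocale bounded_open \<Omega>
  using lipschitz_domain by unfold_locales (auto simp: bounded_lipschitz_domain_def)

abbreviation "dS \<equiv> surface_measure \<Omega>"

lemma chart_exists:
  assumes "x0 \<in> frontier \<Omega>"
  shows "\<exists>\<nu> L r \<gamma>. lip_chart \<Omega> \<nu> x0 L r \<gamma>"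
proof -
  obtain r \<nu> L \<gamma> where "0 < r" "norm \<nu> = 1" "L-lipschitz_on {z. z \<bullet> \<nu> = 0} \<gamma>"
    "\<Omega> \<inter> ball x0 r = {y \<in> ball x0 r. \<gamma> (y - (y \<bullet> \<nu>) *\<^sub>R \<nu>) < y \<bullet> \<nu>}"
    using lipschitz_domain assms unfolding bounded_lipschitz_domain_def by blast
  then have "lip_chart \<Omega> \<nu> x0 L r \<gamma>"
    by (intro lip_chart.intro lip_chart_axioms.intro bounded_open_axioms)
  then show ?thesis by blast
qed

text \<open>At boundary points the direction of the shift is a multiple of the chart axis \<nu>; at
  interior points a small centred ball already lies in \<Omega>, so the shift is 0.\<close>

lemma approximable_H1:
  assumes "v \<in> H1 \<Omega>" shows "approximable v"
proof (rule approximable_of_charts[OF _ assms])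
  fix x0 assume x0: "x0 \<in> closure \<Omega>"
  show "\<exists>\<rho>>0. \<exists>\<epsilon>0>0. \<exists>d. \<forall>x\<in>\<Omega> \<inter> ball x0 (2 * \<rho>). \<forall>\<epsilon>. 0 < \<epsilon> \<longrightarrow> \<epsilon> < \<epsilon>0 \<longrightarrow> cball (x + \<epsilon> *\<^sub>R d) \<epsilon> \<subseteq> \<Omega>"
  proof (cases "x0 \<in> \<Omega>")
    case True
    then obtain r where r: "r > 0" "ball x0 r \<subseteq> \<Omega>" using open_\<Omega> open_contains_ball by blast
    have "cball (x + \<epsilon> *\<^sub>R 0) \<epsilon> \<subseteq> \<Omega>" if "x \<in> \<Omega> \<inter> ball x0 (2 * (r/4))" "0 < \<epsilon>" "\<epsilon> < r / 2" for x \<epsilon>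
    proof
      fix y assume "y \<in> cball (x + \<epsilon> *\<^sub>R 0) \<epsilon>"
      then have "dist x y \<le> \<epsilon>" by simp
      then have "dist x0 y < r" using that dist_triangle[of x0 y x] by simp
      then show "y \<in> \<Omega>" using r(2) by (simp add: subset_eq)
    qed
    then show ?thesis using r(1) by (intro exI[of _ "r/4"] exI[of _ "r/2"] exI[of _ 0] conjI ballI allI impI) simp_all
  next
    case False
    then have "x0 \<in> frontier \<Omega>" using x0 open_\<Omega> by (simp add: frontier_def interior_open)
    then obtain \<nu> L r \<gamma> where c: "lip_chart \<Omega> \<nu> x0 L r \<gamma>" using chart_exists by blast
    interpret c: lip_chart \<Omega> \<nu> x0 L r \<gamma> by (rule c)
    have "r / 4 > 0" "r / (2 * (L + 3)) > 0" using c.r c.L by simp_all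
    then show ?thesis
      using c.shifted_ball by (intro exI[of _ "r/4"] exI[of _ "r / (2 * (L + 3))"] exI[of _ "(L + 2) *\<^sub>R \<nu>"] conjI ballI allI impI) simp_all
  qed
qed

text \<open>Compactness of the boundary reduces the estimate to finitely many charts; overlaps of
  the balls only enlarge the sum.\<close>

lemma trace_inequality_nn:
  "\<exists>K\<ge>0. \<forall>\<phi>. C1_fun \<phi> \<longrightarrow> (\<integral>\<^sup>+x. ennreal ((cmod (\<phi> x))\<^sup>2) \<partial>dS) \<le> ennreal (K * (H1_norm \<Omega> \<phi>)\<^sup>2)"
proof -
  have "\<forall>x0\<in>frontier \<Omega>. \<exists>r K. r > 0 \<and> K \<ge> 0 \<and> (\<forall>\<phi>. C1_fun \<phi> \<longrightarrow>
    (\<integral>\<^sup>+x. indicator (ball x0 r) x * ennreal ((cmod (\<phi> x))\<^sup>2) \<partial>dS) \<le> ennreal (K * (H1_norm \<Omega> \<phi>)\<^sup>2))"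
  proof
    fix x0 assume "x0 \<in> frontier \<Omega>"
    then obtain \<nu> L r \<gamma> where c: "lip_chart \<Omega> \<nu> x0 L r \<gamma>" using chart_exists by blast
    interpret c: lip_chart \<Omega> \<nu> x0 L r \<gamma> by (rule c)
    show "\<exists>r K. r > 0 \<and> K \<ge> 0 \<and> (\<forall>\<phi>. C1_fun \<phi> \<longrightarrow>
      (\<integral>\<^sup>+x. indicator (ball x0 r) x * ennreal ((cmod (\<phi> x))\<^sup>2) \<partial>dS) \<le> ennreal (K * (H1_norm \<Omega> \<phi>)\<^sup>2))"
      using c.h c.local_trace_inequality[OF dim] by blast
  qed
  from bchoice[OF this] obtain r where "\<forall>x0\<in>frontier \<Omega>. \<exists>K. r x0 > 0 \<and> K \<ge> 0 \<and> (\<forall>\<phi>. C1_fun \<phi> \<longrightarrow>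
    (\<integral>\<^sup>+x. indicator (ball x0 (r x0)) x * ennreal ((cmod (\<phi> x))\<^sup>2) \<partial>dS) \<le> ennreal (K * (H1_norm \<Omega> \<phi>)\<^sup>2))" ..
  from bchoice[OF this] obtain K where K: "\<forall>x0\<in>frontier \<Omega>. r x0 > 0 \<and> K x0 \<ge> 0 \<and> (\<forall>\<phi>. C1_fun \<phi> \<longrightarrow>
    (\<integral>\<^sup>+x. indicator (ball x0 (r x0)) x * ennreal ((cmod (\<phi> x))\<^sup>2) \<partial>dS) \<le> ennreal (K x0 * (H1_norm \<Omega> \<phi>)\<^sup>2))" ..
  have "compact (frontier \<Omega>)" using bounded_\<Omega> by (rule compact_frontier_bounded)
  moreover have "frontier \<Omega> \<subseteq> (\<Union>x0\<in>frontier \<Omega>. ball x0 (r x0))"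
  proof
    fix x assume x: "x \<in> frontier \<Omega>"
    then have "x \<in> ball x (r x)" using K by simp
    with x show "x \<in> (\<Union>x0\<in>frontier \<Omega>. ball x0 (r x0))" by blast
  qed
  ultimately obtain F where F: "F \<subseteq> frontier \<Omega>" "finite F" "frontier \<Omega> \<subseteq> (\<Union>x0\<in>F. ball x0 (r x0))"
    using compactE_image[of "frontier \<Omega>" "frontier \<Omega>" "\<lambda>x0. ball x0 (r x0)"] by blast
  show ?thesis
  proof (intro exI conjI allI impI)
    show "0 \<le> (\<Sum>x0\<in>F. K x0)" using K F(1) by (intro sum_nonneg) blast
    fix \<phi> :: "real^'n \<Rightarrow> complex" assume \<phi>: "C1_fun \<phi>"
    have m: "\<phi> \<in> borel_measurable borel" by (intro borel_measurable_continuous_onI C1_fun_continuous \<phi>)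
    note [measurable] = m
    have m1: "(\<lambda>x. ennreal ((cmod (\<phi> x))\<^sup>2)) \<in> borel_measurable borel" by measurable
    have m': "(\<lambda>x. indicator (ball x0 (r x0)) x * ennreal ((cmod (\<phi> x))\<^sup>2)) \<in> borel_measurable dS" for x0
      by (intro borel_measurable_surfaceI borel_measurable_times_ennreal borel_measurable_indicator m1) simp
    have "(\<integral>\<^sup>+x. ennreal ((cmod (\<phi> x))\<^sup>2) \<partial>dS) \<le> (\<integral>\<^sup>+x. (\<Sum>x0\<in>F. indicator (ball x0 (r x0)) x * ennreal ((cmod (\<phi> x))\<^sup>2)) \<partial>dS)"
    proof (rule nn_integral_mono)
      fix x assume "x \<in> space dS"
      then obtain x0 where x0: "x0 \<in> F" "x \<in> ball x0 (r x0)" using F(3) by auto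
      then have "ennreal ((cmod (\<phi> x))\<^sup>2) = (\<Sum>x0\<in>{x0}. indicator (ball x0 (r x0)) x * ennreal ((cmod (\<phi> x))\<^sup>2))" by simp
      also have "\<dots> \<le> (\<Sum>x0\<in>F. indicator (ball x0 (r x0)) x * ennreal ((cmod (\<phi> x))\<^sup>2))"
        using x0 F(2) by (intro sum_mono2) auto
      finally show "ennreal ((cmod (\<phi> x))\<^sup>2) \<le> (\<Sum>x0\<in>F. indicator (ball x0 (r x0)) x * ennreal ((cmod (\<phi> x))\<^sup>2))" .
    qed
    also have "\<dots> = (\<Sum>x0\<in>F. \<integral>\<^sup>+x. indicator (ball x0 (r x0)) x * ennreal ((cmod (\<phi> x))\<^sup>2) \<partial>dS)"
      by (rule nn_integral_sum) (rule m')
    also have "\<dots> \<le> (\<Sum>x0\<in>F. ennreal (K x0 * (H1_norm \<Omega> \<phi>)\<^sup>2))"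
    proof (rule sum_mono)
      fix x0 assume "x0 \<in> F"
      then have "x0 \<in> frontier \<Omega>" using F(1) by blast
      with K \<phi> show "(\<integral>\<^sup>+x. indicator (ball x0 (r x0)) x * ennreal ((cmod (\<phi> x))\<^sup>2) \<partial>dS) \<le> ennreal (K x0 * (H1_norm \<Omega> \<phi>)\<^sup>2)"
        by simp
    qed
    also have "\<dots> = ennreal (\<Sum>x0\<in>F. K x0 * (H1_norm \<Omega> \<phi>)\<^sup>2)"
      using K F(1) by (intro sum_ennreal) (simp add: subset_eq)
    also have "(\<Sum>x0\<in>F. K x0 * (H1_norm \<Omega> \<phi>)\<^sup>2) = (\<Sum>x0\<in>F. K x0) * (H1_norm \<Omega> \<phi>)\<^sup>2"
      by (rule sum_distrib_right[symmetric])
    finally show "(\<integral>\<^sup>+x. ennreal ((cmod (\<phi> x))\<^sup>2) \<partial>dS) \<le> ennreal ((\<Sum>x0\<in>F. K x0) * (H1_norm \<Omega> \<phi>)\<^sup>2)" .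
  qed
qed

definition "Ktr = (SOME K. 0 \<le> K \<and> (\<forall>\<phi>. C1_fun \<phi> \<longrightarrow> \<phi> \<in> L2 dS \<and> l2 dS \<phi> \<le> K * H1_norm \<Omega> \<phi>))"

lemma
  shows Ktr_nonneg: "0 \<le> Ktr"
    and L2_dS_C1: "C1_fun \<phi> \<Longrightarrow> \<phi> \<in> L2 dS"
    and trace_inequality: "C1_fun \<phi> \<Longrightarrow> l2 dS \<phi> \<le> Ktr * H1_norm \<Omega> \<phi>"
proof -
  obtain K where K: "K \<ge> 0" "\<And>\<phi>. C1_fun \<phi> \<Longrightarrow> (\<integral>\<^sup>+x. ennreal ((cmod (\<phi> x))\<^sup>2) \<partial>dS) \<le> ennreal (K * (H1_norm \<Omega> \<phi>)\<^sup>2)"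
    using trace_inequality_nn by blast
  have "\<exists>K\<ge>0. \<forall>\<phi>. C1_fun \<phi> \<longrightarrow> \<phi> \<in> L2 dS \<and> l2 dS \<phi> \<le> K * H1_norm \<Omega> \<phi>"
  proof (intro exI[of _ "sqrt K"] conjI allI impI)
    fix \<phi> :: "real^'n \<Rightarrow> complex" assume \<phi>: "C1_fun \<phi>"
    have m: "\<phi> \<in> borel_measurable dS"
      by (intro borel_measurable_surfaceI borel_measurable_continuous_onI C1_fun_continuous \<phi>)
    show "\<phi> \<in> L2 dS" by (rule L2_nn_I(1)[OF m K(2)[OF \<phi>]])
    have "0 \<le> K * (H1_norm \<Omega> \<phi>)\<^sup>2" using K(1) by simp
    from L2_nn_I(2)[OF m K(2)[OF \<phi>] this] show "l2 dS \<phi> \<le> sqrt K * H1_norm \<Omega> \<phi>"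
      by (simp add: real_sqrt_mult)
  qed (use K(1) in simp)
  from someI_ex[OF this]
  have "0 \<le> Ktr \<and> (\<forall>\<phi>. C1_fun \<phi> \<longrightarrow> \<phi> \<in> L2 dS \<and> l2 dS \<phi> \<le> Ktr * H1_norm \<Omega> \<phi>)"
    unfolding Ktr_def .
  then show "0 \<le> Ktr" "C1_fun \<phi> \<Longrightarrow> \<phi> \<in> L2 dS" "C1_fun \<phi> \<Longrightarrow> l2 dS \<phi> \<le> Ktr * H1_norm \<Omega> \<phi>"
    by blast+
qed

lemma has_trace_iff:
  "has_trace \<Omega> v g \<longleftrightarrow> g \<in> L2 dS \<and> (\<exists>\<phi>. (\<forall>k::nat. C1_fun (\<phi> k)) \<and>
    (\<lambda>k. H1_norm \<Omega> (\<lambda>x. \<phi> k x - v x)) \<longlonglongrightarrow> 0 \<and> (\<lambda>k. l2 dS (\<lambda>x. \<phi> k x - g x)) \<longlonglongrightarrow> 0)"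
proof -
  have "(\<lambda>k. (l2 dS (\<lambda>x. \<phi> k x - g x))\<^sup>2) \<longlonglongrightarrow> 0 \<longleftrightarrow> (\<lambda>k. l2 dS (\<lambda>x. \<phi> k x - g x)) \<longlonglongrightarrow> 0" for \<phi> :: "nat \<Rightarrow> real^'n \<Rightarrow> complex"
    by simp
  then show ?thesis unfolding has_trace_def l2_sq by simp
qed

lemma H1_C1: "C1_fun \<phi> \<Longrightarrow> \<phi> \<in> H1 \<Omega>"
  using wg_C1 wg_D(3) by blast

text \<open>The trace inequality turns a sequence of C1 functions that converges in H1 into a Cauchy
  sequence on the boundary.\<close>

lemma has_trace_exists:
  assumes v: "v \<in> H1 \<Omega>"
  shows "\<exists>g. has_trace \<Omega> v g"
proof -
  have "\<exists>\<phi>. C1_fun \<phi> \<and> H1_norm \<Omega> (\<lambda>x. \<phi> x - v x) < inverse (real (Suc k))" for k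
    using approximable_H1[OF v] unfolding approximable_def by simp
  then have "\<forall>k. \<exists>\<phi>. C1_fun \<phi> \<and> H1_norm \<Omega> (\<lambda>x. \<phi> x - v x) < inverse (real (Suc k))" by blast
  from choice[OF this] obtain \<phi> where \<phi>: "\<And>k. C1_fun (\<phi> k)" "\<And>k. H1_norm \<Omega> (\<lambda>x. \<phi> k x - v x) < inverse (real (Suc k))"
    by blast
  have lim: "(\<lambda>k. H1_norm \<Omega> (\<lambda>x. \<phi> k x - v x)) \<longlonglongrightarrow> 0"
  proof (rule Lim_null_comparison[OF _ LIMSEQ_inverse_real_of_nat], rule always_eventually, rule allI)
    show "norm (H1_norm \<Omega> (\<lambda>x. \<phi> k x - v x)) \<le> inverse (real (Suc k))" for k
      using \<phi>(2)[of k] by simp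
  qed
  have le: "l2 dS (\<lambda>x. \<phi> m x - \<phi> n x) \<le> Ktr * (H1_norm \<Omega> (\<lambda>x. \<phi> m x - v x) + H1_norm \<Omega> (\<lambda>x. \<phi> n x - v x))" for m n
  proof -
    have "H1_norm \<Omega> (\<lambda>x. (\<phi> m x - v x) + (v x - \<phi> n x)) \<le> H1_norm \<Omega> (\<lambda>x. \<phi> m x - v x) + H1_norm \<Omega> (\<lambda>x. v x - \<phi> n x)"
      by (intro H1_norm_triangle H1_diff H1_C1 \<phi> v)
    moreover have "H1_norm \<Omega> (\<lambda>x. v x - \<phi> n x) = H1_norm \<Omega> (\<lambda>x. \<phi> n x - v x)"
      by (intro H1_norm_minus_commute H1_C1 \<phi> v)
    ultimately have "H1_norm \<Omega> (\<lambda>x. \<phi> m x - \<phi> n x) \<le> H1_norm \<Omega> (\<lambda>x. \<phi> m x - v x) + H1_norm \<Omega> (\<lambda>x. \<phi> n x - v x)"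
      by simp
    then show ?thesis
      using trace_inequality[OF C1_fun_diff[OF \<phi>(1) \<phi>(1)], of m n] mult_left_mono[OF _ Ktr_nonneg] order_trans by blast
  qed
  have "\<exists>g\<in>L2 dS. (\<lambda>k. l2 dS (\<lambda>x. \<phi> k x - g x)) \<longlonglongrightarrow> 0"
  proof (rule L2_complete)
    show "\<phi> n \<in> L2 dS" for n by (rule L2_dS_C1[OF \<phi>(1)])
    fix e :: real assume e: "e > 0"
    \<comment> \<open>Two tail terms, both multiplied by \<open>Ktr\<close>; the added 1 admits
      \<open>Ktr\<close> = 0.\<close>
    have pos: "e / (2 * (Ktr + 1)) > 0" using e Ktr_nonneg by simp
    from order_tendstoD(2)[OF lim pos] obtain N where N: "\<And>k. k \<ge> N \<Longrightarrow> H1_norm \<Omega> (\<lambda>x. \<phi> k x - v x) < e / (2 * (Ktr + 1))"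
      unfolding eventually_sequentially by blast
    show "\<exists>N. \<forall>m\<ge>N. \<forall>n\<ge>N. l2 dS (\<lambda>x. \<phi> m x - \<phi> n x) < e"
    proof (intro exI[of _ N] allI impI)
      fix m n assume mn: "m \<ge> N" "n \<ge> N"
      have "H1_norm \<Omega> (\<lambda>x. \<phi> m x - v x) + H1_norm \<Omega> (\<lambda>x. \<phi> n x - v x) \<le> e / (Ktr + 1)"
      proof -
        have "2 * (e / (2 * y)) = e / y" for y by simp
        from this[of "Ktr + 1"] show ?thesis
          using add_strict_mono[OF N[OF mn(1)] N[OF mn(2)]] unfolding mult_2 by (simp only: less_imp_le)
      qed
      then have "l2 dS (\<lambda>x. \<phi> m x - \<phi> n x) \<le> Ktr * (e / (Ktr + 1))"
        using le[of m n] mult_left_mono[OF _ Ktr_nonneg] order_trans by blast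
      also have "\<dots> < e" using e Ktr_nonneg by (simp add: field_simps)
      finally show "l2 dS (\<lambda>x. \<phi> m x - \<phi> n x) < e" .
    qed
  qed
  then show ?thesis using \<phi>(1) lim unfolding has_trace_iff by blast
qed

lemma has_trace_trace_on: "v \<in> H1 \<Omega> \<Longrightarrow> has_trace \<Omega> v (trace_on \<Omega> v)"
  unfolding trace_on_def by (rule someI_ex[OF has_trace_exists])

lemma has_trace_L2: "has_trace \<Omega> v g \<Longrightarrow> g \<in> L2 dS"
  by (simp add: has_trace_iff)

text \<open>The estimate for C1 functions passes to the limit along an approximating
  sequence.\<close>

lemma has_trace_bound:
  assumes g: "has_trace \<Omega> v g" and v: "v \<in> H1 \<Omega>"
  shows "l2 dS g \<le> Ktr * H1_norm \<Omega> v"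
proof -
  obtain \<phi> where \<phi>: "\<And>k::nat. C1_fun (\<phi> k)" "(\<lambda>k. H1_norm \<Omega> (\<lambda>x. \<phi> k x - v x)) \<longlonglongrightarrow> 0" "(\<lambda>k. l2 dS (\<lambda>x. \<phi> k x - g x)) \<longlonglongrightarrow> 0"
    using g unfolding has_trace_iff by blast
  have gL: "g \<in> L2 dS" by (rule has_trace_L2[OF g])
  have le: "l2 dS g \<le> l2 dS (\<lambda>x. \<phi> k x - g x) + Ktr * (H1_norm \<Omega> (\<lambda>x. \<phi> k x - v x) + H1_norm \<Omega> v)" for k
  proof -
    have "l2 dS g \<le> l2 dS (\<lambda>x. g x - \<phi> k x) + l2 dS (\<phi> k)"
      using l2_triangle[OF L2_diff[OF gL L2_dS_C1[OF \<phi>(1)[of k]]] L2_dS_C1[OF \<phi>(1)[of k]]] by simp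
    moreover have "l2 dS (\<lambda>x. g x - \<phi> k x) = l2 dS (\<lambda>x. \<phi> k x - g x)" by (rule l2_minus_commute)
    moreover have "H1_norm \<Omega> (\<phi> k) \<le> H1_norm \<Omega> (\<lambda>x. \<phi> k x - v x) + H1_norm \<Omega> v"
      using H1_norm_triangle[OF H1_diff[OF H1_C1[OF \<phi>(1)[of k]] v] v] by simp
    ultimately show ?thesis
      using trace_inequality[OF \<phi>(1)[of k]] mult_left_mono[of "H1_norm \<Omega> (\<phi> k)" _ Ktr, OF _ Ktr_nonneg] by fastforce
  qed
  have "(\<lambda>k. l2 dS (\<lambda>x. \<phi> k x - g x) + Ktr * (H1_norm \<Omega> (\<lambda>x. \<phi> k x - v x) + H1_norm \<Omega> v)) \<longlonglongrightarrow> 0 + Ktr * (0 + H1_norm \<Omega> v)"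
    by (intro tendsto_intros \<phi>)
  then show ?thesis using le by (intro LIMSEQ_le_const[where a = "l2 dS g"]) auto
qed

lemma has_trace_C1: "C1_fun \<phi> \<Longrightarrow> has_trace \<Omega> \<phi> \<phi>"
proof -
  assume \<phi>: "C1_fun \<phi>"
  have "H1_norm \<Omega> (\<lambda>x. 0) = 0"
    using H1_norm_cmult[OF H1_C1[OF \<phi>], of 0] by simp
  then show "has_trace \<Omega> \<phi> \<phi>"
    unfolding has_trace_iff using \<phi> L2_dS_C1[OF \<phi>] by (intro conjI exI[of _ "\<lambda>k. \<phi>"]) auto
qed

lemma has_trace_add:
  assumes g: "has_trace \<Omega> v g" "v \<in> H1 \<Omega>" and g': "has_trace \<Omega> w g'" "w \<in> H1 \<Omega>"
  shows "has_trace \<Omega> (\<lambda>x. v x + w x) (\<lambda>x. g x + g' x)"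
proof -
  obtain \<phi> where \<phi>: "\<And>k::nat. C1_fun (\<phi> k)" "(\<lambda>k. H1_norm \<Omega> (\<lambda>x. \<phi> k x - v x)) \<longlonglongrightarrow> 0" "(\<lambda>k. l2 dS (\<lambda>x. \<phi> k x - g x)) \<longlonglongrightarrow> 0"
    using g(1) unfolding has_trace_iff by blast
  obtain \<psi> where \<psi>: "\<And>k::nat. C1_fun (\<psi> k)" "(\<lambda>k. H1_norm \<Omega> (\<lambda>x. \<psi> k x - w x)) \<longlonglongrightarrow> 0" "(\<lambda>k. l2 dS (\<lambda>x. \<psi> k x - g' x)) \<longlonglongrightarrow> 0"
    using g'(1) unfolding has_trace_iff by blast
  note gL = has_trace_L2[OF g(1)] has_trace_L2[OF g'(1)]
  show ?thesis unfolding has_trace_iff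
  proof (intro conjI exI[of _ "\<lambda>k x. \<phi> k x + \<psi> k x"] allI)
    show "(\<lambda>x. g x + g' x) \<in> L2 dS" by (intro L2_add gL)
    show "C1_fun (\<lambda>x. \<phi> k x + \<psi> k x)" for k by (intro C1_fun_add \<phi> \<psi>)
    have "(\<lambda>k. H1_norm \<Omega> (\<lambda>x. \<phi> k x - v x) + H1_norm \<Omega> (\<lambda>x. \<psi> k x - w x)) \<longlonglongrightarrow> 0 + 0"
      by (intro tendsto_add \<phi> \<psi>)
    then have l1: "(\<lambda>k. H1_norm \<Omega> (\<lambda>x. \<phi> k x - v x) + H1_norm \<Omega> (\<lambda>x. \<psi> k x - w x)) \<longlonglongrightarrow> 0" by simp
    show "(\<lambda>k. H1_norm \<Omega> (\<lambda>x. \<phi> k x + \<psi> k x - (v x + w x))) \<longlonglongrightarrow> 0"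
    proof (rule Lim_null_comparison[OF _ l1], rule always_eventually, rule allI)
      fix k
      have "(\<lambda>x. \<phi> k x + \<psi> k x - (v x + w x)) = (\<lambda>x. (\<phi> k x - v x) + (\<psi> k x - w x))" by auto
      then show "norm (H1_norm \<Omega> (\<lambda>x. \<phi> k x + \<psi> k x - (v x + w x))) \<le> H1_norm \<Omega> (\<lambda>x. \<phi> k x - v x) + H1_norm \<Omega> (\<lambda>x. \<psi> k x - w x)"
        using H1_norm_triangle[OF H1_diff[OF H1_C1[OF \<phi>(1)] g(2)] H1_diff[OF H1_C1[OF \<psi>(1)] g'(2)], of k k] by simp
    qed
    have "(\<lambda>k. l2 dS (\<lambda>x. \<phi> k x - g x) + l2 dS (\<lambda>x. \<psi> k x - g' x)) \<longlonglongrightarrow> 0 + 0"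
      by (intro tendsto_add \<phi> \<psi>)
    then have l2: "(\<lambda>k. l2 dS (\<lambda>x. \<phi> k x - g x) + l2 dS (\<lambda>x. \<psi> k x - g' x)) \<longlonglongrightarrow> 0" by simp
    show "(\<lambda>k. l2 dS (\<lambda>x. \<phi> k x + \<psi> k x - (g x + g' x))) \<longlonglongrightarrow> 0"
    proof (rule Lim_null_comparison[OF _ l2], rule always_eventually, rule allI)
      fix k
      have "(\<lambda>x. \<phi> k x + \<psi> k x - (g x + g' x)) = (\<lambda>x. (\<phi> k x - g x) + (\<psi> k x - g' x))" by auto
      then show "norm (l2 dS (\<lambda>x. \<phi> k x + \<psi> k x - (g x + g' x))) \<le> l2 dS (\<lambda>x. \<phi> k x - g x) + l2 dS (\<lambda>x. \<psi> k x - g' x)"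
        using l2_triangle[OF L2_diff[OF L2_dS_C1[OF \<phi>(1)] gL(1)] L2_diff[OF L2_dS_C1[OF \<psi>(1)] gL(2)], of k k] by simp
    qed
  qed
qed

lemma has_trace_cmult:
  assumes g: "has_trace \<Omega> v g" "v \<in> H1 \<Omega>"
  shows "has_trace \<Omega> (\<lambda>x. c * v x) (\<lambda>x. c * g x)"
proof -
  obtain \<phi> where \<phi>: "\<And>k::nat. C1_fun (\<phi> k)" "(\<lambda>k. H1_norm \<Omega> (\<lambda>x. \<phi> k x - v x)) \<longlonglongrightarrow> 0" "(\<lambda>k. l2 dS (\<lambda>x. \<phi> k x - g x)) \<longlonglongrightarrow> 0"
    using g(1) unfolding has_trace_iff by blast
  show ?thesis unfolding has_trace_iff
  proof (intro conjI exI[of _ "\<lambda>k x. c * \<phi> k x"] allI)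
    show "(\<lambda>x. c * g x) \<in> L2 dS" by (intro L2_cmult has_trace_L2[OF g(1)])
    show "C1_fun (\<lambda>x. c * \<phi> k x)" for k by (intro C1_fun_cmult \<phi>)
    have "H1_norm \<Omega> (\<lambda>x. c * \<phi> k x - c * v x) = cmod c * H1_norm \<Omega> (\<lambda>x. \<phi> k x - v x)" for k
      using H1_norm_cmult[OF H1_diff[OF H1_C1[OF \<phi>(1)] g(2)], of c k] by (simp add: right_diff_distrib)
    then show "(\<lambda>k. H1_norm \<Omega> (\<lambda>x. c * \<phi> k x - c * v x)) \<longlonglongrightarrow> 0"
      using tendsto_mult_right_zero[OF \<phi>(2)] by simp
    have "l2 dS (\<lambda>x. c * \<phi> k x - c * g x) = cmod c * l2 dS (\<lambda>x. \<phi> k x - g x)" for k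
      using l2_cmult[of dS c "\<lambda>x. \<phi> k x - g x"] by (simp add: right_diff_distrib)
    then show "(\<lambda>k. l2 dS (\<lambda>x. c * \<phi> k x - c * g x)) \<longlonglongrightarrow> 0"
      using tendsto_mult_right_zero[OF \<phi>(3)] by simp
  qed
qed

lemma H1_norm_cnj: "v \<in> H1 \<Omega> \<Longrightarrow> H1_norm \<Omega> (\<lambda>x. cnj (v x)) = H1_norm \<Omega> v"
  using H1_norm_wg[OF wg_cnj[OF wg_weak_grad]] H1_norm_wg[OF wg_weak_grad] by (simp add: l2_def)

lemma has_trace_cnj:
  assumes g: "has_trace \<Omega> v g" "v \<in> H1 \<Omega>"
  shows "has_trace \<Omega> (\<lambda>x. cnj (v x)) (\<lambda>x. cnj (g x))"
proof -
  obtain \<phi> where \<phi>: "\<And>k::nat. C1_fun (\<phi> k)" "(\<lambda>k. H1_norm \<Omega> (\<lambda>x. \<phi> k x - v x)) \<longlonglongrightarrow> 0" "(\<lambda>k. l2 dS (\<lambda>x. \<phi> k x - g x)) \<longlonglongrightarrow> 0"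
    using g(1) unfolding has_trace_iff by blast
  show ?thesis unfolding has_trace_iff
  proof (intro conjI exI[of _ "\<lambda>k x. cnj (\<phi> k x)"] allI)
    show "(\<lambda>x. cnj (g x)) \<in> L2 dS" by (intro L2_cnj has_trace_L2[OF g(1)])
    show "C1_fun (\<lambda>x. cnj (\<phi> k x))" for k by (intro C1_fun_cnj \<phi>)
    have "H1_norm \<Omega> (\<lambda>x. cnj (\<phi> k x) - cnj (v x)) = H1_norm \<Omega> (\<lambda>x. \<phi> k x - v x)" for k
      using H1_norm_cnj[OF H1_diff[OF H1_C1[OF \<phi>(1)] g(2)], of k] by simp
    then show "(\<lambda>k. H1_norm \<Omega> (\<lambda>x. cnj (\<phi> k x) - cnj (v x))) \<longlonglongrightarrow> 0" using \<phi>(2) by simp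
    have "l2 dS (\<lambda>x. cnj (\<phi> k x) - cnj (g x)) = l2 dS (\<lambda>x. \<phi> k x - g x)" for k
      by (simp add: l2_def flip: complex_cnj_diff)
    then show "(\<lambda>k. l2 dS (\<lambda>x. cnj (\<phi> k x) - cnj (g x))) \<longlonglongrightarrow> 0" using \<phi>(3) by simp
  qed
qed

text \<open>The difference of two traces is a trace of v - v, whose norm is 0, and
  \<open>has_trace_bound\<close> forces it to vanish. It is written with the factor -1 so that
  additivity and homogeneity of traces apply.\<close>

lemma has_trace_unique:
  assumes g: "has_trace \<Omega> v g" "has_trace \<Omega> v g'" and v: "v \<in> H1 \<Omega>"
  shows "AE x in dS. g x = g' x"
proof -
  have d: "has_trace \<Omega> (\<lambda>x. v x + (-1) * v x) (\<lambda>x. g x + (-1) * g' x)"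
    by (intro has_trace_add has_trace_cmult g v H1_cmult)
  have dH: "(\<lambda>x. v x + (-1) * v x) \<in> H1 \<Omega>" by (intro H1_add H1_cmult v)
  have "H1_norm \<Omega> (\<lambda>x. v x + (-1) * v x) = 0"
    using H1_norm_cmult[OF v, of 0] by simp
  then have "l2 dS (\<lambda>x. g x + (-1) * g' x) \<le> 0" using has_trace_bound[OF d dH] by simp
  then have "AE x in dS. g x + (-1) * g' x = 0"
    using l2_eq_0[OF has_trace_L2[OF d]] l2_nonneg[of dS "\<lambda>x. g x + (-1) * g' x"] by linarith
  then show ?thesis by eventually_elim simp
qed

lemma trace_on_AE: "has_trace \<Omega> v g \<Longrightarrow> v \<in> H1 \<Omega> \<Longrightarrow> AE x in dS. trace_on \<Omega> v x = g x"
  using has_trace_unique has_trace_trace_on by blast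

end

section \<open>The Lax--Milgram lemma\<close>

text \<open>The point t = -b/(c + 1), defined also for c = 0, makes the quadratic negative unless b
  = 0.\<close>

lemma nonneg_quadratic_imp_zero:
  fixes b c :: real
  assumes "\<And>t. 0 \<le> 2 * t * b + t\<^sup>2 * c" "0 \<le> c"
  shows "b = 0"
proof (rule ccontr)
  assume b: "b \<noteq> 0"
  define u where "u = b / (c + 1)"
  have bu: "b = u * (c + 1)" "u \<noteq> 0" using b assms(2) by (auto simp: u_def)
  have "0 \<le> 2 * (- u) * b + (- u)\<^sup>2 * c" by (rule assms(1))
  also have "\<dots> = - (u\<^sup>2 * (c + 2))"
    unfolding bu(1) by (simp add: power2_eq_square algebra_simps)
  also have "\<dots> < 0" using bu(2) assms(2) by simp
  finally show False by simp
qed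

text \<open>Scalar multiplication need not satisfy any law beyond homogeneity of the inner product, so that
  states represented by functions fit without passing to a quotient.\<close>

locale semi_hilbert =
  fixes S :: "'a::ab_group_add set" and sc :: "real \<Rightarrow> 'a \<Rightarrow> 'a" and ip :: "'a \<Rightarrow> 'a \<Rightarrow> real"
  assumes zero_S: "0 \<in> S"
    and add_S: "p \<in> S \<Longrightarrow> q \<in> S \<Longrightarrow> p + q \<in> S"
    and diff_S: "p \<in> S \<Longrightarrow> q \<in> S \<Longrightarrow> p - q \<in> S"
    and sc_S: "p \<in> S \<Longrightarrow> sc t p \<in> S"
    and ip_add: "p \<in> S \<Longrightarrow> q \<in> S \<Longrightarrow> u \<in> S \<Longrightarrow> ip (p + q) u = ip p u + ip q u"
    and ip_sc: "p \<in> S \<Longrightarrow> u \<in> S \<Longrightarrow> ip (sc t p) u = t * ip p u"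
    and ip_commute: "p \<in> S \<Longrightarrow> q \<in> S \<Longrightarrow> ip p q = ip q p"
    and ip_nonneg: "p \<in> S \<Longrightarrow> 0 \<le> ip p p"
    and complete: "(\<And>n::nat. X n \<in> S) \<Longrightarrow>
      (\<And>e. e > 0 \<Longrightarrow> \<exists>N. \<forall>m\<ge>N. \<forall>n\<ge>N. sqrt (ip (X m - X n) (X m - X n)) < e) \<Longrightarrow>
      \<exists>p\<in>S. (\<lambda>n. sqrt (ip (X n - p) (X n - p))) \<longlonglongrightarrow> 0"
begin

definition "nr p = sqrt (ip p p)"

lemma nr_nonneg: "p \<in> S \<Longrightarrow> 0 \<le> nr p" by (simp add: nr_def ip_nonneg)
lemma nr_sq: "p \<in> S \<Longrightarrow> (nr p)\<^sup>2 = ip p p" by (simp add: nr_def ip_nonneg)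

lemma additive_diff:
  assumes f: "\<And>p q. p \<in> S \<Longrightarrow> q \<in> S \<Longrightarrow> f (p + q) = f p + (f q :: real)" and pq: "p \<in> S" "q \<in> S"
  shows "f (p - q) = f p - f q"
  using f[OF diff_S[OF pq] pq(2)] by simp

lemma ip_diff: "p \<in> S \<Longrightarrow> q \<in> S \<Longrightarrow> u \<in> S \<Longrightarrow> ip (p - q) u = ip p u - ip q u"
  by (rule additive_diff[where f="\<lambda>p. ip p u"]) (simp_all add: ip_add)

lemma ip_add_right: "p \<in> S \<Longrightarrow> q \<in> S \<Longrightarrow> u \<in> S \<Longrightarrow> ip u (p + q) = ip u p + ip u q"
  using ip_commute[of u] add_S by (simp add: ip_add)

lemma ip_diff_right: "p \<in> S \<Longrightarrow> q \<in> S \<Longrightarrow> u \<in> S \<Longrightarrow> ip u (p - q) = ip u p - ip u q"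
  using ip_commute[of u] diff_S by (simp add: ip_diff)

lemma ip_sc_right: "p \<in> S \<Longrightarrow> u \<in> S \<Longrightarrow> ip u (sc t p) = t * ip u p"
  using ip_commute[of u] sc_S by (simp add: ip_sc)

text \<open>The inner product may be degenerate. For a vector of length 0, positivity of all
  combinations kills the mixed term; otherwise the usual optimal combination is inserted.\<close>

lemma Cauchy_Schwarz:
  assumes p: "p \<in> S" and q: "q \<in> S"
  shows "\<bar>ip p q\<bar> \<le> nr p * nr q"
proof -
  have quad: "0 \<le> s\<^sup>2 * ip p p + 2 * (s * t) * ip p q + t\<^sup>2 * ip q q" for s t
  proof -
    have "0 \<le> ip (sc s p + sc t q) (sc s p + sc t q)" by (intro ip_nonneg add_S sc_S p q)
    also have "\<dots> = s\<^sup>2 * ip p p + 2 * (s * t) * ip p q + t\<^sup>2 * ip q q"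
      using p q ip_commute[OF q p] by (simp add: ip_add ip_add_right ip_sc ip_sc_right add_S sc_S power2_eq_square algebra_simps)
    finally show ?thesis .
  qed
  show ?thesis
  proof (cases "ip p p = 0")
    case True
    have "ip p q = 0"
    proof (rule nonneg_quadratic_imp_zero[where c="ip q q"])
      show "0 \<le> ip q q" by (rule ip_nonneg[OF q])
      fix t :: real
      have "0 \<le> 2 * t * ip p q + t\<^sup>2 * ip q q" if "t = 0" using that by simp
      moreover have "0 \<le> 2 * t * ip p q + t\<^sup>2 * ip q q"
        using quad[of 1 t] True by simp
      ultimately show "0 \<le> 2 * t * ip p q + t\<^sup>2 * ip q q" by simp
    qed
    then show ?thesis using nr_nonneg[OF p] nr_nonneg[OF q] by simp
  next
    case False
    then have pp: "ip p p > 0" using ip_nonneg[OF p] by simp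
    have "0 \<le> (ip p q)\<^sup>2 * ip p p + 2 * (ip p q * (- ip p p)) * ip p q + (- ip p p)\<^sup>2 * ip q q"
      by (rule quad)
    also have "\<dots> = ip p p * (ip p p * ip q q - (ip p q)\<^sup>2)" by (simp add: power2_eq_square algebra_simps)
    finally have "(ip p q)\<^sup>2 \<le> ip p p * ip q q" using pp by (simp add: zero_le_mult_iff)
    then have "sqrt ((ip p q)\<^sup>2) \<le> sqrt (ip p p * ip q q)" by (rule real_sqrt_le_mono)
    then show ?thesis by (simp add: nr_def real_sqrt_mult)
  qed
qed

lemma nr_diff_sq:
  assumes "p \<in> S" "q \<in> S" shows "(nr (p - q))\<^sup>2 = (nr p)\<^sup>2 - 2 * ip q p + (nr q)\<^sup>2"
  using assms ip_commute[OF assms] by (simp add: nr_sq diff_S ip_diff ip_diff_right)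

lemma nr_triangle:
  assumes "p \<in> S" "q \<in> S" shows "nr (p + q) \<le> nr p + nr q"
proof (rule power2_le_imp_le)
  have "(nr (p + q))\<^sup>2 = (nr p)\<^sup>2 + 2 * ip p q + (nr q)\<^sup>2"
    using assms ip_commute[OF assms] by (simp add: nr_sq add_S ip_add ip_add_right)
  also have "\<dots> \<le> (nr p + nr q)\<^sup>2" using Cauchy_Schwarz[OF assms] by (simp add: power2_sum)
  finally show "(nr (p + q))\<^sup>2 \<le> (nr p + nr q)\<^sup>2" .
qed (use assms nr_nonneg in simp)

lemma ip_tendsto:
  assumes X: "\<And>n. X n \<in> S" and p: "p \<in> S" and q: "q \<in> S" and lim: "(\<lambda>n. nr (X n - p)) \<longlonglongrightarrow> 0"
  shows "(\<lambda>n. ip (X n) q) \<longlonglongrightarrow> ip p q"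
proof (rule LIM_zero_cancel, rule Lim_null_comparison)
  show "\<forall>\<^sub>F n in sequentially. norm (ip (X n) q - ip p q) \<le> nr (X n - p) * nr q"
    using Cauchy_Schwarz[OF diff_S[OF X p] q] by (simp add: ip_diff X p q)
  show "(\<lambda>n. nr (X n - p) * nr q) \<longlonglongrightarrow> 0" by (rule tendsto_mult_left_zero[OF lim])
qed

text \<open>The minimiser of \<open>ip p p - 2 * l p\<close> represents the functional. Minimising
  sequences are Cauchy by the parallelogram identity, and the first variation at the limit is the
  equation.\<close>

lemma Riesz:
  assumes l_add: "\<And>p q. p \<in> S \<Longrightarrow> q \<in> S \<Longrightarrow> l (p + q) = l p + (l q :: real)"
    and l_sc: "\<And>t p. p \<in> S \<Longrightarrow> l (sc t p) = t * l p"
    and l_bound: "\<And>p. p \<in> S \<Longrightarrow> \<bar>l p\<bar> \<le> m * nr p"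
  shows "\<exists>p\<in>S. \<forall>q\<in>S. ip p q = l q"
proof -
  define J where "J p = ip p p - 2 * l p" for p
  have J_ge: "J p \<ge> - m\<^sup>2" if "p \<in> S" for p
  proof -
    have "2 * l p \<le> 2 * (m * nr p)" using l_bound[OF that] by simp
    moreover have "2 * m * nr p \<le> m\<^sup>2 + (nr p)\<^sup>2" by (rule sum_squares_bound)
    ultimately show ?thesis using nr_sq[OF that] by (simp add: J_def)
  qed
  define d where "d = Inf (J ` S)"
  have bdd: "bdd_below (J ` S)" using J_ge by (intro bdd_belowI2)
  have d_le: "d \<le> J p" if "p \<in> S" for p unfolding d_def using bdd that by (intro cInf_lower) auto
  have "\<exists>p\<in>S. J p < d + inverse (real (Suc n))" for n
  proof -
    have "Inf (J ` S) < d + inverse (real (Suc n))" by (simp add: d_def)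
    then show ?thesis using zero_S cInf_lessD[of "J ` S"] by blast
  qed
  then have "\<forall>n. \<exists>p. p \<in> S \<and> J p < d + inverse (real (Suc n))" by blast
  from choice[OF this] obtain X where X: "\<And>n. X n \<in> S" "\<And>n. J (X n) < d + inverse (real (Suc n))" by blast
  \<comment> \<open>Parallelogram identity: the squared distance is 2J(X i) + 2J(X j) minus four
    times \<open>J\<close> at the midpoint, where \<open>J\<close> is at least the infimum
    \<open>d\<close>.\<close>
  have Cauchy: "ip (X i - X j) (X i - X j) \<le> 2 * inverse (real (Suc i)) + 2 * inverse (real (Suc j))" for i j
  proof -
    let ?h = "sc (1/2) (X i + X j)"
    have h: "?h \<in> S" by (intro sc_S add_S X)
    have s: "X i + X j \<in> S" by (intro add_S X)
    have "ip ?h ?h = (ip (X i) (X i) + 2 * ip (X i) (X j) + ip (X j) (X j)) / 4"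
      using X(1) s ip_commute[OF X(1) X(1), of j i]
      by (simp add: ip_sc ip_sc_right sc_S ip_add ip_add_right, simp add: field_simps)
    moreover have "l ?h = (l (X i) + l (X j)) / 2" using X(1) s by (simp add: l_sc l_add)
    moreover have "ip (X i - X j) (X i - X j) = ip (X i) (X i) - 2 * ip (X i) (X j) + ip (X j) (X j)"
      using X(1) ip_commute[OF X(1) X(1), of j i] by (simp add: ip_diff ip_diff_right diff_S)
    ultimately have "ip (X i - X j) (X i - X j) = 2 * J (X i) + 2 * J (X j) - 4 * J ?h"
      unfolding J_def by (simp add: field_simps)
    then show ?thesis using X(2)[of i] X(2)[of j] d_le[OF h] by linarith
  qed
  have "\<exists>p\<in>S. (\<lambda>n. sqrt (ip (X n - p) (X n - p))) \<longlonglongrightarrow> 0"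
  proof (rule complete[OF X(1)])
    fix e :: real assume e: "e > 0"
    obtain N where N: "inverse (real (Suc N)) < e\<^sup>2 / 4" using reals_Archimedean[of "e\<^sup>2 / 4"] e by auto
    show "\<exists>N. \<forall>m\<ge>N. \<forall>n\<ge>N. sqrt (ip (X m - X n) (X m - X n)) < e"
    proof (intro exI[of _ N] allI impI)
      fix m n assume mn: "m \<ge> N" "n \<ge> N"
      have "inverse (real (Suc m)) \<le> inverse (real (Suc N))" "inverse (real (Suc n)) \<le> inverse (real (Suc N))"
        using mn by (auto intro!: le_imp_inverse_le)
      then have "ip (X m - X n) (X m - X n) < e\<^sup>2" using Cauchy[of m n] N by linarith
      then have "sqrt (ip (X m - X n) (X m - X n)) < sqrt (e\<^sup>2)" by (rule real_sqrt_less_mono)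
      then show "sqrt (ip (X m - X n) (X m - X n)) < e" using e by simp
    qed
  qed
  then obtain p where p: "p \<in> S" "(\<lambda>n. nr (X n - p)) \<longlonglongrightarrow> 0" by (auto simp: nr_def)
  have "ip p q = l q" if q: "q \<in> S" for q
  proof -
    have "ip p q - l q = 0"
    proof (rule nonneg_quadratic_imp_zero[where c="ip q q"])
      show "0 \<le> ip q q" by (rule ip_nonneg[OF q])
      fix t :: real
      \<comment> \<open>The variation is taken at \<open>X n\<close>, where \<open>J\<close> is
        within 1/(n+1) of its infimum; n tends to infinity afterwards.\<close>
      have ge: "- inverse (real (Suc n)) \<le> 2 * t * (ip (X n) q - l q) + t\<^sup>2 * ip q q" for n
      proof -
        have "J (X n + sc t q) = J (X n) + 2 * t * (ip (X n) q - l q) + t\<^sup>2 * ip q q"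
          using X(1)[of n] q ip_commute[OF X(1)[of n] q]
          unfolding J_def by (simp add: ip_sc ip_sc_right ip_add ip_add_right l_sc l_add sc_S add_S power2_eq_square algebra_simps)
        moreover have "d \<le> J (X n + sc t q)" by (intro d_le add_S sc_S X q)
        ultimately show ?thesis using X(2)[of n] by linarith
      qed
      have "(\<lambda>n. - inverse (real (Suc n))) \<longlonglongrightarrow> - 0"
        by (rule tendsto_minus[OF LIMSEQ_inverse_real_of_nat])
      moreover have "(\<lambda>n. 2 * t * (ip (X n) q - l q) + t\<^sup>2 * ip q q) \<longlonglongrightarrow> 2 * t * (ip p q - l q) + t\<^sup>2 * ip q q"
        by (intro tendsto_intros ip_tendsto X p q)
      ultimately have "- 0 \<le> 2 * t * (ip p q - l q) + t\<^sup>2 * ip q q"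
        by (rule LIMSEQ_le) (use ge in auto)
      then show "0 \<le> 2 * t * (ip p q - l q) + t\<^sup>2 * ip q q" by simp
    qed
    then show ?thesis by simp
  qed
  then show ?thesis using p(1) by blast
qed

text \<open>The solution is the limit of the contraction iteration \<open>p \<mapsto> p - \<rho> (A p - l)\<close>.\<close>

lemma Lax_Milgram:
  assumes a_add: "\<And>p q u. p \<in> S \<Longrightarrow> q \<in> S \<Longrightarrow> u \<in> S \<Longrightarrow> a (p + q) u = a p u + (a q u :: real)"
    and a_add_right: "\<And>p q u. p \<in> S \<Longrightarrow> q \<in> S \<Longrightarrow> u \<in> S \<Longrightarrow> a u (p + q) = a u p + a u q"
    and a_sc_right: "\<And>t p u. p \<in> S \<Longrightarrow> u \<in> S \<Longrightarrow> a u (sc t p) = t * a u p"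
    and a_bound: "\<And>p q. p \<in> S \<Longrightarrow> q \<in> S \<Longrightarrow> \<bar>a p q\<bar> \<le> K * nr p * nr q"
    and coercive: "c > 0" "\<And>p. p \<in> S \<Longrightarrow> c * (nr p)\<^sup>2 \<le> a p p"
    and l_add: "\<And>p q. p \<in> S \<Longrightarrow> q \<in> S \<Longrightarrow> l (p + q) = l p + (l q :: real)"
    and l_sc: "\<And>t p. p \<in> S \<Longrightarrow> l (sc t p) = t * l p"
    and l_bound: "\<And>p. p \<in> S \<Longrightarrow> \<bar>l p\<bar> \<le> m * nr p"
  shows "\<exists>p\<in>S. \<forall>q\<in>S. a p q = l q"
proof -
  \<comment> \<open>A bound of at least 2c makes \<open>k\<close> positive and at least
    \<open>c\<close>, so that \<kappa> below is nonnegative.\<close>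
  define k where "k = max K (2 * c)"
  have k: "k > 0" "K \<le> k" "2 * c \<le> k" using coercive(1) by (auto simp: k_def)
  have a_bound': "\<bar>a p q\<bar> \<le> k * nr p * nr q" if "p \<in> S" "q \<in> S" for p q
  proof -
    have "K * (nr p * nr q) \<le> k * (nr p * nr q)" using k(2) nr_nonneg that by (intro mult_right_mono) auto
    then show ?thesis using a_bound[OF that] by (simp add: mult.assoc)
  qed
  have "\<exists>u. u \<in> S \<and> (\<forall>q\<in>S. ip u q = a p q - l q)" if p: "p \<in> S" for p
  proof -
    have "\<exists>u\<in>S. \<forall>q\<in>S. ip u q = a p q - l q"
    proof (rule Riesz[where m = "k * nr p + m"])
      show "a p (u + q) - l (u + q) = a p u - l u + (a p q - l q)" if "u \<in> S" "q \<in> S" for u q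
        using that p by (simp add: a_add_right l_add)
      show "a p (sc t u) - l (sc t u) = t * (a p u - l u)" if "u \<in> S" for t u
        using that p by (simp add: a_sc_right l_sc algebra_simps)
      show "\<bar>a p u - l u\<bar> \<le> (k * nr p + m) * nr u" if "u \<in> S" for u
        using a_bound'[OF p that] l_bound[OF that] by (simp add: distrib_right)
    qed
    then show ?thesis by blast
  qed
  then have "\<forall>p\<in>S. \<exists>u. u \<in> S \<and> (\<forall>q\<in>S. ip u q = a p q - l q)" by blast
  \<comment> \<open>\<open>R p\<close> represents the residual of the equation at \<open>p\<close>
    in the inner product.\<close>
  from bchoice[OF this] obtain R where R: "\<And>p. p \<in> S \<Longrightarrow> R p \<in> S" "\<And>p q. p \<in> S \<Longrightarrow> q \<in> S \<Longrightarrow> ip (R p) q = a p q - l q"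
    by blast
  \<comment> \<open>This value minimises 1 - 2 \<rho> c + \<rho>^2 k^2, the bound for the squared
    contraction factor, and \<kappa> is the minimum.\<close>
  define \<rho> where "\<rho> = c / k\<^sup>2"
  have \<rho>: "\<rho> > 0" using coercive(1) k(1) by (simp add: \<rho>_def)
  define \<kappa> where "\<kappa> = 1 - c\<^sup>2 / k\<^sup>2"
  have \<kappa>: "0 \<le> \<kappa>" "\<kappa> < 1"
  proof -
    have "c\<^sup>2 \<le> k\<^sup>2" using k coercive(1) by (intro power_mono) auto
    then show "0 \<le> \<kappa>" using k(1) by (simp add: \<kappa>_def)
    show "\<kappa> < 1" using k(1) coercive(1) by (simp add: \<kappa>_def)
  qed
  define \<Phi> where "\<Phi> p = p - sc \<rho> (R p)" for p
  have \<Phi>S: "\<Phi> p \<in> S" if "p \<in> S" for p unfolding \<Phi>_def by (intro diff_S sc_S R that)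
  have a_diff: "a (p - q) u = a p u - a q u" if "p \<in> S" "q \<in> S" "u \<in> S" for p q u
    by (rule additive_diff[where f="\<lambda>p. a p u"]) (simp_all add: a_add that)
  have contr: "(nr (\<Phi> p - \<Phi> p'))\<^sup>2 \<le> \<kappa> * (nr (p - p'))\<^sup>2" if p: "p \<in> S" and p': "p' \<in> S" for p p'
  proof -
    let ?e = "p - p'" and ?w = "sc \<rho> (R p) - sc \<rho> (R p')"
    have e: "?e \<in> S" and w: "?w \<in> S" by (intro diff_S sc_S p p' R)+
    have ne: "nr ?e \<ge> 0" "nr ?w \<ge> 0" using nr_nonneg e w by auto
    have ipw: "ip ?w q = \<rho> * a ?e q" if q: "q \<in> S" for q
    proof -
      have "ip ?w q = \<rho> * ip (R p) q - \<rho> * ip (R p') q"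
        by (simp only: ip_diff[OF sc_S[OF R(1)[OF p]] sc_S[OF R(1)[OF p']] q] ip_sc[OF R(1)[OF p] q] ip_sc[OF R(1)[OF p'] q])
      also have "\<dots> = \<rho> * (ip (R p) q - ip (R p') q)" by (rule right_diff_distrib[symmetric])
      also have "ip (R p) q - ip (R p') q = a ?e q" using R(2)[OF p q] R(2)[OF p' q] a_diff[OF p p' q] by simp
      finally show ?thesis .
    qed
    have "(nr ?w)\<^sup>2 \<le> \<rho> * (k * nr ?e * nr ?w)"
      using a_bound'[OF e w] ipw[OF w] nr_sq[OF w] \<rho> by (simp add: abs_le_iff)
    then have w_le: "nr ?w \<le> \<rho> * k * nr ?e"
      using ne k(1) \<rho> by (cases "nr ?w = 0") (auto simp: power2_eq_square mult.assoc[symmetric])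
    have "\<Phi> p - \<Phi> p' = ?e - ?w" by (simp add: \<Phi>_def)
    then have "(nr (\<Phi> p - \<Phi> p'))\<^sup>2 = (nr ?e)\<^sup>2 - 2 * ip ?w ?e + (nr ?w)\<^sup>2"
      using nr_diff_sq[OF e w] by simp
    also have "\<dots> \<le> (nr ?e)\<^sup>2 - 2 * (\<rho> * (c * (nr ?e)\<^sup>2)) + (\<rho> * k * nr ?e)\<^sup>2"
    proof -
      have "\<rho> * (c * (nr ?e)\<^sup>2) \<le> ip ?w ?e" unfolding ipw[OF e] using coercive(2)[OF e] \<rho> by simp
      moreover have "(nr ?w)\<^sup>2 \<le> (\<rho> * k * nr ?e)\<^sup>2" using w_le ne by (intro power_mono) auto
      ultimately show ?thesis by linarith
    qed
    also have "\<dots> = \<kappa> * (nr ?e)\<^sup>2"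
      using k(1) by (simp add: \<rho>_def \<kappa>_def power2_eq_square field_simps)
    finally show ?thesis .
  qed
  define s where "s = sqrt \<kappa>"
  have s: "0 \<le> s" "s < 1" using \<kappa> by (auto simp: s_def)
  have contr': "nr (\<Phi> p - \<Phi> p') \<le> s * nr (p - p')" if "p \<in> S" "p' \<in> S" for p p'
  proof (rule power2_le_imp_le)
    show "(nr (\<Phi> p - \<Phi> p'))\<^sup>2 \<le> (s * nr (p - p'))\<^sup>2"
      using contr[OF that] \<kappa>(1) by (simp add: s_def power_mult_distrib)
    show "0 \<le> s * nr (p - p')" using s(1) nr_nonneg[OF diff_S[OF that]] by simp
  qed
  define X where "X n = (\<Phi> ^^ n) 0" for n
  have XS: "X n \<in> S" for n unfolding X_def by (induction n) (simp_all add: zero_S \<Phi>S)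
  have X_Suc: "X (Suc n) = \<Phi> (X n)" for n by (simp add: X_def)
  \<comment> \<open>Sum of the geometric series that dominates the increments of the
    iteration.\<close>
  define D where "D = nr (X 1 - X 0) / (1 - s)"
  have D: "D \<ge> 0" using s nr_nonneg[OF diff_S[OF XS XS]] by (simp add: D_def)
  have from0: "nr (X j - X 0) \<le> D" for j
  proof (induction j)
    case 0
    have "ip 0 0 = 0" using ip_add[OF zero_S zero_S zero_S] by simp
    then show ?case using D by (simp add: nr_def)
  next
    case (Suc j)
    have "nr (X (Suc j) - X 0) = nr ((\<Phi> (X j) - \<Phi> (X 0)) + (X 1 - X 0))" by (simp add: X_Suc)
    also have "\<dots> \<le> nr (\<Phi> (X j) - \<Phi> (X 0)) + nr (X 1 - X 0)"
      by (intro nr_triangle diff_S \<Phi>S XS)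
    also have "\<dots> \<le> s * D + (1 - s) * D"
    proof (rule add_mono)
      show "nr (\<Phi> (X j) - \<Phi> (X 0)) \<le> s * D"
        using contr'[OF XS XS, of j 0] mult_left_mono[OF Suc s(1)] by linarith
      show "nr (X 1 - X 0) \<le> (1 - s) * D" using s by (simp add: D_def)
    qed
    also have "\<dots> = D" by (simp add: algebra_simps)
    finally show ?case .
  qed
  have step: "nr (X (n + j) - X n) \<le> s ^ n * D" for n j
  proof (induction n)
    case 0 then show ?case using from0[of j] by simp
  next
    case (Suc n)
    have "nr (X (Suc n + j) - X (Suc n)) \<le> s * nr (X (n + j) - X n)"
      using contr'[OF XS XS, of "n + j" n] by (simp add: X_Suc)
    also have "\<dots> \<le> s * (s ^ n * D)" by (rule mult_left_mono[OF Suc s(1)])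
    finally show ?case by (simp add: mult.assoc)
  qed
  have nr_commute: "nr (p - q) = nr (q - p)" if "p \<in> S" "q \<in> S" for p q
  proof (rule power2_eq_imp_eq)
    show "(nr (p - q))\<^sup>2 = (nr (q - p))\<^sup>2"
      using nr_diff_sq[OF that] nr_diff_sq[OF that(2,1)] ip_commute[OF that] by simp
  qed (use nr_nonneg diff_S that in blast)+
  have "\<exists>p\<in>S. (\<lambda>n. sqrt (ip (X n - p) (X n - p))) \<longlonglongrightarrow> 0"
  proof (rule complete[OF XS])
    fix e :: real assume e: "e > 0"
    have "(\<lambda>n. s ^ n * D) \<longlonglongrightarrow> 0 * D" by (intro tendsto_mult tendsto_const LIMSEQ_realpow_zero s)
    then have lim: "(\<lambda>n. s ^ n * D) \<longlonglongrightarrow> 0" by simp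
    from order_tendstoD(2)[OF lim e] obtain N where N: "\<And>n. n \<ge> N \<Longrightarrow> s ^ n * D < e"
      unfolding eventually_sequentially by blast
    have *: "nr (X m - X n) < e" if "n \<ge> N" "m \<ge> n" for m n
      using step[of n "m - n"] N[OF that(1)] that(2) by simp
    show "\<exists>N. \<forall>m\<ge>N. \<forall>n\<ge>N. sqrt (ip (X m - X n) (X m - X n)) < e"
      unfolding nr_def[symmetric]
    proof (intro exI[of _ N] allI impI)
      fix m n assume "m \<ge> N" "n \<ge> N"
      then show "nr (X m - X n) < e"
        using *[of n m] *[of m n] nr_commute[OF XS XS, of m n] by (cases "m \<ge> n") auto
    qed
  qed
  then obtain p where p: "p \<in> S" "(\<lambda>n. nr (X n - p)) \<longlonglongrightarrow> 0" by (auto simp: nr_def)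
  have "a p q = l q" if q: "q \<in> S" for q
  proof -
    \<comment> \<open>Each increment of the iteration equals \<rho> times the residual at
      \<open>X n\<close>. The increments tend to 0 and the residual is continuous, so the limit
      solves the equation.\<close>
    have "ip (X n) q - ip (X (Suc n)) q = \<rho> * (a (X n) q - l q)" for n
    proof -
      have "ip (X (Suc n)) q = ip (X n) q - \<rho> * ip (R (X n)) q"
        unfolding X_Suc \<Phi>_def
        by (simp only: ip_diff[OF XS sc_S[OF R(1)[OF XS]] q] ip_sc[OF R(1)[OF XS] q])
      then show ?thesis using R(2)[OF XS q] by simp
    qed
    moreover have "(\<lambda>n. ip (X n) q - ip (X (Suc n)) q) \<longlonglongrightarrow> ip p q - ip p q"
      by (intro tendsto_diff LIMSEQ_Suc ip_tendsto XS p q)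
    ultimately have 1: "(\<lambda>n. \<rho> * (a (X n) q - l q)) \<longlonglongrightarrow> 0" by simp
    have "(\<lambda>n. a (X n) q) \<longlonglongrightarrow> a p q"
    proof (rule LIM_zero_cancel, rule Lim_null_comparison)
      show "\<forall>\<^sub>F n in sequentially. norm (a (X n) q - a p q) \<le> nr (X n - p) * (k * nr q)"
      proof (rule always_eventually, rule allI)
        fix n
        show "norm (a (X n) q - a p q) \<le> nr (X n - p) * (k * nr q)"
          using a_bound'[OF diff_S[OF XS p(1)] q, of n] a_diff[OF XS p(1) q, of n] by (simp add: mult_ac)
      qed
      show "(\<lambda>n. nr (X n - p) * (k * nr q)) \<longlonglongrightarrow> 0" by (rule tendsto_mult_left_zero[OF p(2)])
    qed
    then have "(\<lambda>n. \<rho> * (a (X n) q - l q)) \<longlonglongrightarrow> \<rho> * (a p q - l q)" by (intro tendsto_intros)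
    from LIMSEQ_unique[OF this 1] show ?thesis using \<rho> by simp
  qed
  then show ?thesis using p(1) by blast
qed

end

section \<open>The sesquilinear form\<close>

lemma cmod_sum_mult_le_complex:
  fixes a b :: "complex^'k"
  shows "cmod (\<Sum>i\<in>UNIV. a $ i * b $ i) \<le> norm a * norm b"
proof -
  have "cmod (\<Sum>i\<in>UNIV. a $ i * b $ i) \<le> (\<Sum>i\<in>UNIV. \<bar>cmod (a $ i)\<bar> * \<bar>cmod (b $ i)\<bar>)"
    by (rule order_trans[OF norm_sum]) (simp add: norm_mult)
  also have "\<dots> \<le> norm a * norm b"
    unfolding norm_vec_def by (rule L2_set_mult_ineq)
  finally show ?thesis .
qed

text \<open>The bound is a parameter and not the essential supremum, so that sums and multiples of
  coefficients carry explicit bounds.\<close>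

definition multiplier :: "'a measure \<Rightarrow> ('a \<Rightarrow> complex) \<Rightarrow> real \<Rightarrow> bool" where
  "multiplier M a s \<longleftrightarrow> a \<in> borel_measurable M \<and> 0 \<le> s \<and> (AE x in M. cmod (a x) \<le> s)"

lemma multiplier_mono: "multiplier M a s \<Longrightarrow> s \<le> t \<Longrightarrow> multiplier M a t"
  unfolding multiplier_def by (auto elim: eventually_mono)

lemma multiplier_add:
  "multiplier M a s \<Longrightarrow> multiplier M b t \<Longrightarrow> multiplier M (\<lambda>x. a x + b x) (s + t)"
  unfolding multiplier_def
proof (elim conjE, intro conjI)
  assume "AE x in M. cmod (a x) \<le> s" "AE x in M. cmod (b x) \<le> t"
  then show "AE x in M. cmod (a x + b x) \<le> s + t"
    by eventually_elim (rule norm_triangle_le, simp)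
qed auto

lemma multiplier_cmult: "multiplier M a s \<Longrightarrow> multiplier M (\<lambda>x. c * a x) (cmod c * s)"
  unfolding multiplier_def by (auto simp: norm_mult elim!: eventually_mono intro: mult_left_mono)

lemma multiplier_Linf:
  assumes "a \<in> Linf M" shows "multiplier M a (max 0 (Linf_norm M a))"
proof -
  have m: "a \<in> borel_measurable M" and fin: "esssup M (\<lambda>x. ereal (cmod (a x))) < \<infinity>"
    using assms by (auto simp: Linf_def)
  have "AE x in M. ereal (cmod (a x)) \<le> esssup M (\<lambda>x. ereal (cmod (a x)))" by (rule esssup_AE)
  then have "AE x in M. cmod (a x) \<le> max 0 (Linf_norm M a)"
  proof eventually_elim
    case (elim x)
    then show ?case
      using fin unfolding Linf_norm_def by (cases "esssup M (\<lambda>x. ereal (cmod (a x)))") auto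
  qed
  then show ?thesis using m by (simp add: multiplier_def)
qed

lemma multiplier_L2:
  fixes f :: "'a \<Rightarrow> complex"
  assumes a: "multiplier M a s" and f: "f \<in> L2 M"
  shows "(\<lambda>x. a x * f x) \<in> L2 M" "l2 M (\<lambda>x. a x * f x) \<le> s * l2 M f"
proof -
  have am[measurable]: "a \<in> borel_measurable M" and s: "0 \<le> s" and ae: "AE x in M. cmod (a x) \<le> s"
    using a by (auto simp: multiplier_def)
  note [measurable] = L2_measurable[OF f]
  have m: "(\<lambda>x. a x * f x) \<in> borel_measurable M" by measurable
  have le: "AE x in M. norm (a x * f x) \<le> s * norm (f x)"
    using ae by eventually_elim (simp add: norm_mult mult_right_mono)
  show "(\<lambda>x. a x * f x) \<in> L2 M" by (rule L2_bound[OF f m le])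
  show "l2 M (\<lambda>x. a x * f x) \<le> s * l2 M f" by (rule l2_bound_AE[OF f m le s])
qed

text \<open>Both parts of the form and of the right-hand sides reduce to such integrals with the
  coefficient in the first slot; linearity and bounds are proved once for all of them.\<close>

definition tri :: "'a measure \<Rightarrow> ('a \<Rightarrow> complex) \<Rightarrow> ('a \<Rightarrow> complex) \<Rightarrow> ('a \<Rightarrow> complex) \<Rightarrow> complex" where
  "tri M a f g = (LINT x|M. a x * f x * g x)"

context
  fixes M :: "'a measure" and a :: "'a \<Rightarrow> complex" and s :: real
  assumes a: "multiplier M a s"
begin

lemma tri_integrable: "f \<in> L2 M \<Longrightarrow> g \<in> L2 M \<Longrightarrow> integrable M (\<lambda>x. a x * f x * g x)"
  by (rule L2_mult_integrable[OF multiplier_L2(1)[OF a]])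

lemma tri_bound:
  assumes f: "f \<in> L2 M" and g: "g \<in> L2 M" shows "cmod (tri M a f g) \<le> s * l2 M f * l2 M g"
proof -
  have "cmod (tri M a f g) \<le> l2 M (\<lambda>x. a x * f x) * l2 M g"
    unfolding tri_def by (rule L2_mult_integral_le[OF multiplier_L2(1)[OF a f] g])
  also have "\<dots> \<le> s * l2 M f * l2 M g" by (intro mult_right_mono multiplier_L2(2)[OF a f]) simp
  finally show ?thesis .
qed

lemma tri_add:
  assumes "f \<in> L2 M" "f' \<in> L2 M" "g \<in> L2 M"
  shows "tri M a (\<lambda>x. f x + f' x) g = tri M a f g + tri M a f' g"
    and "tri M a g (\<lambda>x. f x + f' x) = tri M a g f + tri M a g f'"
  unfolding tri_def using assms tri_integrable by (simp_all add: distrib_left distrib_right)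

lemma tri_cmult:
  "tri M a (\<lambda>x. c * f x) g = c * tri M a f g" "tri M a g (\<lambda>x. c * f x) = c * tri M a g f"
  unfolding tri_def by (simp_all add: mult_ac flip: integral_mult_right_zero)

lemma tri_cong:
  assumes L: "f \<in> L2 M" "f' \<in> L2 M" "g \<in> L2 M" "g' \<in> L2 M" and ae: "AE x in M. f x = f' x" "AE x in M. g x = g' x"
  shows "tri M a f g = tri M a f' g'"
  unfolding tri_def
proof (rule integral_cong_AE)
  have [measurable]: "a \<in> borel_measurable M" using a by (simp add: multiplier_def)
  note [measurable] = L[THEN L2_measurable]
  show "(\<lambda>x. a x * f x * g x) \<in> borel_measurable M" "(\<lambda>x. a x * f' x * g' x) \<in> borel_measurable M" by measurable
  show "AE x in M. a x * f x * g x = a x * f' x * g' x" using ae by eventually_elim simp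
qed

lemma tri_add_coeff:
  assumes b: "multiplier M b t" and "f \<in> L2 M" "g \<in> L2 M"
  shows "tri M (\<lambda>x. a x + b x) f g = tri M a f g + tri M b f g"
  unfolding tri_def using assms tri_integrable L2_mult_integrable[OF multiplier_L2(1)[OF b]] by (simp add: distrib_right)

end

lemma tri_cmult_coeff: "tri M (\<lambda>x. c * a x) f g = c * tri M a f g"
  unfolding tri_def by (simp add: mult_ac flip: integral_mult_right_zero)

lemma tri_commute: "tri M a f g = tri M a g f"
  unfolding tri_def by (simp add: mult_ac)

section \<open>States, electrode potentials and jumps\<close>

definition state_scale :: "complex \<Rightarrow> ('n, 'm::finite) state \<Rightarrow> ('n, 'm) state" where
  "state_scale c p = (\<lambda>x. c * fst p x, c *s snd p)"

definition state_cnj :: "('n, 'm::finite) state \<Rightarrow> ('n, 'm) state" where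
  "state_cnj p = (\<lambda>x. cnj (fst p x), cnj_vec (snd p))"

text \<open>The multiples of (1, \<one>) that the quotient divides out.\<close>

definition state_const :: "complex \<Rightarrow> ('n, 'm::finite) state" where
  "state_const c = (\<lambda>x. c, \<chi> m. c)"

lemma vec_mean_linear:
  "vec_mean (V + W) = vec_mean V + vec_mean W" "vec_mean (c *s V) = c * vec_mean V"
  "vec_mean (cnj_vec V) = cnj (vec_mean V)" "vec_mean (\<chi> m. c) = c"
  by (auto simp: vec_mean_def sum.distrib add_divide_distrib cnj_vec_def simp flip: sum_distrib_left)

text \<open>For a constant vector the deviations from the mean vanish and only the mean on the
  closed region is left. This law makes jumps invariant under constants on that region.\<close>

lemma electrode_fun_linear:
  "electrode_fun EE (V + W) x = electrode_fun EE V x + electrode_fun EE W x"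
  "electrode_fun EE (c *s V) x = c * electrode_fun EE V x"
  "electrode_fun EE (cnj_vec V) x = cnj (electrode_fun EE V x)"
  "electrode_fun EE (\<chi> m. c) x = c * indicator (electrode_region EE) x"
proof -
  have cnj_ind: "cnj (indicator A y) = indicator A y" for A :: "'z set" and y by (simp add: indicator_def)
  show "electrode_fun EE (V + W) x = electrode_fun EE V x + electrode_fun EE W x"
    by (simp add: electrode_fun_def vec_mean_linear algebra_simps sum.distrib sum_subtractf)
  show "electrode_fun EE (c *s V) x = c * electrode_fun EE V x"
  proof -
    have "((c *s V) $ m - vec_mean (c *s V)) * b = c * ((V $ m - vec_mean V) * b)" for m b
      by (simp add: vec_mean_linear algebra_simps)
    then show ?thesis
      unfolding electrode_fun_def by (simp only: sum_distrib_left[symmetric] vec_mean_linear distrib_left mult.assoc)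
  qed
  have "cnj_vec V $ m = cnj (V $ m)" for m by (simp add: cnj_vec_def)
  then show "electrode_fun EE (cnj_vec V) x = cnj (electrode_fun EE V x)"
    by (simp add: electrode_fun_def vec_mean_linear cnj_ind)
  show "electrode_fun EE (\<chi> m. c) x = c * indicator (electrode_region EE) x"
    by (simp add: electrode_fun_def vec_mean_linear)
qed

lemma norm_vec_mean_le: "cmod (vec_mean V) \<le> norm (V :: complex^'m)"
proof -
  have "cmod (vec_mean V) = cmod (\<Sum>m\<in>UNIV. V $ m) / real CARD('m)"
    by (simp add: vec_mean_def norm_divide)
  also have "\<dots> \<le> (\<Sum>m\<in>(UNIV :: 'm set). norm V) / real CARD('m)"
    by (intro divide_right_mono sum_norm_le) (auto simp: Finite_Cartesian_Product.norm_nth_le)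
  finally show ?thesis by simp
qed

locale eit = lip_dom \<Omega> for \<Omega> :: "(real^'n) set" +
  fixes EE :: "'m::finite \<Rightarrow> (real^'n) set"
  assumes open_EE: "openin (top_of_set (frontier \<Omega>)) (EE m)"
begin

abbreviation "reg \<equiv> electrode_region EE"
abbreviation "wgr p \<equiv> weak_grad \<Omega> (fst p)"
abbreviation "jmp p \<equiv> jump \<Omega> EE (p :: ('n, 'm) state)"
abbreviation "\<H> \<equiv> (HH \<Omega> :: ('n, 'm) state set)"

text \<open>The norm of the direct sum for one representative, not the quotient norm. On zero-mean
  states the quotient norm controls it, by \<open>st_norm_le_HH_norm\<close>.\<close>

definition st_norm :: "('n, 'm) state \<Rightarrow> real" where
  "st_norm p = sqrt ((H1_norm \<Omega> (fst p))\<^sup>2 + (norm (snd p))\<^sup>2)"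

lemma st_norm_nonneg [simp]: "0 \<le> st_norm p" by (simp add: st_norm_def)

lemma H1_le_st_norm: "H1_norm \<Omega> (fst p) \<le> st_norm p" and snd_le_st_norm: "norm (snd p) \<le> st_norm p"
  by (auto simp: st_norm_def intro: real_le_rsqrt)

lemma HH_iff: "p \<in> \<H> \<longleftrightarrow> fst p \<in> H1 \<Omega>"
  by (simp add: HH_def mem_Times_iff)

lemma fst_plus: "fst (p + q) = (\<lambda>x. fst p x + fst q x)" for p q :: "('n, 'm) state"
  by (simp add: plus_fun_def)

lemma fst_minus: "fst (p - q) = (\<lambda>x. fst p x - fst q x)" for p q :: "('n, 'm) state"
  by (simp add: fun_diff_def)

lemma state_minus: "p - q = p + state_scale (-1) q" for p q :: "('n, 'm) state"
  by (rule prod_eqI) (auto simp: state_scale_def plus_fun_def fun_diff_def vec_eq_iff)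

lemma HH_add: "p \<in> \<H> \<Longrightarrow> q \<in> \<H> \<Longrightarrow> p + q \<in> \<H>"
  unfolding HH_iff fst_plus by (rule H1_add)

lemma HH_scale: "p \<in> \<H> \<Longrightarrow> state_scale c p \<in> \<H>"
  by (simp add: HH_iff state_scale_def H1_cmult)

lemma HH_diff: "p \<in> \<H> \<Longrightarrow> q \<in> \<H> \<Longrightarrow> p - q \<in> \<H>"
  unfolding state_minus by (intro HH_add HH_scale)

lemma HH_cnj: "p \<in> \<H> \<Longrightarrow> state_cnj p \<in> \<H>"
  by (simp add: HH_iff state_cnj_def H1_cnj)

lemma HH_const: "state_const c \<in> \<H>"
  by (simp add: HH_iff state_const_def H1_C1 C1_fun_const)

lemma wgr_wg: "p \<in> \<H> \<Longrightarrow> wg \<Omega> (fst p) (wgr p)"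
  unfolding HH_iff by (rule wg_weak_grad)

lemma wgr_L2: "p \<in> \<H> \<Longrightarrow> wgr p \<in> L2 M\<Omega>"
  by (rule wg_D(2)[OF wgr_wg])

lemma wgr_l2_le: "p \<in> \<H> \<Longrightarrow> l2 M\<Omega> (wgr p) \<le> st_norm p"
proof -
  assume p: "p \<in> \<H>"
  have "l2 M\<Omega> (wgr p) \<le> H1_norm \<Omega> (fst p)"
    unfolding H1_norm_wg[OF wgr_wg[OF p]] by (rule real_le_rsqrt) simp
  then show ?thesis using H1_le_st_norm[of p] by linarith
qed

lemma wgr_add: "p \<in> \<H> \<Longrightarrow> q \<in> \<H> \<Longrightarrow> AE x in M\<Omega>. wgr (p + q) x = wgr p x + wgr q x"
  unfolding fst_plus by (intro weak_grad_AE wg_add wgr_wg)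

lemma wgr_scale: "p \<in> \<H> \<Longrightarrow> AE x in M\<Omega>. wgr (state_scale c p) x = c *s wgr p x"
  unfolding state_scale_def fst_conv by (intro weak_grad_AE wg_cmult wgr_wg)

lemma wgr_cnj: "p \<in> \<H> \<Longrightarrow> AE x in M\<Omega>. wgr (state_cnj p) x = cnj_vec (wgr p x)"
  unfolding state_cnj_def fst_conv by (intro weak_grad_AE wg_cnj wgr_wg)

lemma wgr_const: "AE x in M\<Omega>. wgr (state_const c :: ('n, 'm) state) x = 0"
  using weak_grad_AE[OF wg_C1[OF C1_fun_const[of c]]] by (simp add: state_const_def cgrad_const)

lemma sets_EE: "EE m \<in> sets dS"
proof -
  obtain T where T: "open T" "EE m = frontier \<Omega> \<inter> T" using open_EE[of m] by (auto simp: openin_open)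
  then show ?thesis
    unfolding sets_surface_measure_iff by (auto intro!: sets.Int borel_closed frontier_closed)
qed

lemma reg_borel: "reg \<in> sets borel"
  unfolding electrode_region_def by (intro sets.finite_UN borel_closed) auto

lemma reg_sets: "reg \<inter> frontier \<Omega> \<in> sets dS"
  unfolding sets_surface_measure_iff using reg_borel by (auto intro: sets.Int borel_closed)

lemma indicator_reg_measurable: "(indicator reg :: real^'n \<Rightarrow> complex) \<in> borel_measurable dS"
  by (rule borel_measurable_surfaceI) (intro borel_measurable_indicator reg_borel)

lemma indicator_EE_measurable: "(indicator (EE m) :: real^'n \<Rightarrow> complex) \<in> borel_measurable dS"
  by (intro borel_measurable_indicator sets_EE)

lemma electrode_fun_measurable: "electrode_fun EE V \<in> borel_measurable dS"
  unfolding electrode_fun_def[abs_def]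
  using indicator_reg_measurable indicator_EE_measurable
  by (intro borel_measurable_add borel_measurable_sum borel_measurable_times borel_measurable_const)

text \<open>Each of the deviations from the mean is at most 2|V|, and the mean itself at most
  |V|.\<close>

definition "Ce = 2 * real CARD('m) + 1"

lemma electrode_fun_le: "cmod (electrode_fun EE V x) \<le> Ce * norm V"
proof -
  have i: "cmod (indicator A x) \<le> 1" for A :: "(real^'n) set" by (simp add: indicator_def)
  have "cmod ((V $ m - vec_mean V) * indicator (EE m) x) \<le> 2 * norm V" for m
  proof -
    have "cmod (V $ m - vec_mean V) \<le> norm V + norm V"
      using norm_triangle_ineq4[of "V $ m" "vec_mean V"] Finite_Cartesian_Product.norm_nth_le[of V m] norm_vec_mean_le[of V] by linarith
    then have "cmod (V $ m - vec_mean V) * cmod (indicator (EE m) x) \<le> (norm V + norm V) * 1"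
      by (intro mult_mono i) auto
    then show ?thesis by (simp add: norm_mult)
  qed
  then have 1: "cmod (\<Sum>m\<in>UNIV. (V $ m - vec_mean V) * indicator (EE m) x) \<le> (\<Sum>m\<in>(UNIV :: 'm set). 2 * norm V)"
    by (intro sum_norm_le)
  have "cmod (vec_mean V) * cmod (indicator reg x) \<le> norm V * 1"
    by (intro mult_mono i norm_vec_mean_le) auto
  then have 2: "cmod (vec_mean V * indicator reg x) \<le> norm V" by (simp add: norm_mult)
  have "cmod (electrode_fun EE V x) \<le> (\<Sum>m\<in>(UNIV :: 'm set). 2 * norm V) + norm V"
    unfolding electrode_fun_def using norm_triangle_le[OF add_mono[OF 1 2]] .
  then show ?thesis by (simp add: Ce_def algebra_simps)
qed

text \<open>Bound for the jump in \<open>L2 dS\<close> by \<open>st_norm\<close>: potentials cost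
  \<open>Ce\<close> times the root of the total area, traces cost \<open>Ktr\<close>.\<close>

definition "Cj = Ce * l2 dS (\<lambda>x. 1 :: complex) + Ktr"

lemma Cj_nonneg: "0 \<le> Cj" by (simp add: Cj_def Ce_def Ktr_nonneg)

lemma
  shows electrode_fun_L2: "electrode_fun EE V \<in> L2 dS"
    and electrode_fun_l2_le: "l2 dS (electrode_fun EE V) \<le> Ce * norm V * l2 dS (\<lambda>x. 1 :: complex)"
proof -
  have 1: "(\<lambda>x. 1 :: complex) \<in> L2 dS" by (rule L2_dS_C1[OF C1_fun_const])
  have le: "AE x in dS. norm (electrode_fun EE V x) \<le> Ce * norm V * norm (1 :: complex)"
    using electrode_fun_le by (intro AE_I2) simp
  show "electrode_fun EE V \<in> L2 dS" by (rule L2_bound[OF 1 electrode_fun_measurable le])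
  show "l2 dS (electrode_fun EE V) \<le> Ce * norm V * l2 dS (\<lambda>x. 1 :: complex)"
    by (rule l2_bound_AE[OF 1 electrode_fun_measurable le]) (simp add: Ce_def)
qed

lemma trace_on_L2: "p \<in> \<H> \<Longrightarrow> trace_on \<Omega> (fst p) \<in> L2 dS"
  unfolding HH_iff by (rule has_trace_L2[OF has_trace_trace_on])

lemma jmp_eq: "jmp p x = electrode_fun EE (snd p) x - trace_on \<Omega> (fst p) x"
  by (simp add: jump_def split_beta)

lemma jmp_L2: "p \<in> \<H> \<Longrightarrow> jmp p \<in> L2 dS"
  unfolding jmp_eq[abs_def] by (intro L2_diff electrode_fun_L2 trace_on_L2)

lemma jmp_l2_le:
  assumes p: "p \<in> \<H>" shows "l2 dS (jmp p) \<le> Cj * st_norm p"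
proof -
  have "l2 dS (jmp p) \<le> l2 dS (electrode_fun EE (snd p)) + l2 dS (\<lambda>x. - trace_on \<Omega> (fst p) x)"
    unfolding jmp_eq[abs_def]
    using l2_triangle[OF electrode_fun_L2 L2_uminus[OF trace_on_L2[OF p]], of "snd p"] by simp
  also have "l2 dS (\<lambda>x. - trace_on \<Omega> (fst p) x) = l2 dS (trace_on \<Omega> (fst p))" by (simp add: l2_def)
  also have "l2 dS (electrode_fun EE (snd p)) + l2 dS (trace_on \<Omega> (fst p)) \<le> Ce * st_norm p * l2 dS (\<lambda>x. 1 :: complex) + Ktr * st_norm p"
  proof (rule add_mono)
    have "Ce * norm (snd p) * l2 dS (\<lambda>x. 1 :: complex) \<le> Ce * st_norm p * l2 dS (\<lambda>x. 1 :: complex)"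
      using snd_le_st_norm[of p] by (intro mult_right_mono mult_left_mono) (auto simp: Ce_def)
    then show "l2 dS (electrode_fun EE (snd p)) \<le> Ce * st_norm p * l2 dS (\<lambda>x. 1 :: complex)"
      using electrode_fun_l2_le[of "snd p"] by linarith
    have v: "fst p \<in> H1 \<Omega>" using p HH_iff by blast
    have "Ktr * H1_norm \<Omega> (fst p) \<le> Ktr * st_norm p"
      using H1_le_st_norm by (intro mult_left_mono Ktr_nonneg)
    then show "l2 dS (trace_on \<Omega> (fst p)) \<le> Ktr * st_norm p"
      using has_trace_bound[OF has_trace_trace_on[OF v] v] by linarith
  qed
  also have "\<dots> = Cj * st_norm p" by (simp add: Cj_def algebra_simps)
  finally show ?thesis .
qed

lemma jmp_add:
  assumes p: "p \<in> \<H>" and q: "q \<in> \<H>" shows "AE x in dS. jmp (p + q) x = jmp p x + jmp q x"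
proof -
  have v: "fst p \<in> H1 \<Omega>" "fst q \<in> H1 \<Omega>" using p q HH_iff by blast+
  have "AE x in dS. trace_on \<Omega> (\<lambda>x. fst p x + fst q x) x = trace_on \<Omega> (fst p) x + trace_on \<Omega> (fst q) x"
    by (intro trace_on_AE has_trace_add has_trace_trace_on H1_add v)
  then show ?thesis unfolding jmp_eq fst_plus snd_add electrode_fun_linear by eventually_elim simp
qed

lemma jmp_scale:
  assumes p: "p \<in> \<H>" shows "AE x in dS. jmp (state_scale c p) x = c * jmp p x"
proof -
  have v: "fst p \<in> H1 \<Omega>" using p HH_iff by blast
  have "AE x in dS. trace_on \<Omega> (\<lambda>x. c * fst p x) x = c * trace_on \<Omega> (fst p) x"
    by (intro trace_on_AE has_trace_cmult has_trace_trace_on H1_cmult v)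
  then show ?thesis
    unfolding jmp_eq state_scale_def fst_conv snd_conv electrode_fun_linear by eventually_elim (simp add: algebra_simps)
qed

lemma jmp_cnj:
  assumes p: "p \<in> \<H>" shows "AE x in dS. jmp (state_cnj p) x = cnj (jmp p x)"
proof -
  have v: "fst p \<in> H1 \<Omega>" using p HH_iff by blast
  have "AE x in dS. trace_on \<Omega> (\<lambda>x. cnj (fst p x)) x = cnj (trace_on \<Omega> (fst p) x)"
    by (intro trace_on_AE has_trace_cnj has_trace_trace_on H1_cnj v)
  then show ?thesis
    unfolding jmp_eq state_cnj_def fst_conv snd_conv electrode_fun_linear by eventually_elim simp
qed

text \<open>A constant state has jump c - c = 0 on the electrode region but -c on the rest of the
  boundary, hence the indicator.\<close>

lemma jmp_const: "AE x in dS. indicator reg x * jmp (state_const c) x = 0"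
proof -
  have "AE x in dS. trace_on \<Omega> (\<lambda>x. c) x = c"
    by (intro trace_on_AE has_trace_C1 H1_C1 C1_fun_const)
  then show ?thesis
    unfolding jmp_eq state_const_def fst_conv snd_conv electrode_fun_linear
    by eventually_elim (simp add: indicator_def)
qed

text \<open>One number bounds both coefficients, and the contact coefficient enters through its
  continuation by zero. The boundedness of the form is expressed through \<open>s\<close>
  alone.\<close>

definition coef :: "(real^'n \<Rightarrow> complex) \<Rightarrow> (real^'n \<Rightarrow> complex) \<Rightarrow> real \<Rightarrow> bool" where
  "coef \<omega> \<eta> s \<longleftrightarrow> multiplier M\<Omega> \<omega> s \<and> multiplier dS (\<lambda>x. indicator reg x * \<eta> x) s"

lemma coef_nonneg: "coef \<omega> \<eta> s \<Longrightarrow> 0 \<le> s"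
  by (simp add: coef_def multiplier_def)

lemma coef_add: "coef \<omega> \<eta> s \<Longrightarrow> coef \<omega>' \<eta>' t \<Longrightarrow> coef (\<lambda>x. \<omega> x + \<omega>' x) (\<lambda>x. \<eta> x + \<eta>' x) (s + t)"
  unfolding coef_def using multiplier_add[of M\<Omega> \<omega> s \<omega>' t]
    multiplier_add[of dS "\<lambda>x. indicator reg x * \<eta> x" s "\<lambda>x. indicator reg x * \<eta>' x" t]
  by (simp add: distrib_left)

text \<open>The contact coefficient is given on a restricted measure space; multiplication by the
  indicator transports measurability and bound to the whole boundary.\<close>

lemma coef_Linf:
  assumes \<omega>: "\<omega> \<in> Linf M\<Omega>" and \<eta>: "\<eta> \<in> Linf (contact_measure \<Omega> EE)"
  shows "coef \<omega> \<eta> (max 0 (max (Linf_norm M\<Omega> \<omega>) (Linf_norm (contact_measure \<Omega> EE) \<eta>)))"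
proof -
  have m: "multiplier (contact_measure \<Omega> EE) \<eta> (max 0 (Linf_norm (contact_measure \<Omega> EE) \<eta>))"
    by (rule multiplier_Linf[OF \<eta>])
  then have "(\<lambda>x. indicator reg x *\<^sub>R \<eta> x) \<in> borel_measurable dS"
    unfolding multiplier_def contact_measure_def using reg_sets
    by (subst (asm) borel_measurable_restrict_space_iff) auto
  moreover have "(\<lambda>x. indicator reg x *\<^sub>R \<eta> x) = (\<lambda>x. indicator reg x * \<eta> x)"
    by (auto simp: indicator_def fun_eq_iff)
  moreover have "AE x in dS. x \<in> reg \<longrightarrow> cmod (\<eta> x) \<le> max 0 (Linf_norm (contact_measure \<Omega> EE) \<eta>)"
    using m reg_sets unfolding multiplier_def contact_measure_def by (simp add: AE_restrict_space_iff)
  then have "AE x in dS. cmod (indicator reg x * \<eta> x) \<le> max 0 (Linf_norm (contact_measure \<Omega> EE) \<eta>)"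
    by eventually_elim (auto simp: indicator_def)
  ultimately have "multiplier dS (\<lambda>x. indicator reg x * \<eta> x) (max 0 (Linf_norm (contact_measure \<Omega> EE) \<eta>))"
    by (simp add: multiplier_def)
  then show ?thesis
    unfolding coef_def by (intro conjI multiplier_mono[OF multiplier_Linf[OF \<omega>]]) (auto elim!: multiplier_mono)
qed

section \<open>Algebra and boundedness of the form\<close>

lemma interior_form_tri:
  assumes "multiplier M\<Omega> \<omega> s" "F \<in> L2 M\<Omega>" "G \<in> L2 M\<Omega>"
  shows "interior_form \<Omega> \<omega> F G = (\<Sum>i\<in>UNIV. tri M\<Omega> \<omega> (\<lambda>x. F x $ i) (\<lambda>x. G x $ i))"
  unfolding interior_form_def tri_def
  using tri_integrable[OF assms(1) L2_component[OF assms(2)] L2_component[OF assms(3)]]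
  by (subst Bochner_Integration.integral_sum[symmetric]) (auto simp: sum_distrib_left mult.assoc)

lemma boundary_form_tri: "boundary_form \<Omega> EE \<eta> f g = tri dS (\<lambda>x. indicator reg x * \<eta> x) f g"
  by (simp add: boundary_form_def tri_def)

text \<open>Unlike the jump itself, its restriction to the electrode region is invariant under adding constants to a
  state.\<close>

definition rj :: "('n, 'm) state \<Rightarrow> real^'n \<Rightarrow> complex" where
  "rj p x = indicator reg x * jmp p x"

lemma indicator_le: "cmod (indicator A y) \<le> 1"
  by (simp add: indicator_def)

lemma
  assumes p: "p \<in> \<H>"
  shows rj_L2: "rj p \<in> L2 dS" and rj_l2_le: "l2 dS (rj p) \<le> Cj * st_norm p"
proof -
  have m: "multiplier dS (indicator reg) 1"
    using indicator_reg_measurable by (auto simp: multiplier_def indicator_le intro!: AE_I2)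
  note b = multiplier_L2[OF m jmp_L2[OF p]]
  show "rj p \<in> L2 dS" unfolding rj_def[abs_def] by (rule b(1))
  show "l2 dS (rj p) \<le> Cj * st_norm p" unfolding rj_def[abs_def] using b(2) jmp_l2_le[OF p] by simp
qed

lemma rj_add: "p \<in> \<H> \<Longrightarrow> q \<in> \<H> \<Longrightarrow> AE x in dS. rj (p + q) x = rj p x + rj q x"
  using jmp_add[of p q] unfolding rj_def by (auto elim!: eventually_mono simp: distrib_left)

lemma rj_scale: "p \<in> \<H> \<Longrightarrow> AE x in dS. rj (state_scale c p) x = c * rj p x"
  using jmp_scale[of p c] unfolding rj_def by (auto elim!: eventually_mono)

lemma rj_cnj: "p \<in> \<H> \<Longrightarrow> AE x in dS. rj (state_cnj p) x = cnj (rj p x)"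
  using jmp_cnj[of p] unfolding rj_def by (auto elim!: eventually_mono simp: indicator_def)

lemma rj_const: "AE x in dS. rj (state_const c) x = 0"
  using jmp_const unfolding rj_def .

lemma wgr_i_L2: "p \<in> \<H> \<Longrightarrow> (\<lambda>x. wgr p x $ i) \<in> L2 M\<Omega>"
  by (intro L2_component wgr_L2)

abbreviation bd :: "(real^'n \<Rightarrow> complex) \<Rightarrow> real^'n \<Rightarrow> complex" where
  "bd \<eta> \<equiv> (\<lambda>x. indicator reg x * \<eta> x)"

text \<open>The boundary coefficient already contains the indicator of the region, so jumps may be
  replaced by their restrictions \<open>rj\<close>.\<close>

lemma B_form_eq:
  assumes c: "coef \<omega> \<eta> s" and p: "p \<in> \<H>" and q: "q \<in> \<H>"
  shows "B_form \<Omega> EE \<omega> \<eta> p q = (\<Sum>i\<in>UNIV. tri M\<Omega> \<omega> (\<lambda>x. wgr p x $ i) (\<lambda>x. cnj (wgr q x $ i)))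
    + tri dS (bd \<eta>) (rj p) (\<lambda>x. cnj (rj q x))"
proof -
  have m: "multiplier M\<Omega> \<omega> s" using c by (simp add: coef_def)
  have "interior_form \<Omega> \<omega> (wgr p) (\<lambda>x. cnj_vec (wgr q x)) = (\<Sum>i\<in>UNIV. tri M\<Omega> \<omega> (\<lambda>x. wgr p x $ i) (\<lambda>x. cnj_vec (wgr q x) $ i))"
    by (rule interior_form_tri[OF m wgr_L2[OF p] L2_cnj_vec[OF wgr_L2[OF q]]])
  moreover have "tri dS (bd \<eta>) (jmp p) (\<lambda>x. cnj (jmp q x)) = tri dS (bd \<eta>) (rj p) (\<lambda>x. cnj (rj q x))"
    unfolding tri_def rj_def by (rule Bochner_Integration.integral_cong) (auto simp: indicator_def)
  ultimately show ?thesis unfolding B_form_def boundary_form_tri by (simp add: cnj_vec_def)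
qed

text \<open>Gradients and jumps of sums and multiples of states are known only almost everywhere.
  This lemma and its counterpart \<open>B_form_right\<close> substitute such representatives inside
  the form; linearity in each argument follows.\<close>

lemma B_form_left:
  assumes c: "coef \<omega> \<eta> s" and p: "p \<in> \<H>" and q: "q \<in> \<H>"
    and G: "AE x in M\<Omega>. wgr p x = G x" "G \<in> L2 M\<Omega>" and J: "AE x in dS. rj p x = J x" "J \<in> L2 dS"
  shows "B_form \<Omega> EE \<omega> \<eta> p q = (\<Sum>i\<in>UNIV. tri M\<Omega> \<omega> (\<lambda>x. G x $ i) (\<lambda>x. cnj (wgr q x $ i)))
    + tri dS (bd \<eta>) J (\<lambda>x. cnj (rj q x))"
proof -
  have m: "multiplier M\<Omega> \<omega> s" "multiplier dS (bd \<eta>) s" using c by (auto simp: coef_def)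
  have "tri M\<Omega> \<omega> (\<lambda>x. wgr p x $ i) (\<lambda>x. cnj (wgr q x $ i)) = tri M\<Omega> \<omega> (\<lambda>x. G x $ i) (\<lambda>x. cnj (wgr q x $ i))" for i
    by (rule tri_cong[OF m(1) wgr_i_L2[OF p] L2_component[OF G(2)] L2_cnj[OF wgr_i_L2[OF q]] L2_cnj[OF wgr_i_L2[OF q]]])
       (use G(1) in \<open>auto elim: eventually_mono\<close>)
  moreover have "tri dS (bd \<eta>) (rj p) (\<lambda>x. cnj (rj q x)) = tri dS (bd \<eta>) J (\<lambda>x. cnj (rj q x))"
    by (rule tri_cong[OF m(2) rj_L2[OF p] J(2) L2_cnj[OF rj_L2[OF q]] L2_cnj[OF rj_L2[OF q]] J(1)]) simp
  ultimately show ?thesis unfolding B_form_eq[OF c p q] by simp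
qed

lemma B_form_right:
  assumes c: "coef \<omega> \<eta> s" and p: "p \<in> \<H>" and q: "q \<in> \<H>"
    and G: "AE x in M\<Omega>. wgr q x = G x" "G \<in> L2 M\<Omega>" and J: "AE x in dS. rj q x = J x" "J \<in> L2 dS"
  shows "B_form \<Omega> EE \<omega> \<eta> p q = (\<Sum>i\<in>UNIV. tri M\<Omega> \<omega> (\<lambda>x. wgr p x $ i) (\<lambda>x. cnj (G x $ i)))
    + tri dS (bd \<eta>) (rj p) (\<lambda>x. cnj (J x))"
proof -
  have m: "multiplier M\<Omega> \<omega> s" "multiplier dS (bd \<eta>) s" using c by (auto simp: coef_def)
  have "tri M\<Omega> \<omega> (\<lambda>x. wgr p x $ i) (\<lambda>x. cnj (wgr q x $ i)) = tri M\<Omega> \<omega> (\<lambda>x. wgr p x $ i) (\<lambda>x. cnj (G x $ i))" for i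
    by (rule tri_cong[OF m(1) wgr_i_L2[OF p] wgr_i_L2[OF p] L2_cnj[OF wgr_i_L2[OF q]] L2_cnj[OF L2_component[OF G(2)]]])
       (use G(1) in \<open>auto elim: eventually_mono\<close>)
  moreover have "tri dS (bd \<eta>) (rj p) (\<lambda>x. cnj (rj q x)) = tri dS (bd \<eta>) (rj p) (\<lambda>x. cnj (J x))"
    by (rule tri_cong[OF m(2) rj_L2[OF p] rj_L2[OF p] L2_cnj[OF rj_L2[OF q]] L2_cnj[OF J(2)]])
       (use J(1) in \<open>auto elim: eventually_mono\<close>)
  ultimately show ?thesis unfolding B_form_eq[OF c p q] by simp
qed

context
  fixes \<omega> \<eta> s assumes c: "coef \<omega> \<eta> s"
begin

lemma m\<omega>: "multiplier M\<Omega> \<omega> s" and m\<eta>: "multiplier dS (bd \<eta>) s"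
  using c by (auto simp: coef_def)

lemma B_add_left:
  assumes p: "p \<in> \<H>" and p': "p' \<in> \<H>" and q: "q \<in> \<H>"
  shows "B_form \<Omega> EE \<omega> \<eta> (p + p') q = B_form \<Omega> EE \<omega> \<eta> p q + B_form \<Omega> EE \<omega> \<eta> p' q"
  unfolding B_form_left[OF c HH_add[OF p p'] q wgr_add[OF p p'] L2_add[OF wgr_L2[OF p] wgr_L2[OF p']]
      rj_add[OF p p'] L2_add[OF rj_L2[OF p] rj_L2[OF p']]] B_form_eq[OF c p q] B_form_eq[OF c p' q]
  by (simp add: tri_add(1)[OF m\<omega> wgr_i_L2[OF p] wgr_i_L2[OF p'] L2_cnj[OF wgr_i_L2[OF q]]]
      tri_add(1)[OF m\<eta> rj_L2[OF p] rj_L2[OF p'] L2_cnj[OF rj_L2[OF q]]] sum.distrib)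

lemma B_add_right:
  assumes p: "p \<in> \<H>" and p': "p' \<in> \<H>" and q: "q \<in> \<H>"
  shows "B_form \<Omega> EE \<omega> \<eta> q (p + p') = B_form \<Omega> EE \<omega> \<eta> q p + B_form \<Omega> EE \<omega> \<eta> q p'"
  unfolding B_form_right[OF c q HH_add[OF p p'] wgr_add[OF p p'] L2_add[OF wgr_L2[OF p] wgr_L2[OF p']]
      rj_add[OF p p'] L2_add[OF rj_L2[OF p] rj_L2[OF p']]] B_form_eq[OF c q p] B_form_eq[OF c q p']
  by (simp add: tri_add(2)[OF m\<omega> L2_cnj[OF wgr_i_L2[OF p]] L2_cnj[OF wgr_i_L2[OF p']] wgr_i_L2[OF q]]
      tri_add(2)[OF m\<eta> L2_cnj[OF rj_L2[OF p]] L2_cnj[OF rj_L2[OF p']] rj_L2[OF q]] sum.distrib)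

lemma B_scale_left:
  assumes p: "p \<in> \<H>" and q: "q \<in> \<H>"
  shows "B_form \<Omega> EE \<omega> \<eta> (state_scale k p) q = k * B_form \<Omega> EE \<omega> \<eta> p q"
  unfolding B_form_left[OF c HH_scale[OF p] q wgr_scale[OF p] L2_smult_vec[OF wgr_L2[OF p]]
      rj_scale[OF p] L2_cmult[OF rj_L2[OF p]]] B_form_eq[OF c p q]
  by (simp add: tri_cmult[OF m\<omega>] tri_cmult[OF m\<eta>] sum_distrib_left distrib_left)

lemma B_scale_right:
  assumes p: "p \<in> \<H>" and q: "q \<in> \<H>"
  shows "B_form \<Omega> EE \<omega> \<eta> q (state_scale k p) = cnj k * B_form \<Omega> EE \<omega> \<eta> q p"
  unfolding B_form_right[OF c q HH_scale[OF p] wgr_scale[OF p] L2_smult_vec[OF wgr_L2[OF p]]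
      rj_scale[OF p] L2_cmult[OF rj_L2[OF p]]] B_form_eq[OF c q p]
  by (simp add: tri_cmult[OF m\<omega>] tri_cmult[OF m\<eta>] sum_distrib_left distrib_left)

lemma B_diff_left:
  assumes p: "p \<in> \<H>" and p': "p' \<in> \<H>" and q: "q \<in> \<H>"
  shows "B_form \<Omega> EE \<omega> \<eta> (p - p') q = B_form \<Omega> EE \<omega> \<eta> p q - B_form \<Omega> EE \<omega> \<eta> p' q"
  using B_add_left[OF HH_diff[OF p p'] p' q] by simp

text \<open>Adding a constant changes neither the gradient nor the jump on the region, almost
  everywhere. Together with \<open>B_const_right\<close> this makes the form well defined on the
  quotient.\<close>

lemma B_const_left:
  assumes p: "p \<in> \<H>" and q: "q \<in> \<H>"
  shows "B_form \<Omega> EE \<omega> \<eta> (p + state_const k) q = B_form \<Omega> EE \<omega> \<eta> p q"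
proof -
  have "AE x in M\<Omega>. wgr (p + state_const k) x = wgr p x"
    using wgr_add[OF p HH_const[of k]] wgr_const[of k] by eventually_elim simp
  moreover have "AE x in dS. rj (p + state_const k) x = rj p x"
    using rj_add[OF p HH_const[of k]] rj_const[of k] by eventually_elim simp
  ultimately show ?thesis
    using B_form_left[OF c HH_add[OF p HH_const] q _ wgr_L2[OF p] _ rj_L2[OF p]] B_form_eq[OF c p q] by simp
qed

lemma B_const_right:
  assumes p: "p \<in> \<H>" and q: "q \<in> \<H>"
  shows "B_form \<Omega> EE \<omega> \<eta> q (p + state_const k) = B_form \<Omega> EE \<omega> \<eta> q p"
proof -
  have "AE x in M\<Omega>. wgr (p + state_const k) x = wgr p x"
    using wgr_add[OF p HH_const[of k]] wgr_const[of k] by eventually_elim simp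
  moreover have "AE x in dS. rj (p + state_const k) x = rj p x"
    using rj_add[OF p HH_const[of k]] rj_const[of k] by eventually_elim simp
  ultimately show ?thesis
    using B_form_right[OF c q HH_add[OF p HH_const] _ wgr_L2[OF p] _ rj_L2[OF p]] B_form_eq[OF c q p] by simp
qed

text \<open>Conjugating the test state undoes the conjugation in the form and leaves the bilinear
  expression of the assembly formula.\<close>

lemma B_cnj_eq:
  assumes p: "p \<in> \<H>" and q: "q \<in> \<H>"
  shows "B_form \<Omega> EE \<omega> \<eta> p (state_cnj q) = interior_form \<Omega> \<omega> (wgr p) (wgr q) + boundary_form \<Omega> EE \<eta> (jmp p) (jmp q)"
proof -
  have "tri dS (bd \<eta>) (jmp p) (jmp q) = tri dS (bd \<eta>) (rj p) (rj q)"
    unfolding tri_def rj_def by (rule Bochner_Integration.integral_cong) (auto simp: indicator_def)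
  then show ?thesis
    unfolding B_form_right[OF c p HH_cnj[OF q] wgr_cnj[OF q] L2_cnj_vec[OF wgr_L2[OF q]] rj_cnj[OF q] L2_cnj[OF rj_L2[OF q]]]
      boundary_form_tri interior_form_tri[OF m\<omega> wgr_L2[OF p] wgr_L2[OF q]]
    by (simp add: cnj_vec_def)
qed

text \<open>The bilinear expression is symmetric, because its coefficients are scalars.\<close>

lemma B_cnj_commute:
  assumes p: "p \<in> \<H>" and q: "q \<in> \<H>"
  shows "B_form \<Omega> EE \<omega> \<eta> p (state_cnj q) = B_form \<Omega> EE \<omega> \<eta> q (state_cnj p)"
  unfolding B_cnj_eq[OF p q] B_cnj_eq[OF q p] boundary_form_tri
    interior_form_tri[OF m\<omega> wgr_L2[OF p] wgr_L2[OF q]] interior_form_tri[OF m\<omega> wgr_L2[OF q] wgr_L2[OF p]]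
  by (simp add: tri_commute[of dS _ "jmp p"] tri_commute[of M\<Omega> _ "\<lambda>x. wgr p x $ _"])

lemma B_add_coef:
  assumes c': "coef \<omega>' \<eta>' t" and p: "p \<in> \<H>" and q: "q \<in> \<H>"
  shows "B_form \<Omega> EE (\<lambda>x. \<omega> x + \<omega>' x) (\<lambda>x. \<eta> x + \<eta>' x) p q = B_form \<Omega> EE \<omega> \<eta> p q + B_form \<Omega> EE \<omega>' \<eta>' p q"
proof -
  have m': "multiplier M\<Omega> \<omega>' t" "multiplier dS (bd \<eta>') t" using c' by (auto simp: coef_def)
  have "tri dS (bd (\<lambda>x. \<eta> x + \<eta>' x)) (rj p) (\<lambda>x. cnj (rj q x)) = tri dS (bd \<eta>) (rj p) (\<lambda>x. cnj (rj q x)) + tri dS (bd \<eta>') (rj p) (\<lambda>x. cnj (rj q x))"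
    using tri_add_coeff[OF m\<eta> m'(2) rj_L2[OF p] L2_cnj[OF rj_L2[OF q]]] by (simp add: distrib_left)
  then show ?thesis
    unfolding B_form_eq[OF coef_add[OF c c'] p q] B_form_eq[OF c p q] B_form_eq[OF c' p q]
    by (simp add: tri_add_coeff[OF m\<omega> m'(1) wgr_i_L2[OF p] L2_cnj[OF wgr_i_L2[OF q]]] sum.distrib)
qed

lemma coef_cmult: "coef (\<lambda>x. k * \<omega> x) (\<lambda>x. k * \<eta> x) (cmod k * s)"
  using multiplier_cmult[OF m\<omega>, of k] multiplier_cmult[OF m\<eta>, of k] by (simp add: coef_def mult.left_commute)

lemma B_cmult_coef:
  assumes p: "p \<in> \<H>" and q: "q \<in> \<H>"
  shows "B_form \<Omega> EE (\<lambda>x. k * \<omega> x) (\<lambda>x. k * \<eta> x) p q = k * B_form \<Omega> EE \<omega> \<eta> p q"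
proof -
  have "tri dS (bd (\<lambda>x. k * \<eta> x)) f g = k * tri dS (bd \<eta>) f g" for f g
    using tri_cmult_coeff[of dS k "bd \<eta>" f g] by (simp add: mult.left_commute)
  then show ?thesis
    unfolding B_form_eq[OF coef_cmult p q] B_form_eq[OF c p q]
    by (simp add: tri_cmult_coeff sum_distrib_left distrib_left)
qed

text \<open>Cauchy-Schwarz for each of the n gradient components and for the boundary term, where
  each of the two jumps contributes a factor \<open>Cj\<close>.\<close>

lemma B_bound:
  assumes p: "p \<in> \<H>" and q: "q \<in> \<H>"
  shows "cmod (B_form \<Omega> EE \<omega> \<eta> p q) \<le> (real CARD('n) + Cj\<^sup>2) * s * st_norm p * st_norm q"
proof -
  have s: "0 \<le> s" by (rule coef_nonneg[OF c])
  have cnj: "l2 M (\<lambda>x. cnj (f x)) = l2 M f" for M :: "(real^'n) measure" and f by (simp add: l2_def)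
  have "cmod (tri M\<Omega> \<omega> (\<lambda>x. wgr p x $ i) (\<lambda>x. cnj (wgr q x $ i))) \<le> s * st_norm p * st_norm q" for i
  proof -
    have "cmod (tri M\<Omega> \<omega> (\<lambda>x. wgr p x $ i) (\<lambda>x. cnj (wgr q x $ i))) \<le> s * l2 M\<Omega> (\<lambda>x. wgr p x $ i) * l2 M\<Omega> (\<lambda>x. cnj (wgr q x $ i))"
      by (rule tri_bound[OF m\<omega> wgr_i_L2[OF p] L2_cnj[OF wgr_i_L2[OF q]]])
    also have "\<dots> \<le> s * st_norm p * st_norm q"
      unfolding cnj
      using order_trans[OF l2_component_le[OF wgr_L2[OF p]] wgr_l2_le[OF p]] order_trans[OF l2_component_le[OF wgr_L2[OF q]] wgr_l2_le[OF q]] s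
      by (intro mult_mono mult_left_mono) auto
    finally show ?thesis .
  qed
  then have 1: "cmod (\<Sum>i\<in>UNIV. tri M\<Omega> \<omega> (\<lambda>x. wgr p x $ i) (\<lambda>x. cnj (wgr q x $ i))) \<le> (\<Sum>i\<in>(UNIV :: 'n set). s * st_norm p * st_norm q)"
    by (intro sum_norm_le)
  have "cmod (tri dS (bd \<eta>) (rj p) (\<lambda>x. cnj (rj q x))) \<le> s * l2 dS (rj p) * l2 dS (\<lambda>x. cnj (rj q x))"
    by (rule tri_bound[OF m\<eta> rj_L2[OF p] L2_cnj[OF rj_L2[OF q]]])
  also have "\<dots> \<le> s * (Cj * st_norm p) * (Cj * st_norm q)"
    unfolding cnj using rj_l2_le[OF p] rj_l2_le[OF q] s Cj_nonneg by (intro mult_mono mult_left_mono) auto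
  finally have "cmod (B_form \<Omega> EE \<omega> \<eta> p q) \<le> (\<Sum>i\<in>(UNIV :: 'n set). s * st_norm p * st_norm q) + s * (Cj * st_norm p) * (Cj * st_norm q)"
    unfolding B_form_eq[OF c p q] by (rule norm_triangle_le[OF add_mono[OF 1]])
  then show ?thesis by (simp add: power2_eq_square algebra_simps)
qed

end

end

section \<open>The forward problem and its linearization\<close>

lemma L2_inner_integrable:
  fixes f g :: "'a \<Rightarrow> 'b::euclidean_space"
  assumes f: "f \<in> L2 M" and g: "g \<in> L2 M"
  shows "integrable M (\<lambda>x. f x \<bullet> g x)"
proof -
  note [measurable] = f[THEN L2_measurable] g[THEN L2_measurable]
  show ?thesis
    by (rule Bochner_Integration.integrable_bound[OF L2_integrable_mult[OF f g]])
       (auto intro!: AE_I2 simp: abs_mult Cauchy_Schwarz_ineq2)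
qed

lemma inner_smult_real: "(of_real t *s v) \<bullet> (w :: complex^'k) = t * (v \<bullet> w)"
proof -
  have "of_real t *s v = t *\<^sub>R v"
    by (simp add: vec_eq_iff scaleR_conv_of_real[where 'a = complex])
  then show ?thesis by simp
qed

lemma le_of_sq_le_mult:
  fixes x y c :: real assumes "c * x\<^sup>2 \<le> y * x" "0 \<le> x" "0 \<le> y" shows "c * x \<le> y"
  using assms by (cases "x = 0") (auto simp: power2_eq_square mult.assoc[symmetric])

lemma cmod_dot_le: "cmod (dot a (cnj_vec b)) \<le> norm a * norm b"
  using cmod_sum_mult_le_complex[of a "cnj_vec b"] by (simp add: dot_def)

section \<open>Zero-mean states as a semi-Hilbert space\<close>

context eit
begin

text \<open>Zero mean of the potentials singles out one representative in each class modulo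
  constants.\<close>

definition S0 :: "('n, 'm) state set" where
  "S0 = {p \<in> \<H>. snd p \<in> Cdiamond}"

lemma S0_HH: "p \<in> S0 \<Longrightarrow> p \<in> \<H>" by (simp add: S0_def)

lemma S0_add: "p \<in> S0 \<Longrightarrow> q \<in> S0 \<Longrightarrow> p + q \<in> S0"
  by (simp add: S0_def HH_add Cdiamond_def sum.distrib)

lemma S0_diff: "p \<in> S0 \<Longrightarrow> q \<in> S0 \<Longrightarrow> p - q \<in> S0"
  by (simp add: S0_def HH_diff Cdiamond_def sum_subtractf)

lemma S0_scale: "p \<in> S0 \<Longrightarrow> state_scale c p \<in> S0"
  by (simp add: S0_def HH_scale Cdiamond_def) (simp add: state_scale_def flip: sum_distrib_left)

lemma S0_zero: "0 \<in> S0"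
  using C1_fun_const[of 0, THEN H1_C1] by (simp add: S0_def HH_iff Cdiamond_def zero_fun_def)

lemma S0_centre:
  assumes p: "p \<in> \<H>"
  obtains p0 k where "p0 \<in> S0" "p = p0 + state_const k"
proof
  let ?k = "vec_mean (snd p)"
  show "p - state_const ?k \<in> S0"
    by (simp add: S0_def HH_diff p HH_const Cdiamond_def)
       (simp add: state_const_def sum_subtractf vec_mean_def)
  show "p = p - state_const ?k + state_const ?k" by simp
qed

text \<open>A real inner product on complex data: \<open>semi_hilbert\<close> works over the reals,
  and \<open>solve\<close> recovers the complex equations.\<close>

definition st_ip :: "('n, 'm) state \<Rightarrow> ('n, 'm) state \<Rightarrow> real" where
  "st_ip p q = (LINT x|M\<Omega>. fst p x \<bullet> fst q x) + (LINT x|M\<Omega>. wgr p x \<bullet> wgr q x) + snd p \<bullet> snd q"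

lemma st_ip_self: "p \<in> \<H> \<Longrightarrow> st_ip p p = (st_norm p)\<^sup>2"
  unfolding st_ip_def st_norm_def by (simp add: H1_norm_wg[OF wgr_wg] l2_sq power2_norm_eq_inner)

lemma fst_L2: "p \<in> \<H> \<Longrightarrow> fst p \<in> L2 M\<Omega>"
  by (rule wg_D(1)[OF wgr_wg])

lemma st_ip_add:
  assumes p: "p \<in> \<H>" and q: "q \<in> \<H>" and u: "u \<in> \<H>"
  shows "st_ip (p + q) u = st_ip p u + st_ip q u"
proof -
  have "(LINT x|M\<Omega>. fst (p + q) x \<bullet> fst u x) = (LINT x|M\<Omega>. fst p x \<bullet> fst u x) + (LINT x|M\<Omega>. fst q x \<bullet> fst u x)"
    unfolding fst_plus using p q u by (simp add: inner_add_left L2_inner_integrable fst_L2)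
  moreover have "(LINT x|M\<Omega>. wgr (p + q) x \<bullet> wgr u x) = (LINT x|M\<Omega>. (wgr p x + wgr q x) \<bullet> wgr u x)"
  proof (rule integral_cong_AE)
    note [measurable] = wgr_L2[OF p, THEN L2_measurable] wgr_L2[OF q, THEN L2_measurable] wgr_L2[OF u, THEN L2_measurable]
      wgr_L2[OF HH_add[OF p q], THEN L2_measurable]
    show "(\<lambda>x. wgr (p + q) x \<bullet> wgr u x) \<in> borel_measurable M\<Omega>" "(\<lambda>x. (wgr p x + wgr q x) \<bullet> wgr u x) \<in> borel_measurable M\<Omega>"
      by measurable
    show "AE x in M\<Omega>. wgr (p + q) x \<bullet> wgr u x = (wgr p x + wgr q x) \<bullet> wgr u x"
      using wgr_add[OF p q] by eventually_elim simp
  qed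
  moreover have "(LINT x|M\<Omega>. (wgr p x + wgr q x) \<bullet> wgr u x) = (LINT x|M\<Omega>. wgr p x \<bullet> wgr u x) + (LINT x|M\<Omega>. wgr q x \<bullet> wgr u x)"
    using p q u by (simp add: inner_add_left L2_inner_integrable wgr_L2)
  ultimately show ?thesis by (simp add: st_ip_def inner_add_left)
qed

lemma st_ip_scale:
  assumes p: "p \<in> \<H>" and u: "u \<in> \<H>"
  shows "st_ip (state_scale (of_real t) p) u = t * st_ip p u"
proof -
  have "(of_real t * z) \<bullet> w = t * (z \<bullet> w)" for z w :: complex
    by (simp add: inner_complex_def algebra_simps)
  then have "(LINT x|M\<Omega>. fst (state_scale (of_real t) p) x \<bullet> fst u x) = t * (LINT x|M\<Omega>. fst p x \<bullet> fst u x)"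
    by (simp add: state_scale_def)
  moreover have "(LINT x|M\<Omega>. wgr (state_scale (of_real t) p) x \<bullet> wgr u x) = (LINT x|M\<Omega>. t * (wgr p x \<bullet> wgr u x))"
  proof (rule integral_cong_AE)
    note [measurable] = wgr_L2[OF p, THEN L2_measurable] wgr_L2[OF u, THEN L2_measurable]
      wgr_L2[OF HH_scale[OF p], THEN L2_measurable]
    show "(\<lambda>x. wgr (state_scale (of_real t) p) x \<bullet> wgr u x) \<in> borel_measurable M\<Omega>" "(\<lambda>x. t * (wgr p x \<bullet> wgr u x)) \<in> borel_measurable M\<Omega>"
      by measurable
    show "AE x in M\<Omega>. wgr (state_scale (of_real t) p) x \<bullet> wgr u x = t * (wgr p x \<bullet> wgr u x)"
      using wgr_scale[OF p, of "of_real t"] by eventually_elim (simp add: inner_smult_real)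
  qed
  moreover have "snd (state_scale (of_real t) p) \<bullet> snd u = t * (snd p \<bullet> snd u)"
    by (simp add: state_scale_def inner_smult_real)
  ultimately show ?thesis by (simp add: st_ip_def distrib_left)
qed

lemma Cdiamond_closed: "closed (Cdiamond :: (complex^'m) set)"
  unfolding Cdiamond_def by (intro closed_Collect_eq continuous_intros)

text \<open>Completeness splits into that of \<open>H1 \<Omega>\<close> and that of the closed
  subspace \<open>Cdiamond\<close> of a finite-dimensional space.\<close>

sublocale semi_hilbert S0 "\<lambda>t. state_scale (of_real t)" st_ip
proof
  fix X :: "nat \<Rightarrow> ('n, 'm) state"
  assume X: "\<And>n. X n \<in> S0" and C: "\<And>e. e > 0 \<Longrightarrow> \<exists>N. \<forall>m\<ge>N. \<forall>n\<ge>N. sqrt (st_ip (X m - X n) (X m - X n)) < e"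
  note XH = S0_HH[OF X]
  have C': "\<exists>N. \<forall>m\<ge>N. \<forall>n\<ge>N. st_norm (X m - X n) < e" if "e > 0" for e
    using C[OF that] st_ip_self[OF HH_diff[OF XH XH]] by simp
  have "\<exists>w\<in>H1 \<Omega>. (\<lambda>n. H1_norm \<Omega> (\<lambda>x. fst (X n) x - w x)) \<longlonglongrightarrow> 0"
  proof (rule H1_complete)
    show "fst (X n) \<in> H1 \<Omega>" for n using XH[of n] by (simp add: HH_iff)
    fix e :: real assume "e > 0"
    from C'[OF this] show "\<exists>N. \<forall>m\<ge>N. \<forall>n\<ge>N. H1_norm \<Omega> (\<lambda>x. fst (X m) x - fst (X n) x) < e"
      using H1_le_st_norm[of "X _ - X _"] unfolding fst_minus by (meson le_less_trans)
  qed
  then obtain w where w: "w \<in> H1 \<Omega>" "(\<lambda>n. H1_norm \<Omega> (\<lambda>x. fst (X n) x - w x)) \<longlonglongrightarrow> 0" by blast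
  have "Cauchy (\<lambda>n. snd (X n))"
  proof (rule CauchyI)
    fix e :: real assume "e > 0"
    from C'[OF this] show "\<exists>M. \<forall>m\<ge>M. \<forall>n\<ge>M. norm (snd (X m) - snd (X n)) < e"
      using snd_le_st_norm[of "X _ - X _"] unfolding snd_diff by (meson le_less_trans)
  qed
  then obtain V where V: "(\<lambda>n. snd (X n)) \<longlonglongrightarrow> V" using Cauchy_convergent convergent_def by blast
  have "V \<in> Cdiamond" by (rule closed_sequentially[OF Cdiamond_closed _ V]) (use X in \<open>simp add: S0_def\<close>)
  then have p: "(w, V) \<in> S0" using w(1) by (simp add: S0_def HH_iff)
  have V0: "(\<lambda>n. norm (snd (X n) - V)) \<longlonglongrightarrow> 0" using V by (simp add: LIM_zero tendsto_norm_zero)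
  have "(\<lambda>n. sqrt ((H1_norm \<Omega> (\<lambda>x. fst (X n) x - w x))\<^sup>2 + (norm (snd (X n) - V))\<^sup>2)) \<longlonglongrightarrow> sqrt (0\<^sup>2 + 0\<^sup>2)"
    by (intro tendsto_intros w V0)
  moreover have "sqrt (st_ip (X n - (w, V)) (X n - (w, V))) = sqrt ((H1_norm \<Omega> (\<lambda>x. fst (X n) x - w x))\<^sup>2 + (norm (snd (X n) - V))\<^sup>2)" for n
    using st_ip_self[OF HH_diff[OF XH[of n] S0_HH[OF p]]] by (simp add: st_norm_def fun_diff_def)
  ultimately show "\<exists>p\<in>S0. (\<lambda>n. sqrt (st_ip (X n - p) (X n - p))) \<longlonglongrightarrow> 0" using p by (intro bexI[of _ "(w, V)"]) simp_all
next
  show "st_ip p q = st_ip q p" for p q by (simp add: st_ip_def inner_commute)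
next
  show "0 \<le> st_ip p p" if "p \<in> S0" for p using st_ip_self[OF S0_HH[OF that]] by simp
qed (auto intro: S0_zero S0_add S0_diff S0_scale S0_HH st_ip_add st_ip_scale)

lemma nr_st_norm: "p \<in> S0 \<Longrightarrow> nr p = st_norm p"
  by (simp add: nr_def st_ip_self S0_HH)

lemma st_norm_triangle: "p \<in> S0 \<Longrightarrow> q \<in> S0 \<Longrightarrow> st_norm (p + q) \<le> st_norm p + st_norm q"
  using nr_triangle[of p q] by (simp add: nr_st_norm S0_add)

lemma snd_add_const: "snd (p + state_const k) = snd p + (\<chi> m. k)" for p :: "('n, 'm) state"
  by (simp add: state_const_def)

text \<open>A zero-mean vector is orthogonal to constant vectors, so by Pythagoras the shifted
  vector dominates both the vector and the shift \<open>c\<close>. Once \<open>c\<close> is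
  controlled, the function component is recovered from the shifted one at the cost of |c| times the
  norm of the constant 1.\<close>

lemma st_norm_le_HH_norm:
  assumes p: "p \<in> S0"
  shows "st_norm p \<le> (2 + H1_norm \<Omega> (\<lambda>x. 1)) * HH_norm \<Omega> p"
proof -
  let ?\<kappa> = "H1_norm \<Omega> (\<lambda>x. 1)"
  have pos: "0 < 2 + ?\<kappa>" using H1_norm_nonneg[of "\<lambda>x. 1"] by linarith
  have v: "fst p \<in> H1 \<Omega>" using S0_HH[OF p] by (simp add: HH_iff)
  have "st_norm p / (2 + ?\<kappa>) \<le> sqrt ((H1_norm \<Omega> (\<lambda>x. fst p x - c))\<^sup>2 + (norm (snd p - (\<chi> m. c)))\<^sup>2)" (is "_ \<le> ?X") for c
  proof -
    have orth: "snd p \<bullet> (\<chi> m. c) = 0"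
    proof -
      have "snd p \<bullet> (\<chi> m. c) = (\<Sum>m\<in>UNIV. snd p $ m) \<bullet> c" by (simp add: inner_vec_def inner_sum_left)
      then show ?thesis using p by (simp add: S0_def Cdiamond_def)
    qed
    have "(norm (snd p - (\<chi> m. c)))\<^sup>2 = (norm (snd p))\<^sup>2 + (norm (\<chi> m::'m. c))\<^sup>2"
      unfolding power2_norm_eq_inner using orth by (simp add: inner_diff_left inner_diff_right inner_commute[of "\<chi> m. c" "snd p"])
    moreover have "cmod c \<le> norm (\<chi> m::'m. c)"
      using Finite_Cartesian_Product.norm_nth_le[of "\<chi> m::'m. c"] by simp
    then have "(cmod c)\<^sup>2 \<le> (norm (\<chi> m::'m. c))\<^sup>2" by (intro power_mono) auto
    ultimately have V: "(norm (snd p))\<^sup>2 \<le> (norm (snd p - (\<chi> m. c)))\<^sup>2" "(cmod c)\<^sup>2 \<le> (norm (snd p - (\<chi> m. c)))\<^sup>2"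
      using zero_le_power2[of "norm (snd p)"] zero_le_power2[of "norm (\<chi> m::'m. c)"] by linarith+
    have X0: "0 \<le> ?X" by simp
    have Hle: "H1_norm \<Omega> (\<lambda>x. fst p x - c) \<le> ?X" by (rule real_le_rsqrt) simp
    have cle: "cmod c \<le> ?X" by (rule real_le_rsqrt) (use V(2) in \<open>simp add: add_increasing\<close>)
    have Vle: "norm (snd p) \<le> ?X" by (rule real_le_rsqrt) (use V(1) in \<open>simp add: add_increasing\<close>)
    have "H1_norm \<Omega> (fst p) \<le> H1_norm \<Omega> (\<lambda>x. fst p x - c) + H1_norm \<Omega> (\<lambda>x. c * 1)"
      using H1_norm_triangle[OF H1_diff[OF v H1_C1[OF C1_fun_const[of c]]] H1_C1[OF C1_fun_const[of c]]] by simp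
    also have "H1_norm \<Omega> (\<lambda>x. c * 1) = cmod c * ?\<kappa>" by (rule H1_norm_cmult[OF H1_C1[OF C1_fun_const]])
    also have "H1_norm \<Omega> (\<lambda>x. fst p x - c) + cmod c * ?\<kappa> \<le> ?X + ?X * ?\<kappa>"
      by (intro add_mono mult_right_mono Hle cle) simp
    finally have "H1_norm \<Omega> (fst p) \<le> (1 + ?\<kappa>) * ?X" by (simp add: distrib_right mult.commute)
    have "st_norm p \<le> H1_norm \<Omega> (fst p) + norm (snd p)"
      unfolding st_norm_def by (rule sqrt_sum_squares_le_sum) auto
    also have "\<dots> \<le> (1 + ?\<kappa>) * ?X + ?X" by (rule add_mono[OF \<open>H1_norm \<Omega> (fst p) \<le> (1 + ?\<kappa>) * ?X\<close> Vle])
    finally have "st_norm p \<le> (2 + ?\<kappa>) * ?X" by (simp add: distrib_right)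
    then show ?thesis using pos by (simp add: divide_le_eq mult.commute)
  qed
  then have "st_norm p / (2 + ?\<kappa>) \<le> HH_norm \<Omega> p"
    unfolding HH_norm_def split_beta by (intro cINF_greatest) auto
  then show ?thesis using pos by (simp add: divide_le_eq mult.commute)
qed

text \<open>Coercivity on zero-mean states for one fixed pair of coefficients, with an explicit
  constant that survives small perturbations of the pair. The existence, uniqueness and remainder
  results below start from this property.\<close>

definition coercive :: "(real^'n \<Rightarrow> complex) \<Rightarrow> (real^'n \<Rightarrow> complex) \<Rightarrow> real \<Rightarrow> bool" where
  "coercive \<sigma> \<zeta> c \<longleftrightarrow> 0 < c \<and> (\<exists>s. coef \<sigma> \<zeta> s) \<and> (\<forall>q\<in>S0. c * (st_norm q)\<^sup>2 \<le> Re (B_form \<Omega> EE \<sigma> \<zeta> q q))"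

text \<open>The constant from \<open>ZZ'\<close> is divided by the square of the factor by which
  \<open>st_norm\<close> can exceed the quotient norm.\<close>

lemma coercive_ZZ':
  assumes \<sigma>: "\<sigma> \<in> SS \<Omega>" and \<zeta>: "\<zeta> \<in> ZZ' \<Omega> EE"
  shows "\<exists>c. coercive \<sigma> \<zeta> c"
proof -
  let ?k = "2 + H1_norm \<Omega> (\<lambda>x. 1)"
  have k: "0 < ?k" using H1_norm_nonneg[of "\<lambda>x. 1"] by linarith
  obtain c where c: "c > 0" "\<And>q. q \<in> \<H> \<Longrightarrow> c * (HH_norm \<Omega> q)\<^sup>2 \<le> Re (B_form \<Omega> EE \<sigma> \<zeta> q q)"
    using \<sigma> \<zeta> unfolding ZZ'_def by blast
  have "coef \<sigma> \<zeta> (max 0 (max (Linf_norm M\<Omega> \<sigma>) (Linf_norm (contact_measure \<Omega> EE) \<zeta>)))"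
    by (rule coef_Linf) (use \<sigma> \<zeta> in \<open>auto simp: SS_def ZZ'_def\<close>)
  moreover have "c / ?k\<^sup>2 * (st_norm q)\<^sup>2 \<le> Re (B_form \<Omega> EE \<sigma> \<zeta> q q)" if q: "q \<in> S0" for q
  proof -
    have "(st_norm q)\<^sup>2 \<le> (?k * HH_norm \<Omega> q)\<^sup>2" by (intro power_mono st_norm_le_HH_norm q) simp
    then have "c / ?k\<^sup>2 * (st_norm q)\<^sup>2 \<le> c / ?k\<^sup>2 * (?k * HH_norm \<Omega> q)\<^sup>2"
      using c(1) by (intro mult_left_mono) auto
    also have "\<dots> = c * (HH_norm \<Omega> q)\<^sup>2" using k by (simp add: power_mult_distrib)
    also note c(2)[OF S0_HH[OF q]]
    finally show ?thesis .
  qed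
  moreover have "c / ?k\<^sup>2 > 0" using c(1) k by simp
  ultimately show ?thesis unfolding coercive_def by blast
qed

section \<open>Solvability and uniqueness for coercive coefficients\<close>

definition "CB = real CARD('n) + Cj\<^sup>2"

lemma CB_nonneg: "0 \<le> CB" by (simp add: CB_def)

lemma B_form_bound: "coef \<omega> \<eta> s \<Longrightarrow> p \<in> \<H> \<Longrightarrow> q \<in> \<H> \<Longrightarrow> cmod (B_form \<Omega> EE \<omega> \<eta> p q) \<le> CB * s * st_norm p * st_norm q"
  unfolding CB_def by (rule B_bound)

text \<open>The real Lax-Milgram lemma is applied to real parts. Testing with the multiple of
  \<open>q\<close> by the imaginary unit turns the real part of the equation into its imaginary
  part.\<close>

lemma solve:
  assumes co: "coercive \<sigma> \<zeta> c"
    and l_add: "\<And>p q. p \<in> S0 \<Longrightarrow> q \<in> S0 \<Longrightarrow> l (p + q) = l p + l q"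
    and l_scale: "\<And>k p. p \<in> S0 \<Longrightarrow> l (state_scale k p) = cnj k * l p"
    and l_bound: "\<And>p. p \<in> S0 \<Longrightarrow> cmod (l p) \<le> m * st_norm p"
  shows "\<exists>p\<in>S0. \<forall>q\<in>S0. B_form \<Omega> EE \<sigma> \<zeta> p q = l q"
proof -
  obtain s where s: "coef \<sigma> \<zeta> s" using co by (auto simp: coercive_def)
  have "\<exists>p\<in>S0. \<forall>q\<in>S0. Re (B_form \<Omega> EE \<sigma> \<zeta> p q) = Re (l q)"
  proof (rule Lax_Milgram[where K = "CB * s" and c = c and m = m])
    show "0 < c" using co by (simp add: coercive_def)
    show "\<bar>Re (B_form \<Omega> EE \<sigma> \<zeta> p q)\<bar> \<le> CB * s * nr p * nr q" if "p \<in> S0" "q \<in> S0" for p q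
      using order_trans[OF abs_Re_le_cmod B_form_bound[OF s S0_HH[OF that(1)] S0_HH[OF that(2)]]] that by (simp add: nr_st_norm)
    show "c * (nr p)\<^sup>2 \<le> Re (B_form \<Omega> EE \<sigma> \<zeta> p p)" if "p \<in> S0" for p
      using co that by (simp add: coercive_def nr_st_norm)
    show "\<bar>Re (l p)\<bar> \<le> m * nr p" if "p \<in> S0" for p
      using order_trans[OF abs_Re_le_cmod l_bound[OF that]] that by (simp add: nr_st_norm)
  qed (simp_all add: B_add_left[OF s] B_add_right[OF s] B_scale_right[OF s] S0_HH l_add l_scale)
  then obtain p where p: "p \<in> S0" "\<And>q. q \<in> S0 \<Longrightarrow> Re (B_form \<Omega> EE \<sigma> \<zeta> p q) = Re (l q)" by blast
  have "B_form \<Omega> EE \<sigma> \<zeta> p q = l q" if q: "q \<in> S0" for q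
    using p(2)[OF q] p(2)[OF S0_scale[OF q, of \<i>]]
    by (simp add: B_scale_right[OF s S0_HH[OF q] S0_HH[OF p(1)]] l_scale q complex_eq_iff)
  then show ?thesis using p(1) by blast
qed

lemma coercive_bound:
  assumes co: "coercive \<sigma> \<zeta> c" and p: "p \<in> S0" and K: "0 \<le> K" and B: "cmod (B_form \<Omega> EE \<sigma> \<zeta> p p) \<le> K * st_norm p"
  shows "c * st_norm p \<le> K"
proof (rule le_of_sq_le_mult[OF _ _ K])
  have "c * (st_norm p)\<^sup>2 \<le> Re (B_form \<Omega> EE \<sigma> \<zeta> p p)" using co p by (simp add: coercive_def)
  also have "\<dots> \<le> K * st_norm p" using order_trans[OF complex_Re_le_cmod B] .
  finally show "c * (st_norm p)\<^sup>2 \<le> K * st_norm p" .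
qed simp

text \<open>Coercivity only makes the seminorm of the difference vanish, which still leaves the
  functions free on null sets; the potential vectors coincide exactly.\<close>

lemma solution_unique:
  assumes co: "coercive \<sigma> \<zeta> c" and p: "p \<in> S0" "p' \<in> S0"
    and eq: "\<And>q. q \<in> S0 \<Longrightarrow> B_form \<Omega> EE \<sigma> \<zeta> p q = B_form \<Omega> EE \<sigma> \<zeta> p' q"
  shows "st_norm (p - p') = 0" "snd p = snd p'"
proof -
  obtain s where s: "coef \<sigma> \<zeta> s" using co by (auto simp: coercive_def)
  note d = S0_diff[OF p]
  have "B_form \<Omega> EE \<sigma> \<zeta> (p - p') (p - p') = 0"
    using eq[OF d] by (simp add: B_diff_left[OF s S0_HH[OF p(1)] S0_HH[OF p(2)] S0_HH[OF d]])
  then have "c * st_norm (p - p') \<le> 0" by (intro coercive_bound[OF co d]) auto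
  then show 0: "st_norm (p - p') = 0"
    using co st_norm_nonneg[of "p - p'"] by (simp add: coercive_def mult_le_0_iff)
  show "snd p = snd p'" using snd_le_st_norm[of "p - p'"] 0 by simp
qed

lemma dot_const: "I \<in> Cdiamond \<Longrightarrow> dot I (cnj_vec (V + (\<chi> m. k))) = dot I (cnj_vec V)" for I :: "complex^'m"
  by (simp add: dot_def cnj_vec_def distrib_left sum.distrib Cdiamond_def flip: sum_distrib_right)

text \<open>Adding a constant to the test state changes neither side of the equation, the right-hand
  side because the currents sum to zero. So zero-mean test states suffice.\<close>

lemma forward_solution_iff:
  assumes co: "coercive \<sigma> \<zeta> c" and I: "I \<in> Cdiamond" and p: "p \<in> \<H>"
  shows "forward_solution \<Omega> EE \<sigma> \<zeta> I p \<longleftrightarrow> (\<forall>q\<in>S0. B_form \<Omega> EE \<sigma> \<zeta> p q = dot I (cnj_vec (snd q)))"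
proof
  assume "forward_solution \<Omega> EE \<sigma> \<zeta> I p"
  then show "\<forall>q\<in>S0. B_form \<Omega> EE \<sigma> \<zeta> p q = dot I (cnj_vec (snd q))" by (simp add: forward_solution_def S0_HH)
next
  assume *: "\<forall>q\<in>S0. B_form \<Omega> EE \<sigma> \<zeta> p q = dot I (cnj_vec (snd q))"
  obtain s where s: "coef \<sigma> \<zeta> s" using co by (auto simp: coercive_def)
  show "forward_solution \<Omega> EE \<sigma> \<zeta> I p"
    unfolding forward_solution_def
  proof (intro conjI ballI p)
    fix q :: "('n, 'm) state" assume "q \<in> \<H>"
    then obtain q0 k where q: "q0 \<in> S0" "q = q0 + state_const k" by (rule S0_centre)
    show "B_form \<Omega> EE \<sigma> \<zeta> p q = dot I (cnj_vec (snd q))"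
      unfolding q(2) B_const_right[OF s S0_HH[OF q(1)] p] snd_add_const dot_const[OF I] using * q(1) by blast
  qed
qed

text \<open>Names the forward solution that \<open>linearized_solution\<close> hides under an
  existential quantifier, and gathers both perturbation integrals in one form.\<close>

definition lin_eq :: "(real^'n \<Rightarrow> complex) \<Rightarrow> (real^'n \<Rightarrow> complex) \<Rightarrow> ('n, 'm) state \<Rightarrow> (real^'n \<Rightarrow> complex) \<Rightarrow> (real^'n \<Rightarrow> complex) \<Rightarrow> complex^'m \<Rightarrow> ('n, 'm) state \<Rightarrow> bool" where
  "lin_eq \<sigma> \<zeta> p \<omega> \<eta> J p' \<longleftrightarrow> (\<forall>q\<in>S0. B_form \<Omega> EE \<sigma> \<zeta> p' q = dot J (cnj_vec (snd q)) - B_form \<Omega> EE \<omega> \<eta> p q)"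

lemma forward_exists:
  assumes co: "coercive \<sigma> \<zeta> c" and I: "I \<in> Cdiamond"
  shows "\<exists>p\<in>S0. forward_solution \<Omega> EE \<sigma> \<zeta> I p"
proof -
  have "\<exists>p\<in>S0. \<forall>q\<in>S0. B_form \<Omega> EE \<sigma> \<zeta> p q = dot I (cnj_vec (snd q))"
  proof (rule solve[OF co])
    show "cmod (dot I (cnj_vec (snd p))) \<le> norm I * st_norm p" for p :: "('n, 'm) state"
      using cmod_dot_le[of I "snd p"] mult_left_mono[OF snd_le_st_norm[of p] norm_ge_zero[of I]] by linarith
  qed (simp_all add: dot_def cnj_vec_def state_scale_def sum.distrib distrib_left sum_distrib_left mult_ac)
  then show ?thesis using forward_solution_iff[OF co I S0_HH] by blast
qed

text \<open>Evaluates the \<open>THE\<close>: every zero-mean forward solution has the same second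
  component.\<close>

lemma U_map_eq:
  assumes co: "coercive \<sigma> \<zeta> c" and I: "I \<in> Cdiamond" and p: "p \<in> S0" "forward_solution \<Omega> EE \<sigma> \<zeta> I p"
  shows "U_map \<Omega> EE (\<sigma>, \<zeta>, I) = snd p"
  unfolding U_map_def split
proof (rule the_equality)
  show "snd p \<in> Cdiamond \<and> (\<exists>u. forward_solution \<Omega> EE \<sigma> \<zeta> I (u, snd p))"
    using p by (auto simp: S0_def intro!: exI[of _ "fst p"])
next
  fix U :: "complex^'m" assume "U \<in> Cdiamond \<and> (\<exists>u. forward_solution \<Omega> EE \<sigma> \<zeta> I (u, U))"
  then obtain u where u: "forward_solution \<Omega> EE \<sigma> \<zeta> I (u, U)" "U \<in> Cdiamond" by blast
  then have S: "(u, U) \<in> S0" by (simp add: S0_def forward_solution_def)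
  have "snd (u, U) = snd p"
    by (rule solution_unique(2)[OF co S p(1)]) (use u(1) p(2) S0_HH in \<open>simp add: forward_solution_def\<close>)
  then show "U = snd p" by simp
qed

text \<open>Two forward solutions differ by a constant and a state of seminorm 0, and no form with
  bounded coefficients sees either. Hence \<open>linearized_solution\<close> is the same condition
  for every choice of forward solution.\<close>

lemma B_form_forward_unique:
  assumes co: "coercive \<sigma> \<zeta> c" and cf: "coef \<omega> \<eta> s"
    and p: "forward_solution \<Omega> EE \<sigma> \<zeta> I p" "forward_solution \<Omega> EE \<sigma> \<zeta> I p'" and q: "q \<in> \<H>"
  shows "B_form \<Omega> EE \<omega> \<eta> p q = B_form \<Omega> EE \<omega> \<eta> p' q"
proof -
  obtain t where t: "coef \<sigma> \<zeta> t" using co by (auto simp: coercive_def)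
  have pH: "p \<in> \<H>" "p' \<in> \<H>" using p by (auto simp: forward_solution_def)
  obtain p0 k where p0: "p0 \<in> S0" "p = p0 + state_const k" using S0_centre[OF pH(1)] .
  obtain p0' k' where p0': "p0' \<in> S0" "p' = p0' + state_const k'" using S0_centre[OF pH(2)] .
  have "st_norm (p0 - p0') = 0"
  proof (rule solution_unique(1)[OF co p0(1) p0'(1)])
    fix u assume u: "u \<in> S0"
    show "B_form \<Omega> EE \<sigma> \<zeta> p0 u = B_form \<Omega> EE \<sigma> \<zeta> p0' u"
      using p S0_HH[OF u] B_const_left[OF t S0_HH[OF p0(1)] S0_HH[OF u], of k] B_const_left[OF t S0_HH[OF p0'(1)] S0_HH[OF u], of k']
      unfolding forward_solution_def p0(2) p0'(2) by simp
  qed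
  then have "cmod (B_form \<Omega> EE \<omega> \<eta> (p0 - p0') q) \<le> 0"
    using B_form_bound[OF cf S0_HH[OF S0_diff[OF p0(1) p0'(1)]] q] by simp
  then have "B_form \<Omega> EE \<omega> \<eta> p0 q = B_form \<Omega> EE \<omega> \<eta> p0' q"
    by (simp add: B_diff_left[OF cf S0_HH[OF p0(1)] S0_HH[OF p0'(1)] q])
  then show ?thesis
    unfolding p0(2) p0'(2) B_const_left[OF cf S0_HH[OF p0(1)] q] B_const_left[OF cf S0_HH[OF p0'(1)] q] .
qed

lemma linearized_solution_iff:
  assumes co: "coercive \<sigma> \<zeta> c" and cf: "coef \<omega> \<eta> s" and J: "J \<in> Cdiamond"
    and p: "forward_solution \<Omega> EE \<sigma> \<zeta> I p" and p': "p' \<in> \<H>"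
  shows "linearized_solution \<Omega> EE \<sigma> \<zeta> I \<omega> \<eta> J p' \<longleftrightarrow> lin_eq \<sigma> \<zeta> p \<omega> \<eta> J p'"
proof -
  obtain t where t: "coef \<sigma> \<zeta> t" using co by (auto simp: coercive_def)
  have pH: "p \<in> \<H>" using p by (simp add: forward_solution_def)
  have B: "dot J (cnj_vec (snd q)) - interior_form \<Omega> \<omega> (wgr p1) (\<lambda>x. cnj_vec (wgr q x)) - boundary_form \<Omega> EE \<eta> (jmp p1) (\<lambda>x. cnj (jmp q x))
     = dot J (cnj_vec (snd q)) - B_form \<Omega> EE \<omega> \<eta> p1 q" for p1 q :: "('n, 'm) state"
    by (simp add: B_form_def)
  have all: "(\<forall>q\<in>\<H>. B_form \<Omega> EE \<sigma> \<zeta> p' q = dot J (cnj_vec (snd q)) - B_form \<Omega> EE \<omega> \<eta> p q) \<longleftrightarrow> lin_eq \<sigma> \<zeta> p \<omega> \<eta> J p'"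
  proof
    assume *: "lin_eq \<sigma> \<zeta> p \<omega> \<eta> J p'"
    show "\<forall>q\<in>\<H>. B_form \<Omega> EE \<sigma> \<zeta> p' q = dot J (cnj_vec (snd q)) - B_form \<Omega> EE \<omega> \<eta> p q"
    proof
      fix q :: "('n, 'm) state" assume "q \<in> \<H>"
      then obtain q0 k where q: "q0 \<in> S0" "q = q0 + state_const k" by (rule S0_centre)
      show "B_form \<Omega> EE \<sigma> \<zeta> p' q = dot J (cnj_vec (snd q)) - B_form \<Omega> EE \<omega> \<eta> p q"
        unfolding q(2) B_const_right[OF t S0_HH[OF q(1)] p'] B_const_right[OF cf S0_HH[OF q(1)] pH] snd_add_const dot_const[OF J]
        using * q(1) unfolding lin_eq_def by blast
    qed
  qed (simp add: lin_eq_def S0_HH)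
  show ?thesis
  proof
    assume "linearized_solution \<Omega> EE \<sigma> \<zeta> I \<omega> \<eta> J p'"
    then obtain p1 where p1: "forward_solution \<Omega> EE \<sigma> \<zeta> I p1" "\<forall>q\<in>\<H>. B_form \<Omega> EE \<sigma> \<zeta> p' q = dot J (cnj_vec (snd q)) - B_form \<Omega> EE \<omega> \<eta> p1 q"
      unfolding linearized_solution_def B by blast
    have "\<forall>q\<in>\<H>. B_form \<Omega> EE \<sigma> \<zeta> p' q = dot J (cnj_vec (snd q)) - B_form \<Omega> EE \<omega> \<eta> p q"
      using p1(2) B_form_forward_unique[OF co cf p1(1) p] by simp
    then show "lin_eq \<sigma> \<zeta> p \<omega> \<eta> J p'" using all by blast
  next
    assume "lin_eq \<sigma> \<zeta> p \<omega> \<eta> J p'"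
    then show "linearized_solution \<Omega> EE \<sigma> \<zeta> I \<omega> \<eta> J p'"
      unfolding linearized_solution_def B using all p p' by blast
  qed
qed

lemma lin_eq_exists:
  assumes co: "coercive \<sigma> \<zeta> c" and cf: "coef \<omega> \<eta> s" and p: "p \<in> \<H>"
  shows "\<exists>p'\<in>S0. lin_eq \<sigma> \<zeta> p \<omega> \<eta> J p'"
  unfolding lin_eq_def
proof (rule solve[OF co])
  show "cmod (dot J (cnj_vec (snd q)) - B_form \<Omega> EE \<omega> \<eta> p q) \<le> (norm J + CB * s * st_norm p) * st_norm q" if "q \<in> S0" for q
  proof -
    have "cmod (dot J (cnj_vec (snd q))) \<le> norm J * st_norm q"
      using cmod_dot_le[of J "snd q"] mult_left_mono[OF snd_le_st_norm[of q] norm_ge_zero[of J]] by linarith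
    then show ?thesis
      using B_form_bound[OF cf p S0_HH[OF that]] norm_triangle_ineq4[of "dot J (cnj_vec (snd q))" "B_form \<Omega> EE \<omega> \<eta> p q"]
      by (simp add: distrib_right)
  qed
  show "dot J (cnj_vec (snd (q + q'))) - B_form \<Omega> EE \<omega> \<eta> p (q + q') = dot J (cnj_vec (snd q)) - B_form \<Omega> EE \<omega> \<eta> p q + (dot J (cnj_vec (snd q')) - B_form \<Omega> EE \<omega> \<eta> p q')"
    if "q \<in> S0" "q' \<in> S0" for q q'
    using that by (simp add: B_add_right[OF cf] S0_HH p dot_def cnj_vec_def sum.distrib distrib_left)
  show "dot J (cnj_vec (snd (state_scale k q))) - B_form \<Omega> EE \<omega> \<eta> p (state_scale k q) = cnj k * (dot J (cnj_vec (snd q)) - B_form \<Omega> EE \<omega> \<eta> p q)"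
    if "q \<in> S0" for k q
  proof -
    have "dot J (cnj_vec (snd (state_scale k q))) = cnj k * dot J (cnj_vec (snd q))"
      by (simp add: dot_def cnj_vec_def state_scale_def sum_distrib_left mult_ac)
    then show ?thesis using that by (simp add: B_scale_right[OF cf S0_HH p] right_diff_distrib)
  qed
qed

lemma U_deriv_eq:
  assumes co: "coercive \<sigma> \<zeta> c" and cf: "coef \<omega> \<eta> s" and J: "J \<in> Cdiamond"
    and p: "forward_solution \<Omega> EE \<sigma> \<zeta> I p" and p': "p' \<in> S0" "lin_eq \<sigma> \<zeta> p \<omega> \<eta> J p'"
  shows "U_deriv \<Omega> EE (\<sigma>, \<zeta>, I) (\<omega>, \<eta>, J) = snd p'"
  unfolding U_deriv_def split
proof (rule the_equality)
  note iff = linearized_solution_iff[OF co cf J p]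
  show "snd p' \<in> Cdiamond \<and> (\<exists>u'. linearized_solution \<Omega> EE \<sigma> \<zeta> I \<omega> \<eta> J (u', snd p'))"
    using p' iff[OF S0_HH[OF p'(1)]] by (auto simp: S0_def intro!: exI[of _ "fst p'"])
  fix U :: "complex^'m" assume "U \<in> Cdiamond \<and> (\<exists>u'. linearized_solution \<Omega> EE \<sigma> \<zeta> I \<omega> \<eta> J (u', U))"
  then obtain u where u: "linearized_solution \<Omega> EE \<sigma> \<zeta> I \<omega> \<eta> J (u, U)" "U \<in> Cdiamond" by blast
  then have S: "(u, U) \<in> S0" by (simp add: S0_def linearized_solution_def)
  have "lin_eq \<sigma> \<zeta> p \<omega> \<eta> J (u, U)" using iff[OF S0_HH[OF S]] u(1) by blast
  then have "snd (u, U) = snd p'"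
    by (intro solution_unique(2)[OF co S p'(1)]) (use p'(2) in \<open>simp add: lin_eq_def\<close>)
  then show "U = snd p'" by simp
qed

text \<open>The remainder \<open>r = p\<^sub>h - p - p'\<close> solves the same problem with right-hand side \<open>- B\<^sub>\<omega>\<^sub>\<eta>(p\<^sub>h - p, \<cdot>)\<close>,
  so that it is of second order.\<close>

lemma remainder_estimate:
  assumes co: "coercive \<sigma> \<zeta> c" and I: "I \<in> Cdiamond"
  shows "\<exists>C\<ge>0. \<exists>\<delta>>0. \<forall>\<omega> \<eta> J s. coef \<omega> \<eta> s \<longrightarrow> s \<le> \<delta> \<longrightarrow> J \<in> Cdiamond \<longrightarrow>
    norm (U_map \<Omega> EE (\<lambda>x. \<sigma> x + \<omega> x, \<lambda>x. \<zeta> x + \<eta> x, I + J) - U_map \<Omega> EE (\<sigma>, \<zeta>, I) - U_deriv \<Omega> EE (\<sigma>, \<zeta>, I) (\<omega>, \<eta>, J))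
      \<le> C * (max s (norm J))\<^sup>2"
proof -
  have c: "c > 0" using co by (simp add: coercive_def)
  obtain t where t: "coef \<sigma> \<zeta> t" using co by (auto simp: coercive_def)
  obtain p where p: "p \<in> S0" "forward_solution \<Omega> EE \<sigma> \<zeta> I p" using forward_exists[OF co I] by blast
  note pH = S0_HH[OF p(1)]
  \<comment> \<open>Chosen so that the first-order difference \<open>d\<close> below satisfies
    \<open>st_norm d \<le> A * ?m\<close>. The 2 reflects that half of the coercivity is spent on
    absorbing a term; the bracket adds the effect of the current and that of the
    coefficients.\<close>
  define A where "A = 2 * (1 + CB * st_norm p) / c"
  have A: "0 \<le> A" using c CB_nonneg by (simp add: A_def)
  \<comment> \<open>Keeps \<open>CB * s\<close> at most c/2 for all s \<le> \<delta>; the added 1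
    avoids a division by 0.\<close>
  define \<delta> where "\<delta> = c / (2 * (CB + 1))"
  have \<delta>: "\<delta> > 0" using c CB_nonneg by (simp add: \<delta>_def)
  have main: "norm (U_map \<Omega> EE (\<lambda>x. \<sigma> x + \<omega> x, \<lambda>x. \<zeta> x + \<eta> x, I + J) - U_map \<Omega> EE (\<sigma>, \<zeta>, I) - U_deriv \<Omega> EE (\<sigma>, \<zeta>, I) (\<omega>, \<eta>, J))
      \<le> CB * A / c * (max s (norm J))\<^sup>2"
    if cf: "coef \<omega> \<eta> s" and s\<delta>: "s \<le> \<delta>" and J: "J \<in> Cdiamond" for \<omega> \<eta> J s
  proof -
    let ?\<sigma> = "\<lambda>x. \<sigma> x + \<omega> x" and ?\<zeta> = "\<lambda>x. \<zeta> x + \<eta> x"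
    let ?m = "max s (norm J)"
    have s: "0 \<le> s" by (rule coef_nonneg[OF cf])
    have CBs: "CB * s \<le> c / 2"
    proof -
      have "CB * s \<le> (CB + 1) * \<delta>" using s s\<delta> CB_nonneg by (intro mult_mono) auto
      also have "\<dots> = c / 2" using CB_nonneg by (simp add: \<delta>_def field_simps add_nonneg_eq_0_iff)
      finally show ?thesis .
    qed
    note Badd = B_add_coef[OF t cf]
    \<comment> \<open>The perturbation costs at most half of the coercivity constant, so the forward
      problem stays uniquely solvable at the perturbed parameters.\<close>
    have co': "coercive ?\<sigma> ?\<zeta> (c / 2)"
      unfolding coercive_def
    proof (intro conjI ballI)
      show "\<exists>s. coef ?\<sigma> ?\<zeta> s" using coef_add[OF t cf] by blast
      fix q assume q: "q \<in> S0"
      have "- Re (B_form \<Omega> EE \<omega> \<eta> q q) \<le> CB * s * st_norm q * st_norm q"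
        using B_form_bound[OF cf S0_HH[OF q] S0_HH[OF q]] abs_Re_le_cmod[of "B_form \<Omega> EE \<omega> \<eta> q q"] by linarith
      also have "\<dots> = (CB * s) * (st_norm q)\<^sup>2" by (simp add: power2_eq_square)
      also have "\<dots> \<le> c / 2 * (st_norm q)\<^sup>2" by (intro mult_right_mono CBs) simp
      finally have "- Re (B_form \<Omega> EE \<omega> \<eta> q q) \<le> c / 2 * (st_norm q)\<^sup>2" .
      moreover have "c * (st_norm q)\<^sup>2 \<le> Re (B_form \<Omega> EE \<sigma> \<zeta> q q)" using co q by (simp add: coercive_def)
      ultimately show "c / 2 * (st_norm q)\<^sup>2 \<le> Re (B_form \<Omega> EE ?\<sigma> ?\<zeta> q q)"
        unfolding Badd[OF S0_HH[OF q] S0_HH[OF q]] by simp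
    qed (use c in simp)
    have IJ: "I + J \<in> Cdiamond" using I J by (simp add: Cdiamond_def sum.distrib)
    obtain ph where ph: "ph \<in> S0" "forward_solution \<Omega> EE ?\<sigma> ?\<zeta> (I + J) ph" using forward_exists[OF co' IJ] by blast
    obtain p' where p': "p' \<in> S0" "lin_eq \<sigma> \<zeta> p \<omega> \<eta> J p'" using lin_eq_exists[OF co cf pH] by blast
    note phH = S0_HH[OF ph(1)]
    define d where "d = ph - p"
    have d: "d \<in> S0" unfolding d_def by (rule S0_diff[OF ph(1) p(1)])
    \<comment> \<open>Difference of the two forward equations, with the perturbation form moved to
      the right, where it acts on the perturbed solution \<open>ph\<close>.\<close>
    have Bd: "B_form \<Omega> EE \<sigma> \<zeta> d q = dot J (cnj_vec (snd q)) - B_form \<Omega> EE \<omega> \<eta> ph q" if q: "q \<in> S0" for q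
    proof -
      have "B_form \<Omega> EE \<sigma> \<zeta> ph q + B_form \<Omega> EE \<omega> \<eta> ph q = dot (I + J) (cnj_vec (snd q))"
        using ph(2) S0_HH[OF q] Badd[OF phH S0_HH[OF q]] by (simp add: forward_solution_def)
      moreover have "B_form \<Omega> EE \<sigma> \<zeta> p q = dot I (cnj_vec (snd q))"
        using p(2) S0_HH[OF q] by (simp add: forward_solution_def)
      moreover have "dot (I + J) (cnj_vec (snd q)) = dot I (cnj_vec (snd q)) + dot J (cnj_vec (snd q))"
        by (simp add: dot_def distrib_right sum.distrib)
      ultimately show ?thesis
        unfolding d_def B_diff_left[OF t phH pH S0_HH[OF q]] by (simp add: algebra_simps)
    qed
    have "c * st_norm d \<le> norm J + CB * s * st_norm ph"
    proof (rule coercive_bound[OF co d])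
      show "0 \<le> norm J + CB * s * st_norm ph" using s CB_nonneg by simp
      have "cmod (dot J (cnj_vec (snd d))) \<le> norm J * st_norm d"
        using cmod_dot_le[of J "snd d"] mult_left_mono[OF snd_le_st_norm[of d] norm_ge_zero[of J]] by linarith
      then show "cmod (B_form \<Omega> EE \<sigma> \<zeta> d d) \<le> (norm J + CB * s * st_norm ph) * st_norm d"
        unfolding Bd[OF d]
        using B_form_bound[OF cf phH S0_HH[OF d]] norm_triangle_ineq4[of "dot J (cnj_vec (snd d))" "B_form \<Omega> EE \<omega> \<eta> ph d"]
        by (simp add: distrib_right)
    qed
    \<comment> \<open>Splitting ph = d + p leaves a term with \<open>d\<close> whose factor
      \<open>CB * s\<close> is at most c/2, so that the left-hand side can absorb it.\<close>
    also have "\<dots> \<le> norm J + CB * s * (st_norm d + st_norm p)"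
    proof -
      have "ph = d + p" by (simp add: d_def)
      then have "st_norm ph \<le> st_norm d + st_norm p" using st_norm_triangle[OF d p(1)] by simp
      then show ?thesis using s CB_nonneg by (intro add_left_mono mult_left_mono) auto
    qed
    also have "\<dots> \<le> norm J + (c / 2 * st_norm d + CB * s * st_norm p)"
      using mult_right_mono[OF CBs st_norm_nonneg[of d]] by (simp add: distrib_left)
    finally have "c / 2 * st_norm d \<le> norm J + CB * st_norm p * s" by (simp add: mult_ac)
    also have "\<dots> \<le> ?m + CB * st_norm p * ?m"
      using CB_nonneg by (intro add_mono mult_left_mono) auto
    finally have "st_norm d \<le> A * ?m"
      using c by (simp add: A_def field_simps)
    define r where "r = d - p'"
    have r: "r \<in> S0" unfolding r_def by (rule S0_diff[OF d p'(1)])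
    \<comment> \<open>The current terms cancel, and the two perturbation forms combine into one that
      acts on \<open>d\<close>: a small coefficient times a first-order quantity.\<close>
    have Br: "B_form \<Omega> EE \<sigma> \<zeta> r r = - B_form \<Omega> EE \<omega> \<eta> d r"
    proof -
      have "B_form \<Omega> EE \<sigma> \<zeta> r r = B_form \<Omega> EE \<omega> \<eta> p r - B_form \<Omega> EE \<omega> \<eta> ph r"
        using B_diff_left[OF t S0_HH[OF d] S0_HH[OF p'(1)] S0_HH[OF r]] Bd[OF r] p'(2) r
        unfolding lin_eq_def r_def[symmetric] by simp
      then show ?thesis using B_diff_left[OF cf phH pH S0_HH[OF r]] by (simp add: d_def)
    qed
    have "c * st_norm r \<le> CB * s * st_norm d"
    proof (rule coercive_bound[OF co r])
      show "0 \<le> CB * s * st_norm d" using s CB_nonneg by simp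
      show "cmod (B_form \<Omega> EE \<sigma> \<zeta> r r) \<le> CB * s * st_norm d * st_norm r"
        unfolding Br norm_minus_cancel by (rule B_form_bound[OF cf S0_HH[OF d] S0_HH[OF r]])
    qed
    also have "\<dots> \<le> CB * ?m * (A * ?m)"
      using \<open>st_norm d \<le> A * ?m\<close> s CB_nonneg by (intro mult_mono mult_left_mono) (auto simp: le_max_iff_disj)
    finally have "st_norm r \<le> CB * A / c * ?m\<^sup>2"
      using c by (simp add: field_simps power2_eq_square)
    moreover have "snd r = U_map \<Omega> EE (?\<sigma>, ?\<zeta>, I + J) - U_map \<Omega> EE (\<sigma>, \<zeta>, I) - U_deriv \<Omega> EE (\<sigma>, \<zeta>, I) (\<omega>, \<eta>, J)"
      unfolding U_map_eq[OF co' IJ ph] U_map_eq[OF co I p] U_deriv_eq[OF co cf J p(2) p'] by (simp add: r_def d_def)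
    ultimately show ?thesis using snd_le_st_norm[of r] by simp
  qed
  show ?thesis
    by (rule exI[of _ "CB * A / c"], rule conjI)
       (use A c CB_nonneg \<delta> main in \<open>auto intro!: exI[of _ \<delta>]\<close>)
qed

section \<open>Linearity, boundedness and assembly of the derivative\<close>

context
  fixes \<sigma> \<zeta> :: "real^'n \<Rightarrow> complex" and c :: real and I :: "complex^'m" and p :: "('n, 'm) state"
  assumes co: "coercive \<sigma> \<zeta> c" and I: "I \<in> Cdiamond" and p: "p \<in> S0" "forward_solution \<Omega> EE \<sigma> \<zeta> I p"
begin

lemma U_deriv_state:
  assumes cf: "coef \<omega> \<eta> s" and J: "J \<in> Cdiamond"
  obtains p' where "p' \<in> S0" "lin_eq \<sigma> \<zeta> p \<omega> \<eta> J p'" "U_deriv \<Omega> EE (\<sigma>, \<zeta>, I) (\<omega>, \<eta>, J) = snd p'"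
proof -
  obtain p' where p': "p' \<in> S0" "lin_eq \<sigma> \<zeta> p \<omega> \<eta> J p'" using lin_eq_exists[OF co cf S0_HH[OF p(1)]] by blast
  show ?thesis by (rule that[OF p' U_deriv_eq[OF co cf J p(2) p']])
qed

lemma U_deriv_solution:
  assumes cf: "coef \<omega> \<eta> s" and J: "J \<in> Cdiamond"
  shows "U_deriv \<Omega> EE (\<sigma>, \<zeta>, I) (\<omega>, \<eta>, J) \<in> Cdiamond"
    and "\<exists>u'. linearized_solution \<Omega> EE \<sigma> \<zeta> I \<omega> \<eta> J (u', U_deriv \<Omega> EE (\<sigma>, \<zeta>, I) (\<omega>, \<eta>, J))"
proof -
  obtain p' where p': "p' \<in> S0" "lin_eq \<sigma> \<zeta> p \<omega> \<eta> J p'" "U_deriv \<Omega> EE (\<sigma>, \<zeta>, I) (\<omega>, \<eta>, J) = snd p'"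
    by (rule U_deriv_state[OF cf J])
  show "U_deriv \<Omega> EE (\<sigma>, \<zeta>, I) (\<omega>, \<eta>, J) \<in> Cdiamond" using p' by (simp add: S0_def)
  have "linearized_solution \<Omega> EE \<sigma> \<zeta> I \<omega> \<eta> J (fst p', snd p')"
    using linearized_solution_iff[OF co cf J p(2) S0_HH[OF p'(1)]] p'(2) by simp
  then show "\<exists>u'. linearized_solution \<Omega> EE \<sigma> \<zeta> I \<omega> \<eta> J (u', U_deriv \<Omega> EE (\<sigma>, \<zeta>, I) (\<omega>, \<eta>, J))"
    unfolding p'(3) by (intro exI[of _ "fst p'"])
qed

lemma U_deriv_add:
  assumes cf: "coef \<omega> \<eta> s" and J: "J \<in> Cdiamond" and cf': "coef \<omega>' \<eta>' s'" and J': "J' \<in> Cdiamond"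
  shows "U_deriv \<Omega> EE (\<sigma>, \<zeta>, I) (\<lambda>x. \<omega> x + \<omega>' x, \<lambda>x. \<eta> x + \<eta>' x, J + J')
    = U_deriv \<Omega> EE (\<sigma>, \<zeta>, I) (\<omega>, \<eta>, J) + U_deriv \<Omega> EE (\<sigma>, \<zeta>, I) (\<omega>', \<eta>', J')"
proof -
  obtain t where t: "coef \<sigma> \<zeta> t" using co by (auto simp: coercive_def)
  obtain p1 where p1: "p1 \<in> S0" "lin_eq \<sigma> \<zeta> p \<omega> \<eta> J p1" "U_deriv \<Omega> EE (\<sigma>, \<zeta>, I) (\<omega>, \<eta>, J) = snd p1"
    by (rule U_deriv_state[OF cf J])
  obtain p2 where p2: "p2 \<in> S0" "lin_eq \<sigma> \<zeta> p \<omega>' \<eta>' J' p2" "U_deriv \<Omega> EE (\<sigma>, \<zeta>, I) (\<omega>', \<eta>', J') = snd p2"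
    by (rule U_deriv_state[OF cf' J'])
  have "lin_eq \<sigma> \<zeta> p (\<lambda>x. \<omega> x + \<omega>' x) (\<lambda>x. \<eta> x + \<eta>' x) (J + J') (p1 + p2)"
    unfolding lin_eq_def
  proof
    fix q assume q: "q \<in> S0"
    have "dot (J + J') (cnj_vec (snd q)) = dot J (cnj_vec (snd q)) + dot J' (cnj_vec (snd q))"
      by (simp add: dot_def distrib_right sum.distrib)
    then show "B_form \<Omega> EE \<sigma> \<zeta> (p1 + p2) q
        = dot (J + J') (cnj_vec (snd q)) - B_form \<Omega> EE (\<lambda>x. \<omega> x + \<omega>' x) (\<lambda>x. \<eta> x + \<eta>' x) p q"
      using p1(2) p2(2) q
      by (simp add: lin_eq_def B_add_left[OF t S0_HH[OF p1(1)] S0_HH[OF p2(1)] S0_HH[OF q]]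
          B_add_coef[OF cf cf' S0_HH[OF p(1)] S0_HH[OF q]])
  qed
  moreover have "J + J' \<in> Cdiamond" using J J' by (simp add: Cdiamond_def sum.distrib)
  ultimately have "U_deriv \<Omega> EE (\<sigma>, \<zeta>, I) (\<lambda>x. \<omega> x + \<omega>' x, \<lambda>x. \<eta> x + \<eta>' x, J + J') = snd (p1 + p2)"
    by (intro U_deriv_eq[OF co coef_add[OF cf cf'] _ p(2) S0_add[OF p1(1) p2(1)]])
  then show ?thesis by (simp add: p1(3) p2(3))
qed

lemma U_deriv_scale:
  assumes cf: "coef \<omega> \<eta> s" and J: "J \<in> Cdiamond"
  shows "U_deriv \<Omega> EE (\<sigma>, \<zeta>, I) (\<lambda>x. k * \<omega> x, \<lambda>x. k * \<eta> x, k *s J) = k *s U_deriv \<Omega> EE (\<sigma>, \<zeta>, I) (\<omega>, \<eta>, J)"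
proof -
  obtain t where t: "coef \<sigma> \<zeta> t" using co by (auto simp: coercive_def)
  obtain p1 where p1: "p1 \<in> S0" "lin_eq \<sigma> \<zeta> p \<omega> \<eta> J p1" "U_deriv \<Omega> EE (\<sigma>, \<zeta>, I) (\<omega>, \<eta>, J) = snd p1"
    by (rule U_deriv_state[OF cf J])
  have "lin_eq \<sigma> \<zeta> p (\<lambda>x. k * \<omega> x) (\<lambda>x. k * \<eta> x) (k *s J) (state_scale k p1)"
    unfolding lin_eq_def
  proof
    fix q assume q: "q \<in> S0"
    have "dot (k *s J) (cnj_vec (snd q)) = k * dot J (cnj_vec (snd q))"
      by (simp add: dot_def sum_distrib_left mult.assoc)
    then show "B_form \<Omega> EE \<sigma> \<zeta> (state_scale k p1) q
        = dot (k *s J) (cnj_vec (snd q)) - B_form \<Omega> EE (\<lambda>x. k * \<omega> x) (\<lambda>x. k * \<eta> x) p q"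
      using p1(2) q
      by (simp add: lin_eq_def B_scale_left[OF t S0_HH[OF p1(1)] S0_HH[OF q]]
          B_cmult_coef[OF cf S0_HH[OF p(1)] S0_HH[OF q]] right_diff_distrib)
  qed
  moreover have "k *s J \<in> Cdiamond" using J by (simp add: Cdiamond_def flip: sum_distrib_left)
  ultimately have "U_deriv \<Omega> EE (\<sigma>, \<zeta>, I) (\<lambda>x. k * \<omega> x, \<lambda>x. k * \<eta> x, k *s J) = snd (state_scale k p1)"
    by (intro U_deriv_eq[OF co coef_cmult[OF cf] _ p(2) S0_scale[OF p1(1)]])
  then show ?thesis by (simp add: p1(3) state_scale_def)
qed

text \<open>The linearized equation is tested with its own solution, and coercivity is divided
  out.\<close>

lemma U_deriv_bound:
  assumes cf: "coef \<omega> \<eta> s" and J: "J \<in> Cdiamond"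
  shows "c * norm (U_deriv \<Omega> EE (\<sigma>, \<zeta>, I) (\<omega>, \<eta>, J)) \<le> norm J + CB * s * st_norm p"
proof -
  have c: "0 < c" using co by (simp add: coercive_def)
  obtain p' where p': "p' \<in> S0" "lin_eq \<sigma> \<zeta> p \<omega> \<eta> J p'" "U_deriv \<Omega> EE (\<sigma>, \<zeta>, I) (\<omega>, \<eta>, J) = snd p'"
    by (rule U_deriv_state[OF cf J])
  have "c * st_norm p' \<le> norm J + CB * s * st_norm p"
  proof (rule coercive_bound[OF co p'(1)])
    show "0 \<le> norm J + CB * s * st_norm p" using coef_nonneg[OF cf] CB_nonneg by simp
    have "cmod (dot J (cnj_vec (snd p'))) \<le> norm J * st_norm p'"
      using cmod_dot_le[of J "snd p'"] mult_left_mono[OF snd_le_st_norm[of p'] norm_ge_zero[of J]] by linarith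
    moreover have "B_form \<Omega> EE \<sigma> \<zeta> p' p' = dot J (cnj_vec (snd p')) - B_form \<Omega> EE \<omega> \<eta> p p'"
      using p'(1,2) by (simp add: lin_eq_def)
    ultimately show "cmod (B_form \<Omega> EE \<sigma> \<zeta> p' p') \<le> (norm J + CB * s * st_norm p) * st_norm p'"
      using B_form_bound[OF cf S0_HH[OF p(1)] S0_HH[OF p'(1)]]
        norm_triangle_ineq4[of "dot J (cnj_vec (snd p'))" "B_form \<Omega> EE \<omega> \<eta> p p'"]
      by (simp add: distrib_right)
  qed
  moreover have "c * norm (snd p') \<le> c * st_norm p'" using c snd_le_st_norm[of p'] by simp
  ultimately show ?thesis unfolding p'(3) by linarith
qed

text \<open>Tested with the conjugate of a forward solution, the form becomes bilinear and symmetric.\<close>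

lemma U_deriv_dot:
  assumes cf: "coef \<omega> \<eta> s" and J: "J \<in> Cdiamond"
    and u: "forward_solution \<Omega> EE \<sigma> \<zeta> I q" and u': "forward_solution \<Omega> EE \<sigma> \<zeta> I' q'"
  shows "dot (U_deriv \<Omega> EE (\<sigma>, \<zeta>, I) (\<omega>, \<eta>, J)) I'
    = dot J (snd q') - interior_form \<Omega> \<omega> (wgr q) (wgr q') - boundary_form \<Omega> EE \<eta> (jmp q) (jmp q')"
proof -
  obtain t where t: "coef \<sigma> \<zeta> t" using co by (auto simp: coercive_def)
  obtain p' where p': "p' \<in> S0" "lin_eq \<sigma> \<zeta> p \<omega> \<eta> J p'" "U_deriv \<Omega> EE (\<sigma>, \<zeta>, I) (\<omega>, \<eta>, J) = snd p'"
    by (rule U_deriv_state[OF cf J])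
  have H: "q \<in> \<H>" "q' \<in> \<H>" "p' \<in> \<H>" using u u' S0_HH[OF p'(1)] by (auto simp: forward_solution_def)
  have cc: "cnj_vec (snd (state_cnj r)) = snd r" for r :: "('n, 'm) state"
    by (simp add: state_cnj_def cnj_vec_def)
  \<comment> \<open>\<open>lin_eq\<close> speaks of zero-mean test states, whereas \<open>q'\<close>
    is an arbitrary representative. So the equation is used in its full form, which brings its own
    forward solution \<open>p1\<close>; that one is exchanged for \<open>q\<close> below.\<close>
  have "linearized_solution \<Omega> EE \<sigma> \<zeta> I \<omega> \<eta> J p'"
    using linearized_solution_iff[OF co cf J p(2) H(3)] p'(2) by simp
  then obtain p1 where p1: "forward_solution \<Omega> EE \<sigma> \<zeta> I p1"
    "\<And>r. r \<in> \<H> \<Longrightarrow> B_form \<Omega> EE \<sigma> \<zeta> p' r = dot J (cnj_vec (snd r)) - interior_form \<Omega> \<omega> (wgr p1) (\<lambda>x. cnj_vec (wgr r x))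
      - boundary_form \<Omega> EE \<eta> (jmp p1) (\<lambda>x. cnj (jmp r x))"
    unfolding linearized_solution_def by blast
  have "dot (snd p') I' = dot I' (cnj_vec (snd (state_cnj p')))"
    unfolding cc by (simp add: dot_def mult.commute)
  also have "\<dots> = B_form \<Omega> EE \<sigma> \<zeta> q' (state_cnj p')"
    using u' HH_cnj[OF H(3)] by (simp add: forward_solution_def)
  also have "\<dots> = B_form \<Omega> EE \<sigma> \<zeta> p' (state_cnj q')"
    by (rule B_cnj_commute[OF t H(2,3)])
  also have "\<dots> = dot J (snd q') - B_form \<Omega> EE \<omega> \<eta> p1 (state_cnj q')"
    using p1(2)[OF HH_cnj[OF H(2)], unfolded cc] by (simp add: B_form_def[of _ _ \<omega>])
  also have "B_form \<Omega> EE \<omega> \<eta> p1 (state_cnj q') = B_form \<Omega> EE \<omega> \<eta> q (state_cnj q')"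
    by (rule B_form_forward_unique[OF co cf p1(1) u HH_cnj[OF H(2)]])
  also have "\<dots> = interior_form \<Omega> \<omega> (wgr q) (wgr q') + boundary_form \<Omega> EE \<eta> (jmp q) (jmp q')"
    by (rule B_cnj_eq[OF cf H(1,2)])
  finally show ?thesis unfolding p'(3) by simp
qed

end

section \<open>Differentiability in the parameter norm\<close>

abbreviation "coefsize \<omega> \<eta> \<equiv> max 0 (max (Linf_norm M\<Omega> \<omega>) (Linf_norm (contact_measure \<Omega> EE) \<eta>))"

text \<open>Inserting 0 does not change the maximum, because \<open>norm J\<close> is
  nonnegative.\<close>

lemma param_norm_eq: "param_norm \<Omega> EE (\<omega>, \<eta>, J) = max (coefsize \<omega> \<eta>) (norm J)" for J :: "complex^'m"
proof -
  have "max a (max b d) = max (max 0 (max a b)) d" if "0 \<le> d" for a b d :: real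
    using that by (auto simp: max_def)
  from this[OF norm_ge_zero] show ?thesis by (simp add: param_norm_def)
qed

text \<open>Squaring is monotone on nonnegative numbers, and the truncation at 0 in
  \<open>coefsize\<close> can only lower a square.\<close>

lemma param_sq_le:
  "(max (coefsize \<omega> \<eta>) (norm J))\<^sup>2 \<le> Max {(Linf_norm M\<Omega> \<omega>)\<^sup>2, (Linf_norm (contact_measure \<Omega> EE) \<eta>)\<^sup>2, (norm J)\<^sup>2}"
  for J :: "complex^'m"
proof -
  have "(max (max 0 (max a b)) d)\<^sup>2 \<le> max (a\<^sup>2) (max (b\<^sup>2) (d\<^sup>2))" if "0 \<le> d" for a b d :: real
    using that by (auto simp: max_def)
  from this[OF norm_ge_zero] show ?thesis by simp
qed

lemma param_spaceE:
  assumes "h \<in> param_space \<Omega> EE"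
  obtains \<omega> \<eta> and J :: "complex^'m" where "h = (\<omega>, \<eta>, J)" "coef \<omega> \<eta> (coefsize \<omega> \<eta>)" "J \<in> Cdiamond"
proof -
  obtain \<omega> \<eta> J where h: "h = (\<omega>, \<eta>, J)" by (cases h) auto
  have "\<omega> \<in> Linf M\<Omega>" "\<eta> \<in> Linf (contact_measure \<Omega> EE)" "J \<in> Cdiamond"
    using assms by (auto simp: param_space_def h)
  with h show ?thesis by (intro that coef_Linf)
qed

text \<open>A remainder of at most C m^2 is at most \<epsilon> m as soon as m \<le> \<epsilon>/(C +
  1), where m is the parameter norm of the perturbation.\<close>

lemma has_frechet_derivative_U_map:
  assumes co: "coercive \<sigma> \<zeta> c" and I: "I \<in> Cdiamond"
  shows "has_frechet_derivative_at \<Omega> EE (U_map \<Omega> EE) (U_deriv \<Omega> EE (\<sigma>, \<zeta>, I)) (\<sigma>, \<zeta>, I)"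
proof -
  have c: "0 < c" using co by (simp add: coercive_def)
  obtain p where p: "p \<in> S0" "forward_solution \<Omega> EE \<sigma> \<zeta> I p" using forward_exists[OF co I] by blast
  show ?thesis
    unfolding has_frechet_derivative_at_def
  proof (intro conjI ballI allI impI)
    fix h k assume "h \<in> param_space \<Omega> EE" "k \<in> param_space \<Omega> EE"
    then obtain \<omega> \<eta> J \<omega>' \<eta>' J' where h: "h = (\<omega>, \<eta>, J)" "coef \<omega> \<eta> (coefsize \<omega> \<eta>)" "J \<in> Cdiamond"
      and k: "k = (\<omega>', \<eta>', J')" "coef \<omega>' \<eta>' (coefsize \<omega>' \<eta>')" "J' \<in> Cdiamond"
      by (elim param_spaceE)
    show "U_deriv \<Omega> EE (\<sigma>, \<zeta>, I) (h + k) = U_deriv \<Omega> EE (\<sigma>, \<zeta>, I) h + U_deriv \<Omega> EE (\<sigma>, \<zeta>, I) k"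
      using U_deriv_add[OF co I p h(2,3) k(2,3)] by (simp add: h(1) k(1) plus_fun_def)
  next
    fix k and h assume "h \<in> param_space \<Omega> EE"
    then obtain \<omega> \<eta> J where h: "h = (\<omega>, \<eta>, J)" "coef \<omega> \<eta> (coefsize \<omega> \<eta>)" "J \<in> Cdiamond"
      by (rule param_spaceE)
    show "U_deriv \<Omega> EE (\<sigma>, \<zeta>, I) (param_scale k h) = k *s U_deriv \<Omega> EE (\<sigma>, \<zeta>, I) h"
      using U_deriv_scale[OF co I p h(2,3)] by (simp add: h(1) param_scale_def)
  next
    show "\<exists>K. \<forall>h\<in>param_space \<Omega> EE. norm (U_deriv \<Omega> EE (\<sigma>, \<zeta>, I) h) \<le> K * param_norm \<Omega> EE h"
    proof (intro exI[of _ "(1 + CB * st_norm p) / c"] ballI)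
      fix h assume "h \<in> param_space \<Omega> EE"
      then obtain \<omega> \<eta> J where h: "h = (\<omega>, \<eta>, J)" "coef \<omega> \<eta> (coefsize \<omega> \<eta>)" "J \<in> Cdiamond"
        by (rule param_spaceE)
      let ?m = "param_norm \<Omega> EE h"
      have "c * norm (U_deriv \<Omega> EE (\<sigma>, \<zeta>, I) h) \<le> norm J + CB * coefsize \<omega> \<eta> * st_norm p"
        unfolding h(1) by (rule U_deriv_bound[OF co I p h(2,3)])
      also have "\<dots> \<le> ?m + CB * ?m * st_norm p"
        unfolding h(1) param_norm_eq using CB_nonneg by (intro add_mono mult_left_mono mult_right_mono) auto
      finally show "norm (U_deriv \<Omega> EE (\<sigma>, \<zeta>, I) h) \<le> (1 + CB * st_norm p) / c * ?m"
        using c by (simp add: field_simps)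
    qed
  next
    fix \<epsilon> :: real assume \<epsilon>: "\<epsilon> > 0"
    obtain C \<delta> where C: "C \<ge> 0" "\<delta> > 0" and R: "\<And>\<omega> \<eta> J s. coef \<omega> \<eta> s \<Longrightarrow> s \<le> \<delta> \<Longrightarrow> J \<in> Cdiamond \<Longrightarrow>
      norm (U_map \<Omega> EE (\<lambda>x. \<sigma> x + \<omega> x, \<lambda>x. \<zeta> x + \<eta> x, I + J) - U_map \<Omega> EE (\<sigma>, \<zeta>, I) - U_deriv \<Omega> EE (\<sigma>, \<zeta>, I) (\<omega>, \<eta>, J))
        \<le> C * (max s (norm J))\<^sup>2"
      using remainder_estimate[OF co I] by blast
    define d where "d = min \<delta> (\<epsilon> / (C + 1))"
    have "d > 0" using C \<epsilon> by (simp add: d_def)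
    moreover have "norm (U_map \<Omega> EE ((\<sigma>, \<zeta>, I) + h) - U_map \<Omega> EE (\<sigma>, \<zeta>, I) - U_deriv \<Omega> EE (\<sigma>, \<zeta>, I) h) \<le> \<epsilon> * param_norm \<Omega> EE h"
      if "h \<in> param_space \<Omega> EE" "param_norm \<Omega> EE h < d" for h
    proof -
      obtain \<omega> \<eta> J where h: "h = (\<omega>, \<eta>, J)" "coef \<omega> \<eta> (coefsize \<omega> \<eta>)" "J \<in> Cdiamond"
        by (rule param_spaceE[OF \<open>h \<in> param_space \<Omega> EE\<close>])
      let ?m = "param_norm \<Omega> EE h"
      have m: "0 \<le> ?m" "coefsize \<omega> \<eta> \<le> ?m" unfolding h(1) param_norm_eq by auto
      have md: "?m \<le> \<delta>" "?m \<le> \<epsilon> / (C + 1)" using that(2) by (auto simp: d_def)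
      have e: "(\<sigma>, \<zeta>, I) + h = (\<lambda>x. \<sigma> x + \<omega> x, \<lambda>x. \<zeta> x + \<eta> x, I + J)" by (simp add: h(1) plus_fun_def)
      have "norm (U_map \<Omega> EE ((\<sigma>, \<zeta>, I) + h) - U_map \<Omega> EE (\<sigma>, \<zeta>, I) - U_deriv \<Omega> EE (\<sigma>, \<zeta>, I) h) \<le> C * (max (coefsize \<omega> \<eta>) (norm J))\<^sup>2"
        unfolding e unfolding h(1) by (rule R[OF h(2) order_trans[OF m(2) md(1)] h(3)])
      also have "\<dots> = (C * ?m) * ?m" by (simp add: h(1) param_norm_eq power2_eq_square)
      also have "\<dots> \<le> \<epsilon> * ?m"
      proof (rule mult_right_mono[OF _ m(1)])
        have "C * ?m \<le> (C + 1) * (\<epsilon> / (C + 1))" using C m(1) md(2) by (intro mult_mono) auto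
        also have "\<dots> = \<epsilon>" using C by simp
        finally show "C * ?m \<le> \<epsilon>" .
      qed
      finally show ?thesis .
    qed
    ultimately show "\<exists>\<delta>>0. \<forall>h\<in>param_space \<Omega> EE. param_norm \<Omega> EE h < \<delta> \<longrightarrow>
        norm (U_map \<Omega> EE ((\<sigma>, \<zeta>, I) + h) - U_map \<Omega> EE (\<sigma>, \<zeta>, I) - U_deriv \<Omega> EE (\<sigma>, \<zeta>, I) h) \<le> \<epsilon> * param_norm \<Omega> EE h"
      by blast
  qed
qed

end

theorem theorem2p6:
  fixes \<Omega> :: "(real^'n) set" and e EE :: "'m::finite \<Rightarrow> (real^'n) set"
  assumes "CARD('n) = 2 \<or> CARD('n) = 3"
    and "CARD('m) \<ge> 2"
    and "bounded_lipschitz_domain \<Omega>"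
    and "electrode_config \<Omega> e EE"
  shows
    "\<forall>\<sigma>\<in>SS \<Omega>. \<forall>\<zeta>\<in>ZZ' \<Omega> EE. \<forall>I\<in>Cdiamond.
       U_map \<Omega> EE (\<sigma>, \<zeta>, I) \<in> Cdiamond \<and>
       (\<exists>u. forward_solution \<Omega> EE \<sigma> \<zeta> I (u, U_map \<Omega> EE (\<sigma>, \<zeta>, I))) \<and>
       has_frechet_derivative_at \<Omega> EE (U_map \<Omega> EE) (U_deriv \<Omega> EE (\<sigma>, \<zeta>, I)) (\<sigma>, \<zeta>, I) \<and>
       (\<exists>C. \<exists>\<delta>>0. \<forall>\<omega>\<in>Linf (lebesgue_on \<Omega>). \<forall>\<eta>\<in>Linf (contact_measure \<Omega> EE). \<forall>J\<in>Cdiamond.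
          Linf_norm (lebesgue_on \<Omega>) \<omega> < \<delta> \<and> Linf_norm (contact_measure \<Omega> EE) \<eta> < \<delta> \<and> norm J < \<delta> \<longrightarrow>
          norm (U_map \<Omega> EE (\<lambda>x. \<sigma> x + \<omega> x, \<lambda>x. \<zeta> x + \<eta> x, I + J) - U_map \<Omega> EE (\<sigma>, \<zeta>, I)
                - U_deriv \<Omega> EE (\<sigma>, \<zeta>, I) (\<omega>, \<eta>, J))
          \<le> C * Max {(Linf_norm (lebesgue_on \<Omega>) \<omega>)\<^sup>2, (Linf_norm (contact_measure \<Omega> EE) \<eta>)\<^sup>2, (norm J)\<^sup>2}) \<and>
       (\<forall>\<omega>\<in>Linf (lebesgue_on \<Omega>). \<forall>\<eta>\<in>Linf (contact_measure \<Omega> EE). \<forall>J\<in>Cdiamond.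
          U_deriv \<Omega> EE (\<sigma>, \<zeta>, I) (\<omega>, \<eta>, J) \<in> Cdiamond \<and>
          (\<exists>u'. linearized_solution \<Omega> EE \<sigma> \<zeta> I \<omega> \<eta> J (u', U_deriv \<Omega> EE (\<sigma>, \<zeta>, I) (\<omega>, \<eta>, J))) \<and>
          (\<forall>I'\<in>Cdiamond. \<forall>u U u' U'.
             forward_solution \<Omega> EE \<sigma> \<zeta> I (u, U) \<and> forward_solution \<Omega> EE \<sigma> \<zeta> I' (u', U') \<longrightarrow>
             dot (U_deriv \<Omega> EE (\<sigma>, \<zeta>, I) (\<omega>, \<eta>, J)) I' =
               dot J U'
               - interior_form \<Omega> \<omega> (weak_grad \<Omega> u) (weak_grad \<Omega> u')
               - boundary_form \<Omega> EE \<eta> (jump \<Omega> EE (u, U)) (jump \<Omega> EE (u', U'))))"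
proof (intro ballI conjI)
  interpret eit \<Omega> EE
    using assms by unfold_locales (auto simp: electrode_config_def)
  fix \<sigma> \<zeta> and I :: "complex^'m"
  assume \<sigma>: "\<sigma> \<in> SS \<Omega>" and \<zeta>: "\<zeta> \<in> ZZ' \<Omega> EE" and I: "I \<in> Cdiamond"
  obtain c where co: "coercive \<sigma> \<zeta> c" using coercive_ZZ'[OF \<sigma> \<zeta>] by blast
  obtain p where p: "p \<in> S0" "forward_solution \<Omega> EE \<sigma> \<zeta> I p" using forward_exists[OF co I] by blast
  note U = U_map_eq[OF co I p]
  show "U_map \<Omega> EE (\<sigma>, \<zeta>, I) \<in> Cdiamond" using p(1) by (simp add: U S0_def)
  show "\<exists>u. forward_solution \<Omega> EE \<sigma> \<zeta> I (u, U_map \<Omega> EE (\<sigma>, \<zeta>, I))"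
    using p(2) unfolding U by (intro exI[of _ "fst p"]) simp
  show "has_frechet_derivative_at \<Omega> EE (U_map \<Omega> EE) (U_deriv \<Omega> EE (\<sigma>, \<zeta>, I)) (\<sigma>, \<zeta>, I)"
    by (rule has_frechet_derivative_U_map[OF co I])
  obtain C \<delta> where C: "C \<ge> 0" "\<delta> > 0" and R: "\<And>\<omega> \<eta> J s. coef \<omega> \<eta> s \<Longrightarrow> s \<le> \<delta> \<Longrightarrow> J \<in> Cdiamond \<Longrightarrow>
      norm (U_map \<Omega> EE (\<lambda>x. \<sigma> x + \<omega> x, \<lambda>x. \<zeta> x + \<eta> x, I + J) - U_map \<Omega> EE (\<sigma>, \<zeta>, I) - U_deriv \<Omega> EE (\<sigma>, \<zeta>, I) (\<omega>, \<eta>, J))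
        \<le> C * (max s (norm J))\<^sup>2"
    using remainder_estimate[OF co I] by blast
  \<comment> \<open>The second-order bound with \<open>coefsize\<close> as the bound for the
    coefficients; the square of the maximum is then replaced by the maximum of the squares.\<close>
  have quad: "norm (U_map \<Omega> EE (\<lambda>x. \<sigma> x + \<omega> x, \<lambda>x. \<zeta> x + \<eta> x, I + J) - U_map \<Omega> EE (\<sigma>, \<zeta>, I)
              - U_deriv \<Omega> EE (\<sigma>, \<zeta>, I) (\<omega>, \<eta>, J))
        \<le> C * Max {(Linf_norm (lebesgue_on \<Omega>) \<omega>)\<^sup>2, (Linf_norm (contact_measure \<Omega> EE) \<eta>)\<^sup>2, (norm J)\<^sup>2}"
    if "\<omega> \<in> Linf (lebesgue_on \<Omega>)" "\<eta> \<in> Linf (contact_measure \<Omega> EE)" "J \<in> Cdiamond"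
      "Linf_norm (lebesgue_on \<Omega>) \<omega> < \<delta>" "Linf_norm (contact_measure \<Omega> EE) \<eta> < \<delta>" for \<omega> \<eta> J
    by (rule order_trans[OF R[OF coef_Linf[OF that(1,2)] _ that(3)] mult_left_mono[OF param_sq_le C(1)]])
       (use that C in simp)
  show "\<exists>C. \<exists>\<delta>>0. \<forall>\<omega>\<in>Linf (lebesgue_on \<Omega>). \<forall>\<eta>\<in>Linf (contact_measure \<Omega> EE). \<forall>J\<in>Cdiamond.
          Linf_norm (lebesgue_on \<Omega>) \<omega> < \<delta> \<and> Linf_norm (contact_measure \<Omega> EE) \<eta> < \<delta> \<and> norm J < \<delta> \<longrightarrow>
          norm (U_map \<Omega> EE (\<lambda>x. \<sigma> x + \<omega> x, \<lambda>x. \<zeta> x + \<eta> x, I + J) - U_map \<Omega> EE (\<sigma>, \<zeta>, I)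
                - U_deriv \<Omega> EE (\<sigma>, \<zeta>, I) (\<omega>, \<eta>, J))
          \<le> C * Max {(Linf_norm (lebesgue_on \<Omega>) \<omega>)\<^sup>2, (Linf_norm (contact_measure \<Omega> EE) \<eta>)\<^sup>2, (norm J)\<^sup>2}"
    by (intro exI[of _ C] exI[of _ \<delta>] conjI C(2) ballI impI quad) simp_all
  fix \<omega> \<eta> and J :: "complex^'m"
  assume "\<omega> \<in> Linf (lebesgue_on \<Omega>)" "\<eta> \<in> Linf (contact_measure \<Omega> EE)" and J: "J \<in> Cdiamond"
  then have cf: "coef \<omega> \<eta> (coefsize \<omega> \<eta>)" by (intro coef_Linf)
  show "U_deriv \<Omega> EE (\<sigma>, \<zeta>, I) (\<omega>, \<eta>, J) \<in> Cdiamond"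
    "\<exists>u'. linearized_solution \<Omega> EE \<sigma> \<zeta> I \<omega> \<eta> J (u', U_deriv \<Omega> EE (\<sigma>, \<zeta>, I) (\<omega>, \<eta>, J))"
    by (rule U_deriv_solution[OF co I p cf J])+
  fix I' :: "complex^'m"
  show "\<forall>u U u' U'.
       forward_solution \<Omega> EE \<sigma> \<zeta> I (u, U) \<and> forward_solution \<Omega> EE \<sigma> \<zeta> I' (u', U') \<longrightarrow>
       dot (U_deriv \<Omega> EE (\<sigma>, \<zeta>, I) (\<omega>, \<eta>, J)) I' =
         dot J U'
         - interior_form \<Omega> \<omega> (weak_grad \<Omega> u) (weak_grad \<Omega> u')
         - boundary_form \<Omega> EE \<eta> (jump \<Omega> EE (u, U)) (jump \<Omega> EE (u', U'))"
  proof (intro allI impI, elim conjE)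
    fix u U u' U'
    assume "forward_solution \<Omega> EE \<sigma> \<zeta> I (u, U)" "forward_solution \<Omega> EE \<sigma> \<zeta> I' (u', U')"
    from U_deriv_dot[OF co I p cf J this]
    show "dot (U_deriv \<Omega> EE (\<sigma>, \<zeta>, I) (\<omega>, \<eta>, J)) I' =
         dot J U'
         - interior_form \<Omega> \<omega> (weak_grad \<Omega> u) (weak_grad \<Omega> u')
         - boundary_form \<Omega> EE \<eta> (jump \<Omega> EE (u, U)) (jump \<Omega> EE (u', U'))" by simp
  qed
qed

end
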